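(* Consider a real Banach space $D$, a closed linear codimension-1 subspace $D_0$ and the open half-spaces $D_-$ and $D_+$ such that $D=D_0\cup D_-\cup D_+$. Consider a sequence of smooth operators $R_n\colon D\to D$ with $R_nD_0\subset D_0$; choose a point $x_0\in D_0$ and let $\{x_n\}$ be its orbit, $x_{n+1}=R_nx_n$. Fix $k\in\mathbb N$ and, for a certain $\delta>0$, assume that each $R_n$ is defined and $k$ times differentiable on the semi-neighborhood $B_\delta(x_n)\cap(D_0\cup D_-)$ and has bounded derivatives up to order $k$, with bounds independent of $n$. For a splitting $D=\xi_0+\eta_0+l_0$ with $\dim\xi_0=\dim\eta_0=1$ and $l_0+\eta_0=D_0$, set $$\xi_{n+1}=dR_n|_{x_n}\xi_n,\qquad \eta_{n+1}=dR_n|_{x_n}\eta_n,\qquad l_{n+1}=dR_n|_{x_n}l_n .$$ Suppose that $l_n$ is a stable distribution for $\{R_n\}$ and $\xi_n+\eta_n$ is its unstable distribution. Suppose that $\xi_n$ is uniformly transversal to $D_0$, that the minimal expansion rate $\lambda_1$ of $\{R_n\}$ along $\eta_n$ is larger than the maximal expansion rate $\lambda_2$ along $\xi_n$, and moreover $$k<\frac{\log\lambda_1}{\log\lambda_2}.$$ Suppose that there exist codimension-1 local manifolds $M_n$ with border that pass through $x_n$, such that $(R_nM_n)\cap B_\delta(x_{n+1})\subset M_{n+1}$. Suppose that $M_n\cap D_0$ is a stable foliation (local stable manifold) for $\{R_n\}$, $T(M_n\cap D_0)=l_n$. Let $M_n$ be given by (the graph of) a function $Q_n\colon(l_n+\xi_n)\to\eta_n$;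 suppose that $Q_n$ is well-defined with uniformly bounded derivative in $(l_n+\xi_n)\cap(D_0\cup D_-)\cap B_\delta(x_n)$, where $\delta$ does not depend on $n$. Suppose that $Q_n$ is $k$ times differentiable in $(l_n+\xi_n)\cap D_-\cap B_\delta(x_n)$, and that for any $\delta_1<\delta$ all its derivatives up to order $k$ are bounded, uniformly in $n$, on $D_-\cap(l_n+\xi_n)\cap(B_\delta(D_0)\setminus B_{\delta_1}(D_0))$. Then $Q_n^{(l)}(x)$ with $l\le k$ has a limit as $x\to D_0$; thus $Q_n$ is $k$ times continuously differentiable.
   Context: $B_r(x)$ is the $r$-ball about $x$ and $B_r(D_0)$ the $r$-neighborhood of $D_0$. Here $l_n+\xi_n$, $\eta_n$ are placed at $x_n$: $M_n$ is the graph $\{x_n+y+Q_n(y)\}$ with $y\in l_n+\xi_n$, and subsets of $l_n+\xi_n$ such as $(l_n+\xi_n)\cap B_\delta(x_n)$ refer to points $x_n+y$. Stable (resp. unstable) distribution: an invariant distribution along the orbit on which the compositions of the differentials $dR_{n+j-1}\cdots dR_n$ contract (resp. expand) at a geometric rate, with constants uniform in $n$. Uniformly transversal: angles bounded away from zero uniformly in $n$. The maximal and minimal expansion rates of $\{R_n\}$ along an invariant direction field $e_n$ (i.e. $dR_n|_{x_n}e_n=e_{n+1}$) are $$\lambda_{\max}=\limsup_{n\to\infty}\sup_{m\ge0}\sqrt[n]{\|d(R_{m+n-1}\cdots R_m)|_{e_m}\|},\qquad\lambda_{\min}=\liminf_{n\to\infty}\inf_{m\ge0}\sqrt[n]{\|d(R_{m+n-1}\cdots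 R_m)|_{e_m}\|}.$$
   Formalization: Limits are claimed on a smaller ball about x_n, radius uniform in n; for k = 1 the differentials dR_n are also assumed equicontinuous at x_n, uniformly in n; Q_n is C^k up to D_0 provided it is C^k in D_- (in general, its derivatives are continuous at D_0). *)

theory Defs
  imports "HOL-Analysis.Analysis"
begin

definition codim_one :: "'a::real_vector set \<Rightarrow> bool" where
  "codim_one V \<longleftrightarrow> subspace V \<and> (\<exists>v. v \<notin> V \<and> span (insert v V) = UNIV)"

text \<open>The two sides of a hyperplane \<open>D0\<close>; they are open when \<open>D0\<close> is closed.\<close>

definition half_spaces :: "'a::real_vector set \<Rightarrow> 'a set \<Rightarrow> 'a set \<Rightarrow> bool" where
  "half_spaces D0 Dm Dp \<longleftrightarrow>
     (\<exists>v. v \<notin> D0 \<and> Dm = {u - t *\<^sub>R v |u t. u \<in> D0 \<and> 0 < t}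
                \<and> Dp = {u + t *\<^sub>R v |u t. u \<in> D0 \<and> 0 < t}) \<and>
     UNIV = D0 \<union> Dm \<union> Dp"

definition splitting :: "'a::real_vector set \<Rightarrow> 'a set \<Rightarrow> 'a set \<Rightarrow> bool" where
  "splitting A B C \<longleftrightarrow> subspace A \<and> subspace B \<and> subspace C \<and> A + B + C = UNIV \<and>
     (\<forall>a\<in>A. \<forall>b\<in>B. \<forall>c\<in>C. a + b + c = 0 \<longrightarrow> a = 0 \<and> b = 0 \<and> c = 0)"


section \<open>Higher derivatives in normed spaces\<close>

text \<open>A \<open>j\<close>-linear map on a subspace \<open>E\<close> is a function of lists of length \<open>j\<close> with entries in
  \<open>E\<close> (its values elsewhere are irrelevant).  \<open>multi_norm_le E j g C\<close> says that its operator
  norm is at most \<open>C\<close>.\<close>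

definition multi_norm_le :: "'a::real_normed_vector set \<Rightarrow> nat \<Rightarrow> ('a list \<Rightarrow> 'b::real_normed_vector) \<Rightarrow> real \<Rightarrow> bool" where
  "multi_norm_le E j g C \<longleftrightarrow>
     (\<forall>vs. length vs = j \<and> set vs \<subseteq> E \<longrightarrow> norm (g vs) \<le> C * prod_list (map norm vs))"

definition bounded_multilinear :: "'a::real_normed_vector set \<Rightarrow> nat \<Rightarrow> ('a list \<Rightarrow> 'b::real_normed_vector) \<Rightarrow> bool" where
  "bounded_multilinear E j g \<longleftrightarrow>
     (\<forall>us ws v w a b. length us + length ws + 1 = j \<and> set us \<subseteq> E \<and> set ws \<subseteq> E \<and> v \<in> E \<and> w \<in> E \<longrightarrow>
        g (us @ (a *\<^sub>R v + b *\<^sub>R w) # ws) = a *\<^sub>R g (us @ v # ws) + b *\<^sub>R g (us @ w # ws)) \<and>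
     (\<exists>C. multi_norm_le E j g C)"

text \<open>Convergence \<open>F y \<longlongrightarrow> L\<close> of \<open>j\<close>-linear maps in operator norm, as \<open>y \<rightarrow> p\<close> within \<open>S\<close>.\<close>

definition multi_tendsto ::
  "'a::real_normed_vector set \<Rightarrow> nat \<Rightarrow> 'a set \<Rightarrow> ('a \<Rightarrow> 'a list \<Rightarrow> 'b::real_normed_vector) \<Rightarrow> 'a \<Rightarrow> ('a list \<Rightarrow> 'b) \<Rightarrow> bool" where
  "multi_tendsto E j S F p L \<longleftrightarrow>
     (\<forall>e>0. eventually (\<lambda>y. multi_norm_le E j (\<lambda>vs. F y vs - L vs) e) (at p within S))"

text \<open>\<open>has_derivs_on E S k f F\<close>: on \<open>S \<subseteq> E\<close> the function \<open>f\<close> is \<open>k\<close> times (Frechet)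
  differentiable along the subspace \<open>E\<close>, and \<open>F j x\<close> is its \<open>j\<close>-th derivative at \<open>x\<close>; that is,
  \<open>F j\<close> has at each point, with respect to the operator norm, the derivative
  \<open>h \<mapsto> (vs \<mapsto> F (Suc j) x (h # vs))\<close>.  At points of \<open>S\<close> that are not interior in \<open>E\<close> the
  derivative is taken within \<open>S\<close>, i.e. it is one-sided.\<close>

definition has_derivs_on ::
  "'a::real_normed_vector set \<Rightarrow> 'a set \<Rightarrow> nat \<Rightarrow> ('a \<Rightarrow> 'b::real_normed_vector) \<Rightarrow> (nat \<Rightarrow> 'a \<Rightarrow> 'a list \<Rightarrow> 'b) \<Rightarrow> bool" where
  "has_derivs_on E S k f F \<longleftrightarrow>
     (\<forall>x\<in>S. F 0 x [] = f x) \<and>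
     (\<forall>j\<le>k. \<forall>x\<in>S. bounded_multilinear E j (F j x)) \<and>
     (\<forall>j<k. \<forall>x\<in>S. \<forall>e>0. eventually (\<lambda>y.
        multi_norm_le E j (\<lambda>vs. F j y vs - F j x vs - F (Suc j) x ((y - x) # vs)) (e * norm (y - x)))
        (at x within S))"

definition has_cont_derivs_on ::
  "'a::real_normed_vector set \<Rightarrow> 'a set \<Rightarrow> nat \<Rightarrow> ('a \<Rightarrow> 'b::real_normed_vector) \<Rightarrow> (nat \<Rightarrow> 'a \<Rightarrow> 'a list \<Rightarrow> 'b) \<Rightarrow> bool" where
  "has_cont_derivs_on E S k f F \<longleftrightarrow>
     has_derivs_on E S k f F \<and> (\<forall>j\<le>k. \<forall>x\<in>S. multi_tendsto E j S (F j) x (F j x))"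

definition Ck_on :: "'a::real_normed_vector set \<Rightarrow> 'a set \<Rightarrow> nat \<Rightarrow> ('a \<Rightarrow> 'b::real_normed_vector) \<Rightarrow> bool" where
  "Ck_on E S k f \<longleftrightarrow> (\<exists>F. has_cont_derivs_on E S k f F)"


section \<open>Cocycles, invariant distributions, expansion rates\<close>

text \<open>\<open>compose_from A m j = A (m + j - 1) \<circ> \<dots> \<circ> A m\<close>\<close>

primrec compose_from :: "(nat \<Rightarrow> 'a \<Rightarrow> 'a) \<Rightarrow> nat \<Rightarrow> nat \<Rightarrow> 'a \<Rightarrow> 'a" where
  "compose_from A m 0 = id"
| "compose_from A m (Suc j) = A (m + j) \<circ> compose_from A m j"

definition invariant_distribution :: "(nat \<Rightarrow> 'a \<Rightarrow> 'a) \<Rightarrow> (nat \<Rightarrow> 'a::real_vector set) \<Rightarrow> bool" where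
  "invariant_distribution A V \<longleftrightarrow> (\<forall>n. subspace (V n) \<and> A n ` V n \<subseteq> V (Suc n))"

definition stable_distribution :: "(nat \<Rightarrow> 'a \<Rightarrow> 'a) \<Rightarrow> (nat \<Rightarrow> 'a::real_normed_vector set) \<Rightarrow> bool" where
  "stable_distribution A V \<longleftrightarrow> invariant_distribution A V \<and>
     (\<exists>C>0. \<exists>\<mu>. 0 < \<mu> \<and> \<mu> < 1 \<and>
        (\<forall>n j. \<forall>v\<in>V n. norm (compose_from A n j v) \<le> C * \<mu> ^ j * norm v))"

definition unstable_distribution :: "(nat \<Rightarrow> 'a \<Rightarrow> 'a) \<Rightarrow> (nat \<Rightarrow> 'a::real_normed_vector set) \<Rightarrow> bool" where
  "unstable_distribution A V \<longleftrightarrow> invariant_distribution A V \<and>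
     (\<exists>c>0. \<exists>\<nu>>1. \<forall>n j. \<forall>v\<in>V n. norm (compose_from A n j v) \<ge> c * \<nu> ^ j * norm v)"

text \<open>For a unit vector \<open>v\<close>, \<open>infdist v D0\<close> is a measure of its angle with \<open>D0\<close>.\<close>

definition uniformly_transversal :: "(nat \<Rightarrow> 'a::real_normed_vector set) \<Rightarrow> 'a set \<Rightarrow> bool" where
  "uniformly_transversal V D0 \<longleftrightarrow> (\<exists>c>0. \<forall>n. \<forall>v\<in>V n. infdist v D0 \<ge> c * norm v)"

definition norm_on :: "('a::real_normed_vector \<Rightarrow> 'a) \<Rightarrow> 'a set \<Rightarrow> real" where
  "norm_on L V = (SUP v\<in>V. norm (L v) / norm v)"

definition max_expansion_rate :: "(nat \<Rightarrow> 'a::real_normed_vector \<Rightarrow> 'a) \<Rightarrow> (nat \<Rightarrow> 'a set) \<Rightarrow> ereal" where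
  "max_expansion_rate A V =
     limsup (\<lambda>n. SUP m. ereal (root n (norm_on (compose_from A m n) (V m))))"

definition min_expansion_rate :: "(nat \<Rightarrow> 'a::real_normed_vector \<Rightarrow> 'a) \<Rightarrow> (nat \<Rightarrow> 'a set) \<Rightarrow> ereal" where
  "min_expansion_rate A V =
     liminf (\<lambda>n. INF m. ereal (root n (norm_on (compose_from A m n) (V m))))"


section \<open>Graphs and local manifolds\<close>

text \<open>\<open>chart p X S\<close> is the part of \<open>S\<close> on the affine subspace \<open>p + X\<close>, in the coordinate
  \<open>y \<in> X\<close> of the point \<open>p + y\<close>.\<close>

definition chart :: "'a::real_vector \<Rightarrow> 'a set \<Rightarrow> 'a set \<Rightarrow> 'a set" where
  "chart p X S = {y \<in> X. p + y \<in> S}"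

definition graph_at :: "'a::real_vector \<Rightarrow> 'a set \<Rightarrow> ('a \<Rightarrow> 'a) \<Rightarrow> 'a set" where
  "graph_at p U Q = {p + y + Q y |y. y \<in> U}"

definition tangent_space :: "'a::real_normed_vector set \<Rightarrow> 'a \<Rightarrow> 'a set" where
  "tangent_space S p =
     {v. \<exists>\<gamma>. \<gamma> 0 = p \<and> (\<gamma> has_vector_derivative v) (at (0::real)) \<and>
             eventually (\<lambda>t. \<gamma> t \<in> S) (at 0)}"

text \<open>The points of \<open>W n\<close> near \<open>x n\<close> are attracted by the orbit \<open>x\<close> at a uniform geometric rate.\<close>

definition local_stable_manifold ::
  "(nat \<Rightarrow> 'a \<Rightarrow> 'a) \<Rightarrow> (nat \<Rightarrow> 'a::metric_space) \<Rightarrow> (nat \<Rightarrow> 'a set) \<Rightarrow> bool" where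
  "local_stable_manifold R x W \<longleftrightarrow>
     (\<forall>n. x n \<in> W n) \<and>
     (\<exists>r>0. \<exists>C>0. \<exists>\<mu>. 0 < \<mu> \<and> \<mu> < 1 \<and>
        (\<forall>n. \<forall>p \<in> W n \<inter> ball (x n) r. \<forall>j.
           dist (compose_from R n j p) (x (n + j)) \<le> C * \<mu> ^ j * dist p (x n)))"

end

theory Submission
  imports Defs
begin

text \<open>Write \<open>Q\<^sub>n = q\<^sub>n e\<^sub>n\<close> with \<open>e\<^sub>n\<close> spanning \<open>\<eta>\<^sub>n\<close>.  Invariance of the graphs is an implicit functional
  equation that relates \<open>q\<^sub>n\<close> at \<open>y\<close> to \<open>q\<^sub>n\<^sub>+\<^sub>1\<close> at the projected image of \<open>y\<close>.  Differentiating it \<open>m\<close> times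
  expresses the \<open>m\<close>-th derivative of \<open>q\<^sub>n\<close> through that of \<open>q\<^sub>n\<^sub>+\<^sub>1\<close>, up to terms of lower order; the
  expansion along \<open>\<eta>\<close> is divided out and each of the \<open>m\<close> arguments is expanded at most at the rate of
  \<open>\<xi>\<close>, so the step contracts by about \<open>\<lambda>\<^sub>2\<^sup>m / \<lambda>\<^sub>1\<close>, which is less than \<open>1\<close> for \<open>m \<le> k\<close>.  Since orbits
  leave the boundary along \<open>\<xi>\<close>, the given bounds away from \<open>D0\<close> propagate to all points near \<open>D0\<close>.
  The same contraction, applied to the oscillation of the \<open>m\<close>-th derivative at the points of \<open>D0\<close>, uniformly
  in \<open>n\<close>, forces it to vanish by induction on \<open>m\<close>, and by the mean value inequality the limits are
  the one-sided derivatives of \<open>Q\<^sub>n\<close>.\<close>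

section \<open>Multilinear maps given on lists\<close>

text \<open>The maps \<open>R n\<close> need not be invertible, so the equation is kept in the
  implicit form W o \<open>R n\<close> o \<open>psi n\<close> = 0, where W(z) = \<open>g (Suc n) (z
  - x (Suc n)) - q (Suc n) (pr (Suc n) (z - x (Suc n)))\<close> defines the next graph. All
  derivatives of the composition vanish, and the derivative of \<open>q n\<close> of top order
  occurs in them with a scalar coefficient close to \<open>b n\<close>, the expansion along \<eta>.
  The hypotheses provide rates only asymptotically and for iterates, whereas a contraction in every
  step is wanted. Hence the spanning vectors are rescaled by geometric means of consecutive norms
  and the stable directions get an adapted seminorm; derivatives are measured in the resulting norm
  \<open>N\<close>, because returning to the original norm would cost a factor in each step. At
  points of \<open>D0\<close> no higher derivative is available to begin with, so convergence is
  expressed by the oscillation over pairs of nearby points. Since \<open>phi\<close> maps boundary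
  points to boundary points of the next index, oscillation bounds are compared along the whole
  orbit.\<close>

lemma prod_list_norm_nonneg: "0 \<le> prod_list (map norm vs)"
  by (induction vs) auto

lemma multi_norm_leD:
  "multi_norm_le E j g C \<Longrightarrow> length vs = j \<Longrightarrow> set vs \<subseteq> E \<Longrightarrow> norm (g vs) \<le> C * prod_list (map norm vs)"
  unfolding multi_norm_le_def by blast

lemma multi_norm_le_mono: "multi_norm_le E j g C \<Longrightarrow> C \<le> C' \<Longrightarrow> multi_norm_le E j g C'"
  unfolding multi_norm_le_def
  by (auto intro: order_trans[OF _ mult_right_mono[OF _ prod_list_norm_nonneg]])

lemma bounded_multilinear_Cons:
  assumes "bounded_multilinear E (Suc m) g" "u \<in> E"
  shows "bounded_multilinear E m (\<lambda>ws. g (u # ws))"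
proof -
  from assms obtain C where C: "multi_norm_le E (Suc m) g C" unfolding bounded_multilinear_def by blast
  have "multi_norm_le E m (\<lambda>ws. g (u # ws)) (C * norm u)"
    unfolding multi_norm_le_def using multi_norm_leD[OF C, of "u # _"] assms(2) by (auto simp: mult.assoc)
  moreover have "g (u # us @ (a *\<^sub>R v + b *\<^sub>R w) # ws) = a *\<^sub>R g (u # us @ v # ws) + b *\<^sub>R g (u # us @ w # ws)"
    if "length us + length ws + 1 = m \<and> set us \<subseteq> E \<and> set ws \<subseteq> E \<and> v \<in> E \<and> w \<in> E" for us ws v w a b
    using assms that unfolding bounded_multilinear_def
    by (metis (no_types, lifting) add_Suc append_Cons insert_subset length_Cons list.simps(15))
  ultimately show ?thesis unfolding bounded_multilinear_def by blast
qed

lemma bounded_multilinear_first: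
  assumes "bounded_multilinear E (Suc m) g" "length ws = m" "set ws \<subseteq> E" "v \<in> E" "w \<in> E"
  shows "g ((a *\<^sub>R v + b *\<^sub>R w) # ws) = a *\<^sub>R g (v # ws) + b *\<^sub>R g (w # ws)"
proof -
  have "\<forall>us ws v w a b. length us + length ws + 1 = Suc m \<and> set us \<subseteq> E \<and> set ws \<subseteq> E \<and> v \<in> E \<and> w \<in> E \<longrightarrow>
        g (us @ (a *\<^sub>R v + b *\<^sub>R w) # ws) = a *\<^sub>R g (us @ v # ws) + b *\<^sub>R g (us @ w # ws)"
    using assms(1) unfolding bounded_multilinear_def by blast
  from this[rule_format, of "[]" ws v w a b] assms(2-) show ?thesis by simp
qed

lemma bounded_multilinear_bound:
  assumes "bounded_multilinear E m g"
  obtains C where "1 \<le> C" "multi_norm_le E m g C"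
proof -
  from assms obtain C where "multi_norm_le E m g C" unfolding bounded_multilinear_def by blast
  then have "multi_norm_le E m g (max 1 C)" by (rule multi_norm_le_mono) simp
  then show ?thesis using that[of "max 1 C"] by simp
qed

section \<open>Uniform differentiability of families\<close>

text \<open>The index \<open>i\<close> will run over lists of arguments and \<open>w i\<close> over
  the products of their norms; uniformity in \<open>i\<close> is then differentiability in operator
  norm. A general index set allows some arguments to be frozen as part of the index while another
  one moves.\<close>

definition uniformly_diff ::
  "'p::real_normed_vector set \<Rightarrow> 'p \<Rightarrow> 'i set \<Rightarrow> ('i \<Rightarrow> real) \<Rightarrow> ('p \<Rightarrow> 'i \<Rightarrow> 'b::real_normed_vector) \<Rightarrow> ('i \<Rightarrow> 'p \<Rightarrow> 'b) \<Rightarrow> bool" where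
  "uniformly_diff S x I w G G' \<longleftrightarrow>
     (\<forall>e>0. \<forall>\<^sub>F y in at x within S. \<forall>i\<in>I. norm (G y i - G x i - G' i (y - x)) \<le> e * norm (y - x) * w i)"

lemma uniformly_diff_cong:
  assumes "uniformly_diff S x I w G G'"
    and "\<And>y i. y \<in> S \<Longrightarrow> i \<in> I \<Longrightarrow> G y i = H y i" "\<And>i. i \<in> I \<Longrightarrow> G x i = H x i"
    and "\<And>y i. y \<in> S \<Longrightarrow> i \<in> I \<Longrightarrow> G' i (y - x) = H' i (y - x)" "\<And>i. i \<in> I \<Longrightarrow> w i = w' i"
  shows "uniformly_diff S x I w' H H'"
  unfolding uniformly_diff_def
proof (intro allI impI)
  fix e :: real assume "0 < e"
  then have "\<forall>\<^sub>F y in at x within S. \<forall>i\<in>I. norm (G y i - G x i - G' i (y - x)) \<le> e * norm (y - x) * w i"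
    using assms(1) unfolding uniformly_diff_def by blast
  moreover have "\<forall>\<^sub>F y in at x within S. y \<in> S" by (simp add: eventually_at_filter)
  ultimately show "\<forall>\<^sub>F y in at x within S. \<forall>i\<in>I. norm (H y i - H x i - H' i (y - x)) \<le> e * norm (y - x) * w' i"
    by eventually_elim (use assms in auto)
qed

lemma uniformly_diff_add:
  assumes "uniformly_diff S x I w G G'" "uniformly_diff S x I w H H'"
  shows "uniformly_diff S x I w (\<lambda>y i. G y i + H y i) (\<lambda>i h. G' i h + H' i h)"
  unfolding uniformly_diff_def
proof (intro allI impI)
  fix e :: real assume "0 < e"
  then have "\<forall>\<^sub>F y in at x within S. \<forall>i\<in>I. norm (G y i - G x i - G' i (y - x)) \<le> e/2 * norm (y - x) * w i"
    and "\<forall>\<^sub>F y in at x within S. \<forall>i\<in>I. norm (H y i - H x i - H' i (y - x)) \<le> e/2 * norm (y - x) * w i"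
    using assms[unfolded uniformly_diff_def, rule_format, of "e/2"] by auto
  then show "\<forall>\<^sub>F y in at x within S. \<forall>i\<in>I. norm (G y i + H y i - (G x i + H x i) - (G' i (y - x) + H' i (y - x)))
      \<le> e * norm (y - x) * w i"
  proof eventually_elim
    case (elim y)
    show ?case
    proof
      fix i assume "i \<in> I"
      have "norm (G y i + H y i - (G x i + H x i) - (G' i (y - x) + H' i (y - x)))
        = norm ((G y i - G x i - G' i (y - x)) + (H y i - H x i - H' i (y - x)))" by (simp add: algebra_simps)
      also have "\<dots> \<le> e/2 * norm (y - x) * w i + e/2 * norm (y - x) * w i"
        using elim \<open>i \<in> I\<close> by (intro norm_triangle_mono) auto
      finally show "norm (G y i + H y i - (G x i + H x i) - (G' i (y - x) + H' i (y - x))) \<le> e * norm (y - x) * w i"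
        by (simp add: algebra_simps)
    qed
  qed
qed

lemma uniformly_diff_sum_list:
  assumes "\<And>b. b \<in> set bs \<Longrightarrow> uniformly_diff S x I w (G b) (G' b)" "\<And>i. i \<in> I \<Longrightarrow> 0 \<le> w i"
  shows "uniformly_diff S x I w (\<lambda>y i. \<Sum>b\<leftarrow>bs. G b y i) (\<lambda>i h. \<Sum>b\<leftarrow>bs. G' b i h)"
  using assms(1)
proof (induction bs)
  case Nil
  then show ?case using assms(2) by (auto simp: uniformly_diff_def)
next
  case (Cons b bs)
  then show ?case using uniformly_diff_add[of S x I w "G b" "G' b"] by simp
qed

text \<open>Product rule for an operator applied to a moving argument. The remainder is the sum of
  the remainder of \<open>P\<close> at \<open>U y\<close>, the mixed term \<open>P'\<close> of
  \<open>U y - U x\<close>, and \<open>P x\<close> applied to the remainder of \<open>U\<close>;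
  each is allotted a third of \<open>e\<close>.\<close>

lemma uniformly_diff_slot:
  fixes P :: "'p::real_normed_vector \<Rightarrow> 'i \<Rightarrow> 'b::real_normed_vector \<Rightarrow> 'c::real_normed_vector"
  assumes P: "uniformly_diff S x (I \<times> UNIV) (\<lambda>(i,u). w i * norm u) (\<lambda>y (i,u). P y i u) (\<lambda>(i,u) h. P' i h u)"
    and U: "uniformly_diff S x I a U U'"
    and P_diff: "\<And>i u v. i \<in> I \<Longrightarrow> P x i (u - v) = P x i u - P x i v"
    and P'_diff: "\<And>i y u v. i \<in> I \<Longrightarrow> y \<in> S \<Longrightarrow> P' i (y - x) (u - v) = P' i (y - x) u - P' i (y - x) v"
    and bP: "\<And>i u. i \<in> I \<Longrightarrow> norm (P x i u) \<le> C * w i * norm u"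
    and bP': "\<And>i y u. i \<in> I \<Longrightarrow> y \<in> S \<Longrightarrow> norm (P' i (y - x) u) \<le> C * norm (y - x) * w i * norm u"
    and bU: "\<And>i. i \<in> I \<Longrightarrow> norm (U x i) \<le> C * a i"
    and bU': "\<And>i y. i \<in> I \<Longrightarrow> y \<in> S \<Longrightarrow> norm (U' i (y - x)) \<le> C * norm (y - x) * a i"
    and C: "0 \<le> C" and w: "\<And>i. i \<in> I \<Longrightarrow> 0 \<le> w i" and a: "\<And>i. i \<in> I \<Longrightarrow> 0 \<le> a i"
  shows "uniformly_diff S x I (\<lambda>i. w i * a i) (\<lambda>y i. P y i (U y i)) (\<lambda>i h. P' i h (U x i) + P x i (U' i h))"
  unfolding uniformly_diff_def
proof (intro allI impI)
  fix e :: real assume e: "0 < e"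
  \<comment> \<open>\<open>e1\<close> serves the two remainders and \<open>d\<close>, a bound for
    the distance, the quadratic mixed term. The summand \<open>1\<close> in \<open>C + 1\<close>
    keeps the denominators positive.\<close>
  define e1 where "e1 = min 1 (e / (6 * (C + 1)))"
  have e1: "0 < e1" "e1 \<le> 1" using e C by (auto simp: e1_def)
  have e1': "e1 * (2*C + 1) \<le> e/3" "C * e1 \<le> e/3"
  proof -
    have "e1 \<le> e / (6 * (C + 1))" by (simp add: e1_def)
    then have *: "e1 * (6 * (C + 1)) \<le> e" using C by (simp add: field_simps)
    moreover have "e1 * C \<ge> 0" using e1 C by simp
    ultimately show "e1 * (2*C + 1) \<le> e/3" "C * e1 \<le> e/3" using e1 by (auto simp: algebra_simps)
  qed
  define d where "d = min 1 (e / (3 * (C + 1) * (C + 1)))"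
  have d: "0 < d" "d \<le> 1" using e C by (auto simp: d_def)
  have d': "C * (C + 1) * t \<le> e/3" if "0 \<le> t" "t \<le> d" for t
  proof -
    have "t \<le> e / (3 * (C + 1) * (C + 1))" using that by (simp add: d_def)
    moreover have "0 < 3 * (C + 1) * (C + 1)" using C by simp
    ultimately have "t * (3 * (C + 1) * (C + 1)) \<le> e" by (simp only: pos_le_divide_eq)
    then have "(C + 1) * (C + 1) * t \<le> e/3" by (simp add: algebra_simps)
    moreover have "C * (C + 1) * t \<le> (C + 1) * (C + 1) * t" using C that by (intro mult_right_mono) auto
    ultimately show ?thesis by linarith
  qed
  have "\<forall>\<^sub>F y in at x within S. \<forall>i\<in>I\<times>UNIV. norm ((\<lambda>(i,u). P y i u) i - (\<lambda>(i,u). P x i u) i - (\<lambda>(i,u) h. P' i h u) i (y - x))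
       \<le> e1 * norm (y - x) * (\<lambda>(i,u). w i * norm u) i"
    using P e1 unfolding uniformly_diff_def by blast
  moreover have "\<forall>\<^sub>F y in at x within S. \<forall>i\<in>I. norm (U y i - U x i - U' i (y - x)) \<le> e1 * norm (y - x) * a i"
    using U e1 unfolding uniformly_diff_def by blast
  moreover have "\<forall>\<^sub>F y in at x within S. y \<in> S \<and> dist y x < d"
    unfolding eventually_at using d by blast
  ultimately show "\<forall>\<^sub>F y in at x within S. \<forall>i\<in>I. norm (P y i (U y i) - P x i (U x i) - (P' i (y - x) (U x i) + P x i (U' i (y - x))))
      \<le> e * norm (y - x) * (w i * a i)"
  proof eventually_elim
    case (elim y)
    define t where "t = norm (y - x)"
    have t: "0 \<le> t" "t \<le> d" "t \<le> 1" using elim(3) d by (auto simp: t_def dist_norm)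
    show ?case
    proof
      fix i assume i: "i \<in> I"
      have y: "y \<in> S" using elim by simp
      have 1: "norm (U y i - U x i - U' i (y - x)) \<le> e1 * t * a i" using elim i by (simp add: t_def)
      have 2: "norm (U y i - U x i) \<le> (C + 1) * t * a i"
      proof -
        have "norm (U y i - U x i) \<le> norm (U y i - U x i - U' i (y - x)) + norm (U' i (y - x))"
          by (metis diff_add_cancel norm_triangle_ineq)
        also have "\<dots> \<le> e1 * t * a i + C * t * a i" using 1 bU'[OF i y] by (simp add: t_def)
        also have "\<dots> \<le> 1 * t * a i + C * t * a i" using e1 t a[OF i] by (intro add_mono mult_right_mono) auto
        finally show ?thesis by (simp add: algebra_simps)
      qed
      have 3: "norm (U y i) \<le> (2*C + 1) * a i"
      proof -
        have "norm (U y i) \<le> norm (U y i - U x i) + norm (U x i)"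
          by (metis diff_add_cancel norm_triangle_ineq)
        also have "\<dots> \<le> (C + 1) * t * a i + C * a i" using 2 bU[OF i] by simp
        also have "\<dots> \<le> (C + 1) * 1 * a i + C * a i" using C t a[OF i] by (intro add_mono mult_right_mono mult_left_mono) auto
        finally show ?thesis by (simp add: algebra_simps)
      qed
      have "norm (P y i (U y i) - P x i (U y i) - P' i (y - x) (U y i)) \<le> e1 * t * (w i * norm (U y i))"
        using elim(1) i by (auto simp: t_def)
      also have "\<dots> \<le> e1 * t * (w i * ((2*C+1) * a i))" using 3 e1 t w[OF i] by (intro mult_left_mono) auto
      also have "\<dots> = (e1 * (2*C+1)) * (t * (w i * a i))" by (simp add: algebra_simps)
      also have "\<dots> \<le> e/3 * (t * (w i * a i))" using e1' t w[OF i] a[OF i] by (intro mult_right_mono) auto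
      finally have A: "norm (P y i (U y i) - P x i (U y i) - P' i (y - x) (U y i)) \<le> e/3 * (t * (w i * a i))" .
      have "norm (P' i (y - x) (U y i - U x i)) \<le> C * t * w i * norm (U y i - U x i)" using bP'[OF i y] by (simp add: t_def)
      also have "\<dots> \<le> C * t * w i * ((C + 1) * t * a i)" using 2 C t w[OF i] by (intro mult_left_mono) auto
      also have "\<dots> = (C * (C + 1) * t) * (t * (w i * a i))" by (simp add: algebra_simps)
      also have "\<dots> \<le> e/3 * (t * (w i * a i))" using d' t w[OF i] a[OF i] by (intro mult_right_mono) auto
      finally have B: "norm (P' i (y - x) (U y i - U x i)) \<le> e/3 * (t * (w i * a i))" .
      have "norm (P x i (U y i - U x i - U' i (y - x))) \<le> C * w i * norm (U y i - U x i - U' i (y - x))" using bP[OF i] .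
      also have "\<dots> \<le> C * w i * (e1 * t * a i)" using 1 C w[OF i] by (intro mult_left_mono) auto
      also have "\<dots> = (C * e1) * (t * (w i * a i))" by (simp add: algebra_simps)
      also have "\<dots> \<le> e/3 * (t * (w i * a i))" using e1' t w[OF i] a[OF i] by (intro mult_right_mono) auto
      finally have D: "norm (P x i (U y i - U x i - U' i (y - x))) \<le> e/3 * (t * (w i * a i))" .
      have "P y i (U y i) - P x i (U x i) - (P' i (y - x) (U x i) + P x i (U' i (y - x)))
        = (P y i (U y i) - P x i (U y i) - P' i (y - x) (U y i)) + P' i (y - x) (U y i - U x i) + P x i (U y i - U x i - U' i (y - x))"
        using i y by (simp add: P_diff P'_diff)
      then have "norm (P y i (U y i) - P x i (U x i) - (P' i (y - x) (U x i) + P x i (U' i (y - x))))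
         \<le> e/3 * (t * (w i * a i)) + e/3 * (t * (w i * a i)) + e/3 * (t * (w i * a i))"
        using A B D by (simp only: norm_triangle_mono)
      then show "norm (P y i (U y i) - P x i (U x i) - (P' i (y - x) (U x i) + P x i (U' i (y - x))))
      \<le> e * norm (y - x) * (w i * a i)" by (simp add: t_def mult_ac)
    qed
  qed
qed

lemma uniformly_diffD:
  "uniformly_diff S x I w G G' \<Longrightarrow> 0 < e \<Longrightarrow>
   \<forall>\<^sub>F y in at x within S. \<forall>i\<in>I. norm (G y i - G x i - G' i (y - x)) \<le> e * norm (y - x) * w i"
  unfolding uniformly_diff_def by blast

text \<open>Product rule for a multilinear map with all arguments moving, by induction on their
  number: the first argument is absorbed into the map by \<open>uniformly_diff_slot\<close>. This is
  why the map, its weight and its bound are generalised in the induction.\<close>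

lemma uniformly_diff_list:
  fixes P :: "'p::real_normed_vector \<Rightarrow> 'i \<Rightarrow> 'b::real_normed_vector list \<Rightarrow> 'c::real_normed_vector"
    and U :: "'p \<Rightarrow> 'i \<Rightarrow> 'd \<Rightarrow> 'b"
  assumes P: "uniformly_diff S x (I \<times> {ws. length ws = length bs}) (\<lambda>(i,ws). w i * prod_list (map norm ws))
                (\<lambda>y (i,ws). P y i ws) (\<lambda>(i,ws) h. P' i h ws)"
    and P_lin: "\<And>i. i \<in> I \<Longrightarrow> bounded_multilinear UNIV (length bs) (P x i)"
    and P'_lin: "\<And>i y. i \<in> I \<Longrightarrow> y \<in> S \<Longrightarrow> bounded_multilinear UNIV (length bs) (P' i (y - x))"
    and bP: "\<And>i. i \<in> I \<Longrightarrow> multi_norm_le UNIV (length bs) (P x i) (C * w i)"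
    and bP': "\<And>i y. i \<in> I \<Longrightarrow> y \<in> S \<Longrightarrow> multi_norm_le UNIV (length bs) (P' i (y - x)) (C * norm (y - x) * w i)"
    and U: "\<And>b. b \<in> set bs \<Longrightarrow> uniformly_diff S x I (a b) (\<lambda>y i. U y i b) (\<lambda>i h. U' i h b)"
    and bU: "\<And>b i. b \<in> set bs \<Longrightarrow> i \<in> I \<Longrightarrow> norm (U x i b) \<le> D * a b i"
    and bU': "\<And>b i y. b \<in> set bs \<Longrightarrow> i \<in> I \<Longrightarrow> y \<in> S \<Longrightarrow> norm (U' i (y - x) b) \<le> D * norm (y - x) * a b i"
    and C: "0 \<le> C" "0 \<le> D" and w: "\<And>i. i \<in> I \<Longrightarrow> 0 \<le> w i"
    and a: "\<And>b i. b \<in> set bs \<Longrightarrow> i \<in> I \<Longrightarrow> 0 \<le> a b i"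
  shows "uniformly_diff S x I (\<lambda>i. w i * (\<Prod>b\<leftarrow>bs. a b i)) (\<lambda>y i. P y i (map (U y i) bs))
           (\<lambda>i h. P' i h (map (U x i) bs) + (\<Sum>j<length bs. P x i ((map (U x i) bs)[j := U' i h (bs ! j)])))"
  using assms
proof (induction bs arbitrary: P P' w C)
  case Nil
  show ?case unfolding uniformly_diff_def
  proof (intro allI impI)
    fix e :: real assume "0 < e"
    from uniformly_diffD[OF Nil.prems(1) this]
    show "\<forall>\<^sub>F y in at x within S. \<forall>i\<in>I. norm (P y i (map (U y i) []) - P x i (map (U x i) []) -
        (P' i (y - x) (map (U x i) []) + (\<Sum>j<length []. P x i ((map (U x i) [])[j := U' i (y - x) ([] ! j)]))))
        \<le> e * norm (y - x) * (w i * (\<Prod>b\<leftarrow>[]. a b i))"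
      by eventually_elim auto
  qed
next
  case (Cons b bs)
  let ?m = "length bs" and ?I = "I \<times> {ws :: 'b list. length ws = length bs}"
  \<comment> \<open>The map with its first argument inserted. \<open>P2'\<close> has two summands,
    each bounded by \<open>C * D\<close>, whence \<open>C2\<close>.\<close>
  define P2 where "P2 = (\<lambda>y i ws. P y i (U y i b # ws))"
  define P2' where "P2' = (\<lambda>i h ws. P' i h (U x i b # ws) + P x i (U' i h b # ws))"
  define C2 where "C2 = 2 * C * D"
  note CD = Cons.prems(9,10)
  have w: "0 \<le> w i" if "i \<in> I" for i using Cons.prems(11) that by blast
  have ab: "0 \<le> a b i" if "i \<in> I" for i using Cons.prems(12) that by simp
  have lin: "bounded_multilinear UNIV (Suc ?m) (P x i)" if "i \<in> I" for i
    using Cons.prems(2)[OF that] by simp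
  have lin': "bounded_multilinear UNIV (Suc ?m) (P' i (y - x))" if "i \<in> I" "y \<in> S" for i y
    using Cons.prems(3)[OF that] by simp
  have bP: "norm (P x i (u # ws)) \<le> C * (w i * prod_list (map norm ws)) * norm u" if "i \<in> I" "length ws = ?m" for i u ws
    using multi_norm_leD[OF Cons.prems(4)[OF that(1)], of "u # ws"] that by (simp add: mult_ac)
  have bP': "norm (P' i (y - x) (u # ws)) \<le> C * norm (y - x) * (w i * prod_list (map norm ws)) * norm u"
    if "i \<in> I" "y \<in> S" "length ws = ?m" for i y u ws
    using multi_norm_leD[OF Cons.prems(5)[OF that(1,2)], of "u # ws"] that by (simp add: mult_ac)
  have bU: "norm (U x i b) \<le> D * a b i" if "i \<in> I" for i using Cons.prems(7) that by simp
  have bU': "norm (U' i (y - x) b) \<le> D * norm (y - x) * a b i" if "i \<in> I" "y \<in> S" for i y using Cons.prems(8) that by simp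
  have wn: "0 \<le> w i * prod_list (map norm ws)" if "i \<in> I" for i and ws :: "'b list"
    using w[OF that] prod_list_norm_nonneg by (intro mult_nonneg_nonneg)
  have U1: "uniformly_diff S x ?I (\<lambda>(i,ws). a b i) (\<lambda>y (i,ws). U y i b) (\<lambda>(i,ws) h. U' i h b)"
    using Cons.prems(6)[of b] unfolding uniformly_diff_def by simp
  \<comment> \<open>The remaining arguments \<open>ws\<close> are part of the index here, so only
    the first slot moves.\<close>
  have slot: "uniformly_diff S x ?I (\<lambda>i. (\<lambda>(i,ws). w i * prod_list (map norm ws)) i * (\<lambda>(i,ws). a b i) i)
      (\<lambda>y i. (\<lambda>(i,ws) u. P y i (u # ws)) i ((\<lambda>(i,ws). U y i b) i))
      (\<lambda>i h. (\<lambda>(i,ws) h u. P' i h (u # ws)) i h ((\<lambda>(i,ws). U x i b) i) + (\<lambda>(i,ws) u. P x i (u # ws)) i ((\<lambda>(i,ws) h. U' i h b) i h))"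
  proof (rule uniformly_diff_slot[where C = "max C D" and P = "\<lambda>y i u. (case i of (i, ws) \<Rightarrow> \<lambda>u. P y i (u # ws)) u"
        and P' = "\<lambda>i h u. (case i of (i, ws) \<Rightarrow> \<lambda>h u. P' i h (u # ws)) h u"
        and w = "\<lambda>i. case i of (i, ws) \<Rightarrow> w i * prod_list (map norm ws)" and a = "\<lambda>i. case i of (i, ws) \<Rightarrow> a b i"
        and U = "\<lambda>y i. case i of (i, ws) \<Rightarrow> U y i b" and U' = "\<lambda>i h. (case i of (i, ws) \<Rightarrow> \<lambda>h. U' i h b) h"])
    show "uniformly_diff S x (?I \<times> UNIV) (\<lambda>(i, u). (case i of (i, ws) \<Rightarrow> w i * prod_list (map norm ws)) * norm u)
       (\<lambda>y (i, u). (case i of (i, ws) \<Rightarrow> \<lambda>u. P y i (u # ws)) u)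
       (\<lambda>(i, u) h. (case i of (i, ws) \<Rightarrow> \<lambda>h u. P' i h (u # ws)) h u)"
      unfolding uniformly_diff_def
    proof (intro allI impI)
      fix e :: real assume "0 < e"
      then have "\<forall>\<^sub>F y in at x within S. \<forall>i\<in>I \<times> {ws. length ws = length (b # bs)}. norm ((\<lambda>(i,ws). P y i ws) i - (\<lambda>(i,ws). P x i ws) i - (\<lambda>(i,ws) h. P' i h ws) i (y - x))
         \<le> e * norm (y - x) * (\<lambda>(i,ws). w i * prod_list (map norm ws)) i"
        by (rule uniformly_diffD[OF Cons.prems(1)])
      then show "\<forall>\<^sub>F y in at x within S. \<forall>i\<in>?I \<times> UNIV. norm ((\<lambda>(i, u). (case i of (i, ws) \<Rightarrow> \<lambda>u. P y i (u # ws)) u) i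
          - (\<lambda>(i, u). (case i of (i, ws) \<Rightarrow> \<lambda>u. P x i (u # ws)) u) i
          - (\<lambda>(i, u) h. (case i of (i, ws) \<Rightarrow> \<lambda>h u. P' i h (u # ws)) h u) i (y - x))
          \<le> e * norm (y - x) * (\<lambda>(i, u). (case i of (i, ws) \<Rightarrow> w i * prod_list (map norm ws)) * norm u) i"
      proof eventually_elim
        case (elim y)
        show ?case
        proof
          fix j assume "j \<in> ?I \<times> (UNIV :: 'b set)"
          then obtain i ws u where j: "j = ((i, ws), u)" "i \<in> I" "length ws = ?m" by auto
          show "norm ((\<lambda>(i, u). (case i of (i, ws) \<Rightarrow> \<lambda>u. P y i (u # ws)) u) j
            - (\<lambda>(i, u). (case i of (i, ws) \<Rightarrow> \<lambda>u. P x i (u # ws)) u) j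
            - (\<lambda>(i, u) h. (case i of (i, ws) \<Rightarrow> \<lambda>h u. P' i h (u # ws)) h u) j (y - x))
            \<le> e * norm (y - x) * (\<lambda>(i, u). (case i of (i, ws) \<Rightarrow> w i * prod_list (map norm ws)) * norm u) j"
            using elim[THEN bspec, of "(i, u # ws)"] j by (simp add: mult_ac)
        qed
      qed
    qed
    show "uniformly_diff S x ?I (\<lambda>i. case i of (i, ws) \<Rightarrow> a b i) (\<lambda>y i. case i of (i, ws) \<Rightarrow> U y i b)
        (\<lambda>i h. (case i of (i, ws) \<Rightarrow> \<lambda>h. U' i h b) h)" using U1 by simp
    show "0 \<le> max C D" using CD by simp
  next
    fix i :: "'i \<times> 'b list" and u v :: 'b assume i: "i \<in> ?I"
    show "(case i of (i, ws) \<Rightarrow> \<lambda>u. P x i (u # ws)) (u - v)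
       = (case i of (i, ws) \<Rightarrow> \<lambda>u. P x i (u # ws)) u - (case i of (i, ws) \<Rightarrow> \<lambda>u. P x i (u # ws)) v"
      using i bounded_multilinear_first[OF lin[of "fst i"], of "snd i" u v 1 "-1"] by (auto simp: split_beta)
    fix y assume y: "y \<in> S"
    show "(case i of (i, ws) \<Rightarrow> \<lambda>h u. P' i h (u # ws)) (y - x) (u - v)
       = (case i of (i, ws) \<Rightarrow> \<lambda>h u. P' i h (u # ws)) (y - x) u - (case i of (i, ws) \<Rightarrow> \<lambda>h u. P' i h (u # ws)) (y - x) v"
      using i bounded_multilinear_first[OF lin'[of "fst i" y], of "snd i" u v 1 "-1"] y by (auto simp: split_beta)
  next
    fix i :: "'i \<times> 'b list" and u :: 'b assume i: "i \<in> ?I"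
    obtain j ws where j: "i = (j, ws)" "j \<in> I" "length ws = ?m" using i by auto
    have "C * (w j * prod_list (map norm ws)) * norm u \<le> max C D * (w j * prod_list (map norm ws)) * norm u"
      using wn[OF j(2)] by (intro mult_right_mono) auto
    then show "norm ((case i of (i, ws) \<Rightarrow> \<lambda>u. P x i (u # ws)) u) \<le> max C D * (case i of (i, ws) \<Rightarrow> w i * prod_list (map norm ws)) * norm u"
      using bP[OF j(2,3), of u] by (simp add: j)
    have "D * a b j \<le> max C D * a b j" using ab[OF j(2)] by (intro mult_right_mono) auto
    then show "norm (case i of (i, ws) \<Rightarrow> U x i b) \<le> max C D * (case i of (i, ws) \<Rightarrow> a b i)"
      using bU[OF j(2)] by (simp add: j)
    show "0 \<le> (case i of (i, ws) \<Rightarrow> w i * prod_list (map norm ws))" "0 \<le> (case i of (i, ws) \<Rightarrow> a b i)"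
      using wn ab j by auto
    fix y assume y: "y \<in> S"
    have "C * norm (y - x) * (w j * prod_list (map norm ws)) * norm u \<le> max C D * norm (y - x) * (w j * prod_list (map norm ws)) * norm u"
      using wn[OF j(2)] by (intro mult_right_mono) auto
    then show "norm ((case i of (i, ws) \<Rightarrow> \<lambda>h u. P' i h (u # ws)) (y - x) u)
       \<le> max C D * norm (y - x) * (case i of (i, ws) \<Rightarrow> w i * prod_list (map norm ws)) * norm u"
      using bP'[OF j(2) y j(3), of u] by (simp add: j)
    have "D * norm (y - x) * a b j \<le> max C D * norm (y - x) * a b j" using ab[OF j(2)] by (intro mult_right_mono) auto
    then show "norm ((case i of (i, ws) \<Rightarrow> \<lambda>h. U' i h b) (y - x)) \<le> max C D * norm (y - x) * (case i of (i, ws) \<Rightarrow> a b i)"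
      using bU'[OF j(2) y] by (simp add: j)
  qed
  have "uniformly_diff S x I (\<lambda>i. (w i * a b i) * (\<Prod>b\<leftarrow>bs. a b i)) (\<lambda>y i. P2 y i (map (U y i) bs))
           (\<lambda>i h. P2' i h (map (U x i) bs) + (\<Sum>j<length bs. P2 x i ((map (U x i) bs)[j := U' i h (bs ! j)])))"
  proof (rule Cons.IH[where C = C2])
    show "uniformly_diff S x ?I (\<lambda>(i, ws). w i * a b i * prod_list (map norm ws)) (\<lambda>y (i, ws). P2 y i ws) (\<lambda>(i, ws) h. P2' i h ws)"
      by (rule uniformly_diff_cong[OF slot]) (auto simp: P2_def P2'_def)
    show "bounded_multilinear UNIV ?m (P2 x i)" if "i \<in> I" for i
      unfolding P2_def by (rule bounded_multilinear_Cons) (use lin that in auto)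
    show C2: "0 \<le> C2" "0 \<le> D" using CD by (auto simp: C2_def)
    show "0 \<le> w i * a b i" if "i \<in> I" for i using w ab that by auto
    show "multi_norm_le UNIV ?m (P2 x i) (C2 * (w i * a b i))" if i: "i \<in> I" for i
      unfolding multi_norm_le_def
    proof (intro allI impI, elim conjE)
      fix ws :: "'b list" assume ws: "length ws = ?m"
      have "norm (P2 x i ws) \<le> C * (w i * prod_list (map norm ws)) * norm (U x i b)"
        unfolding P2_def by (rule bP[OF i ws])
      also have "\<dots> \<le> C * (w i * prod_list (map norm ws)) * (D * a b i)"
        using bU[OF i] wn[OF i] CD by (intro mult_left_mono) auto
      also have "\<dots> \<le> 2 * (C * (w i * prod_list (map norm ws)) * (D * a b i))"
        using mult_nonneg_nonneg[OF mult_nonneg_nonneg[OF CD(1) wn[OF i, of ws]] mult_nonneg_nonneg[OF CD(2) ab[OF i]]] by linarith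
      finally show "norm (P2 x i ws) \<le> C2 * (w i * a b i) * prod_list (map norm ws)" by (simp add: C2_def mult_ac)
    qed
    have P2'_bound: "norm (P' i (y - x) (U x i b # ws)) \<le> (C * D * norm (y-x) * (w i * a b i)) * prod_list (map norm ws)"
       "norm (P x i (U' i (y - x) b # ws)) \<le> (C * D * norm (y-x) * (w i * a b i)) * prod_list (map norm ws)"
      if i: "i \<in> I" and y: "y \<in> S" and ws: "length ws = ?m" for i y ws
    proof -
      have "norm (P' i (y - x) (U x i b # ws)) \<le> C * norm (y - x) * (w i * prod_list (map norm ws)) * norm (U x i b)"
        by (rule bP'[OF i y ws])
      also have "\<dots> \<le> C * norm (y - x) * (w i * prod_list (map norm ws)) * (D * a b i)"
        using bU[OF i] wn[OF i] CD by (intro mult_left_mono) auto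
      finally show "norm (P' i (y - x) (U x i b # ws)) \<le> (C * D * norm (y-x) * (w i * a b i)) * prod_list (map norm ws)"
        by (simp add: mult_ac)
      have "norm (P x i (U' i (y - x) b # ws)) \<le> C * (w i * prod_list (map norm ws)) * norm (U' i (y - x) b)"
        by (rule bP[OF i ws])
      also have "\<dots> \<le> C * (w i * prod_list (map norm ws)) * (D * norm (y - x) * a b i)"
        using bU'[OF i y] wn[OF i] CD by (intro mult_left_mono) auto
      finally show "norm (P x i (U' i (y - x) b # ws)) \<le> (C * D * norm (y-x) * (w i * a b i)) * prod_list (map norm ws)"
        by (simp add: mult_ac)
    qed
    show b2: "multi_norm_le UNIV ?m (P2' i (y - x)) (C2 * norm (y - x) * (w i * a b i))" if i: "i \<in> I" and y: "y \<in> S" for i y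
      unfolding multi_norm_le_def
    proof (intro allI impI, elim conjE)
      fix ws :: "'b list" assume ws: "length ws = ?m"
      show "norm (P2' i (y - x) ws) \<le> C2 * norm (y - x) * (w i * a b i) * prod_list (map norm ws)"
        using norm_triangle_mono[OF P2'_bound(1)[OF i y ws] P2'_bound(2)[OF i y ws]]
        by (simp add: P2'_def C2_def algebra_simps)
    qed
    show "bounded_multilinear UNIV ?m (P2' i (y - x))" if i: "i \<in> I" and y: "y \<in> S" for i y
    proof -
      have 1: "bounded_multilinear UNIV ?m (\<lambda>ws. P' i (y - x) (U x i b # ws))"
        by (rule bounded_multilinear_Cons) (use lin' i y in auto)
      have 2: "bounded_multilinear UNIV ?m (\<lambda>ws. P x i (U' i (y - x) b # ws))"
        by (rule bounded_multilinear_Cons) (use lin i in auto)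
      show ?thesis
        using 1 2 b2[OF i y] unfolding bounded_multilinear_def P2'_def by (auto simp: scaleR_add_right)
    qed
  qed (use Cons.prems(6-8,12) in auto)
  moreover have "P2' i h (map (U x i) bs) + (\<Sum>j<length bs. P2 x i ((map (U x i) bs)[j := U' i h (bs ! j)]))
     = P' i h (map (U x i) (b # bs)) + (\<Sum>j<length (b # bs). P x i ((map (U x i) (b # bs))[j := U' i h ((b # bs) ! j)]))" for i h
    by (simp add: P2_def P2'_def sum.lessThan_Suc_shift del: sum.lessThan_Suc)
  ultimately show ?case by (simp add: P2_def mult.assoc)
qed

section \<open>Higher derivatives of composite maps\<close>

text \<open>A partition of \<open>{..<j}\<close> is coded as the list of its blocks.  The variable of the newest
  derivative gets index \<open>0\<close>: it either forms a new block or joins an existing one.\<close>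

definition extend_partition :: "nat list list \<Rightarrow> nat list list list" where
  "extend_partition bs = ([0] # map (map Suc) bs) #
     map (\<lambda>i. (map (map Suc) bs)[i := 0 # map Suc (bs ! i)]) [0..<length bs]"

primrec set_partitions :: "nat \<Rightarrow> nat list list list" where
  "set_partitions 0 = [[]]"
| "set_partitions (Suc j) = concat (map extend_partition (set_partitions j))"

text \<open>Multisets suffice: the predicate serves to count block lengths, to keep indices in range
  and to regroup products of norms, none of which depends on the order of the entries.\<close>

definition is_partition :: "nat \<Rightarrow> nat list list \<Rightarrow> bool" where
  "is_partition j bs \<longleftrightarrow> mset (concat bs) = mset [0..<j] \<and> [] \<notin> set bs"

lemma is_partition_extend:
  assumes "is_partition j bs" "cs \<in> set (extend_partition bs)"
  shows "is_partition (Suc j) cs"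
proof -
  have eq: "mset [0..<Suc j] = add_mset 0 (mset (map Suc [0..<j]))"
    by (simp only: map_Suc_upt upt_conv_Cons[of 0 "Suc j"] mset.simps zero_less_Suc)
  have m: "mset (concat (map (map Suc) bs)) = mset (map Suc [0..<j])"
  proof -
    have "mset (concat (map (map Suc) bs)) = image_mset Suc (mset (concat bs))"
      by (simp only: map_concat[symmetric] mset_map)
    then show ?thesis using assms(1) unfolding is_partition_def by (simp only: mset_map)
  qed
  consider "cs = [0] # map (map Suc) bs" | i where "i < length bs" "cs = (map (map Suc) bs)[i := 0 # map Suc (bs ! i)]"
    using assms(2) unfolding extend_partition_def by auto
  then show ?thesis
  proof cases
    case 1
    then show ?thesis using assms(1) m unfolding is_partition_def eq by auto
  next
    case 2
    let ?bs = "map (map Suc) bs"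
    have "?bs = take i ?bs @ ?bs ! i # drop (Suc i) ?bs" using 2(1) id_take_nth_drop[of i ?bs] by simp
    then have "mset (concat ?bs) = mset (concat (take i ?bs @ ?bs ! i # drop (Suc i) ?bs))" by simp
    also have "add_mset 0 \<dots> = mset (concat cs)"
      unfolding 2(2) using 2(1) by (simp add: upd_conv_take_nth_drop)
    finally have "mset (concat cs) = mset [0..<Suc j]" using m eq by simp
    moreover have "[] \<notin> set cs"
      using assms(1) 2 set_update_subset_insert[of ?bs i "0 # map Suc (bs ! i)"] unfolding is_partition_def by auto
    ultimately show ?thesis unfolding is_partition_def by blast
  qed
qed

lemma is_partition_set_partitions: "bs \<in> set (set_partitions j) \<Longrightarrow> is_partition j bs"
proof (induction j arbitrary: bs)
  case 0
  then show ?case by (simp add: is_partition_def)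
next
  case (Suc j)
  then show ?case using is_partition_extend by auto
qed

lemma is_partition_sum_length: "is_partition j bs \<Longrightarrow> (\<Sum>b\<leftarrow>bs. length b) = j"
proof -
  assume "is_partition j bs"
  then have "size (mset (concat bs)) = size (mset [0..<j])" by (simp only: is_partition_def)
  then show ?thesis by (simp only: size_mset length_concat length_upt diff_zero)
qed

lemma sum_list_ge_length:
  "[] \<notin> set bs \<Longrightarrow> length bs \<le> (\<Sum>b\<leftarrow>bs. length b)"
proof (induction bs)
  case (Cons a bs)
  then have "1 \<le> length a" by (cases a) auto
  with Cons show ?case by simp
qed simp

lemma is_partition_length: "is_partition j bs \<Longrightarrow> length bs \<le> j"
  using sum_list_ge_length[of bs] is_partition_sum_length[of j bs] unfolding is_partition_def by simp

text \<open>Every other block takes up at least one index, which gives the last claim; so a block of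
  a partition with at least two blocks has fewer than \<open>j\<close> entries.\<close>

lemma is_partition_block:
  assumes "is_partition j bs" "b \<in> set bs"
  shows "set b \<subseteq> {..<j}" "1 \<le> length b" "length b + length bs \<le> Suc j"
proof -
  have "set_mset (mset (concat bs)) = set_mset (mset [0..<j])"
    using assms(1) by (simp only: is_partition_def)
  then have "set (concat bs) = {..<j}" by (simp only: set_mset_mset atLeast_upt)
  then show "set b \<subseteq> {..<j}" using assms(2) by auto
  show "1 \<le> length b" using assms unfolding is_partition_def by (cases b) auto
  obtain us vs where "bs = us @ b # vs" using assms(2) by (meson split_list)
  then show "length b + length bs \<le> Suc j"
    using is_partition_sum_length[OF assms(1)] sum_list_ge_length[of us] sum_list_ge_length[of vs] assms(1)
    unfolding is_partition_def by auto
qed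

lemma prod_list_partition:
  fixes f :: "nat \<Rightarrow> real"
  assumes "is_partition j bs"
  shows "(\<Prod>b\<leftarrow>bs. prod_list (map f b)) = prod_list (map f [0..<j])"
proof -
  have *: "prod_list (map f xs) = prod_mset (image_mset f (mset xs))" for xs by (induction xs) auto
  have "(\<Prod>b\<leftarrow>bs. prod_list (map f b)) = prod_list (map f (concat bs))" by (induction bs) auto
  then show ?thesis using assms by (simp only: * is_partition_def)
qed

lemma prod_list_partition_nth:
  fixes f :: "'a \<Rightarrow> real"
  assumes "is_partition j bs" "length vs = j"
  shows "(\<Prod>b\<leftarrow>bs. prod_list (map f (map ((!) vs) b))) = prod_list (map f vs)"
proof -
  have "prod_list (map (\<lambda>i. f (vs ! i)) [0..<j]) = prod_list (map f vs)"
    using arg_cong[OF map_nth[of vs], of "map f"] assms(2) by (simp add: comp_def)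
  then show ?thesis using prod_list_partition[OF assms(1), of "\<lambda>i. f (vs ! i)"] by (simp add: comp_def)
qed

text \<open>The terms of the formula of Faa di Bruno.\<close>

definition block_values :: "(nat \<Rightarrow> 'a list \<Rightarrow> 'b) \<Rightarrow> 'a list \<Rightarrow> nat list \<Rightarrow> 'b" where
  "block_values \<Phi> vs b = \<Phi> (length b) (map ((!) vs) b)"

definition partition_term :: "(nat \<Rightarrow> 'b list \<Rightarrow> 'c) \<Rightarrow> (nat \<Rightarrow> 'a list \<Rightarrow> 'b) \<Rightarrow> 'a list \<Rightarrow> nat list list \<Rightarrow> 'c" where
  "partition_term F \<Phi> vs bs = F (length bs) (map (block_values \<Phi> vs) bs)"

definition comp_derivs ::
  "(nat \<Rightarrow> 'b \<Rightarrow> 'b list \<Rightarrow> 'c::comm_monoid_add) \<Rightarrow> ('a \<Rightarrow> 'b) \<Rightarrow> (nat \<Rightarrow> 'a \<Rightarrow> 'a list \<Rightarrow> 'b) \<Rightarrow> nat \<Rightarrow> 'a \<Rightarrow> 'a list \<Rightarrow> 'c" where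
  "comp_derivs F \<phi> \<Phi> j y vs = (\<Sum>bs\<leftarrow>set_partitions j. partition_term (\<lambda>i. F i (\<phi> y)) (\<lambda>i. \<Phi> i y) vs bs)"

lemma block_values_Suc: "block_values \<Phi> (h # vs) (map Suc b) = block_values \<Phi> vs b"
  by (simp add: block_values_def comp_def)

lemma sum_list_concat_map: "sum_list (map t (concat (map g xs))) = (\<Sum>y\<leftarrow>xs. \<Sum>z\<leftarrow>g y. t z)"
  by (induction xs) auto

text \<open>The product rule in combinatorial form: the new block \<open>[0]\<close> arises when the
  outer map is differentiated, and \<open>0\<close> joins block \<open>i\<close> when the inner
  factor number \<open>i\<close> is.\<close>

lemma comp_derivs_Suc:
  "comp_derivs F \<phi> \<Phi> (Suc j) y (h # vs) = (\<Sum>bs\<leftarrow>set_partitions j.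
      F (Suc (length bs)) (\<phi> y) (\<Phi> 1 y [h] # map (block_values (\<lambda>i. \<Phi> i y) vs) bs) +
      (\<Sum>i<length bs. F (length bs) (\<phi> y)
         ((map (block_values (\<lambda>i. \<Phi> i y) vs) bs)[i := \<Phi> (Suc (length (bs ! i))) y (h # map ((!) vs) (bs ! i))])))"
proof -
  let ?B = "block_values (\<lambda>i. \<Phi> i y)" and ?T = "partition_term (\<lambda>i. F i (\<phi> y)) (\<lambda>i. \<Phi> i y)"
  have ext: "(\<Sum>cs\<leftarrow>extend_partition bs. ?T (h # vs) cs) =
      F (Suc (length bs)) (\<phi> y) (\<Phi> 1 y [h] # map (?B vs) bs) +
      (\<Sum>i<length bs. F (length bs) (\<phi> y) ((map (?B vs) bs)[i := \<Phi> (Suc (length (bs ! i))) y (h # map ((!) vs) (bs ! i))]))" for bs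
  proof -
    have m: "map (?B (h # vs)) (map (map Suc) bs) = map (?B vs) bs"
      by (simp add: block_values_Suc comp_def)
    have "?T (h # vs) ([0] # map (map Suc) bs) = F (Suc (length bs)) (\<phi> y) (\<Phi> 1 y [h] # map (?B vs) bs)"
      unfolding partition_term_def list.map m by (simp add: block_values_def)
    moreover have "?T (h # vs) ((map (map Suc) bs)[i := 0 # map Suc (bs ! i)]) =
       F (length bs) (\<phi> y) ((map (?B vs) bs)[i := \<Phi> (Suc (length (bs ! i))) y (h # map ((!) vs) (bs ! i))])" for i
      unfolding partition_term_def map_update m by (simp add: block_values_def comp_def)
    ultimately show ?thesis
      by (simp add: extend_partition_def comp_def interv_sum_list_conv_sum_set_nat atLeast0LessThan)
  qed
  have "comp_derivs F \<phi> \<Phi> (Suc j) y (h # vs) = (\<Sum>bs\<leftarrow>set_partitions j. \<Sum>cs\<leftarrow>extend_partition bs. ?T (h # vs) cs)"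
    by (simp only: comp_derivs_def set_partitions.simps sum_list_concat_map)
  then show ?thesis by (simp only: ext)
qed

text \<open>\<open>lower_partitions j\<close> lists the partitions other than the coarsest and the finest one.\<close>

fun lower_partitions :: "nat \<Rightarrow> nat list list list" where
  "lower_partitions (Suc (Suc (Suc j))) =
     ([0] # map (map Suc) [[0..<Suc (Suc j)]]) #
     map (\<lambda>i. (map (map Suc) (map (\<lambda>i. [i]) [0..<Suc (Suc j)]))[i := [0, Suc i]]) [0..<Suc (Suc j)] @
     concat (map extend_partition (lower_partitions (Suc (Suc j))))"
| "lower_partitions _ = []"

lemma extend_partition_singleton: "extend_partition [b] = [[[0], map Suc b], [0 # map Suc b]]"
  by (simp add: extend_partition_def)

lemma extend_partition_join:
  "i < length bs \<Longrightarrow> (map (map Suc) bs)[i := 0 # map Suc (bs ! i)] \<in> set (extend_partition bs)"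
  by (auto simp: extend_partition_def)

lemma set_partitions_1: "set_partitions (Suc 0) = [[[0]]]"
  by (simp add: extend_partition_def)

text \<open>The two partitions split off carry the derivatives of top order, the coarsest one that
  of the inner map and the finest one that of the outer map. They are distinct only from two
  elements on, hence the \<open>Suc (Suc j)\<close>.\<close>

lemma sum_set_partitions:
  fixes t :: "nat list list \<Rightarrow> 'c::comm_monoid_add"
  shows "(\<Sum>bs\<leftarrow>set_partitions (Suc (Suc j)). t bs) =
    t [[0..<Suc (Suc j)]] + t (map (\<lambda>i. [i]) [0..<Suc (Suc j)]) + (\<Sum>bs\<leftarrow>lower_partitions (Suc (Suc j)). t bs)"
proof (induction j arbitrary: t)
  case 0
  have "(\<Sum>bs\<leftarrow>set_partitions (Suc (Suc 0)). t bs) = t [[0], [Suc 0]] + t [[0, Suc 0]]"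
    unfolding set_partitions.simps(2)[of "Suc 0"] set_partitions_1 by (simp add: extend_partition_def)
  then show ?case by (simp add: add.commute)
next
  case (Suc j)
  let ?m = "Suc (Suc j)"
  have upt: "0 # map Suc [0..<?m] = [0..<Suc ?m]"
    by (simp only: map_Suc_upt upt_conv_Cons[of 0 "Suc ?m"] zero_less_Suc)
  have single: "[0] # map (map Suc) (map (\<lambda>i. [i]) [0..<?m]) = map (\<lambda>i. [i]) [0..<Suc ?m]"
    by (simp only: upt[symmetric] list.map map_map comp_def)
  have "(\<Sum>bs\<leftarrow>set_partitions (Suc ?m). t bs) = (\<Sum>bs\<leftarrow>set_partitions ?m. \<Sum>cs\<leftarrow>extend_partition bs. t cs)"
    by (simp only: set_partitions.simps(2)[of ?m] sum_list_concat_map)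
  also have "\<dots> = (\<Sum>cs\<leftarrow>extend_partition [[0..<?m]]. t cs) + (\<Sum>cs\<leftarrow>extend_partition (map (\<lambda>i. [i]) [0..<?m]). t cs)
      + (\<Sum>bs\<leftarrow>lower_partitions ?m. \<Sum>cs\<leftarrow>extend_partition bs. t cs)"
    by (rule Suc.IH)
  also have "(\<Sum>cs\<leftarrow>extend_partition [[0..<?m]]. t cs) = t ([0] # map (map Suc) [[0..<?m]]) + t [[0..<Suc ?m]]"
    unfolding upt[symmetric] extend_partition_singleton by (simp del: upt_Suc)
  also have "(\<Sum>cs\<leftarrow>extend_partition (map (\<lambda>i. [i]) [0..<?m]). t cs) = t (map (\<lambda>i. [i]) [0..<Suc ?m]) +
     (\<Sum>cs\<leftarrow>map (\<lambda>i. (map (map Suc) (map (\<lambda>i. [i]) [0..<?m]))[i := [0, Suc i]]) [0..<?m]. t cs)"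
  proof -
    have e: "map (\<lambda>i. (map (map Suc) (map (\<lambda>i. [i]) [0..<?m]))[i := 0 # map Suc (map (\<lambda>i. [i]) [0..<?m] ! i)]) [0..<length (map (\<lambda>i. [i]) [0..<?m])]
       = map (\<lambda>i. (map (map Suc) (map (\<lambda>i. [i]) [0..<?m]))[i := [0, Suc i]]) [0..<?m]"
      by (rule map_cong) (auto simp del: upt_Suc)
    show ?thesis by (simp only: extend_partition_def single e list.map sum_list.Cons)
  qed
  finally have *: "(\<Sum>bs\<leftarrow>set_partitions (Suc ?m). t bs) =
     t ([0] # map (map Suc) [[0..<?m]]) + t [[0..<Suc ?m]] + (t (map (\<lambda>i. [i]) [0..<Suc ?m]) +
     (\<Sum>cs\<leftarrow>map (\<lambda>i. (map (map Suc) (map (\<lambda>i. [i]) [0..<?m]))[i := [0, Suc i]]) [0..<?m]. t cs))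
     + (\<Sum>bs\<leftarrow>lower_partitions ?m. \<Sum>cs\<leftarrow>extend_partition bs. t cs)" .
  have "(\<Sum>bs\<leftarrow>lower_partitions (Suc ?m). t bs) = t ([0] # map (map Suc) [[0..<?m]]) +
     ((\<Sum>cs\<leftarrow>map (\<lambda>i. (map (map Suc) (map (\<lambda>i. [i]) [0..<?m]))[i := [0, Suc i]]) [0..<?m]. t cs)
     + (\<Sum>bs\<leftarrow>lower_partitions ?m. \<Sum>cs\<leftarrow>extend_partition bs. t cs))"
    unfolding lower_partitions.simps(1)[of j] map_append list.map(2)[of t] sum_list.Cons append_Cons sum_list_append
      sum_list_concat_map by (rule refl)
  then show ?case unfolding * by (simp only: ac_simps)
qed

text \<open>At least two blocks keep the inner orders below \<open>j\<close>, fewer than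
  \<open>j\<close> blocks the outer order.\<close>

lemma lower_partitions_props:
  "bs \<in> set (lower_partitions j) \<Longrightarrow> is_partition j bs \<and> 2 \<le> length bs \<and> length bs < j"
proof (induction j arbitrary: bs rule: lower_partitions.induct)
  case (1 j)
  let ?m = "Suc (Suc j)"
  have top: "is_partition ?m [[0..<?m]]" by (simp add: is_partition_def)
  have bot: "is_partition ?m (map (\<lambda>i. [i]) [0..<?m])"
  proof -
    have "concat (map (\<lambda>i. [i]) xs) = xs" for xs :: "nat list" by (induction xs) auto
    then show ?thesis by (auto simp: is_partition_def simp del: upt_Suc)
  qed
  consider "bs = [0] # map (map Suc) [[0..<?m]]"
    | i where "i < ?m" "bs = (map (map Suc) (map (\<lambda>i. [i]) [0..<?m]))[i := [0, Suc i]]"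
    | cs where "cs \<in> set (lower_partitions ?m)" "bs \<in> set (extend_partition cs)"
    using 1(2) by (auto simp del: upt_Suc)
  then show ?case
  proof cases
    case 1
    then have "bs \<in> set (extend_partition [[0..<?m]])" by (simp add: extend_partition_def del: upt_Suc)
    then show ?thesis using is_partition_extend[OF top] 1 by (simp del: upt_Suc)
  next
    case 2
    have "bs \<in> set (extend_partition (map (\<lambda>i. [i]) [0..<?m]))"
      using extend_partition_join[of i "map (\<lambda>i. [i]) [0..<?m]"] 2 by (simp del: upt_Suc)
    then show ?thesis using is_partition_extend[OF bot] 2 by (simp del: upt_Suc)
  next
    case 3
    then have "is_partition ?m cs \<and> 2 \<le> length cs \<and> length cs < ?m" using 1(1) by blast
    moreover have "length bs = length cs \<or> length bs = Suc (length cs)"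
      using 3(2) by (auto simp: extend_partition_def)
    ultimately show ?thesis using is_partition_extend[OF _ 3(2)] by auto
  qed
qed simp_all

text \<open>In contrast to \<open>has_derivs_on\<close>, only homogeneity in the newest variable is required of the
  derivatives; this is enough to differentiate compositions and to see that the derivatives of
  the zero map vanish.\<close>

definition has_weak_derivs_on ::
  "'a::real_normed_vector set \<Rightarrow> 'a set \<Rightarrow> nat \<Rightarrow> ('a \<Rightarrow> 'b::real_normed_vector) \<Rightarrow> (nat \<Rightarrow> 'a \<Rightarrow> 'a list \<Rightarrow> 'b) \<Rightarrow> bool" where
  "has_weak_derivs_on E S k f F \<longleftrightarrow>
     (\<forall>x\<in>S. F 0 x [] = f x) \<and>
     (\<forall>j\<le>k. \<forall>x\<in>S. \<exists>C. multi_norm_le E j (F j x) C) \<and>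
     (\<forall>j<k. \<forall>x\<in>S. \<forall>h\<in>E. \<forall>vs t. length vs = j \<and> set vs \<subseteq> E \<longrightarrow> F (Suc j) x (t *\<^sub>R h # vs) = t *\<^sub>R F (Suc j) x (h # vs)) \<and>
     (\<forall>j<k. \<forall>x\<in>S. uniformly_diff S x {vs. length vs = j \<and> set vs \<subseteq> E} (\<lambda>vs. prod_list (map norm vs))
        (F j) (\<lambda>vs h. F (Suc j) x (h # vs)))"

section \<open>Calculus of iterated derivatives and the chain rule\<close>

lemma uniformly_diff_multi_norm:
  "uniformly_diff S x {vs. length vs = j \<and> set vs \<subseteq> E} (\<lambda>vs. prod_list (map norm vs)) G G' \<longleftrightarrow>
   (\<forall>e>0. eventually (\<lambda>y. multi_norm_le E j (\<lambda>vs. G y vs - G x vs - G' vs (y - x)) (e * norm (y - x))) (at x within S))"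
  unfolding uniformly_diff_def multi_norm_le_def by simp

lemma has_derivs_onD:
  assumes "has_derivs_on E S k f F" "x \<in> S"
  shows "F 0 x [] = f x"
    and "j \<le> k \<Longrightarrow> bounded_multilinear E j (F j x)"
    and "j < k \<Longrightarrow> uniformly_diff S x {vs. length vs = j \<and> set vs \<subseteq> E} (\<lambda>vs. prod_list (map norm vs)) (F j) (\<lambda>vs h. F (Suc j) x (h # vs))"
proof -
  note d = assms(1)[unfolded has_derivs_on_def]
  show "F 0 x [] = f x" using d[THEN conjunct1] assms(2) by simp
  show "bounded_multilinear E j (F j x)" if "j \<le> k" using d[THEN conjunct2, THEN conjunct1] assms(2) that by simp
  show "uniformly_diff S x {vs. length vs = j \<and> set vs \<subseteq> E} (\<lambda>vs. prod_list (map norm vs)) (F j) (\<lambda>vs h. F (Suc j) x (h # vs))"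
    if "j < k"
    using d[THEN conjunct2, THEN conjunct2] assms(2) that by (simp add: uniformly_diff_multi_norm)
qed

lemma has_derivs_onI:
  assumes "\<And>x. x \<in> S \<Longrightarrow> F 0 x [] = f x"
    and "\<And>j x. j \<le> k \<Longrightarrow> x \<in> S \<Longrightarrow> bounded_multilinear E j (F j x)"
    and "\<And>j x. j < k \<Longrightarrow> x \<in> S \<Longrightarrow> uniformly_diff S x {vs. length vs = j \<and> set vs \<subseteq> E} (\<lambda>vs. prod_list (map norm vs)) (F j) (\<lambda>vs h. F (Suc j) x (h # vs))"
  shows "has_derivs_on E S k f F"
  unfolding has_derivs_on_def using assms by (simp add: uniformly_diff_multi_norm)

lemma has_derivs_imp_weak:
  assumes "has_derivs_on E S k f F" "subspace E"
  shows "has_weak_derivs_on E S k f F"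
  unfolding has_weak_derivs_on_def
proof (intro conjI allI impI ballI)
  fix x assume x: "x \<in> S"
  show "F 0 x [] = f x" by (rule has_derivs_onD(1)[OF assms(1) x])
  show "\<exists>C. multi_norm_le E j (F j x) C" if "j \<le> k" for j
    using has_derivs_onD(2)[OF assms(1) x that] by (auto simp: bounded_multilinear_def)
  show "uniformly_diff S x {vs. length vs = j \<and> set vs \<subseteq> E} (\<lambda>vs. prod_list (map norm vs)) (F j) (\<lambda>vs h. F (Suc j) x (h # vs))"
    if "j < k" for j
    by (rule has_derivs_onD(3)[OF assms(1) x that])
  fix j h vs t assume *: "j < k" "h \<in> E" "length vs = j \<and> set vs \<subseteq> E"
  have "bounded_multilinear E (Suc j) (F (Suc j) x)" using has_derivs_onD(2)[OF assms(1) x] * by (simp add: Suc_leI)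
  from bounded_multilinear_first[OF this, of vs h 0 t 0]
  show "F (Suc j) x (t *\<^sub>R h # vs) = t *\<^sub>R F (Suc j) x (h # vs)" using * subspace_0[OF assms(2)] by simp
qed

lemma has_weak_derivsD:
  assumes "has_weak_derivs_on E S k f F" "x \<in> S"
  shows "F 0 x [] = f x"
    and "j \<le> k \<Longrightarrow> \<exists>C\<ge>1. multi_norm_le E j (F j x) C"
    and "j < k \<Longrightarrow> h \<in> E \<Longrightarrow> length vs = j \<Longrightarrow> set vs \<subseteq> E \<Longrightarrow> F (Suc j) x (t *\<^sub>R h # vs) = t *\<^sub>R F (Suc j) x (h # vs)"
    and "j < k \<Longrightarrow> uniformly_diff S x {vs. length vs = j \<and> set vs \<subseteq> E} (\<lambda>vs. prod_list (map norm vs)) (F j) (\<lambda>vs h. F (Suc j) x (h # vs))"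
proof -
  note d = assms(1)[unfolded has_weak_derivs_on_def]
  show "F 0 x [] = f x" using d[THEN conjunct1] assms(2) by simp
  show "F (Suc j) x (t *\<^sub>R h # vs) = t *\<^sub>R F (Suc j) x (h # vs)" if "j < k" "h \<in> E" "length vs = j" "set vs \<subseteq> E"
    using d[THEN conjunct2, THEN conjunct2, THEN conjunct1] assms(2) that by simp
  show "uniformly_diff S x {vs. length vs = j \<and> set vs \<subseteq> E} (\<lambda>vs. prod_list (map norm vs)) (F j) (\<lambda>vs h. F (Suc j) x (h # vs))"
    if "j < k"
    using d[THEN conjunct2, THEN conjunct2, THEN conjunct2] assms(2) that by simp
  assume "j \<le> k"
  then obtain C where "multi_norm_le E j (F j x) C" using d[THEN conjunct2, THEN conjunct1] assms(2) by blast
  then have "multi_norm_le E j (F j x) (max 1 C)" by (rule multi_norm_le_mono) simp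
  then show "\<exists>C\<ge>1. multi_norm_le E j (F j x) C" by (intro exI[of _ "max 1 C"]) simp
qed

lemma has_weak_derivs_diff:
  assumes "has_weak_derivs_on E S k f F" "has_weak_derivs_on E S k g G"
  shows "has_weak_derivs_on E S k (\<lambda>x. f x - g x) (\<lambda>j x vs. F j x vs - G j x vs)"
  unfolding has_weak_derivs_on_def
proof (intro conjI allI impI ballI)
  fix x assume x: "x \<in> S"
  show "F 0 x [] - G 0 x [] = f x - g x" using assms[THEN has_weak_derivsD(1)] x by simp
  fix j
  { assume "j \<le> k"
    then obtain C D where "multi_norm_le E j (F j x) C" "multi_norm_le E j (G j x) D"
      using has_weak_derivsD(2)[OF assms(1) x] has_weak_derivsD(2)[OF assms(2) x] by blast
    then have "multi_norm_le E j (\<lambda>vs. F j x vs - G j x vs) (C + D)"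
      unfolding multi_norm_le_def by (auto simp: algebra_simps intro!: order_trans[OF norm_triangle_ineq4] add_mono)
    then show "\<exists>C. multi_norm_le E j (\<lambda>vs. F j x vs - G j x vs) C" by blast }
  { fix h vs t assume *: "j < k" "h \<in> E" "length vs = j \<and> set vs \<subseteq> E"
    then show "F (Suc j) x (t *\<^sub>R h # vs) - G (Suc j) x (t *\<^sub>R h # vs) = t *\<^sub>R (F (Suc j) x (h # vs) - G (Suc j) x (h # vs))"
      using has_weak_derivsD(3)[OF assms(1) x *(1,2)] has_weak_derivsD(3)[OF assms(2) x *(1,2)]
      by (simp add: scaleR_diff_right) }
  assume j: "j < k"
  let ?I = "{vs. length vs = j \<and> set vs \<subseteq> E}"
  have "uniformly_diff S x ?I (\<lambda>vs. prod_list (map norm vs)) (\<lambda>y vs. - G j y vs) (\<lambda>vs h. - G (Suc j) x (h # vs))"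
    using has_weak_derivsD(4)[OF assms(2) x j] unfolding uniformly_diff_def
    by (simp add: norm_minus_commute algebra_simps)
  from uniformly_diff_add[OF has_weak_derivsD(4)[OF assms(1) x j] this]
  show "uniformly_diff S x ?I (\<lambda>vs. prod_list (map norm vs)) (\<lambda>x vs. F j x vs - G j x vs) (\<lambda>vs h. F (Suc j) x (h # vs) - G (Suc j) x (h # vs))"
    by simp
qed

text \<open>By induction the derivatives of order \<open>j\<close> vanish at \<open>x\<close> and at
  \<open>x + t *\<^sub>R h\<close>, so the next derivative along \<open>t *\<^sub>R h\<close> is
  o(t); by homogeneity it is \<open>t\<close> times a fixed vector, which must then be zero.\<close>

lemma zero_derivs:
  assumes F: "has_weak_derivs_on E S k f F" and f: "\<And>x. x \<in> S \<Longrightarrow> f x = 0"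
    and E: "subspace E" "S \<subseteq> E"
    and S_open: "\<And>x h. x \<in> S \<Longrightarrow> h \<in> E \<Longrightarrow> \<exists>d>0. \<forall>t. 0 < t \<and> t < d \<longrightarrow> x + t *\<^sub>R h \<in> S"
  shows "j \<le> k \<Longrightarrow> x \<in> S \<Longrightarrow> length vs = j \<Longrightarrow> set vs \<subseteq> E \<Longrightarrow> F j x vs = 0"
proof (induction j arbitrary: x vs)
  case 0
  then show ?case using has_weak_derivsD(1)[OF F] f by simp
next
  case (Suc j)
  obtain h ws where vs: "vs = h # ws" using Suc.prems(3) by (cases vs) auto
  have ws: "length ws = j" "set ws \<subseteq> E" "h \<in> E" using Suc.prems vs by auto
  let ?p = "prod_list (map norm ws)"
  have "norm (F (Suc j) x (h # ws)) \<le> e * (norm h * ?p)" if e: "e > 0" for e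
  proof (cases "h = 0")
    case True
    then show ?thesis using has_weak_derivsD(3)[OF F Suc.prems(2), of j h ws 0] Suc.prems ws by simp
  next
    case False
    have "\<forall>\<^sub>F y in at x within S. \<forall>ws\<in>{vs. length vs = j \<and> set vs \<subseteq> E}. norm (F j y ws - F j x ws - F (Suc j) x ((y - x) # ws))
       \<le> e * norm (y - x) * prod_list (map norm ws)"
      using uniformly_diffD[OF has_weak_derivsD(4)[OF F Suc.prems(2)] e] Suc.prems by simp
    then obtain d where d: "d > 0" "\<And>y. y \<in> S \<Longrightarrow> y \<noteq> x \<Longrightarrow> dist y x < d \<Longrightarrow>
        norm (F j y ws - F j x ws - F (Suc j) x ((y - x) # ws)) \<le> e * norm (y - x) * ?p"
      unfolding eventually_at using ws by blast
    obtain d' where d': "d' > 0" "\<And>t. 0 < t \<Longrightarrow> t < d' \<Longrightarrow> x + t *\<^sub>R h \<in> S" using S_open[OF Suc.prems(2) ws(3)] by blast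
    define t where "t = min (d'/2) (d / (2 * norm h))"
    have t: "0 < t" "t < d'" "t * norm h < d"
    proof -
      show "0 < t" "t < d'" using d d' False by (auto simp: t_def)
      have "t * norm h \<le> d / (2 * norm h) * norm h" by (intro mult_right_mono) (auto simp: t_def)
      also have "\<dots> < d" using d False by simp
      finally show "t * norm h < d" .
    qed
    let ?y = "x + t *\<^sub>R h"
    have y: "?y \<in> S" using d' t by simp
    have "norm (F j ?y ws - F j x ws - F (Suc j) x ((?y - x) # ws)) \<le> e * norm (?y - x) * ?p"
      using d(2)[OF y] t False by (simp add: dist_norm)
    moreover have "F j ?y ws = 0" "F j x ws = 0" using Suc y ws by auto
    moreover have "F (Suc j) x ((?y - x) # ws) = t *\<^sub>R F (Suc j) x (h # ws)"
      using has_weak_derivsD(3)[OF F Suc.prems(2), of j h ws t] Suc.prems ws by simp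
    ultimately have "t * norm (F (Suc j) x (h # ws)) \<le> t * (e * (norm h * ?p))" using t by (simp add: mult_ac)
    then show ?thesis using t by simp
  qed
  then have "norm (F (Suc j) x (h # ws)) \<le> 0 + e" if "e > 0" for e
  proof -
    have p: "0 \<le> norm h * ?p" using prod_list_norm_nonneg[of ws] by simp
    have "norm (F (Suc j) x (h # ws)) \<le> e / (norm h * ?p + 1) * (norm h * ?p)"
      using \<open>\<And>e. e > 0 \<Longrightarrow> _\<close>[of "e / (norm h * ?p + 1)"] that p by (simp add: add_nonneg_pos)
    also have "\<dots> \<le> e" using that p by (simp add: field_simps)
    finally show ?thesis by simp
  qed
  then have "norm (F (Suc j) x (h # ws)) \<le> 0" by (rule field_le_epsilon)
  then show ?case using vs by simp
qed

text \<open>The outer factor of the chain rule: the multilinear map \<open>F m\<close> at the moving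
  point \<open>\<phi> y\<close>, uniformly in all arguments. The index set \<open>I\<close> is
  carried along because \<open>uniformly_diff_list\<close> wants pairs of an index and an argument
  list.\<close>

lemma uniformly_diff_outer:
  fixes F :: "nat \<Rightarrow> 'b::real_normed_vector \<Rightarrow> 'b list \<Rightarrow> 'c::real_normed_vector" and \<phi> :: "'p::real_normed_vector \<Rightarrow> 'b"
  assumes lin: "bounded_multilinear UNIV (Suc m) (F (Suc m) (\<phi> x))"
    and dF: "uniformly_diff T (\<phi> x) {ws. length ws = m \<and> set ws \<subseteq> UNIV} (\<lambda>ws. prod_list (map norm ws)) (F m) (\<lambda>ws h. F (Suc m) (\<phi> x) (h # ws))"
    and \<phi>: "\<And>e. e > 0 \<Longrightarrow> \<forall>\<^sub>F y in at x within S. norm (\<phi> y - \<phi> x - \<phi>' (y - x)) \<le> e * norm (y - x)"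
    and b\<phi>': "\<And>y. y \<in> S \<Longrightarrow> norm (\<phi>' (y - x)) \<le> C * norm (y - x)" and C: "0 \<le> C"
    and T: "\<phi> ` S \<subseteq> T"
  shows "uniformly_diff S x (I \<times> {ws. length ws = m}) (\<lambda>(i,ws). prod_list (map norm ws))
     (\<lambda>y (i,ws). F m (\<phi> y) ws) (\<lambda>(i,ws) h. F (Suc m) (\<phi> x) (\<phi>' h # ws))"
  unfolding uniformly_diff_def
proof (intro allI impI)
  fix e :: real assume e: "0 < e"
  obtain D where D: "1 \<le> D" "multi_norm_le UNIV (Suc m) (F (Suc m) (\<phi> x)) D"
    using bounded_multilinear_bound[OF lin] by blast
  define e1 where "e1 = e / (2 * (C + 1))"
  define e2 where "e2 = min 1 (e / (2 * D))"
  have e12: "e1 > 0" "e2 > 0" "e2 \<le> 1" "D * e2 \<le> e/2" "e1 * (C + 1) = e/2"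
  proof -
    show "e1 > 0" "e2 > 0" "e2 \<le> 1" using e C D by (auto simp: e1_def e2_def)
    have "D * e2 \<le> D * (e / (2 * D))" using D by (intro mult_left_mono) (auto simp: e2_def)
    then show "D * e2 \<le> e/2" using D by simp
    have "C + 1 \<noteq> 0" using C by simp
    then show "e1 * (C + 1) = e/2" unfolding e1_def by (simp add: divide_simps)
  qed
  from uniformly_diffD[OF dF e12(1)] obtain d where d: "d > 0"
    "\<And>z. z \<in> T \<Longrightarrow> z \<noteq> \<phi> x \<Longrightarrow> dist z (\<phi> x) < d \<Longrightarrow> \<forall>ws\<in>{ws. length ws = m \<and> set ws \<subseteq> UNIV}.
       norm (F m z ws - F m (\<phi> x) ws - F (Suc m) (\<phi> x) ((z - \<phi> x) # ws)) \<le> e1 * norm (z - \<phi> x) * prod_list (map norm ws)"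
    unfolding eventually_at by blast
  have "\<forall>\<^sub>F y in at x within S. norm (\<phi> y - \<phi> x - \<phi>' (y - x)) \<le> e2 * norm (y - x)" by (rule \<phi>[OF e12(2)])
  moreover have "\<forall>\<^sub>F y in at x within S. y \<in> S \<and> dist y x < d / (C + 1)"
    unfolding eventually_at using d C by (intro exI[of _ "d / (C + 1)"]) auto
  ultimately show "\<forall>\<^sub>F y in at x within S. \<forall>i\<in>I \<times> {ws. length ws = m}. norm ((case i of (i,ws) \<Rightarrow> F m (\<phi> y) ws) -
      (case i of (i,ws) \<Rightarrow> F m (\<phi> x) ws) - (case i of (i,ws) \<Rightarrow> \<lambda>h. F (Suc m) (\<phi> x) (\<phi>' h # ws)) (y - x))
      \<le> e * norm (y - x) * (case i of (i,ws) \<Rightarrow> prod_list (map norm ws))"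
  proof eventually_elim
    case (elim y)
    define t where "t = norm (y - x)"
    have y: "y \<in> S" "t * (C + 1) < d" using elim C by (auto simp: t_def dist_norm field_simps)
    have t0: "t \<ge> 0" by (simp add: t_def)
    have 1: "norm (\<phi> y - \<phi> x) \<le> (C + 1) * t"
    proof -
      have "norm (\<phi> y - \<phi> x) \<le> norm (\<phi> y - \<phi> x - \<phi>' (y - x)) + norm (\<phi>' (y - x))"
        by (metis diff_add_cancel norm_triangle_ineq)
      also have "\<dots> \<le> e2 * t + C * t" using elim b\<phi>'[OF y(1)] by (simp add: t_def)
      also have "\<dots> \<le> 1 * t + C * t" using e12 t0 by (intro add_mono mult_right_mono) auto
      finally show ?thesis by (simp add: algebra_simps)
    qed
    show ?case
    proof
      fix j assume "j \<in> I \<times> {ws :: 'b list. length ws = m}"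
      then obtain i ws where j: "j = (i, ws)" "length ws = m" by auto
      let ?p = "prod_list (map norm ws)"
      have p: "?p \<ge> 0" by (rule prod_list_norm_nonneg)
      have F0: "F (Suc m) (\<phi> x) ((u - v) # ws) = F (Suc m) (\<phi> x) (u # ws) - F (Suc m) (\<phi> x) (v # ws)" for u v
        using bounded_multilinear_first[OF lin j(2), of u v 1 "-1"] by simp
      have A: "norm (F m (\<phi> y) ws - F m (\<phi> x) ws - F (Suc m) (\<phi> x) ((\<phi> y - \<phi> x) # ws)) \<le> e1 * norm (\<phi> y - \<phi> x) * ?p"
      \<comment> \<open>The filter \<open>at\<close> excludes the point itself; when
        \<open>\<phi>\<close> takes the same value at both points, the claim is that the derivative
        vanishes on \<open>0\<close>.\<close>
      proof (cases "\<phi> y = \<phi> x")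
        case True
        then show ?thesis using F0[of 0 0] by simp
      next
        case False
        then show ?thesis using d(2)[of "\<phi> y"] T y 1 j by (auto simp: dist_norm mult.commute)
      qed
      also have "\<dots> \<le> e1 * ((C + 1) * t) * ?p" using 1 e12 p by (intro mult_right_mono mult_left_mono) auto
      also have "\<dots> = (e1 * (C + 1)) * t * ?p" by simp
      finally have A: "norm (F m (\<phi> y) ws - F m (\<phi> x) ws - F (Suc m) (\<phi> x) ((\<phi> y - \<phi> x) # ws)) \<le> e/2 * t * ?p"
        unfolding e12(5) .
      have "norm (F (Suc m) (\<phi> x) ((\<phi> y - \<phi> x - \<phi>' (y - x)) # ws)) \<le> D * (norm (\<phi> y - \<phi> x - \<phi>' (y - x)) * ?p)"
        using multi_norm_leD[OF D(2), of "(\<phi> y - \<phi> x - \<phi>' (y - x)) # ws"] j by simp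
      also have "\<dots> \<le> D * ((e2 * t) * ?p)" using elim D p by (intro mult_left_mono mult_right_mono) (auto simp: t_def)
      also have "\<dots> = (D * e2) * (t * ?p)" by simp
      also have "\<dots> \<le> e/2 * (t * ?p)" using e12 t0 p by (intro mult_right_mono) auto
      finally have B: "norm (F (Suc m) (\<phi> x) ((\<phi> y - \<phi> x - \<phi>' (y - x)) # ws)) \<le> e/2 * t * ?p" by simp
      have eq: "F m (\<phi> y) ws - F m (\<phi> x) ws - F (Suc m) (\<phi> x) (\<phi>' (y - x) # ws) =
        (F m (\<phi> y) ws - F m (\<phi> x) ws - F (Suc m) (\<phi> x) ((\<phi> y - \<phi> x) # ws)) + F (Suc m) (\<phi> x) ((\<phi> y - \<phi> x - \<phi>' (y - x)) # ws)"
        by (simp add: F0)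
      have "norm (F m (\<phi> y) ws - F m (\<phi> x) ws - F (Suc m) (\<phi> x) (\<phi>' (y - x) # ws)) \<le> e/2 * t * ?p + e/2 * t * ?p"
        using norm_triangle_mono[OF A B] by (simp only: eq)
      then show "norm ((case j of (i,ws) \<Rightarrow> F m (\<phi> y) ws) - (case j of (i,ws) \<Rightarrow> F m (\<phi> x) ws)
         - (case j of (i,ws) \<Rightarrow> \<lambda>h. F (Suc m) (\<phi> x) (\<phi>' h # ws)) (y - x))
         \<le> e * norm (y - x) * (case j of (i,ws) \<Rightarrow> prod_list (map norm ws))"
        by (simp add: j t_def mult_ac)
    qed
  qed
qed

lemma uniformly_diff_reindex:
  assumes "uniformly_diff S x I w G G'" "\<And>i. i \<in> J \<Longrightarrow> r i \<in> I"
  shows "uniformly_diff S x J (\<lambda>i. w (r i)) (\<lambda>y i. G y (r i)) (\<lambda>i h. G' (r i) h)"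
  unfolding uniformly_diff_def
proof (intro allI impI)
  fix e :: real assume "0 < e"
  from uniformly_diffD[OF assms(1) this]
  show "\<forall>\<^sub>F y in at x within S. \<forall>i\<in>J. norm (G y (r i) - G x (r i) - G' (r i) (y - x)) \<le> e * norm (y - x) * w (r i)"
    by eventually_elim (use assms(2) in blast)
qed

lemma bounded_multilinear_update:
  assumes "bounded_multilinear UNIV m g" "length ws = m" "i < m"
  shows "g (ws[i := t *\<^sub>R u]) = t *\<^sub>R g (ws[i := u])"
proof -
  note d = assms(1)[unfolded bounded_multilinear_def, THEN conjunct1]
  from d[rule_format, of "take i ws" "drop (Suc i) ws" u 0 t 0] show ?thesis
    using assms(2,3) by (simp add: upd_conv_take_nth_drop)
qed

lemma prod_list_mono_bound:
  fixes a :: "'d \<Rightarrow> real"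
  assumes "\<And>b. b \<in> set bs \<Longrightarrow> norm (u b) \<le> D * a b" "0 \<le> D"
  shows "prod_list (map norm (map u bs)) \<le> D ^ length bs * (\<Prod>b\<leftarrow>bs. a b)"
  using assms(1)
proof (induction bs)
  case (Cons b bs)
  have "norm (u b) * prod_list (map norm (map u bs)) \<le> (D * a b) * (D ^ length bs * (\<Prod>b\<leftarrow>bs. a b))"
    using Cons.prems[of b] norm_ge_zero[of "u b"] prod_list_norm_nonneg[of "map u bs"]
    by (intro mult_mono Cons.IH Cons.prems) (auto intro: order_trans[OF norm_ge_zero])
  then show ?case by (simp add: mult_ac)
qed simp

text \<open>Telescoping: the arguments are changed from \<open>u\<close> to \<open>v\<close> one at
  a time, which produces the factor \<open>length bs\<close>. As \<open>1 \<le> D\<close>, all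
  powers can be raised to the same exponent.\<close>

lemma multilinear_list_diff:
  fixes F :: "'b::real_normed_vector list \<Rightarrow> 'c::real_normed_vector"
  assumes "bounded_multilinear UNIV (length bs) F" "multi_norm_le UNIV (length bs) F C"
    and "\<And>b. b \<in> set bs \<Longrightarrow> norm (u b) \<le> D * a b" "\<And>b. b \<in> set bs \<Longrightarrow> norm (v b) \<le> D * a b"
    and "\<And>b. b \<in> set bs \<Longrightarrow> norm (u b - v b) \<le> e * a b" "\<And>b. b \<in> set bs \<Longrightarrow> 0 \<le> a b"
    and "0 \<le> C" "1 \<le> D" "0 \<le> e"
  shows "norm (F (map u bs) - F (map v bs)) \<le> C * length bs * D ^ length bs * e * (\<Prod>b\<leftarrow>bs. a b)"
  using assms(1-7)
proof (induction bs arbitrary: F C)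
  case Nil
  then show ?case by simp
next
  case (Cons b bs)
  let ?m = "length bs" and ?p = "\<Prod>b\<leftarrow>bs. a b"
  have D: "0 \<le> D" "1 \<le> D" using assms by auto
  have p: "0 \<le> ?p"
  proof -
    have "0 \<le> (\<Prod>b\<leftarrow>xs. a b)" if "\<And>b. b \<in> set xs \<Longrightarrow> 0 \<le> a b" for xs
      using that by (induction xs) auto
    then show ?thesis using Cons.prems(6) by simp
  qed
  have ab: "0 \<le> a b" using Cons.prems by simp
  have lin: "bounded_multilinear UNIV (Suc ?m) F" and bF: "multi_norm_le UNIV (Suc ?m) F C" using Cons.prems by simp_all
  have "F (u b # map u bs) - F (v b # map u bs) = F ((u b - v b) # map u bs)"
    using bounded_multilinear_first[OF lin, of "map u bs" "u b" "v b" 1 "-1"] by simp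
  also have "norm \<dots> \<le> C * (norm (u b - v b) * prod_list (map norm (map u bs)))"
    using multi_norm_leD[OF bF, of "(u b - v b) # map u bs"] by simp
  also have "\<dots> \<le> C * ((e * a b) * (D ^ ?m * ?p))"
    using Cons.prems(3,5,7) D prod_list_norm_nonneg[of "map u bs"] ab assms(9)
    by (intro mult_left_mono mult_mono prod_list_mono_bound) auto
  also have "\<dots> \<le> C * ((e * a b) * (D ^ Suc ?m * ?p))"
    using Cons.prems(7) D p ab assms(9) by (intro mult_left_mono mult_right_mono power_increasing) auto
  finally have 1: "norm (F (u b # map u bs) - F (v b # map u bs)) \<le> C * ((e * a b) * (D ^ Suc ?m * ?p))" .
  have "multi_norm_le UNIV ?m (\<lambda>ws. F (v b # ws)) (C * (D * a b))"
    unfolding multi_norm_le_def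
  proof (intro allI impI, elim conjE)
    fix ws :: "'b list" assume ws: "length ws = ?m"
    have "norm (F (v b # ws)) \<le> C * (norm (v b) * prod_list (map norm ws))" using multi_norm_leD[OF bF, of "v b # ws"] ws by simp
    also have "\<dots> \<le> C * ((D * a b) * prod_list (map norm ws))"
      using Cons.prems(4,7) prod_list_norm_nonneg[of ws] by (intro mult_left_mono mult_right_mono) auto
    finally show "norm (F (v b # ws)) \<le> C * (D * a b) * prod_list (map norm ws)" by simp
  qed
  then have 2: "norm (F (v b # map u bs) - F (v b # map v bs)) \<le> C * (D * a b) * ?m * D ^ ?m * e * ?p"
    by (intro Cons.IH bounded_multilinear_Cons[OF lin]) (use Cons.prems D ab in auto)
  have "norm (F (u b # map u bs) - F (v b # map v bs)) \<le>
     norm (F (u b # map u bs) - F (v b # map u bs)) + norm (F (v b # map u bs) - F (v b # map v bs))"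
    by norm
  also have "\<dots> \<le> C * ((e * a b) * (D ^ Suc ?m * ?p)) + C * (D * a b) * ?m * D ^ ?m * e * ?p"
    using 1 2 by linarith
  finally show ?case by (simp add: algebra_simps)
qed

lemma set_map_nth_subset:
  assumes "set b \<subseteq> {..<length vs}" "set vs \<subseteq> E"
  shows "set (map ((!) vs) b) \<subseteq> E"
proof
  fix u assume "u \<in> set (map ((!) vs) b)"
  then obtain i where "i \<in> set b" "u = vs ! i" by auto
  moreover from this have "i \<in> {..<length vs}" using assms by blast
  ultimately show "u \<in> E" using assms(2) nth_mem[of i vs] by auto
qed

lemma block_values_bound:
  assumes "is_partition j bs" "b \<in> set bs" "length vs = j" "set vs \<subseteq> E" "multi_norm_le E (length b) (\<Phi> (length b)) D"
  shows "norm (block_values \<Phi> vs b) \<le> D * prod_list (map norm (map ((!) vs) b))"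
proof -
  have "set (map ((!) vs) b) \<subseteq> E" using is_partition_block(1)[OF assms(1,2)] assms(3,4) set_map_nth_subset[of b vs E] by simp
  then show ?thesis unfolding block_values_def using multi_norm_leD[OF assms(5), of "map ((!) vs) b"] by simp
qed

lemma partition_term_bound:
  assumes bs: "is_partition j bs" and vs: "length vs = j" "set vs \<subseteq> E"
    and F: "multi_norm_le UNIV (length bs) (F (length bs)) C"
    and \<Phi>: "\<And>b. b \<in> set bs \<Longrightarrow> multi_norm_le E (length b) (\<Phi> (length b)) D"
    and CD: "0 \<le> C" "1 \<le> D"
  shows "norm (partition_term F \<Phi> vs bs) \<le> C * D ^ j * prod_list (map norm vs)"
proof -
  have "norm (partition_term F \<Phi> vs bs) \<le> C * prod_list (map norm (map (block_values \<Phi> vs) bs))"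
    unfolding partition_term_def using multi_norm_leD[OF F, of "map (block_values \<Phi> vs) bs"] by simp
  also have "\<dots> \<le> C * (D ^ length bs * (\<Prod>b\<leftarrow>bs. prod_list (map norm (map ((!) vs) b))))"
    using block_values_bound[where \<Phi> = \<Phi>, OF bs _ vs \<Phi>] CD by (intro mult_left_mono prod_list_mono_bound) auto
  also have "\<dots> = C * (D ^ length bs * prod_list (map norm vs))" by (simp only: prod_list_partition_nth[OF bs vs(1)])
  also have "\<dots> \<le> C * (D ^ j * prod_list (map norm vs))"
    using CD is_partition_length[OF bs] prod_list_norm_nonneg[of vs]
    by (intro mult_left_mono mult_right_mono power_increasing) auto
  finally show ?thesis by simp
qed

text \<open>First the outer map is changed with the inner values kept at \<open>\<Phi>'\<close>,
  then the inner values are changed by telescoping; these two steps give the summands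
  \<open>1\<close> and \<open>C * j\<close> of the constant.\<close>

lemma partition_term_diff:
  assumes bs: "is_partition j bs" and vs: "length vs = j" "set vs \<subseteq> E"
    and F: "multi_norm_le UNIV (length bs) (F (length bs)) C" "bounded_multilinear UNIV (length bs) (F (length bs))"
    and \<Phi>: "\<And>b. b \<in> set bs \<Longrightarrow> multi_norm_le E (length b) (\<Phi> (length b)) C"
      "\<And>b. b \<in> set bs \<Longrightarrow> multi_norm_le E (length b) (\<Phi>' (length b)) C"
    and FF: "multi_norm_le UNIV (length bs) (\<lambda>ws. F' (length bs) ws - F (length bs) ws) e"
    and \<Phi>\<Phi>: "\<And>b. b \<in> set bs \<Longrightarrow> multi_norm_le E (length b) (\<lambda>ws. \<Phi>' (length b) ws - \<Phi> (length b) ws) e"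
    and CD: "1 \<le> C" "0 \<le> e"
  shows "norm (partition_term F' \<Phi>' vs bs - partition_term F \<Phi> vs bs) \<le> (1 + C * j) * C ^ j * e * prod_list (map norm vs)"
proof -
  let ?u = "map (block_values \<Phi>' vs) bs" and ?v = "map (block_values \<Phi> vs) bs" and ?p = "prod_list (map norm vs)"
  have p: "0 \<le> ?p" by (rule prod_list_norm_nonneg)
  have "norm (F' (length bs) ?u - F (length bs) ?u) \<le> e * C ^ j * ?p"
    using partition_term_bound[OF bs vs, of "\<lambda>j ws. F' j ws - F j ws" e \<Phi>' C] FF \<Phi>(2) CD
    by (simp add: partition_term_def)
  moreover have "norm (F (length bs) ?u - F (length bs) ?v) \<le> C * j * C ^ j * e * ?p"
  proof -
    have "norm (F (length bs) ?u - F (length bs) ?v) \<le> C * length bs * C ^ length bs * e * (\<Prod>b\<leftarrow>bs. prod_list (map norm (map ((!) vs) b)))"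
    proof (rule multilinear_list_diff)
      fix b assume b: "b \<in> set bs"
      show "norm (block_values \<Phi>' vs b) \<le> C * prod_list (map norm (map ((!) vs) b))" by (rule block_values_bound[where \<Phi> = \<Phi>', OF bs b vs \<Phi>(2)[OF b]])
      show "norm (block_values \<Phi> vs b) \<le> C * prod_list (map norm (map ((!) vs) b))" by (rule block_values_bound[where \<Phi> = \<Phi>, OF bs b vs \<Phi>(1)[OF b]])
      show "norm (block_values \<Phi>' vs b - block_values \<Phi> vs b) \<le> e * prod_list (map norm (map ((!) vs) b))"
        using block_values_bound[OF bs b vs, of "\<lambda>j ws. \<Phi>' j ws - \<Phi> j ws" e] \<Phi>\<Phi>[OF b] by (simp add: block_values_def)
    qed (use F CD in \<open>auto simp del: map_map intro: prod_list_norm_nonneg\<close>)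
    also have "\<dots> = C * length bs * C ^ length bs * e * ?p" by (simp only: prod_list_partition_nth[OF bs vs(1)])
    also have "\<dots> \<le> C * j * C ^ j * e * ?p"
      using CD p is_partition_length[OF bs] by (intro mult_right_mono mult_mono power_increasing) auto
    finally show ?thesis .
  qed
  moreover have "partition_term F' \<Phi>' vs bs - partition_term F \<Phi> vs bs =
     (F' (length bs) ?u - F (length bs) ?u) + (F (length bs) ?u - F (length bs) ?v)" by (simp add: partition_term_def)
  ultimately have "norm (partition_term F' \<Phi>' vs bs - partition_term F \<Phi> vs bs) \<le> e * C ^ j * ?p + C * j * C ^ j * e * ?p"
    by (simp only: norm_triangle_mono)
  then show ?thesis by (simp add: algebra_simps)
qed

lemma sum_list_scaleR: "(\<Sum>b\<leftarrow>bs. t *\<^sub>R g b) = t *\<^sub>R (\<Sum>b\<leftarrow>bs. g b :: 'a::real_vector)"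
  by (induction bs) (auto simp: scaleR_add_right)

lemma uniform_bound_derivs:
  assumes "\<And>j. j \<le> k \<Longrightarrow> \<exists>C\<ge>1. multi_norm_le E j (F j) C"
  obtains C where "1 \<le> C" "\<And>j. j \<le> k \<Longrightarrow> multi_norm_le E j (F j) C"
proof -
  from assms obtain c where c: "\<And>j. j \<le> k \<Longrightarrow> 1 \<le> c j \<and> multi_norm_le E j (F j) (c j)" by metis
  have "c j \<le> (\<Sum>i\<le>k. c i)" if "j \<le> k" for j
    using that c by (intro member_le_sum) (auto intro: order_trans[of 0 1])
  then show thesis
    using that[of "\<Sum>i\<le>k. c i"] c by (meson multi_norm_le_mono order_trans le0)
qed

text \<open>The formula of Faa di Bruno is differentiated term by term: in each partition term the
  outer map and all block values move, so \<open>uniformly_diff_list\<close> applies, and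
  \<open>comp_derivs_Suc\<close> recognises the result as the next derivative. The weak notion in
  the conclusion spares a proof of linearity in the older variables.\<close>

theorem has_weak_derivs_compose:
  fixes \<phi> :: "'p::real_normed_vector \<Rightarrow> 'b::real_normed_vector" and f :: "'b \<Rightarrow> 'c::real_normed_vector"
  assumes F: "has_derivs_on UNIV T k f F" and \<Phi>: "has_weak_derivs_on E S k \<phi> \<Phi>"
    and T: "\<phi> ` S \<subseteq> T" and E: "subspace E" "S \<subseteq> E"
  shows "has_weak_derivs_on E S k (\<lambda>y. f (\<phi> y)) (comp_derivs F \<phi> \<Phi>)"
  unfolding has_weak_derivs_on_def
proof (intro conjI allI impI ballI)
  fix x assume x: "x \<in> S"
  have \<phi>x: "\<phi> x \<in> T" using T x by auto
  show "comp_derivs F \<phi> \<Phi> 0 x [] = f (\<phi> x)"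
    using has_derivs_onD(1)[OF F \<phi>x] by (simp add: comp_derivs_def partition_term_def)
  obtain D where D: "1 \<le> D" "\<And>j. j \<le> k \<Longrightarrow> multi_norm_le E j (\<Phi> j x) D"
    using uniform_bound_derivs[of k E "\<lambda>j. \<Phi> j x"] has_weak_derivsD(2)[OF \<Phi> x] by blast
  have "\<exists>C\<ge>1. multi_norm_le UNIV j (F j (\<phi> x)) C" if "j \<le> k" for j
    using bounded_multilinear_bound[OF has_derivs_onD(2)[OF F \<phi>x that]] by blast
  from uniform_bound_derivs[of k UNIV "\<lambda>j. F j (\<phi> x)", OF this]
  obtain C where C: "1 \<le> C" "\<And>j. j \<le> k \<Longrightarrow> multi_norm_le UNIV j (F j (\<phi> x)) C" by blast
  fix j
  { assume j: "j \<le> k"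
    have "norm (partition_term (\<lambda>i. F i (\<phi> x)) (\<lambda>i. \<Phi> i x) vs bs) \<le> C * D ^ j * prod_list (map norm vs)"
      if "bs \<in> set (set_partitions j)" "length vs = j" "set vs \<subseteq> E" for bs vs
    proof -
      have bs: "is_partition j bs" using is_partition_set_partitions that by blast
      have "length b \<le> k" if "b \<in> set bs" for b
        using is_partition_block(3)[OF bs that] that j by (cases bs) auto
      then show ?thesis
        using partition_term_bound[OF bs that(2,3), of "\<lambda>i. F i (\<phi> x)" C "\<lambda>i. \<Phi> i x" D] is_partition_length[OF bs] j C D by auto
    qed
    then have "multi_norm_le E j (comp_derivs F \<phi> \<Phi> j x) (length (set_partitions j) * (C * D ^ j))"
      unfolding multi_norm_le_def comp_derivs_def
    proof (intro allI impI, elim conjE)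
      fix vs assume *: "length vs = j" "set vs \<subseteq> E"
        and b: "\<And>bs vs. bs \<in> set (set_partitions j) \<Longrightarrow> length vs = j \<Longrightarrow> set vs \<subseteq> E \<Longrightarrow>
          norm (partition_term (\<lambda>i. F i (\<phi> x)) (\<lambda>i. \<Phi> i x) vs bs) \<le> C * D ^ j * prod_list (map norm vs)"
      have "norm (\<Sum>bs\<leftarrow>xs. partition_term (\<lambda>i. F i (\<phi> x)) (\<lambda>i. \<Phi> i x) vs bs) \<le> length xs * (C * D ^ j * prod_list (map norm vs))"
        if "set xs \<subseteq> set (set_partitions j)" for xs
        using that
      proof (induction xs)
        case (Cons a xs)
        then show ?case using norm_triangle_mono[OF b[of a, OF _ *] Cons.IH] by (simp add: algebra_simps)
      qed simp
      then show "norm (\<Sum>bs\<leftarrow>set_partitions j. partition_term (\<lambda>i. F i (\<phi> x)) (\<lambda>i. \<Phi> i x) vs bs)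
        \<le> length (set_partitions j) * (C * D ^ j) * prod_list (map norm vs)" by (simp add: mult.assoc)
    qed
    then show "\<exists>C. multi_norm_le E j (comp_derivs F \<phi> \<Phi> j x) C" by blast }
  assume j: "j < k"
  have block_len: "length b \<le> j" "set b \<subseteq> {..<j}" if "bs \<in> set (set_partitions j)" "b \<in> set bs" for bs b
    using is_partition_block[OF is_partition_set_partitions[OF that(1)] that(2)] that by (cases bs; auto)+
  have bs_len: "length bs \<le> j" if "bs \<in> set (set_partitions j)" for bs
    using is_partition_length[OF is_partition_set_partitions[OF that]] .
  { fix h vs t assume h: "h \<in> E" and vs: "length vs = j \<and> set vs \<subseteq> E"
    have "\<Phi> 1 x [t *\<^sub>R h] = t *\<^sub>R \<Phi> 1 x [h]" using has_weak_derivsD(3)[OF \<Phi> x, of 0 h "[]" t] h j by simp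
    moreover have "F (Suc (length bs)) (\<phi> x) (t *\<^sub>R u # ws) = t *\<^sub>R F (Suc (length bs)) (\<phi> x) (u # ws)"
      if "bs \<in> set (set_partitions j)" "length ws = length bs" for bs u ws
      using bounded_multilinear_update[OF has_derivs_onD(2)[OF F \<phi>x, of "Suc (length bs)"], of "u # ws" 0] that bs_len[OF that(1)] j by simp
    moreover have "\<Phi> (Suc (length b)) x (t *\<^sub>R h # map ((!) vs) b) = t *\<^sub>R \<Phi> (Suc (length b)) x (h # map ((!) vs) b)"
      if "bs \<in> set (set_partitions j)" "b \<in> set bs" for b bs
      using has_weak_derivsD(3)[OF \<Phi> x, of "length b" h "map ((!) vs) b" t] block_len[OF that] h vs j
        set_map_nth_subset[of b vs E] by simp
    moreover have "F (length bs) (\<phi> x) (ws[i := t *\<^sub>R u]) = t *\<^sub>R F (length bs) (\<phi> x) (ws[i := u])"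
      if "bs \<in> set (set_partitions j)" "length ws = length bs" "i < length bs" for bs u ws i
      using bounded_multilinear_update[OF has_derivs_onD(2)[OF F \<phi>x, of "length bs"]] that bs_len[OF that(1)] j by simp
    ultimately have "(\<Sum>bs\<leftarrow>set_partitions j.
        F (Suc (length bs)) (\<phi> x) (\<Phi> 1 x [t *\<^sub>R h] # map (block_values (\<lambda>i. \<Phi> i x) vs) bs) +
        (\<Sum>i<length bs. F (length bs) (\<phi> x)
         ((map (block_values (\<lambda>i. \<Phi> i x) vs) bs)[i := \<Phi> (Suc (length (bs ! i))) x (t *\<^sub>R h # map ((!) vs) (bs ! i))])))
      = (\<Sum>bs\<leftarrow>set_partitions j. t *\<^sub>R (
        F (Suc (length bs)) (\<phi> x) (\<Phi> 1 x [h] # map (block_values (\<lambda>i. \<Phi> i x) vs) bs) +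
        (\<Sum>i<length bs. F (length bs) (\<phi> x)
         ((map (block_values (\<lambda>i. \<Phi> i x) vs) bs)[i := \<Phi> (Suc (length (bs ! i))) x (h # map ((!) vs) (bs ! i))]))))"
      by (intro arg_cong[where f = sum_list] map_cong) (auto simp: scaleR_add_right scaleR_sum_right intro!: arg_cong2[where f = plus] sum.cong)
    also have "\<dots> = t *\<^sub>R comp_derivs F \<phi> \<Phi> (Suc j) x (h # vs)"
      by (simp only: comp_derivs_Suc sum_list_scaleR)
    finally show "comp_derivs F \<phi> \<Phi> (Suc j) x (t *\<^sub>R h # vs) = t *\<^sub>R comp_derivs F \<phi> \<Phi> (Suc j) x (h # vs)"
      by (simp only: comp_derivs_Suc) }
  let ?I = "{vs. length vs = j \<and> set vs \<subseteq> E}"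
  let ?U' = "\<lambda>vs h b. \<Phi> (Suc (length b)) x (h # map ((!) vs) b)"
  let ?G' = "\<lambda>bs vs h. F (Suc (length bs)) (\<phi> x) (\<Phi> 1 x [h] # map (block_values (\<lambda>i. \<Phi> i x) vs) bs) +
      (\<Sum>i<length bs. F (length bs) (\<phi> x) ((map (block_values (\<lambda>i. \<Phi> i x) vs) bs)[i := ?U' vs h (bs ! i)]))"
  have "uniformly_diff S x ?I (\<lambda>vs. prod_list (map norm vs)) (\<lambda>y vs. \<Sum>bs\<leftarrow>set_partitions j. partition_term (\<lambda>i. F i (\<phi> y)) (\<lambda>i. \<Phi> i y) vs bs)
     (\<lambda>vs h. \<Sum>bs\<leftarrow>set_partitions j. ?G' bs vs h)"
  proof (rule uniformly_diff_sum_list)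
    fix bs assume bs: "bs \<in> set (set_partitions j)"
    note part = is_partition_set_partitions[OF bs]
    let ?m = "length bs"
    have m: "?m < k" using bs_len[OF bs] j by simp
    let ?a = "\<lambda>b vs. prod_list (map norm (map ((!) vs) b))"
    have \<phi>: "\<forall>\<^sub>F y in at x within S. norm (\<phi> y - \<phi> x - \<Phi> 1 x [y - x]) \<le> e * norm (y - x)" if "e > 0" for e
    proof -
      have "\<forall>\<^sub>F y in at x within S. y \<in> S" by (simp add: eventually_at_filter)
      moreover have "\<forall>\<^sub>F y in at x within S. norm (\<Phi> 0 y [] - \<Phi> 0 x [] - \<Phi> 1 x [y - x]) \<le> e * norm (y - x)"
        using uniformly_diffD[OF has_weak_derivsD(4)[OF \<Phi> x, of 0] that] j by simp
      ultimately show ?thesis by eventually_elim (simp add: has_weak_derivsD(1)[OF \<Phi>] x)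
    qed
    have \<Phi>1: "norm (\<Phi> 1 x [y - x]) \<le> D * norm (y - x)" if "y \<in> S" for y
      using multi_norm_leD[OF D(2), of 1 "[y - x]"] j subspace_diff[OF E(1), of y x] E(2) that x by auto
    have h: "y - x \<in> E" if "y \<in> S" for y using subspace_diff[OF E(1), of y x] E(2) that x by auto
    have "uniformly_diff S x ?I (\<lambda>vs. 1 * (\<Prod>b\<leftarrow>bs. ?a b vs)) (\<lambda>y vs. F ?m (\<phi> y) (map (block_values (\<lambda>i. \<Phi> i y) vs) bs)) (?G' bs)"
    proof (rule uniformly_diff_list[where C = "C * D" and D = D and P = "\<lambda>y vs ws. F ?m (\<phi> y) ws"
          and P' = "\<lambda>vs h ws. F (Suc ?m) (\<phi> x) (\<Phi> 1 x [h] # ws)" and U = "\<lambda>y vs b. block_values (\<lambda>i. \<Phi> i y) vs b" and U' = ?U'])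
      have lin: "bounded_multilinear UNIV (Suc ?m) (F (Suc ?m) (\<phi> x))" using has_derivs_onD(2)[OF F \<phi>x] m by simp
      have "uniformly_diff S x (?I \<times> {ws. length ws = ?m}) (\<lambda>(i, ws). prod_list (map norm ws))
           (\<lambda>y (i, ws). F ?m (\<phi> y) ws) (\<lambda>(i, ws) h. F (Suc ?m) (\<phi> x) (\<Phi> 1 x [h] # ws))"
        by (rule uniformly_diff_outer[OF lin has_derivs_onD(3)[OF F \<phi>x m] \<phi> \<Phi>1 _ T]) (use D in auto)
      then show "uniformly_diff S x (?I \<times> {ws. length ws = ?m}) (\<lambda>(i, ws). 1 * prod_list (map norm ws))
           (\<lambda>y (i, ws). F ?m (\<phi> y) ws) (\<lambda>(i, ws) h. F (Suc ?m) (\<phi> x) (\<Phi> 1 x [h] # ws))" by simp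
      show "bounded_multilinear UNIV ?m (F ?m (\<phi> x))" using has_derivs_onD(2)[OF F \<phi>x] m by simp
      show "bounded_multilinear UNIV ?m (\<lambda>ws. F (Suc ?m) (\<phi> x) (\<Phi> 1 x [h] # ws))" for h
        by (rule bounded_multilinear_Cons[OF lin]) simp
      have "C * 1 \<le> C * D" using C D by (intro mult_left_mono) auto
      then show "multi_norm_le UNIV ?m (F ?m (\<phi> x)) (C * D * 1)"
        using multi_norm_le_mono[OF C(2)[of ?m]] m by simp
      show "multi_norm_le UNIV ?m (\<lambda>ws. F (Suc ?m) (\<phi> x) (\<Phi> 1 x [y - x] # ws)) (C * D * norm (y - x) * 1)" if "y \<in> S" for y
        unfolding multi_norm_le_def
      proof (intro allI impI, elim conjE)
        fix ws :: "'b list" assume "length ws = ?m"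
        then have "norm (F (Suc ?m) (\<phi> x) (\<Phi> 1 x [y - x] # ws)) \<le> C * (norm (\<Phi> 1 x [y - x]) * prod_list (map norm ws))"
          using multi_norm_leD[OF C(2), of "Suc ?m" "\<Phi> 1 x [y - x] # ws"] m by simp
        also have "\<dots> \<le> C * ((D * norm (y - x)) * prod_list (map norm ws))"
          using \<Phi>1[OF that] C prod_list_norm_nonneg[of ws] by (intro mult_left_mono mult_right_mono) auto
        finally show "norm (F (Suc ?m) (\<phi> x) (\<Phi> 1 x [y - x] # ws)) \<le> C * D * norm (y - x) * 1 * prod_list (map norm ws)" by simp
      qed
      fix b assume b: "b \<in> set bs"
      have lb: "length b < k" using block_len[OF bs b] j by simp
      have "uniformly_diff S x ?I (\<lambda>vs. (\<lambda>vs. prod_list (map norm vs)) (map ((!) vs) b)) (\<lambda>y vs. \<Phi> (length b) y (map ((!) vs) b))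
          (\<lambda>vs h. \<Phi> (Suc (length b)) x (h # map ((!) vs) b))"
        by (rule uniformly_diff_reindex[OF has_weak_derivsD(4)[OF \<Phi> x lb], of _ "\<lambda>vs. map ((!) vs) b"])
          (use block_len(2)[OF bs b] set_map_nth_subset[of b _ E] in simp)
      then show "uniformly_diff S x ?I (?a b) (\<lambda>y vs. block_values (\<lambda>i. \<Phi> i y) vs b) (\<lambda>vs h. ?U' vs h b)"
        by (simp add: block_values_def)
      fix vs assume vs: "vs \<in> ?I"
      show "norm (block_values (\<lambda>i. \<Phi> i x) vs b) \<le> D * ?a b vs"
        using block_values_bound[OF part b, of vs E "\<lambda>i. \<Phi> i x" D] vs D(2) lb by simp
      show "0 \<le> ?a b vs" by (rule prod_list_norm_nonneg)
      fix y assume y: "y \<in> S"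
      show "norm (?U' vs (y - x) b) \<le> D * norm (y - x) * ?a b vs"
        using multi_norm_leD[OF D(2), of "Suc (length b)" "(y - x) # map ((!) vs) b"] lb block_len(2)[OF bs b] vs h[OF y]
          set_map_nth_subset[of b vs E] by (simp add: mult.assoc)
    qed (use C D in auto)
    then show "uniformly_diff S x ?I (\<lambda>vs. prod_list (map norm vs)) (\<lambda>y vs. partition_term (\<lambda>i. F i (\<phi> y)) (\<lambda>i. \<Phi> i y) vs bs) (?G' bs)"
      by (rule uniformly_diff_cong) (auto simp only: partition_term_def prod_list_partition_nth[OF part] mem_Collect_eq mult_1)
  qed (rule prod_list_norm_nonneg)
  then show "uniformly_diff S x ?I (\<lambda>vs. prod_list (map norm vs)) (comp_derivs F \<phi> \<Phi> j) (\<lambda>vs h. comp_derivs F \<phi> \<Phi> (Suc j) x (h # vs))"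
    by (rule uniformly_diff_cong) (simp_all only: comp_derivs_def[of F \<phi> \<Phi> j] comp_derivs_Suc)
qed

section \<open>Derivatives of affine maps, linear images, sums and pre-compositions\<close>

definition affine_derivs :: "('a \<Rightarrow> 'b::real_normed_vector) \<Rightarrow> 'b \<Rightarrow> nat \<Rightarrow> 'a \<Rightarrow> 'a list \<Rightarrow> 'b" where
  "affine_derivs L c j z vs = (if j = 0 then c + L z else if j = 1 then L (hd vs) else 0)"

lemma has_derivs_affine:
  assumes "bounded_linear L"
  shows "has_derivs_on E S k (\<lambda>z. c + L z) (affine_derivs L c)"
proof (rule has_derivs_onI)
  interpret bounded_linear L by fact
  fix x j
  show "affine_derivs L c 0 x [] = c + L x" by (simp add: affine_derivs_def)
  obtain K where K: "\<And>v. norm (L v) \<le> norm v * K" using bounded by blast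
  have "multi_norm_le E j (affine_derivs L c j x) (if j = 0 then norm (c + L x) else max K 0)"
    unfolding multi_norm_le_def
  proof (intro allI impI, elim conjE)
    fix vs :: "'a list" assume vs: "length vs = j"
    have "norm (L v) \<le> max K 0 * norm v" for v
      using K[of v] mult_right_mono[of K "max K 0" "norm v"] by (simp add: mult.commute)
    moreover have "\<exists>v. vs = [v]" if "j = 1" using vs that by (cases vs) auto
    ultimately show "norm (affine_derivs L c j x vs) \<le> (if j = 0 then norm (c + L x) else max K 0) * prod_list (map norm vs)"
      using vs prod_list_norm_nonneg[of vs] by (auto simp: affine_derivs_def)
  qed
  then show "bounded_multilinear E j (affine_derivs L c j x)"
    unfolding bounded_multilinear_def by (auto simp: affine_derivs_def add scaleR)
  have eq: "affine_derivs L c j y vs - affine_derivs L c j x vs - affine_derivs L c (Suc j) x ((y - x) # vs) = 0" for y vs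
    by (simp add: affine_derivs_def diff)
  have "0 \<le> e * norm (y - x) * prod_list (map norm vs)" if "e > 0" for e y and vs :: "'a list"
    using that prod_list_norm_nonneg[of vs] by simp
  then show "uniformly_diff S x {vs. length vs = j \<and> set vs \<subseteq> E} (\<lambda>vs. prod_list (map norm vs))
      (affine_derivs L c j) (\<lambda>vs h. affine_derivs L c (Suc j) x (h # vs))"
    unfolding uniformly_diff_def eq by simp
qed

lemma has_derivs_linear:
  assumes "bounded_linear L" "has_derivs_on E S k f F"
  shows "has_derivs_on E S k (\<lambda>x. L (f x)) (\<lambda>j x vs. L (F j x vs))"
proof (rule has_derivs_onI)
  interpret bounded_linear L by fact
  obtain K where K: "K > 0" "\<And>v. norm (L v) \<le> norm v * K" using pos_bounded by blast
  fix x assume x: "x \<in> S"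
  show "L (F 0 x []) = L (f x)" using has_derivs_onD(1)[OF assms(2) x] by simp
  fix j
  show "bounded_multilinear E j (\<lambda>vs. L (F j x vs))" if "j \<le> k"
  proof -
    note b = has_derivs_onD(2)[OF assms(2) x that]
    obtain C where C: "multi_norm_le E j (F j x) C" using b unfolding bounded_multilinear_def by blast
    have "multi_norm_le E j (\<lambda>vs. L (F j x vs)) (C * K)"
      unfolding multi_norm_le_def
    proof (intro allI impI, elim conjE)
      fix vs assume "length vs = j" "set vs \<subseteq> E"
      then have "norm (F j x vs) * K \<le> (C * prod_list (map norm vs)) * K" using multi_norm_leD[OF C] K by (intro mult_right_mono) auto
      then show "norm (L (F j x vs)) \<le> C * K * prod_list (map norm vs)" using K(2)[of "F j x vs"] by (simp add: mult_ac)
    qed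
    with b show ?thesis unfolding bounded_multilinear_def by (auto simp: add scaleR)
  qed
  assume j: "j < k"
  show "uniformly_diff S x {vs. length vs = j \<and> set vs \<subseteq> E} (\<lambda>vs. prod_list (map norm vs)) (\<lambda>x vs. L (F j x vs)) (\<lambda>vs h. L (F (Suc j) x (h # vs)))"
    unfolding uniformly_diff_def
  proof (intro allI impI)
    fix e :: real assume "0 < e"
    then have "0 < e / K" using K by simp
    from uniformly_diffD[OF has_derivs_onD(3)[OF assms(2) x j] this]
    show "\<forall>\<^sub>F y in at x within S. \<forall>vs\<in>{vs. length vs = j \<and> set vs \<subseteq> E}.
       norm (L (F j y vs) - L (F j x vs) - L (F (Suc j) x ((y - x) # vs))) \<le> e * norm (y - x) * prod_list (map norm vs)"
    proof eventually_elim
      case (elim y)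
      show ?case
      proof
        fix vs assume "vs \<in> {vs. length vs = j \<and> set vs \<subseteq> E}"
        then have "norm (F j y vs - F j x vs - F (Suc j) x ((y - x) # vs)) * K \<le> (e / K * norm (y - x) * prod_list (map norm vs)) * K"
          using elim K by (intro mult_right_mono) auto
        then show "norm (L (F j y vs) - L (F j x vs) - L (F (Suc j) x ((y - x) # vs))) \<le> e * norm (y - x) * prod_list (map norm vs)"
          using K(1) K(2)[of "F j y vs - F j x vs - F (Suc j) x ((y - x) # vs)"] by (simp add: diff)
      qed
    qed
  qed
qed

lemma has_derivs_add:
  assumes "has_derivs_on E S k f F" "has_derivs_on E S k g G"
  shows "has_derivs_on E S k (\<lambda>x. f x + g x) (\<lambda>j x vs. F j x vs + G j x vs)"
proof (rule has_derivs_onI)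
  fix x assume x: "x \<in> S"
  show "F 0 x [] + G 0 x [] = f x + g x" using has_derivs_onD(1)[OF assms(1) x] has_derivs_onD(1)[OF assms(2) x] by simp
  fix j
  show "bounded_multilinear E j (\<lambda>vs. F j x vs + G j x vs)" if "j \<le> k"
  proof -
    note b = has_derivs_onD(2)[OF assms(1) x that] has_derivs_onD(2)[OF assms(2) x that]
    obtain C D where "multi_norm_le E j (F j x) C" "multi_norm_le E j (G j x) D" using b unfolding bounded_multilinear_def by blast
    then have "multi_norm_le E j (\<lambda>vs. F j x vs + G j x vs) (C + D)"
      unfolding multi_norm_le_def by (auto simp: distrib_right intro!: norm_triangle_mono)
    with b show ?thesis unfolding bounded_multilinear_def by (auto simp: scaleR_add_right)
  qed
  assume j: "j < k"
  show "uniformly_diff S x {vs. length vs = j \<and> set vs \<subseteq> E} (\<lambda>vs. prod_list (map norm vs)) (\<lambda>x vs. F j x vs + G j x vs) (\<lambda>vs h. F (Suc j) x (h # vs) + G (Suc j) x (h # vs))"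
    by (rule uniformly_diff_add[OF has_derivs_onD(3)[OF assms(1) x j] has_derivs_onD(3)[OF assms(2) x j]])
qed

lemma has_derivs_on_subset:
  assumes "has_derivs_on E S k f F" "T \<subseteq> S"
  shows "has_derivs_on E T k f F"
proof (rule has_derivs_onI)
  fix x assume "x \<in> T"
  then have x: "x \<in> S" using assms by blast
  show "F 0 x [] = f x" by (rule has_derivs_onD(1)[OF assms(1) x])
  fix j
  show "bounded_multilinear E j (F j x)" if "j \<le> k" by (rule has_derivs_onD(2)[OF assms(1) x that])
  assume j: "j < k"
  show "uniformly_diff T x {vs. length vs = j \<and> set vs \<subseteq> E} (\<lambda>vs. prod_list (map norm vs)) (F j) (\<lambda>vs h. F (Suc j) x (h # vs))"
    unfolding uniformly_diff_def
  proof (intro allI impI)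
    fix e :: real assume "0 < e"
    from uniformly_diffD[OF has_derivs_onD(3)[OF assms(1) x j] this]
    show "\<forall>\<^sub>F y in at x within T. \<forall>vs\<in>{vs. length vs = j \<and> set vs \<subseteq> E}. norm (F j y vs - F j x vs - F (Suc j) x ((y - x) # vs)) \<le> e * norm (y - x) * prod_list (map norm vs)"
      by (rule filter_leD[OF at_le[OF assms(2)]])
  qed
qed

lemma prod_list_norm_map_le:
  assumes "\<And>v. norm (L v) \<le> K * norm v" "0 \<le> K"
  shows "prod_list (map norm (map L vs)) \<le> K ^ length vs * prod_list (map norm vs)"
  using prod_list_mono_bound[of vs L K norm] assms by simp

text \<open>With \<open>L\<close> a projection onto \<open>E\<close>, a function on the subspace
  becomes one on the whole space and can then follow a map into that space.\<close>

lemma has_derivs_precompose: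
  fixes L :: "'b::real_normed_vector \<Rightarrow> 'a::real_normed_vector"
  assumes f: "has_derivs_on E S k f F" and L: "bounded_linear L" "range L \<subseteq> E"
  shows "has_derivs_on UNIV {z. L (z - p) \<in> S} k (\<lambda>z. f (L (z - p))) (\<lambda>j z vs. F j (L (z - p)) (map L vs))"
proof (rule has_derivs_onI)
  interpret bounded_linear L by fact
  obtain K where K: "K > 0" "\<And>v. norm (L v) \<le> K * norm v" using pos_bounded by (auto simp: mult.commute)
  fix z assume "z \<in> {z. L (z - p) \<in> S}"
  then have z: "L (z - p) \<in> S" by simp
  show "F 0 (L (z - p)) (map L []) = f (L (z - p))" using has_derivs_onD(1)[OF f z] by simp
  have map_L: "set (map L vs) \<subseteq> E" for vs using L(2) by auto
  fix j
  show "bounded_multilinear UNIV j (\<lambda>vs. F j (L (z - p)) (map L vs))" if j: "j \<le> k"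
  proof -
    note b = has_derivs_onD(2)[OF f z j]
    obtain C where C: "1 \<le> C" "multi_norm_le E j (F j (L (z - p))) C" using bounded_multilinear_bound[OF b] by blast
    have "multi_norm_le UNIV j (\<lambda>vs. F j (L (z - p)) (map L vs)) (C * K ^ j)"
      unfolding multi_norm_le_def
    proof (intro allI impI, elim conjE)
      fix vs :: "'b list" assume vs: "length vs = j"
      have "norm (F j (L (z - p)) (map L vs)) \<le> C * prod_list (map norm (map L vs))"
        using multi_norm_leD[OF C(2), of "map L vs"] map_L vs by simp
      also have "\<dots> \<le> C * (K ^ length vs * prod_list (map norm vs))"
        using C K by (intro mult_left_mono prod_list_norm_map_le) auto
      finally show "norm (F j (L (z - p)) (map L vs)) \<le> C * K ^ j * prod_list (map norm vs)" using vs by simp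
    qed
    moreover have "F j (L (z - p)) (map L (us @ (a *\<^sub>R v + b *\<^sub>R w) # ws)) =
       a *\<^sub>R F j (L (z - p)) (map L (us @ v # ws)) + b *\<^sub>R F j (L (z - p)) (map L (us @ w # ws))"
      if "length us + length ws + 1 = j" for us ws v w a b
      using b[unfolded bounded_multilinear_def, THEN conjunct1, rule_format, of "map L us" "map L ws" "L v" "L w" a b] that map_L[of us] map_L[of ws] subsetD[OF L(2) rangeI]
      by (simp add: add scaleR)
    ultimately show ?thesis unfolding bounded_multilinear_def by blast
  qed
  assume j: "j < k"
  show "uniformly_diff {z. L (z - p) \<in> S} z {vs. length vs = j \<and> set vs \<subseteq> UNIV} (\<lambda>vs. prod_list (map norm vs))
     (\<lambda>z vs. F j (L (z - p)) (map L vs)) (\<lambda>vs h. F (Suc j) (L (z - p)) (map L (h # vs)))"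
    unfolding uniformly_diff_def
  proof (intro allI impI)
    fix e :: real assume e: "0 < e"
    \<comment> \<open>One factor \<open>K\<close> is for the increment and \<open>j\<close> factors
      are for the arguments.\<close>
    define e' where "e' = e / K ^ Suc j"
    have e': "0 < e'" using e K by (simp add: e'_def)
    from uniformly_diffD[OF has_derivs_onD(3)[OF f z j] this] obtain d where d: "d > 0"
      "\<And>y. y \<in> S \<Longrightarrow> y \<noteq> L (z - p) \<Longrightarrow> dist y (L (z - p)) < d \<Longrightarrow> \<forall>vs\<in>{vs. length vs = j \<and> set vs \<subseteq> E}.
         norm (F j y vs - F j (L (z - p)) vs - F (Suc j) (L (z - p)) ((y - L (z - p)) # vs)) \<le> e' * norm (y - L (z - p)) * prod_list (map norm vs)"
      unfolding eventually_at by blast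
    have "\<forall>\<^sub>F y in at z within {z. L (z - p) \<in> S}. L (y - p) \<in> S \<and> dist y z < d / K"
      unfolding eventually_at using d K by (intro exI[of _ "d / K"]) auto
    then show "\<forall>\<^sub>F y in at z within {z. L (z - p) \<in> S}. \<forall>vs\<in>{vs. length vs = j \<and> set vs \<subseteq> UNIV}.
       norm (F j (L (y - p)) (map L vs) - F j (L (z - p)) (map L vs) - F (Suc j) (L (z - p)) (map L ((y - z) # vs))) \<le> e * norm (y - z) * prod_list (map norm vs)"
    proof eventually_elim
      case (elim y)
      have diff_eq: "L (y - p) - L (z - p) = L (y - z)" by (simp add: diff)
      have "norm (L (y - z)) \<le> K * norm (y - z)" by (rule K)
      also have "\<dots> < d" using elim K by (simp add: dist_norm field_simps)
      finally have near: "dist (L (y - p)) (L (z - p)) < d" by (simp add: dist_norm diff_eq)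
      show ?case
      proof
        fix vs :: "'b list" assume "vs \<in> {vs. length vs = j \<and> set vs \<subseteq> UNIV}"
        then have vs: "length vs = j" by simp
        let ?X = "F j (L (y - p)) (map L vs) - F j (L (z - p)) (map L vs) - F (Suc j) (L (z - p)) (map L ((y - z) # vs))"
        have "norm ?X \<le> e' * norm (L (y - z)) * prod_list (map norm (map L vs))"
        proof (cases "L (y - p) = L (z - p)")
          case True
          have "L (y - z) = 0" using True diff_eq by simp
          moreover have "F (Suc j) (L (z - p)) (0 # map L vs) = 0"
            using bounded_multilinear_first[OF has_derivs_onD(2)[OF f z], of j "map L vs" "L 0" "L 0" 0 0] j vs map_L[of vs]
              subsetD[OF L(2) rangeI[of L 0]] by simp
          ultimately show ?thesis using True by simp
        next
          case False
          then show ?thesis using d(2)[OF _ False near, THEN bspec, of "map L vs"] elim vs map_L[of vs] by (simp add: diff_eq)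
        qed
        also have "\<dots> \<le> e' * (K * norm (y - z)) * (K ^ length vs * prod_list (map norm vs))"
          using e' K prod_list_norm_nonneg[of "map L vs"] by (intro mult_mono mult_left_mono prod_list_norm_map_le) auto
        also have "\<dots> = e * norm (y - z) * prod_list (map norm vs)" using K vs by (simp add: e'_def field_simps)
        finally show "norm ?X \<le> e * norm (y - z) * prod_list (map norm vs)" .
      qed
    qed
  qed
qed

section \<open>Mean value inequality and limits of derivatives at the boundary\<close>

text \<open>The ordinary mean value inequality for \<open>F j\<close> along the segment minus the
  linear path \<open>t *\<^sub>R c\<close>. Subtracting \<open>c\<close> turns closeness of the
  derivatives to a fixed value into a first-order estimate.\<close>

lemma mean_value_derivs:
  fixes F :: "nat \<Rightarrow> 'a::real_normed_vector \<Rightarrow> 'a list \<Rightarrow> 'b::real_normed_vector"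
  assumes F: "has_weak_derivs_on E S k f F" and E: "subspace E" "S \<subseteq> E" and j: "j < k"
    and y: "closed_segment z y \<subseteq> S"
    and vs: "length vs = j" "set vs \<subseteq> E"
    and B: "\<And>u. u \<in> closed_segment z y \<Longrightarrow> norm (F (Suc j) u ((y - z) # vs) - c) \<le> B"
  shows "norm (F j y vs - F j z vs - c) \<le> B"
proof -
  define h where "h = y - z"
  define p where "p t = z + t *\<^sub>R h" for t :: real
  have p_seg: "p t \<in> closed_segment z y" if "t \<in> {0..1}" for t
    using that unfolding closed_segment_def p_def h_def
    by (auto intro!: exI[of _ t] simp: algebra_simps)
  have h: "h \<in> E" unfolding h_def using y E by (intro subspace_diff) auto
  have "((\<lambda>t. F j (p t) vs - t *\<^sub>R c) has_derivative (\<lambda>s. s *\<^sub>R (F (Suc j) (p t) (h # vs) - c))) (at t within {0..1})"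
    if t: "t \<in> {0..1}" for t
  proof -
    have pt: "p t \<in> S" using p_seg[OF t] y by blast
    let ?p = "norm h * prod_list (map norm vs)"
    have pn: "0 \<le> ?p" using prod_list_norm_nonneg[of vs] by simp
    show ?thesis unfolding has_derivative_within_alt2
    proof (intro conjI allI impI)
      show "bounded_linear (\<lambda>s. s *\<^sub>R (F (Suc j) (p t) (h # vs) - c))" by (rule bounded_linear_scaleR_left)
      fix e :: real assume e: "0 < e"
      define e' where "e' = e / (?p + 1)"
      have e': "0 < e'" "e' * ?p \<le> e"
      proof -
        show "0 < e'" using e pn by (simp add: e'_def)
        have "e * ?p \<le> e * (?p + 1)" using e by simp
        then show "e' * ?p \<le> e" using pn unfolding e'_def by (simp add: divide_simps add_nonneg_pos)
      qed
      from uniformly_diffD[OF has_weak_derivsD(4)[OF F pt j] e'(1)] obtain d where d: "d > 0"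
        "\<And>u. u \<in> S \<Longrightarrow> u \<noteq> p t \<Longrightarrow> dist u (p t) < d \<Longrightarrow> \<forall>vs\<in>{vs. length vs = j \<and> set vs \<subseteq> E}.
           norm (F j u vs - F j (p t) vs - F (Suc j) (p t) ((u - p t) # vs)) \<le> e' * norm (u - p t) * prod_list (map norm vs)"
        unfolding eventually_at by blast
      have "\<forall>\<^sub>F s in at t within {0..1}. s \<in> {0..1} \<and> dist s t < d / (norm h + 1)"
        unfolding eventually_at using d by (intro exI[of _ "d / (norm h + 1)"]) (auto simp: add_nonneg_pos)
      then show "\<forall>\<^sub>F s in at t within {0..1}. norm (F j (p s) vs - s *\<^sub>R c - (F j (p t) vs - t *\<^sub>R c)
           - (s - t) *\<^sub>R (F (Suc j) (p t) (h # vs) - c)) \<le> e * norm (s - t)"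
      proof eventually_elim
        case (elim s)
        have ps: "p s \<in> S" using p_seg elim y by blast
        have dif: "p s - p t = (s - t) *\<^sub>R h" by (simp add: p_def algebra_simps)
        have "norm (p s - p t) \<le> \<bar>s - t\<bar> * (norm h + 1)" unfolding dif norm_scaleR by (intro mult_left_mono) auto
        also have "\<dots> < d" using elim by (simp add: dist_real_def pos_less_divide_eq add_nonneg_pos)
        finally have near: "dist (p s) (p t) < d" by (simp add: dist_norm)
        have hom: "F (Suc j) (p t) ((p s - p t) # vs) = (s - t) *\<^sub>R F (Suc j) (p t) (h # vs)"
          unfolding dif using has_weak_derivsD(3)[OF F pt j h vs] .
        have "norm (F j (p s) vs - F j (p t) vs - F (Suc j) (p t) ((p s - p t) # vs)) \<le> e' * norm (p s - p t) * prod_list (map norm vs)"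
        proof (cases "p s = p t")
          case True
          then have "F (Suc j) (p t) ((p s - p t) # vs) = 0" using has_weak_derivsD(3)[OF F pt j h vs, of 0] by simp
          then show ?thesis using True by simp
        next
          case False
          then show ?thesis using d(2)[OF ps False near] vs by simp
        qed
        also have "\<dots> = (e' * ?p) * \<bar>s - t\<bar>" by (simp add: dif)
        also have "\<dots> \<le> e * \<bar>s - t\<bar>" using e' by (intro mult_right_mono) auto
        finally show ?case unfolding hom by (simp add: algebra_simps)
      qed
    qed
  qed
  moreover have "onorm (\<lambda>s. s *\<^sub>R (F (Suc j) (p t) (h # vs) - c)) \<le> B" if "t \<in> {0..1}" for t
    using B[OF p_seg[OF that]] by (intro onorm_le) (auto simp: h_def mult.commute[of B] intro: mult_left_mono)
  ultimately have "norm ((F j (p 1) vs - 1 *\<^sub>R c) - (F j (p 0) vs - 0 *\<^sub>R c)) \<le> B * norm (1 - 0 :: real)"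
    by (intro differentiable_bound[where S = "{0..1}"]) auto
  then show ?thesis by (simp add: p_def h_def algebra_simps)
qed

text \<open>The Cauchy property in operator norm, formulated with pairs because no candidate for the
  limit is at hand, and for an arbitrary filter so that it can be pulled back along maps.\<close>

definition multi_cauchy ::
  "'a::real_normed_vector set \<Rightarrow> nat \<Rightarrow> 'p filter \<Rightarrow> ('p \<Rightarrow> 'a list \<Rightarrow> 'b::real_normed_vector) \<Rightarrow> bool" where
  "multi_cauchy E j \<F> F \<longleftrightarrow> (\<forall>e>0. \<forall>\<^sub>F w in \<F> \<times>\<^sub>F \<F>. multi_norm_le E j (\<lambda>vs. F (fst w) vs - F (snd w) vs) e)"

text \<open>Completeness gives a limit for each argument list separately. Fixing one point of the
  Cauchy estimate and letting the other run to the limit makes the convergence uniform, and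
  multilinearity is inherited pointwise.\<close>

lemma multi_cauchy_limit:
  fixes F :: "'p \<Rightarrow> 'a::real_normed_vector list \<Rightarrow> 'b::banach"
  assumes cauchy: "multi_cauchy E j \<F> F" and "\<F> \<noteq> bot" and E: "subspace E"
    and lin: "\<forall>\<^sub>F y in \<F>. bounded_multilinear E j (F y)"
  obtains L where "bounded_multilinear E j L" "\<And>e. e > 0 \<Longrightarrow> \<forall>\<^sub>F y in \<F>. multi_norm_le E j (\<lambda>vs. F y vs - L vs) e"
proof -
  have P: "\<exists>P. eventually P \<F> \<and> (\<forall>x y. P x \<and> P y \<longrightarrow> multi_norm_le E j (\<lambda>vs. F x vs - F y vs) e)" if "e > 0" for e
    using cauchy[unfolded multi_cauchy_def, rule_format, OF that] unfolding eventually_prod_same by fastforce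
  have "\<exists>l. ((\<lambda>y. F y vs) \<longlongrightarrow> l) \<F>" if vs: "length vs = j" "set vs \<subseteq> E" for vs
  proof -
    have "cauchy_filter (filtermap (\<lambda>y. F y vs) \<F>)"
      unfolding cauchy_filter_metric_filtermap
    proof (intro allI impI)
      fix e :: real assume e: "e > 0"
      let ?p = "prod_list (map norm vs)"
      have p: "0 \<le> ?p" by (rule prod_list_norm_nonneg)
      have "0 < e / (2 * (?p + 1))" using e p by simp
      from P[OF this] obtain P where P: "eventually P \<F>"
        "\<And>x y. P x \<Longrightarrow> P y \<Longrightarrow> multi_norm_le E j (\<lambda>vs. F x vs - F y vs) (e / (2 * (?p + 1)))" by blast
      have "dist (F x vs) (F y vs) < e" if "P x" "P y" for x y
      proof -
        have "dist (F x vs) (F y vs) \<le> e / (2 * (?p + 1)) * ?p" using multi_norm_leD[OF P(2)[OF that] vs] by (simp add: dist_norm)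
        also have "\<dots> \<le> e / (2 * (?p + 1)) * (?p + 1)" using e p by (intro mult_left_mono) auto
        also have "\<dots> = e / 2" using p by (simp add: field_simps)
        finally show ?thesis using e by linarith
      qed
      then show "\<exists>P. eventually P \<F> \<and> (\<forall>x y. P x \<and> P y \<longrightarrow> dist (F x vs) (F y vs) < e)" using P by blast
    qed
    moreover have "filtermap (\<lambda>y. F y vs) \<F> \<noteq> bot" using assms(2) by (simp add: filtermap_bot_iff)
    ultimately obtain l where "filtermap (\<lambda>y. F y vs) \<F> \<le> nhds l"
      using complete_UNIV[where 'a = 'b] unfolding complete_uniform by auto
    then show ?thesis unfolding filterlim_def by blast
  qed
  then obtain L where L: "\<And>vs. length vs = j \<Longrightarrow> set vs \<subseteq> E \<Longrightarrow> ((\<lambda>y. F y vs) \<longlongrightarrow> L vs) \<F>" by metis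
  have lim: "\<forall>\<^sub>F y in \<F>. multi_norm_le E j (\<lambda>vs. F y vs - L vs) e" if "e > 0" for e
  proof -
    from P[OF that] obtain P where P: "eventually P \<F>" "\<And>x y. P x \<Longrightarrow> P y \<Longrightarrow> multi_norm_le E j (\<lambda>vs. F x vs - F y vs) e" by blast
    show ?thesis using P(1)
    proof eventually_elim
      case (elim y)
      show ?case unfolding multi_norm_le_def
      proof (intro allI impI, elim conjE)
        fix vs assume vs: "length vs = j" "set vs \<subseteq> E"
        have "((\<lambda>z. norm (F y vs - F z vs)) \<longlongrightarrow> norm (F y vs - L vs)) \<F>" by (intro tendsto_intros L vs)
        moreover have "\<forall>\<^sub>F z in \<F>. norm (F y vs - F z vs) \<le> e * prod_list (map norm vs)"
          using P(1) by eventually_elim (use multi_norm_leD[OF P(2)[OF elim] vs] in simp)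
        ultimately show "norm (F y vs - L vs) \<le> e * prod_list (map norm vs)" using assms(2) by (rule tendsto_upperbound)
      qed
    qed
  qed
  have "L (us @ (a *\<^sub>R v + b *\<^sub>R w) # ws) = a *\<^sub>R L (us @ v # ws) + b *\<^sub>R L (us @ w # ws)"
    if "length us + length ws + 1 = j" "set us \<subseteq> E" "set ws \<subseteq> E" "v \<in> E" "w \<in> E" for us ws v w a b
  proof (rule tendsto_unique[OF assms(2)])
    have "a *\<^sub>R v + b *\<^sub>R w \<in> E" using E that by (intro subspace_add subspace_scale)
    then show "((\<lambda>y. F y (us @ (a *\<^sub>R v + b *\<^sub>R w) # ws)) \<longlongrightarrow> L (us @ (a *\<^sub>R v + b *\<^sub>R w) # ws)) \<F>"
      by (intro L) (use that in auto)
    have "((\<lambda>y. a *\<^sub>R F y (us @ v # ws) + b *\<^sub>R F y (us @ w # ws)) \<longlongrightarrow> a *\<^sub>R L (us @ v # ws) + b *\<^sub>R L (us @ w # ws)) \<F>"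
      by (intro tendsto_intros L) (use that in auto)
    moreover have "\<forall>\<^sub>F y in \<F>. a *\<^sub>R F y (us @ v # ws) + b *\<^sub>R F y (us @ w # ws) = F y (us @ (a *\<^sub>R v + b *\<^sub>R w) # ws)"
      using lin
    proof eventually_elim
      case (elim y)
      show ?case
        using elim[unfolded bounded_multilinear_def, THEN conjunct1, rule_format, of us ws v w a b] that by simp
    qed
    ultimately show "((\<lambda>y. F y (us @ (a *\<^sub>R v + b *\<^sub>R w) # ws)) \<longlongrightarrow> a *\<^sub>R L (us @ v # ws) + b *\<^sub>R L (us @ w # ws)) \<F>"
      by (rule Lim_transform_eventually)
  qed
  moreover have "\<exists>C. multi_norm_le E j L C"
  proof -
    have "\<forall>\<^sub>F y in \<F>. multi_norm_le E j (\<lambda>vs. F y vs - L vs) 1 \<and> bounded_multilinear E j (F y)"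
      using lim[of 1] lin by (simp add: eventually_conj_iff)
    then obtain y where y: "multi_norm_le E j (\<lambda>vs. F y vs - L vs) 1" "bounded_multilinear E j (F y)"
      using eventually_happens'[OF assms(2)] by blast
    obtain C where C: "multi_norm_le E j (F y) C" using y(2) unfolding bounded_multilinear_def by blast
    have "multi_norm_le E j L (C + 1)" unfolding multi_norm_le_def
    proof (intro allI impI, elim conjE)
      fix vs assume vs: "length vs = j" "set vs \<subseteq> E"
      have "norm (L vs) \<le> norm (F y vs) + norm (F y vs - L vs)" by norm
      then show "norm (L vs) \<le> (C + 1) * prod_list (map norm vs)"
        using multi_norm_leD[OF C vs] multi_norm_leD[OF y(1) vs] by (simp add: algebra_simps)
    qed
    then show ?thesis ..
  qed
  ultimately have "bounded_multilinear E j L" unfolding bounded_multilinear_def by blast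
  then show thesis using that lim by blast
qed

lemma multi_tendstoD:
  assumes "multi_tendsto E j S F p L" "0 < e"
  obtains d where "d > 0" "\<And>y. y \<in> S \<Longrightarrow> y \<noteq> p \<Longrightarrow> dist y p < d \<Longrightarrow> multi_norm_le E j (\<lambda>vs. F y vs - L vs) e"
proof -
  have "\<forall>\<^sub>F y in at p within S. multi_norm_le E j (\<lambda>vs. F y vs - L vs) e"
    using assms unfolding multi_tendsto_def by simp
  then obtain d where "d > 0" "\<forall>y\<in>S. y \<noteq> p \<and> dist y p < d \<longrightarrow> multi_norm_le E j (\<lambda>vs. F y vs - L vs) e"
    unfolding eventually_at by (elim exE conjE)
  then show thesis using that[of d] by simp
qed

text \<open>Here \<open>S - S\<^sub>0\<close> is the boundary part of \<open>S\<close>, and \<open>s\<close> is a direction pointing from it into \<open>S\<^sub>0\<close>.\<close>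

lemma derivs_extend_to_boundary:
  fixes f :: "'a::real_normed_vector \<Rightarrow> 'b::banach"
  assumes E: "subspace E" "S \<subseteq> E" and S0: "S\<^sub>0 \<subseteq> S" "convex S\<^sub>0" "s \<in> E"
    and shift: "\<And>y. y \<in> S \<Longrightarrow> \<exists>d>0. \<forall>t. 0 < t \<and> t < d \<longrightarrow> y + t *\<^sub>R s \<in> S\<^sub>0"
    and S0_open: "\<And>y. y \<in> S\<^sub>0 \<Longrightarrow> \<exists>d>0. \<forall>z\<in>S. dist z y < d \<longrightarrow> z \<in> S\<^sub>0"
    and f: "continuous_on S f" and F: "has_derivs_on E S\<^sub>0 k f F"
    and lim: "\<And>j p. j \<le> k \<Longrightarrow> p \<in> S - S\<^sub>0 \<Longrightarrow> bounded_multilinear E j (L j p)"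
      "\<And>j p. j \<le> k \<Longrightarrow> p \<in> S - S\<^sub>0 \<Longrightarrow> multi_tendsto E j S\<^sub>0 (F j) p (L j p)"
  defines "G \<equiv> \<lambda>j y. if y \<in> S\<^sub>0 then F j y else L j y"
  shows "has_derivs_on E S k f G"
    and "\<And>j p. j \<le> k \<Longrightarrow> p \<in> S - S\<^sub>0 \<Longrightarrow> multi_tendsto E j S (G j) p (G j p)"
    and "has_cont_derivs_on E S\<^sub>0 k f F \<Longrightarrow> has_cont_derivs_on E S k f G"
proof -
  have weak: "has_weak_derivs_on E S\<^sub>0 k f F" using F E(1) by (rule has_derivs_imp_weak)
  \<comment> \<open>Moving along \<open>s\<close> approaches every point of \<open>S\<close> from
    within \<open>S\<^sub>0\<close>; inequalities on \<open>S\<^sub>0\<close> are carried to the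
    boundary by letting \<open>t\<close> tend to \<open>0\<close>.\<close>
  have shift_within: "filterlim (\<lambda>t. y + t *\<^sub>R s) (at y within S\<^sub>0) (at_right 0)" if y: "y \<in> S" "s \<noteq> 0" for y
  proof -
    obtain d where d: "d > 0" "\<And>t. 0 < t \<Longrightarrow> t < d \<Longrightarrow> y + t *\<^sub>R s \<in> S\<^sub>0" using shift[OF y(1)] by blast
    have "((\<lambda>t. y + t *\<^sub>R s) \<longlongrightarrow> y + 0 *\<^sub>R s) (at_right 0)" by (intro tendsto_intros)
    moreover have "\<forall>\<^sub>F t in at_right 0. y + t *\<^sub>R s \<in> S\<^sub>0 \<and> y + t *\<^sub>R s \<noteq> y"
      unfolding eventually_at_right_field using d y(2) by (intro exI[of _ d]) auto
    ultimately show ?thesis unfolding filterlim_at by (simp add: eventually_conj_iff)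
  qed
  have s0: "s \<noteq> 0" if pB: "p \<in> S - S\<^sub>0" for p
  proof
    assume "s = 0"
    obtain d where "d > 0" "\<forall>t. 0 < t \<and> t < d \<longrightarrow> p + t *\<^sub>R s \<in> S\<^sub>0" using shift[of p] pB by blast
    then have "p + (d/2) *\<^sub>R s \<in> S\<^sub>0" by simp
    then show False using pB \<open>s = 0\<close> by simp
  qed
  have limB: "((\<lambda>t. F j (y + t *\<^sub>R s) vs) \<longlongrightarrow> L j y vs) (at_right 0)"
    if j: "j \<le> k" and y: "y \<in> S - S\<^sub>0" and vs: "length vs = j" "set vs \<subseteq> E" for j y vs
  proof -
    let ?p = "prod_list (map norm vs)"
    have p: "0 \<le> ?p" by (rule prod_list_norm_nonneg)
    have "((\<lambda>y. F j y vs) \<longlongrightarrow> L j y vs) (at y within S\<^sub>0)"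
    proof (rule tendstoI)
      fix e :: real assume e: "e > 0"
      then have "0 < e / (?p + 1)" using p by simp
      with lim(2)[OF j y] have "\<forall>\<^sub>F z in at y within S\<^sub>0. multi_norm_le E j (\<lambda>vs. F j z vs - L j y vs) (e / (?p + 1))"
        unfolding multi_tendsto_def by blast
      then show "\<forall>\<^sub>F z in at y within S\<^sub>0. dist (F j z vs) (L j y vs) < e"
      proof eventually_elim
        case (elim z)
        have "norm (F j z vs - L j y vs) \<le> e / (?p + 1) * ?p" by (rule multi_norm_leD[OF elim vs])
        also have "\<dots> < e" using e p by (simp add: divide_simps)
        finally show ?case by (simp add: dist_norm)
      qed
    qed
    from filterlim_compose[OF this shift_within] show ?thesis using y s0[OF y] by simp
  qed
  \<comment> \<open>At interior points this is continuity of \<open>F j\<close>, a consequence of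
    its differentiability and therefore restricted to \<open>j < k\<close>.\<close>
  have limS: "((\<lambda>t. F j (y + t *\<^sub>R s) vs) \<longlongrightarrow> G j y vs) (at_right 0)"
    if j: "j < k" and y: "y \<in> S" and vs: "length vs = j" "set vs \<subseteq> E" for j y vs
  proof (cases "y \<in> S\<^sub>0")
    case False
    then show ?thesis using limB[of j y vs] that by (simp add: G_def)
  next
    case y0: True
    obtain C where C: "1 \<le> C" "multi_norm_le E (Suc j) (F (Suc j) y) C"
      using bounded_multilinear_bound[OF has_derivs_onD(2)[OF F y0, of "Suc j"]] j by auto
    let ?p = "prod_list (map norm vs)"
    have p: "0 \<le> ?p" by (rule prod_list_norm_nonneg)
    have "\<forall>\<^sub>F z in at y within S\<^sub>0. norm (F j z vs - F j y vs) \<le> ((C + 1) * ?p) * norm (z - y)"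
    proof -
      have "\<forall>\<^sub>F z in at y within S\<^sub>0. z \<in> S\<^sub>0" by (simp add: eventually_at_filter)
      with uniformly_diffD[OF has_derivs_onD(3)[OF F y0 j], of 1, simplified] show ?thesis
      proof eventually_elim
        case (elim z)
        have h: "z - y \<in> E" using elim y0 S0(1) E by (intro subspace_diff) auto
        have "norm (F j z vs - F j y vs) \<le> norm (F j z vs - F j y vs - F (Suc j) y ((z - y) # vs)) + norm (F (Suc j) y ((z - y) # vs))"
          by norm
        also have "\<dots> \<le> norm (z - y) * ?p + C * (norm (z - y) * ?p)"
          using elim vs multi_norm_leD[OF C(2), of "(z - y) # vs"] h by (intro add_mono) auto
        finally show ?case by (simp add: algebra_simps)
      qed
    qed
    moreover have "((\<lambda>z. ((C + 1) * ?p) * norm (z - y)) \<longlongrightarrow> 0) (at y within S\<^sub>0)"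
    proof -
      have "((\<lambda>z. ((C + 1) * ?p) * norm (z - y)) \<longlongrightarrow> ((C + 1) * ?p) * norm (y - y)) (at y within S\<^sub>0)"
        by (intro tendsto_intros)
      then show ?thesis by simp
    qed
    ultimately have "((\<lambda>z. F j z vs - F j y vs) \<longlongrightarrow> 0) (at y within S\<^sub>0)" by (rule Lim_null_comparison)
    then have *: "((\<lambda>z. F j z vs) \<longlongrightarrow> F j y vs) (at y within S\<^sub>0)" by (rule LIM_zero_cancel)
    show ?thesis
    proof (cases "s = 0")
      case True
      then show ?thesis using y0 by (simp add: G_def)
    next
      case False
      from filterlim_compose[OF * shift_within[OF y False]] show ?thesis using y0 by (simp add: G_def)
    qed
  qed
  \<comment> \<open>\<open>S\<^sub>0\<close> is relatively open in \<open>S\<close>, so both sets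
    agree near each of its points.\<close>
  have at_S0: "at y within S = at y within S\<^sub>0" if y: "y \<in> S\<^sub>0" for y
  proof -
    obtain d where d: "d > 0" "\<forall>z\<in>S. dist z y < d \<longrightarrow> z \<in> S\<^sub>0" using S0_open[OF y] by blast
    show ?thesis
      by (rule at_within_nhd[of y "ball y d"]) (use d S0(1) in \<open>auto simp: dist_commute\<close>)
  qed
  have inS0: "\<forall>\<^sub>F z in at y within S\<^sub>0. z \<in> S\<^sub>0" for y by (simp add: eventually_at_filter)
  show derivs: "has_derivs_on E S k f G"
  proof (rule has_derivs_onI)
    fix x assume x: "x \<in> S"
    show "G 0 x [] = f x"
    proof (cases "x \<in> S\<^sub>0")
      case True
      then show ?thesis using has_derivs_onD(1)[OF F] by (simp add: G_def)
    next
      case False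
      then have xB: "x \<in> S - S\<^sub>0" using x by simp
      have "(f \<longlongrightarrow> f x) (at x within S)" using f x by (simp add: continuous_on_def)
      then have "(f \<longlongrightarrow> f x) (at x within S\<^sub>0)" by (rule tendsto_within_subset[OF _ S0(1)])
      from filterlim_compose[OF this shift_within[OF x s0[OF xB]]]
      have "((\<lambda>t. f (x + t *\<^sub>R s)) \<longlongrightarrow> f x) (at_right 0)" .
      moreover have "\<forall>\<^sub>F t in at_right 0. f (x + t *\<^sub>R s) = F 0 (x + t *\<^sub>R s) []"
        using filterlim_iff[THEN iffD1, OF shift_within[OF x s0[OF xB]], rule_format, OF inS0]
        by eventually_elim (use has_derivs_onD(1)[OF F] in simp)
      ultimately have "((\<lambda>t. F 0 (x + t *\<^sub>R s) []) \<longlongrightarrow> f x) (at_right 0)" by (rule Lim_transform_eventually)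
      moreover have "((\<lambda>t. F 0 (x + t *\<^sub>R s) []) \<longlongrightarrow> L 0 x []) (at_right 0)" using limB[of 0 x "[]"] xB by simp
      ultimately have "L 0 x [] = f x" using tendsto_unique[OF trivial_limit_at_right_real] by blast
      then show ?thesis using False by (simp add: G_def)
    qed
    fix j
    show "bounded_multilinear E j (G j x)" if "j \<le> k"
      using has_derivs_onD(2)[OF F _ that] lim(1)[OF that] x by (simp add: G_def)
    assume j: "j < k"
    let ?I = "{vs. length vs = j \<and> set vs \<subseteq> E}"
    show "uniformly_diff S x ?I (\<lambda>vs. prod_list (map norm vs)) (G j) (\<lambda>vs h. G (Suc j) x (h # vs))"
    proof (cases "x \<in> S\<^sub>0")
      case True
      have "uniformly_diff S\<^sub>0 x ?I (\<lambda>vs. prod_list (map norm vs)) (G j) (\<lambda>vs h. G (Suc j) x (h # vs))"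
        by (rule uniformly_diff_cong[OF has_derivs_onD(3)[OF F True j]]) (use True in \<open>auto simp: G_def\<close>)
      then show ?thesis unfolding uniformly_diff_def at_S0[OF True] .
    next
      case False
      then have xB: "x \<in> S - S\<^sub>0" using x by simp
      show ?thesis unfolding uniformly_diff_def
      proof (intro allI impI)
        fix e :: real assume e: "e > 0"
        from j have "Suc j \<le> k" by simp
        then obtain d where d0: "d > 0"
          "\<And>y. y \<in> S\<^sub>0 \<Longrightarrow> y \<noteq> x \<Longrightarrow> dist y x < d \<Longrightarrow> multi_norm_le E (Suc j) (\<lambda>vs. F (Suc j) y vs - L (Suc j) x vs) e"
          using multi_tendstoD[OF lim(2)[OF _ xB] e] by blast
        then have d: "d > 0" "\<And>y. y \<in> S\<^sub>0 \<Longrightarrow> dist y x < d \<Longrightarrow> multi_norm_le E (Suc j) (\<lambda>vs. F (Suc j) y vs - L (Suc j) x vs) e"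
          using False by auto
        have "\<forall>\<^sub>F y in at x within S. y \<in> S \<and> dist y x < d"
          unfolding eventually_at using d(1) by blast
        then show "\<forall>\<^sub>F y in at x within S. \<forall>vs\<in>?I. norm (G j y vs - G j x vs - G (Suc j) x ((y - x) # vs)) \<le> e * norm (y - x) * prod_list (map norm vs)"
        proof eventually_elim
          case (elim y)
          show ?case
          proof
            fix vs assume "vs \<in> ?I"
            then have vs: "length vs = j" "set vs \<subseteq> E" by auto
            \<comment> \<open>The mean value inequality is applied to the pair shifted by
              \<open>t *\<^sub>R s\<close>, whose segment lies in the convex set
              \<open>S\<^sub>0\<close>, with the limit derivative at \<open>x\<close> as the fixed
              value; then \<open>t\<close> tends to \<open>0\<close>.\<close>
            let ?c = "L (Suc j) x ((y - x) # vs)"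
            have "((\<lambda>t. norm (F j (y + t *\<^sub>R s) vs - F j (x + t *\<^sub>R s) vs - ?c)) \<longlongrightarrow> norm (G j y vs - G j x vs - ?c)) (at_right 0)"
              using elim x by (intro tendsto_intros limS j vs) auto
            moreover have "\<forall>\<^sub>F t in at_right 0. norm (F j (y + t *\<^sub>R s) vs - F j (x + t *\<^sub>R s) vs - ?c) \<le> e * norm (y - x) * prod_list (map norm vs)"
            proof -
              have "\<forall>\<^sub>F t in at_right 0. y + t *\<^sub>R s \<in> S\<^sub>0 \<and> dist (y + t *\<^sub>R s) x < d"
              proof -
                have "\<forall>\<^sub>F t in at_right 0. y + t *\<^sub>R s \<in> S\<^sub>0"
                  using filterlim_iff[THEN iffD1, OF shift_within[OF _ s0[OF xB]], rule_format, OF _ inS0] elim by blast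
                moreover have "((\<lambda>t. dist (y + t *\<^sub>R s) x) \<longlongrightarrow> dist (y + 0 *\<^sub>R s) x) (at_right 0)" by (intro tendsto_intros)
                then have "\<forall>\<^sub>F t in at_right 0. dist (y + t *\<^sub>R s) x < d" using elim by (intro order_tendstoD(2)[of _ _ _ d]) auto
                ultimately show ?thesis by eventually_elim blast
              qed
              moreover have "\<forall>\<^sub>F t in at_right 0. x + t *\<^sub>R s \<in> S\<^sub>0 \<and> dist (x + t *\<^sub>R s) x < d"
              proof -
                have "\<forall>\<^sub>F t in at_right 0. x + t *\<^sub>R s \<in> S\<^sub>0"
                  using filterlim_iff[THEN iffD1, OF shift_within[OF x s0[OF xB]], rule_format, OF inS0] .
                moreover have "((\<lambda>t. dist (x + t *\<^sub>R s) x) \<longlongrightarrow> dist (x + 0 *\<^sub>R s) x) (at_right 0)" by (intro tendsto_intros)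
                then have "\<forall>\<^sub>F t in at_right 0. dist (x + t *\<^sub>R s) x < d" using d(1) by (intro order_tendstoD(2)[of _ _ _ d]) auto
                ultimately show ?thesis by eventually_elim blast
              qed
              ultimately show ?thesis
              proof eventually_elim
                case (elim t)
                let ?y = "y + t *\<^sub>R s" and ?x = "x + t *\<^sub>R s"
                have "closed_segment ?x ?y \<subseteq> S\<^sub>0 \<inter> ball x d"
                  using elim S0(2) by (intro closed_segment_subset convex_Int) (auto simp: dist_commute)
                then have seg: "closed_segment ?x ?y \<subseteq> S\<^sub>0" "\<And>u. u \<in> closed_segment ?x ?y \<Longrightarrow> dist u x < d"
                  by (auto simp: dist_commute)
                have yx: "?y - ?x = y - x" by simp
                have "y - x \<in> E" using elim S0(1) E subspace_diff[OF E(1), of ?y ?x] unfolding yx by auto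
                then have "norm (F (Suc j) u ((?y - ?x) # vs) - ?c) \<le> e * norm (y - x) * prod_list (map norm vs)"
                  if "u \<in> closed_segment ?x ?y" for u
                  using multi_norm_leD[OF d(2)[of u], of "(y - x) # vs"] seg that vs by (auto simp: mult.assoc)
                from mean_value_derivs[OF weak E(1) _ j seg(1) vs this] show ?case using S0(1) E(2) by auto
              qed
            qed
            ultimately have "norm (G j y vs - G j x vs - ?c) \<le> e * norm (y - x) * prod_list (map norm vs)"
              by (rule tendsto_upperbound) simp
            then show "norm (G j y vs - G j x vs - G (Suc j) x ((y - x) # vs)) \<le> e * norm (y - x) * prod_list (map norm vs)"
              using False by (simp add: G_def)
          qed
        qed
      qed
    qed
  qed
  show cont: "multi_tendsto E j S (G j) p (G j p)" if j: "j \<le> k" and p: "p \<in> S - S\<^sub>0" for j p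
    unfolding multi_tendsto_def
  proof (intro allI impI)
    fix e :: real assume e: "e > 0"
    obtain d where d0: "d > 0"
      "\<And>y. y \<in> S\<^sub>0 \<Longrightarrow> y \<noteq> p \<Longrightarrow> dist y p < d \<Longrightarrow> multi_norm_le E j (\<lambda>vs. F j y vs - L j p vs) e"
      using multi_tendstoD[OF lim(2)[OF j p] e] by blast
    then have d: "d > 0" "\<And>y. y \<in> S\<^sub>0 \<Longrightarrow> dist y p < d \<Longrightarrow> multi_norm_le E j (\<lambda>vs. F j y vs - L j p vs) e"
      using p by auto
    have "\<forall>\<^sub>F y in at p within S. y \<in> S \<and> dist y p < d"
      unfolding eventually_at using d(1) by blast
    then show "\<forall>\<^sub>F y in at p within S. multi_norm_le E j (\<lambda>vs. G j y vs - G j p vs) e"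
    proof eventually_elim
      case (elim y)
      show ?case
      proof (cases "y \<in> S\<^sub>0")
        case True
        then show ?thesis using d(2)[of y] elim p by (simp add: G_def)
      next
        case False
        show ?thesis unfolding multi_norm_le_def
        proof (intro allI impI, elim conjE)
          fix vs assume vs: "length vs = j" "set vs \<subseteq> E"
          have yB: "y \<in> S - S\<^sub>0" using False elim by simp
          have "((\<lambda>t. norm (F j (y + t *\<^sub>R s) vs - L j p vs)) \<longlongrightarrow> norm (L j y vs - L j p vs)) (at_right 0)"
            by (intro tendsto_intros limB j yB vs)
          moreover have "\<forall>\<^sub>F t in at_right 0. norm (F j (y + t *\<^sub>R s) vs - L j p vs) \<le> e * prod_list (map norm vs)"
          proof -
            have "\<forall>\<^sub>F t in at_right 0. y + t *\<^sub>R s \<in> S\<^sub>0"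
              using filterlim_iff[THEN iffD1, OF shift_within[OF _ s0[OF p]], rule_format, OF _ inS0] elim by blast
            moreover have "((\<lambda>t. dist (y + t *\<^sub>R s) p) \<longlongrightarrow> dist (y + 0 *\<^sub>R s) p) (at_right 0)" by (intro tendsto_intros)
            then have "\<forall>\<^sub>F t in at_right 0. dist (y + t *\<^sub>R s) p < d" using elim by (intro order_tendstoD(2)[of _ _ _ d]) auto
            ultimately show ?thesis by eventually_elim (rule multi_norm_leD[OF d(2) vs])
          qed
          ultimately have "norm (L j y vs - L j p vs) \<le> e * prod_list (map norm vs)"
            by (rule tendsto_upperbound) simp
          then show "norm (G j y vs - G j p vs) \<le> e * prod_list (map norm vs)" using False p by (simp add: G_def)
        qed
      qed
    qed
  qed
  assume c: "has_cont_derivs_on E S\<^sub>0 k f F"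
  have "multi_tendsto E j S (G j) p (G j p)" if j: "j \<le> k" and p: "p \<in> S" for j p
  proof (cases "p \<in> S\<^sub>0")
    case False
    then show ?thesis using cont j p by blast
  next
    case True
    have "multi_tendsto E j S\<^sub>0 (F j) p (F j p)" using c j True unfolding has_cont_derivs_on_def by blast
    then show ?thesis unfolding multi_tendsto_def at_S0[OF True]
    proof (intro allI impI)
      fix e :: real assume *: "\<forall>e>0. \<forall>\<^sub>F y in at p within S\<^sub>0. multi_norm_le E j (\<lambda>vs. F j y vs - F j p vs) e" "e > 0"
      from *(1)[rule_format, OF *(2)] inS0[of p]
      show "\<forall>\<^sub>F y in at p within S\<^sub>0. multi_norm_le E j (\<lambda>vs. G j y vs - G j p vs) e"
        by eventually_elim (use True in \<open>simp add: G_def\<close>)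
    qed
  qed
  then show "has_cont_derivs_on E S k f G" using derivs unfolding has_cont_derivs_on_def by blast
qed

section \<open>Terms of top and of lower order in the chain rule; their bounds and Cauchy
  property\<close>

lemma partition_term_coarsest:
  assumes "length vs = m"
  shows "partition_term F \<Phi> vs [[0..<m]] = F 1 [\<Phi> m vs]"
  using map_nth[of vs] assms by (simp add: partition_term_def block_values_def)

lemma partition_term_finest:
  assumes "length vs = m"
  shows "partition_term F \<Phi> vs (map (\<lambda>i. [i]) [0..<m]) = F m (map (\<lambda>v. \<Phi> 1 [v]) vs)"
proof -
  have "map (block_values \<Phi> vs) (map (\<lambda>i. [i]) [0..<m]) = map (\<lambda>v. \<Phi> 1 [v]) (map ((!) vs) [0..<length vs])"
    using assms by (simp add: block_values_def)
  then have "map (block_values \<Phi> vs) (map (\<lambda>i. [i]) [0..<m]) = map (\<lambda>v. \<Phi> 1 [v]) vs" by (simp only: map_nth)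
  then show ?thesis unfolding partition_term_def by (simp only: length_map length_upt diff_zero)
qed

definition lower_derivs ::
  "(nat \<Rightarrow> 'b \<Rightarrow> 'b list \<Rightarrow> 'c::comm_monoid_add) \<Rightarrow> ('a \<Rightarrow> 'b) \<Rightarrow> (nat \<Rightarrow> 'a \<Rightarrow> 'a list \<Rightarrow> 'b) \<Rightarrow> nat \<Rightarrow> 'a \<Rightarrow> 'a list \<Rightarrow> 'c" where
  "lower_derivs F \<phi> \<Phi> j y vs = (\<Sum>bs\<leftarrow>lower_partitions j. partition_term (\<lambda>i. F i (\<phi> y)) (\<lambda>i. \<Phi> i y) vs bs)"

text \<open>The first two terms come from the coarsest and the finest partition. For
  \<open>m = 1\<close> these coincide, which is why first derivatives get an argument of their own
  below.\<close>

lemma comp_derivs_split: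
  assumes "2 \<le> m" "length vs = m"
  shows "comp_derivs F \<phi> \<Phi> m y vs =
    F 1 (\<phi> y) [\<Phi> m y vs] + F m (\<phi> y) (map (\<lambda>v. \<Phi> 1 y [v]) vs) + lower_derivs F \<phi> \<Phi> m y vs"
proof -
  obtain j where m: "m = Suc (Suc j)" using assms(1) by (metis Suc_le_D numeral_2_eq_2 Suc_le_mono)
  let ?t = "partition_term (\<lambda>i. F i (\<phi> y)) (\<lambda>i. \<Phi> i y) vs"
  have "comp_derivs F \<phi> \<Phi> m y vs = ?t [[0..<m]] + ?t (map (\<lambda>i. [i]) [0..<m]) + lower_derivs F \<phi> \<Phi> m y vs"
    unfolding comp_derivs_def lower_derivs_def m by (rule sum_set_partitions)
  then show ?thesis by (simp only: partition_term_coarsest[OF assms(2)] partition_term_finest[OF assms(2)])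
qed

lemma comp_derivs_1: "comp_derivs F \<phi> \<Phi> 1 y [v] = F 1 (\<phi> y) [\<Phi> 1 y [v]]"
  by (simp add: comp_derivs_def set_partitions_1 partition_term_def block_values_def extend_partition_def)

lemma lower_partitions_orders:
  assumes "bs \<in> set (lower_partitions j)"
  shows "is_partition j bs" "1 \<le> length bs" "length bs < j" "b \<in> set bs \<Longrightarrow> 1 \<le> length b" "b \<in> set bs \<Longrightarrow> length b < j"
  using lower_partitions_props[OF assms] is_partition_block[of j bs b] by auto

lemma set_partitions_orders:
  assumes "bs \<in> set (set_partitions j)" "1 \<le> j"
  shows "is_partition j bs" "1 \<le> length bs" "length bs \<le> j" "b \<in> set bs \<Longrightarrow> 1 \<le> length b" "b \<in> set bs \<Longrightarrow> length b \<le> j"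
proof -
  show p: "is_partition j bs" using assms is_partition_set_partitions by blast
  show l: "1 \<le> length bs" using is_partition_sum_length[OF p] assms(2) by (cases bs) auto
  show "length bs \<le> j" by (rule is_partition_length[OF p])
  show "b \<in> set bs \<Longrightarrow> 1 \<le> length b" "b \<in> set bs \<Longrightarrow> length b \<le> j" using is_partition_block[OF p, of b] l by auto
qed

lemma multi_norm_le_sum_list:
  fixes C :: real
  assumes "\<And>b. b \<in> set bs \<Longrightarrow> multi_norm_le E j (G b) C"
  shows "multi_norm_le E j (\<lambda>vs. \<Sum>b\<leftarrow>bs. G b vs) (length bs * C)"
  using assms
proof (induction bs)
  case Nil
  then show ?case by (simp add: multi_norm_le_def)
next
  case (Cons b bs)
  have 1: "multi_norm_le E j (G b) C" using Cons.prems by simp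
  have 2: "multi_norm_le E j (\<lambda>vs. \<Sum>b\<leftarrow>bs. G b vs) (length bs * C)" using Cons by simp
  show ?case unfolding multi_norm_le_def
  proof (intro allI impI, elim conjE)
    fix vs assume vs: "length vs = j" "set vs \<subseteq> E"
    show "norm (\<Sum>b\<leftarrow>b # bs. G b vs) \<le> length (b # bs) * C * prod_list (map norm vs)"
      using norm_triangle_mono[OF multi_norm_leD[OF 1 vs] multi_norm_leD[OF 2 vs]] by (simp add: algebra_simps)
  qed
qed

lemma lower_derivs_bound:
  fixes C :: real
  assumes "\<And>i. 1 \<le> i \<Longrightarrow> i < j \<Longrightarrow> multi_norm_le UNIV i (F i (\<phi> y)) C"
    and "\<And>i. 1 \<le> i \<Longrightarrow> i < j \<Longrightarrow> multi_norm_le E i (\<Phi> i y) C" and "1 \<le> C"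
  shows "multi_norm_le E j (lower_derivs F \<phi> \<Phi> j y) (length (lower_partitions j) * (C * C ^ j))"
  unfolding lower_derivs_def
proof (rule multi_norm_le_sum_list)
  fix bs assume bs: "bs \<in> set (lower_partitions j)"
  note o = lower_partitions_orders[OF bs]
  show "multi_norm_le E j (\<lambda>vs. partition_term (\<lambda>i. F i (\<phi> y)) (\<lambda>i. \<Phi> i y) vs bs) (C * C ^ j)"
    unfolding multi_norm_le_def
    by (intro allI impI, elim conjE, rule partition_term_bound[OF o(1), where E = E]) (use assms o in auto)
qed

lemma comp_derivs_bound:
  fixes C :: real
  assumes "\<And>i. 1 \<le> i \<Longrightarrow> i \<le> j \<Longrightarrow> multi_norm_le UNIV i (F i (\<phi> y)) C"
    and "\<And>i. 1 \<le> i \<Longrightarrow> i \<le> j \<Longrightarrow> multi_norm_le E i (\<Phi> i y) C" and "1 \<le> C" "1 \<le> j"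
  shows "multi_norm_le E j (comp_derivs F \<phi> \<Phi> j y) (length (set_partitions j) * (C * C ^ j))"
  unfolding comp_derivs_def
proof (rule multi_norm_le_sum_list)
  fix bs assume bs: "bs \<in> set (set_partitions j)"
  note o = set_partitions_orders[OF bs assms(4)]
  show "multi_norm_le E j (\<lambda>vs. partition_term (\<lambda>i. F i (\<phi> y)) (\<lambda>i. \<Phi> i y) vs bs) (C * C ^ j)"
    unfolding multi_norm_le_def
    by (intro allI impI, elim conjE, rule partition_term_bound[OF o(1), where E = E]) (use assms o in auto)
qed

lemma eventually_fst: "eventually P \<F> \<Longrightarrow> \<forall>\<^sub>F w in \<F> \<times>\<^sub>F \<G>. P (fst w)"
  using filterlim_fst[of \<F> \<G>] by (simp add: filterlim_iff)

lemma eventually_snd: "eventually P \<G> \<Longrightarrow> \<forall>\<^sub>F w in \<F> \<times>\<^sub>F \<G>. P (snd w)"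
  using filterlim_snd[of \<G> \<F>] by (simp add: filterlim_iff)

lemma multi_cauchyD:
  "multi_cauchy E j \<F> F \<Longrightarrow> 0 < e \<Longrightarrow> \<forall>\<^sub>F w in \<F> \<times>\<^sub>F \<F>. multi_norm_le E j (\<lambda>vs. F (fst w) vs - F (snd w) vs) e"
  by (simp add: multi_cauchy_def)

lemma multi_cauchy_add:
  assumes "multi_cauchy E j \<F> F" "multi_cauchy E j \<F> G"
  shows "multi_cauchy E j \<F> (\<lambda>y vs. F y vs + G y vs)"
  unfolding multi_cauchy_def
proof (intro allI impI)
  fix e :: real assume "0 < e"
  then have "0 < e / 2" by simp
  from multi_cauchyD[OF assms(1) this] multi_cauchyD[OF assms(2) this]
  show "\<forall>\<^sub>F w in \<F> \<times>\<^sub>F \<F>. multi_norm_le E j (\<lambda>vs. F (fst w) vs + G (fst w) vs - (F (snd w) vs + G (snd w) vs)) e"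
  proof eventually_elim
    case (elim w)
    show ?case unfolding multi_norm_le_def
    proof (intro allI impI, elim conjE)
      fix vs assume vs: "length vs = j" "set vs \<subseteq> E"
      have "F (fst w) vs + G (fst w) vs - (F (snd w) vs + G (snd w) vs) = (F (fst w) vs - F (snd w) vs) + (G (fst w) vs - G (snd w) vs)"
        by simp
      then show "norm (F (fst w) vs + G (fst w) vs - (F (snd w) vs + G (snd w) vs)) \<le> e * prod_list (map norm vs)"
        using norm_triangle_mono[OF multi_norm_leD[OF elim(1) vs] multi_norm_leD[OF elim(2) vs]] by (simp add: algebra_simps)
    qed
  qed
qed

lemma multi_cauchy_sum_list:
  fixes E :: "'a::real_normed_vector set" and G :: "'d \<Rightarrow> 'p \<Rightarrow> 'a list \<Rightarrow> 'b::real_normed_vector"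
  assumes "\<And>b. b \<in> set bs \<Longrightarrow> multi_cauchy E j \<F> (G b)"
  shows "multi_cauchy E j \<F> (\<lambda>y vs. \<Sum>b\<leftarrow>bs. G b y vs)"
  using assms
proof (induction bs)
  case Nil
  have "0 \<le> e * prod_list (map norm vs)" if "0 < e" for e and vs :: "'a list"
    using that prod_list_norm_nonneg[of vs] by simp
  then show ?case by (simp add: multi_cauchy_def multi_norm_le_def)
next
  case (Cons b bs)
  then show ?case using multi_cauchy_add[of E j \<F> "G b"] by simp
qed

text \<open>A product of bounded Cauchy families is Cauchy. The accuracy demanded of the factors is
  \<open>e\<close> divided by the constant of \<open>partition_term_diff\<close>.\<close>

lemma multi_cauchy_partition_term:
  assumes bs: "is_partition j bs"
    and F: "\<forall>\<^sub>F y in \<F>. multi_norm_le UNIV (length bs) (F (length bs) y) C \<and> bounded_multilinear UNIV (length bs) (F (length bs) y)"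
      "multi_cauchy UNIV (length bs) \<F> (F (length bs))"
    and \<Phi>: "\<And>b. b \<in> set bs \<Longrightarrow> \<forall>\<^sub>F y in \<F>. multi_norm_le E (length b) (\<Phi> (length b) y) C"
      "\<And>b. b \<in> set bs \<Longrightarrow> multi_cauchy E (length b) \<F> (\<Phi> (length b))"
    and C: "1 \<le> C"
  shows "multi_cauchy E j \<F> (\<lambda>y vs. partition_term (\<lambda>i. F i y) (\<lambda>i. \<Phi> i y) vs bs)"
  unfolding multi_cauchy_def
proof (intro allI impI)
  fix e :: real assume e: "0 < e"
  define c where "c = (1 + C * j) * C ^ j"
  have c: "0 < c" using C by (auto simp: c_def intro!: mult_pos_pos add_pos_nonneg)
  have e': "0 < e / c" using e c by simp
  have "\<forall>\<^sub>F w in \<F> \<times>\<^sub>F \<F>. multi_norm_le UNIV (length bs) (F (length bs) (snd w)) C \<and> bounded_multilinear UNIV (length bs) (F (length bs) (snd w))"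
    by (rule eventually_snd[OF F(1)])
  moreover have "\<forall>\<^sub>F w in \<F> \<times>\<^sub>F \<F>. multi_norm_le UNIV (length bs) (\<lambda>ws. F (length bs) (fst w) ws - F (length bs) (snd w) ws) (e / c)"
    by (rule multi_cauchyD[OF F(2) e'])
  moreover have "\<forall>\<^sub>F w in \<F> \<times>\<^sub>F \<F>. \<forall>b\<in>set bs. multi_norm_le E (length b) (\<Phi> (length b) (fst w)) C"
    by (intro eventually_ball_finite ballI eventually_fst \<Phi>) auto
  moreover have "\<forall>\<^sub>F w in \<F> \<times>\<^sub>F \<F>. \<forall>b\<in>set bs. multi_norm_le E (length b) (\<Phi> (length b) (snd w)) C"
    by (intro eventually_ball_finite ballI eventually_snd \<Phi>) auto
  moreover have "\<forall>\<^sub>F w in \<F> \<times>\<^sub>F \<F>. \<forall>b\<in>set bs. multi_norm_le E (length b) (\<lambda>ws. \<Phi> (length b) (fst w) ws - \<Phi> (length b) (snd w) ws) (e / c)"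
    by (intro eventually_ball_finite ballI multi_cauchyD \<Phi> e') auto
  ultimately show "\<forall>\<^sub>F w in \<F> \<times>\<^sub>F \<F>. multi_norm_le E j (\<lambda>vs. partition_term (\<lambda>i. F i (fst w)) (\<lambda>i. \<Phi> i (fst w)) vs bs -
      partition_term (\<lambda>i. F i (snd w)) (\<lambda>i. \<Phi> i (snd w)) vs bs) e"
  proof eventually_elim
    case (elim w)
    show ?case unfolding multi_norm_le_def
    proof (intro allI impI, elim conjE)
      fix vs assume vs: "length vs = j" "set vs \<subseteq> E"
      have "norm (partition_term (\<lambda>i. F i (fst w)) (\<lambda>i. \<Phi> i (fst w)) vs bs - partition_term (\<lambda>i. F i (snd w)) (\<lambda>i. \<Phi> i (snd w)) vs bs)
        \<le> (1 + C * j) * C ^ j * (e / c) * prod_list (map norm vs)"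
        by (rule partition_term_diff[OF bs vs]) (use elim C e' in auto)
      also have "(1 + C * j) * C ^ j * (e / c) = e" using c unfolding c_def[symmetric] by simp
      finally show "norm (partition_term (\<lambda>i. F i (fst w)) (\<lambda>i. \<Phi> i (fst w)) vs bs - partition_term (\<lambda>i. F i (snd w)) (\<lambda>i. \<Phi> i (snd w)) vs bs)
        \<le> e * prod_list (map norm vs)" .
    qed
  qed
qed

lemma multi_cauchy_lower_derivs:
  assumes F: "\<And>i. 1 \<le> i \<Longrightarrow> i < j \<Longrightarrow> \<forall>\<^sub>F y in \<F>. multi_norm_le UNIV i (F i (\<phi> y)) C \<and> bounded_multilinear UNIV i (F i (\<phi> y))"
      "\<And>i. 1 \<le> i \<Longrightarrow> i < j \<Longrightarrow> multi_cauchy UNIV i \<F> (\<lambda>y. F i (\<phi> y))"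
    and \<Phi>: "\<And>i. 1 \<le> i \<Longrightarrow> i < j \<Longrightarrow> \<forall>\<^sub>F y in \<F>. multi_norm_le E i (\<Phi> i y) C"
      "\<And>i. 1 \<le> i \<Longrightarrow> i < j \<Longrightarrow> multi_cauchy E i \<F> (\<Phi> i)"
    and C: "1 \<le> C"
  shows "multi_cauchy E j \<F> (lower_derivs F \<phi> \<Phi> j)"
proof -
  have "multi_cauchy E j \<F> (\<lambda>y vs. \<Sum>bs\<leftarrow>lower_partitions j. partition_term (\<lambda>i. F i (\<phi> y)) (\<lambda>i. \<Phi> i y) vs bs)"
  proof (rule multi_cauchy_sum_list)
    fix bs assume bs: "bs \<in> set (lower_partitions j)"
    note o = lower_partitions_orders[OF bs]
    show "multi_cauchy E j \<F> (\<lambda>y vs. partition_term (\<lambda>i. F i (\<phi> y)) (\<lambda>i. \<Phi> i y) vs bs)"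
      by (rule multi_cauchy_partition_term[OF o(1), where F = "\<lambda>i y. F i (\<phi> y)" and C = C]) (use F \<Phi> C o in auto)
  qed
  then show ?thesis by (simp add: lower_derivs_def[abs_def])
qed

lemma multi_cauchy_comp_derivs:
  assumes F: "\<And>i. 1 \<le> i \<Longrightarrow> i \<le> j \<Longrightarrow> \<forall>\<^sub>F y in \<F>. multi_norm_le UNIV i (F i (\<phi> y)) C \<and> bounded_multilinear UNIV i (F i (\<phi> y))"
      "\<And>i. 1 \<le> i \<Longrightarrow> i \<le> j \<Longrightarrow> multi_cauchy UNIV i \<F> (\<lambda>y. F i (\<phi> y))"
    and \<Phi>: "\<And>i. 1 \<le> i \<Longrightarrow> i \<le> j \<Longrightarrow> \<forall>\<^sub>F y in \<F>. multi_norm_le E i (\<Phi> i y) C"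
      "\<And>i. 1 \<le> i \<Longrightarrow> i \<le> j \<Longrightarrow> multi_cauchy E i \<F> (\<Phi> i)"
    and C: "1 \<le> C" and j: "1 \<le> j"
  shows "multi_cauchy E j \<F> (comp_derivs F \<phi> \<Phi> j)"
proof -
  have "multi_cauchy E j \<F> (\<lambda>y vs. \<Sum>bs\<leftarrow>set_partitions j. partition_term (\<lambda>i. F i (\<phi> y)) (\<lambda>i. \<Phi> i y) vs bs)"
  proof (rule multi_cauchy_sum_list)
    fix bs assume bs: "bs \<in> set (set_partitions j)"
    note o = set_partitions_orders[OF bs j]
    show "multi_cauchy E j \<F> (\<lambda>y vs. partition_term (\<lambda>i. F i (\<phi> y)) (\<lambda>i. \<Phi> i y) vs bs)"
      by (rule multi_cauchy_partition_term[OF o(1), where F = "\<lambda>i y. F i (\<phi> y)" and C = C]) (use F \<Phi> C o in auto)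
  qed
  then show ?thesis by (simp add: comp_derivs_def[abs_def])
qed

lemma multi_cauchy_compose:
  assumes "multi_cauchy E j \<G> F" "filterlim \<phi> \<G> \<F>"
  shows "multi_cauchy E j \<F> (\<lambda>y. F (\<phi> y))"
  unfolding multi_cauchy_def
proof (intro allI impI)
  fix e :: real assume "0 < e"
  from multi_cauchyD[OF assms(1) this]
  have "\<forall>\<^sub>F w in \<G> \<times>\<^sub>F \<G>. multi_norm_le E j (\<lambda>vs. F (fst w) vs - F (snd w) vs) e" .
  moreover have "filterlim (\<lambda>w. (\<phi> (fst w), \<phi> (snd w))) (\<G> \<times>\<^sub>F \<G>) (\<F> \<times>\<^sub>F \<F>)"
    by (intro filterlim_Pair filterlim_compose[OF assms(2)] filterlim_fst filterlim_snd)
  ultimately have "\<forall>\<^sub>F w in \<F> \<times>\<^sub>F \<F>. multi_norm_le E j (\<lambda>vs. F (fst (\<phi> (fst w), \<phi> (snd w))) vs - F (snd (\<phi> (fst w), \<phi> (snd w))) vs) e"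
    unfolding filterlim_iff by blast
  then show "\<forall>\<^sub>F w in \<F> \<times>\<^sub>F \<F>. multi_norm_le E j (\<lambda>vs. F (\<phi> (fst w)) vs - F (\<phi> (snd w)) vs) e" by simp
qed

lemma multi_cauchy_tendsto:
  assumes "\<And>e. 0 < e \<Longrightarrow> \<forall>\<^sub>F y in \<F>. multi_norm_le E j (\<lambda>vs. F y vs - L vs) e"
  shows "multi_cauchy E j \<F> F"
  unfolding multi_cauchy_def
proof (intro allI impI)
  fix e :: real assume "0 < e"
  then have "0 < e / 2" by simp
  from eventually_fst[OF assms[OF this]] eventually_snd[OF assms[OF this]]
  show "\<forall>\<^sub>F w in \<F> \<times>\<^sub>F \<F>. multi_norm_le E j (\<lambda>vs. F (fst w) vs - F (snd w) vs) e"
  proof eventually_elim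
    case (elim w)
    show ?case unfolding multi_norm_le_def
    proof (intro allI impI, elim conjE)
      fix vs assume vs: "length vs = j" "set vs \<subseteq> E"
      have "norm (F (fst w) vs - F (snd w) vs) \<le> norm (F (fst w) vs - L vs) + norm (F (snd w) vs - L vs)" by norm
      then show "norm (F (fst w) vs - F (snd w) vs) \<le> e * prod_list (map norm vs)"
        using multi_norm_leD[OF elim(1) vs] multi_norm_leD[OF elim(2) vs] by simp
    qed
  qed
qed

section \<open>Invariant graphs along an orbit\<close>

text \<open>The data of the theorem in normalised form.  Here \<open>e n\<close> spans \<open>\<eta>\<^sub>n\<close> and \<open>g n\<close> is the coordinate
  along it with kernel \<open>E n = l\<^sub>n + \<xi>\<^sub>n\<close>, \<open>s n\<close> spans \<open>\<xi>\<^sub>n\<close> and \<open>f n\<close> is the coordinate along it with kernel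
  \<open>D0\<close>, and \<open>w n\<close> is a seminorm adapted to the contraction of the \<open>l\<^sub>n\<close>-component.  The scales of \<open>e n\<close>,
  \<open>s n\<close> and \<open>w n\<close> are such that the rates \<open>\<kappa> < 1 < \<nu> \<le> \<sigma>\<close> and \<open>\<tau>\<close> hold in every single step.\<close>

locale graph_cocycle =
  fixes E :: "nat \<Rightarrow> 'a::real_normed_vector set" and e s x :: "nat \<Rightarrow> 'a"
    and g f w :: "nat \<Rightarrow> 'a \<Rightarrow> real" and a b :: "nat \<Rightarrow> real"
    and R :: "nat \<Rightarrow> 'a \<Rightarrow> 'a" and DR :: "nat \<Rightarrow> nat \<Rightarrow> 'a \<Rightarrow> 'a list \<Rightarrow> 'a"
    and q :: "nat \<Rightarrow> 'a \<Rightarrow> real" and Dq :: "nat \<Rightarrow> nat \<Rightarrow> 'a \<Rightarrow> 'a list \<Rightarrow> real"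
    and k :: nat and \<delta> \<kappa> \<nu> \<sigma> \<tau> K :: real
  assumes E: "subspace (E n)"
    and g_lin: "bounded_linear (g n)" and g_bound: "\<bar>g n u\<bar> \<le> K * norm u"
    and g_e: "g n (e n) = 1" and g_E: "v \<in> E n \<Longrightarrow> g n v = 0"
    and proj_E: "u - g n u *\<^sub>R e n \<in> E n" and e_bound: "norm (e n) \<le> K"
    and f_lin: "bounded_linear (f n)" and f_bound: "\<bar>f n u\<bar> \<le> K * norm u"
    and f_e: "f n (e n) = 0" and f_s: "f n (s n) = 1" and s_bound: "norm (s n) \<le> K" and f_x: "f n (x n) = 0"
    and w_nonneg: "0 \<le> w n u" and w_triangle: "w n (u + v) \<le> w n u + w n v" and w_scale: "w n (t *\<^sub>R u) = \<bar>t\<bar> * w n u"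
    and w_bound: "w n u \<le> K * norm u" and w_e: "w n (e n) = 0"
    and norm_le: "v \<in> E n \<Longrightarrow> norm v \<le> K * (w n v + \<bar>f n v\<bar>)"
    and w_step: "w (Suc n) (DR n 1 (x n) [u]) \<le> \<kappa> * w n u"
    and f_step: "f (Suc n) (DR n 1 (x n) [u]) = a n * f n u" and a_bounds: "\<nu> \<le> \<bar>a n\<bar>" "\<bar>a n\<bar> \<le> \<sigma>"
    and g_step: "g (Suc n) (DR n 1 (x n) [u]) = b n * g n u" and b_bound: "\<tau> \<le> \<bar>b n\<bar>"
    and rates: "0 < \<kappa>" "\<kappa> < 1" "1 < \<nu>" "\<sigma> ^ k < \<tau>" and K: "1 \<le> K" and k: "1 \<le> k" and \<delta>: "0 < \<delta>"
    and x_Suc: "x (Suc n) = R n (x n)"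
    and R_D0: "f n z = 0 \<Longrightarrow> f (Suc n) (R n z) = 0"
    and R_derivs: "has_cont_derivs_on UNIV (ball (x n) \<delta> \<inter> {z. 0 \<le> f n z}) k (R n) (DR n)"
    and R_bound: "z \<in> ball (x n) \<delta> \<inter> {z. 0 \<le> f n z} \<Longrightarrow> 1 \<le> j \<Longrightarrow> j \<le> k \<Longrightarrow> multi_norm_le UNIV j (DR n j z) K"
    and R_unif: "0 < d \<Longrightarrow> \<exists>r>0. \<forall>n. \<forall>z\<in>ball (x n) \<delta> \<inter> {z. 0 \<le> f n z}. norm (z - x n) < r \<longrightarrow>
        multi_norm_le UNIV 1 (\<lambda>vs. DR n 1 z vs - DR n 1 (x n) vs) d"
    and q_derivs: "has_derivs_on (E n) {y \<in> E n. 0 < f n y \<and> norm y < \<delta>} k (q n) (Dq n)"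
    and q_lip: "y \<in> E n \<Longrightarrow> y' \<in> E n \<Longrightarrow> 0 \<le> f n y \<Longrightarrow> 0 \<le> f n y' \<Longrightarrow> norm y < \<delta> \<Longrightarrow> norm y' < \<delta> \<Longrightarrow>
        \<bar>q n y - q n y'\<bar> \<le> K * norm (y - y')"
    and q_0: "q n 0 = 0"
    and q_bound1: "y \<in> E n \<Longrightarrow> 0 < f n y \<Longrightarrow> norm y < \<delta> \<Longrightarrow> multi_norm_le (E n) 1 (Dq n 1 y) K"
    and q_bound: "0 < t \<Longrightarrow> \<exists>C. \<forall>n. \<forall>j\<in>{1..k}. \<forall>y\<in>E n. t \<le> f n y \<and> norm y < \<delta> \<longrightarrow> multi_norm_le (E n) j (Dq n j y) C"
    and invariant: "y \<in> E n \<Longrightarrow> 0 \<le> f n y \<Longrightarrow> norm y < \<delta> \<Longrightarrow> u = R n (x n + y + q n y *\<^sub>R e n) - x (Suc n) \<Longrightarrow> norm u < \<delta> \<Longrightarrow>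
        0 \<le> f (Suc n) u \<and> (norm (u - g (Suc n) u *\<^sub>R e (Suc n)) < \<delta> \<longrightarrow> q (Suc n) (u - g (Suc n) u *\<^sub>R e (Suc n)) = g (Suc n) u)"
begin

text \<open>Up to a translation, both \<open>pr\<close> and \<open>psi\<close> are the identity plus
  a multiple of \<open>e n\<close> whose coefficient has Lipschitz constant \<open>K\<close>, and
  \<open>norm (e n) \<le> K\<close>; hence a common Lipschitz constant.\<close>

definition P :: real where "P = 1 + K * K"
text \<open>On \<open>E n\<close> this is a norm equivalent to the given one, adapted so that the
  derivative at \<open>x n\<close> expands it by at most \<sigma>.\<close>

definition N :: "nat \<Rightarrow> 'a \<Rightarrow> real" where "N n v = w n v + \<bar>f n v\<bar>"
definition pr :: "nat \<Rightarrow> 'a \<Rightarrow> 'a" where "pr n u = u - g n u *\<^sub>R e n"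
text \<open>The graph point over \<open>y\<close>. Its image, relative to \<open>x (Suc n)\<close>,
  is \<open>dev n y\<close>, and \<open>phi n y\<close> is the base coordinate of this image for the
  next graph.\<close>

definition psi :: "nat \<Rightarrow> 'a \<Rightarrow> 'a" where "psi n y = x n + y + q n y *\<^sub>R e n"
definition dev :: "nat \<Rightarrow> 'a \<Rightarrow> 'a" where "dev n y = R n (psi n y) - x (Suc n)"
definition phi :: "nat \<Rightarrow> 'a \<Rightarrow> 'a" where "phi n y = pr (Suc n) (dev n y)"
definition H :: "nat \<Rightarrow> 'a set" where "H n = ball (x n) \<delta> \<inter> {z. 0 \<le> f n z}"
definition S0 :: "nat \<Rightarrow> 'a set" where "S0 n = {y \<in> E n. 0 < f n y \<and> norm y < \<delta>}"

lemma lin: "linear (g n)" "linear (f n)"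
  using g_lin f_lin by (simp_all add: bounded_linear.linear)

lemmas g_simps = lin(1)[THEN linear_add] lin(1)[THEN linear_diff] lin(1)[THEN linear_cmul] lin(1)[THEN linear_0]
lemmas f_simps = lin(2)[THEN linear_add] lin(2)[THEN linear_diff] lin(2)[THEN linear_cmul] lin(2)[THEN linear_0]

lemma P_ge: "2 \<le> P" "1 \<le> P" "K * K \<le> P"
  using mult_mono[of 1 K 1 K] K by (auto simp: P_def)

lemma bounded_linear_pr: "bounded_linear (pr n)"
  unfolding pr_def by (intro bounded_linear_sub bounded_linear_ident bounded_linear_compose[OF bounded_linear_scaleR_left g_lin])

lemmas pr_simps = bounded_linear_pr[THEN bounded_linear.linear, THEN linear_add]
  bounded_linear_pr[THEN bounded_linear.linear, THEN linear_diff]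
  bounded_linear_pr[THEN bounded_linear.linear, THEN linear_cmul]

lemma pr_E: "pr n u \<in> E n"
  unfolding pr_def by (rule proj_E)

lemma pr_bound: "norm (pr n u) \<le> P * norm u"
proof -
  have "norm (pr n u) \<le> norm u + \<bar>g n u\<bar> * norm (e n)"
    unfolding pr_def using norm_triangle_ineq4[of u "g n u *\<^sub>R e n"] by simp
  also have "\<dots> \<le> norm u + (K * norm u) * K"
    using g_bound e_bound K by (intro add_left_mono mult_mono) auto
  finally show ?thesis by (simp add: P_def algebra_simps)
qed

lemma f_pr: "f n (pr n u) = f n u"
  by (simp add: pr_def f_simps f_e)

lemma w_pr: "w n (pr n u) \<le> w n u"
  using w_triangle[of n u "(- g n u) *\<^sub>R e n"] w_scale[of n "- g n u" "e n"] w_e[of n] by (simp add: pr_def)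

lemma N_nonneg: "0 \<le> N n u"
  using w_nonneg[of n u] by (simp add: N_def)

lemma N_pr: "N n (pr n u) \<le> N n u"
  using w_pr[of n u] by (simp add: N_def f_pr)

lemma N_triangle: "N n (u + v) \<le> N n u + N n v"
  using w_triangle[of n u v] by (simp add: N_def f_simps)

lemma N_bound: "N n u \<le> 2 * K * norm u"
  using w_bound[of n u] f_bound[of n u] by (simp add: N_def)

lemma norm_le_N: "v \<in> E n \<Longrightarrow> norm v \<le> K * N n v"
  using norm_le unfolding N_def .

lemma f_psi: "f n (psi n y) = f n y"
  by (simp add: psi_def f_simps f_x f_e)

lemma H_x: "x n \<in> H n"
  using \<delta> by (simp add: H_def f_x)

lemma S0_iff: "y \<in> S0 n \<longleftrightarrow> y \<in> E n \<and> 0 < f n y \<and> norm y < \<delta>"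
  by (simp add: S0_def)

lemma R_has_derivs: "has_derivs_on UNIV (H n) k (R n) (DR n)"
  using R_derivs[of n] unfolding has_cont_derivs_on_def H_def by blast

lemma DR_tendsto: "z \<in> H n \<Longrightarrow> j \<le> k \<Longrightarrow> multi_tendsto UNIV j (H n) (DR n j) z (DR n j z)"
  using R_derivs[of n] unfolding has_cont_derivs_on_def H_def by blast

lemma DR_bound: "z \<in> H n \<Longrightarrow> 1 \<le> j \<Longrightarrow> j \<le> k \<Longrightarrow> multi_norm_le UNIV j (DR n j z) K"
  using R_bound unfolding H_def by blast

lemma DR1_linear:
  assumes "z \<in> H n"
  shows "DR n 1 z [u + v] = DR n 1 z [u] + DR n 1 z [v]" "DR n 1 z [t *\<^sub>R u] = t *\<^sub>R DR n 1 z [u]"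
    "DR n 1 z [u - v] = DR n 1 z [u] - DR n 1 z [v]"
proof -
  have m: "bounded_multilinear UNIV (Suc 0) (DR n 1 z)" using has_derivs_onD(2)[OF R_has_derivs assms, of 1] k by simp
  show "DR n 1 z [u + v] = DR n 1 z [u] + DR n 1 z [v]"
    using bounded_multilinear_first[OF m, of "[]" u v 1 1] by simp
  show "DR n 1 z [t *\<^sub>R u] = t *\<^sub>R DR n 1 z [u]"
    using bounded_multilinear_first[OF m, of "[]" u 0 t 0] by simp
  show "DR n 1 z [u - v] = DR n 1 z [u] - DR n 1 z [v]"
    using bounded_multilinear_first[OF m, of "[]" u v 1 "-1"] by simp
qed

lemma DR1_bound: "z \<in> H n \<Longrightarrow> norm (DR n 1 z [v]) \<le> K * norm v"
  using multi_norm_leD[OF DR_bound, of z n 1 "[v]"] k by simp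

lemma N_step: "N (Suc n) (DR n 1 (x n) [v]) \<le> \<sigma> * N n v"
proof -
  have "\<kappa> * w n v \<le> \<sigma> * w n v" using rates a_bounds[of n] w_nonneg[of n v] by (intro mult_right_mono) auto
  moreover have "\<bar>a n\<bar> * \<bar>f n v\<bar> \<le> \<sigma> * \<bar>f n v\<bar>" using a_bounds by (intro mult_right_mono) auto
  ultimately show ?thesis using w_step[of n v] by (simp add: N_def f_step abs_mult algebra_simps del: One_nat_def)
qed

text \<open>Invariance of \<eta> read off from coordinates: on the image of \<open>e n\<close> both
  \<open>w\<close> and \<open>f\<close> vanish, and on \<open>E (Suc n)\<close> these two control
  the norm.\<close>

lemma pr_DR_e: "pr (Suc n) (DR n 1 (x n) [e n]) = 0"
proof -
  have "w (Suc n) (DR n 1 (x n) [e n]) = 0" using w_step[of n "e n"] w_nonneg[of "Suc n" "DR n 1 (x n) [e n]"] by (simp add: w_e)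
  then have "w (Suc n) (pr (Suc n) (DR n 1 (x n) [e n])) = 0"
    using w_pr[of "Suc n" "DR n 1 (x n) [e n]"] w_nonneg[of "Suc n" "pr (Suc n) (DR n 1 (x n) [e n])"] by simp
  then show ?thesis using norm_le[OF pr_E, of "Suc n" "DR n 1 (x n) [e n]"] by (simp add: f_pr f_step f_e del: One_nat_def)
qed

end

text \<open>Within distance \<open>2 * P * \<rho>\<close> of the orbit the derivative of
  \<open>R\<close> differs by at most \<epsilon> from its value on the orbit, and \<epsilon> is so
  small that the strict inequalities between the rates survive. One half of
  \<open>2 * P * \<rho>\<close> is for graph points, the other for moving them along
  \<open>s n\<close> to \<open>f = 0\<close>; \<open>(K + 1) * P * P\<close> is the Lipschitz
  constant of \<open>phi\<close>. The size \<open>r\<close> belongs to a box in adapted coordinates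
  that fits into the ball of radius \<rho>.\<close>

locale small_cocycle = graph_cocycle +
  fixes \<epsilon> \<rho> r :: real
  assumes eps: "0 < \<epsilon>" "\<epsilon> \<le> 1" and rho: "0 < \<rho>" "2 * P * \<rho> \<le> \<delta>" "(K + 1) * P * P * \<rho> \<le> \<delta>"
    and near: "z \<in> H n \<Longrightarrow> norm (z - x n) < 2 * P * \<rho> \<Longrightarrow> multi_norm_le UNIV 1 (\<lambda>vs. DR n 1 z vs - DR n 1 (x n) vs) \<epsilon>"
    and r: "0 < r" "2 * K * r < \<rho>"
    and small: "(\<sigma> + 2 * K * K * P * P * \<epsilon>) ^ k < \<tau> - K * K * (1 + P) * \<epsilon>"
      "1 < \<nu> - K * K * \<epsilon>" "\<kappa> + 2 * K * K * P * \<epsilon> < 1"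
begin

text \<open>The perturbed one-step rates: \<open>\<sigma>'\<close> bounds the growth of
  \<open>N\<close> under the projected derivative along the graph, \<open>\<tau>'\<close> bounds the
  coefficient of the unknown derivative from below, and \<open>\<nu>'\<close> the growth of
  \<open>f\<close> under \<open>phi\<close>.\<close>

definition \<sigma>' :: real where "\<sigma>' = \<sigma> + 2 * K * K * P * P * \<epsilon>"
definition \<tau>' :: real where "\<tau>' = \<tau> - K * K * (1 + P) * \<epsilon>"
definition \<nu>' :: real where "\<nu>' = \<nu> - K * K * \<epsilon>"
definition S :: "nat \<Rightarrow> 'a set" where "S n = {y \<in> E n. 0 \<le> f n y \<and> norm y < \<rho>}"

lemma \<sigma>'_ge: "1 < \<sigma>'" "\<sigma> \<le> \<sigma>'" "\<sigma> + K * K * \<epsilon> \<le> \<sigma>'"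
proof -
  have "K * K * \<epsilon> * 1 \<le> K * K * \<epsilon> * (2 * P * P)" using K eps P_ge mult_mono[of 1 P 1 P] by (intro mult_left_mono) auto
  moreover have "0 \<le> K * K * \<epsilon>" using K eps by simp
  ultimately show "\<sigma> \<le> \<sigma>'" "\<sigma> + K * K * \<epsilon> \<le> \<sigma>'" by (auto simp: \<sigma>'_def algebra_simps)
  then show "1 < \<sigma>'" using a_bounds[of 0] rates by linarith
qed

lemma \<tau>'_gt: "m \<le> k \<Longrightarrow> \<sigma>' ^ m < \<tau>'" "0 < \<tau>'"
proof -
  have *: "\<sigma>' ^ k < \<tau>'" using small(1) by (simp add: \<sigma>'_def \<tau>'_def)
  show "0 < \<tau>'" by (rule less_trans[OF _ *]) (use \<sigma>'_ge in simp)
  show "\<sigma>' ^ m < \<tau>'" if "m \<le> k" by (rule le_less_trans[OF power_increasing[OF that] *]) (use \<sigma>'_ge in simp)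
qed

lemma \<nu>'_gt: "1 < \<nu>'"
  using small(2) by (simp add: \<nu>'_def)

lemma rho_le: "\<rho> \<le> \<delta>"
proof -
  have "1 * \<rho> \<le> 2 * P * \<rho>" using P_ge rho by (intro mult_right_mono) auto
  then show ?thesis using rho by linarith
qed

lemma S_D: "y \<in> S n \<Longrightarrow> y \<in> E n" "y \<in> S n \<Longrightarrow> 0 \<le> f n y" "y \<in> S n \<Longrightarrow> norm y < \<rho>" "y \<in> S n \<Longrightarrow> norm y < \<delta>"
  using rho_le by (auto simp: S_def)

section \<open>The projected graph map near the orbit\<close>

lemma psi_lip:
  assumes "y \<in> S n" "y' \<in> S n"
  shows "norm (psi n y - psi n y') \<le> P * norm (y - y')"
proof -
  have "psi n y - psi n y' = (y - y') + (q n y - q n y') *\<^sub>R e n" by (simp add: psi_def algebra_simps)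
  also have "norm \<dots> \<le> norm (y - y') + \<bar>q n y - q n y'\<bar> * norm (e n)" by (metis norm_triangle_ineq norm_scaleR)
  also have "\<dots> \<le> norm (y - y') + (K * norm (y - y')) * K"
    using q_lip[of y n y'] assms[THEN S_D(1)] assms[THEN S_D(2)] assms[THEN S_D(4)] e_bound K
    by (intro add_left_mono mult_mono) auto
  finally show ?thesis by (simp add: P_def algebra_simps)
qed

lemma S_0: "0 \<in> S n"
  using E[THEN subspace_0] rho by (simp add: S_def f_simps)

lemma psi_dev: "y \<in> S n \<Longrightarrow> norm (psi n y - x n) \<le> P * norm y"
  using psi_lip[OF _ S_0, of y n] by (simp add: psi_def q_0)

lemma psi_near:
  assumes "y \<in> S n"
  shows "norm (psi n y - x n) < P * \<rho>" "psi n y \<in> H n" "norm (psi n y - x n) < 2 * P * \<rho>"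
proof -
  have "norm (psi n y - x n) \<le> P * norm y" by (rule psi_dev[OF assms])
  also have "\<dots> < P * \<rho>" using S_D(3)[OF assms] P_ge by (intro mult_strict_left_mono) auto
  finally show 1: "norm (psi n y - x n) < P * \<rho>" .
  have "0 < P * \<rho>" using P_ge rho by simp
  with 1 show 2: "norm (psi n y - x n) < 2 * P * \<rho>" by simp
  show "psi n y \<in> H n"
    using 2 rho S_D(2)[OF assms] by (simp add: H_def f_psi dist_norm norm_minus_commute)
qed

text \<open>The half ball is convex, so the mean value inequality applies with the derivative at
  \<open>x n\<close> as the fixed value.\<close>

lemma R_linearized:
  assumes z: "z \<in> H n" "norm (z - x n) < 2 * P * \<rho>" and z': "z' \<in> H n" "norm (z' - x n) < 2 * P * \<rho>"
  shows "norm (R n z - R n z' - DR n 1 (x n) [z - z']) \<le> \<epsilon> * norm (z - z')"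
proof -
  let ?T = "ball (x n) (2 * P * \<rho>) \<inter> H n"
  have "convex {z. 0 \<le> f n z}"
  proof (rule convexI)
    fix u v and p t :: real assume "u \<in> {z. 0 \<le> f n z}" "v \<in> {z. 0 \<le> f n z}" "0 \<le> p" "0 \<le> t"
    then show "p *\<^sub>R u + t *\<^sub>R v \<in> {z. 0 \<le> f n z}" by (simp add: f_simps)
  qed
  then have "convex ?T" unfolding H_def by (intro convex_Int) auto
  then have seg: "closed_segment z' z \<subseteq> ?T"
    using z z' by (intro closed_segment_subset) (auto simp: dist_norm norm_minus_commute)
  have 1: "norm (DR n 1 u [z - z'] - DR n 1 (x n) [z - z']) \<le> \<epsilon> * norm (z - z')" if "u \<in> closed_segment z' z" for u
  proof -
    have "u \<in> H n" "norm (u - x n) < 2 * P * \<rho>" using that seg by (auto simp: dist_norm norm_minus_commute)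
    from multi_norm_leD[OF near[OF this], of "[z - z']"] show ?thesis by simp
  qed
  have w: "has_weak_derivs_on UNIV (H n) k (R n) (DR n)" by (rule has_derivs_imp_weak[OF R_has_derivs subspace_UNIV])
  have "norm (DR n 0 z [] - DR n 0 z' [] - DR n 1 (x n) [z - z']) \<le> \<epsilon> * norm (z - z')"
    using mean_value_derivs[OF w subspace_UNIV subset_UNIV, of 0 z' z "[]" "DR n 1 (x n) [z - z']" "\<epsilon> * norm (z - z')"] k seg 1 by auto
  then show ?thesis using has_derivs_onD(1)[OF R_has_derivs] z z' by simp
qed

lemma R_lip:
  assumes z: "z \<in> H n" "norm (z - x n) < 2 * P * \<rho>" and z': "z' \<in> H n" "norm (z' - x n) < 2 * P * \<rho>"
  shows "norm (R n z - R n z') \<le> (K + 1) * norm (z - z')"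
proof -
  have "norm (R n z - R n z') \<le> norm (R n z - R n z' - DR n 1 (x n) [z - z']) + norm (DR n 1 (x n) [z - z'])" by norm
  also have "\<dots> \<le> \<epsilon> * norm (z - z') + K * norm (z - z')"
    by (rule add_mono[OF R_linearized[OF assms] DR1_bound[OF H_x]])
  also have "\<dots> \<le> 1 * norm (z - z') + K * norm (z - z')" using eps by (intro add_right_mono mult_right_mono) auto
  finally show ?thesis by (simp add: algebra_simps)
qed

lemma dev_lip:
  assumes "y \<in> S n" "y' \<in> S n"
  shows "norm (dev n y - dev n y') \<le> (K + 1) * P * norm (y - y')"
proof -
  have "norm (R n (psi n y) - R n (psi n y')) \<le> (K + 1) * norm (psi n y - psi n y')"
    by (intro R_lip psi_near assms)
  also have "\<dots> \<le> (K + 1) * (P * norm (y - y'))" using psi_lip[OF assms] K by (intro mult_left_mono) auto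
  finally show ?thesis by (simp add: dev_def mult.assoc)
qed

lemma phi_lip:
  assumes "y \<in> S n" "y' \<in> S n"
  shows "norm (phi n y - phi n y') \<le> (K + 1) * P * P * norm (y - y')"
proof -
  have "norm (phi n y - phi n y') \<le> P * norm (dev n y - dev n y')"
    using pr_bound[of "Suc n" "dev n y - dev n y'"] by (simp add: phi_def pr_simps)
  also have "\<dots> \<le> P * ((K + 1) * P * norm (y - y'))" using dev_lip[OF assms] P_ge by (intro mult_left_mono) auto
  finally show ?thesis by (simp add: mult_ac)
qed

lemma dev_0: "dev n 0 = 0" and phi_0: "phi n 0 = 0"
  by (simp_all add: dev_def phi_def psi_def q_0 x_Suc pr_def g_simps)

lemma dev_small:
  assumes y: "y \<in> S n"
  shows "norm (dev n y) < \<delta>" "norm (phi n y) < \<delta>"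
proof -
  have c: "0 < (K + 1) * P * P" using K P_ge by simp
  have "norm (phi n y) \<le> (K + 1) * P * P * norm y" using phi_lip[OF y S_0] by (simp add: phi_0)
  also have "\<dots> < (K + 1) * P * P * \<rho>" using S_D(3)[OF y] c by (intro mult_strict_left_mono) auto
  finally show "norm (phi n y) < \<delta>" using rho by simp
  have "norm (dev n y) \<le> (K + 1) * P * norm y" using dev_lip[OF y S_0] by (simp add: dev_0)
  also have "\<dots> \<le> (K + 1) * P * P * norm y" using P_ge K mult_left_mono[of 1 P "(K + 1) * P"] by (intro mult_right_mono) auto
  also have "\<dots> < (K + 1) * P * P * \<rho>" using S_D(3)[OF y] c by (intro mult_strict_left_mono) auto
  finally show "norm (dev n y) < \<delta>" using rho by simp
qed

lemma phi_E: "phi n y \<in> E (Suc n)"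
  unfolding phi_def by (rule pr_E)

lemma f_phi: "f (Suc n) (phi n y) = f (Suc n) (dev n y)"
  by (simp add: phi_def f_pr)

lemma invariance:
  assumes y: "y \<in> S n"
  shows "0 \<le> f (Suc n) (phi n y)" "q (Suc n) (phi n y) = g (Suc n) (dev n y)"
  using invariant[OF S_D(1)[OF y] S_D(2)[OF y] S_D(4)[OF y], of "dev n y"] dev_small[OF y]
  by (auto simp: dev_def psi_def phi_def pr_def f_phi f_pr[unfolded pr_def])

text \<open>The graph point is compared not with \<open>x n\<close> but with its translate
  \<open>z0\<close> along \<open>s n\<close>, at which \<open>f\<close> vanishes. By invariance of
  the hyperplane the image of \<open>z0\<close> contributes nothing to \<open>f\<close>, and the
  linearisation error becomes proportional to \<open>f n y\<close> instead of
  \<open>norm y\<close>.\<close>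

lemma f_growth:
  assumes y: "y \<in> S n"
  shows "\<nu>' * f n y \<le> f (Suc n) (phi n y)" "f (Suc n) (phi n y) \<le> (\<sigma> + K * K * \<epsilon>) * f n y"
proof -
  define z where "z = psi n y"
  define z0 where "z0 = z - f n y *\<^sub>R s n"
  note fy = S_D(2)[OF y]
  have z: "z \<in> H n" "norm (z - x n) < 2 * P * \<rho>" unfolding z_def using psi_near[OF y] by auto
  have fz0: "f n z0 = 0" by (simp add: z0_def z_def f_simps f_psi f_s)
  have "norm (f n y *\<^sub>R s n) \<le> (K * norm y) * K"
    using f_bound[of n y] s_bound[of n] K unfolding norm_scaleR real_norm_def by (intro mult_mono) auto
  also have "\<dots> \<le> P * norm y" using P_ge(3) mult_right_mono[of "K * K" P "norm y"] by (simp add: mult_ac)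
  also have "\<dots> < P * \<rho>" using S_D(3)[OF y] P_ge by (intro mult_strict_left_mono) auto
  finally have "norm (z0 - x n) < P * \<rho> + P * \<rho>"
    using psi_near(1)[OF y] norm_triangle_ineq4[of "z - x n" "f n y *\<^sub>R s n"] by (simp add: z0_def z_def algebra_simps)
  then have z0: "norm (z0 - x n) < 2 * P * \<rho>" by (simp add: mult_ac)
  then have z0H: "z0 \<in> H n" using rho fz0 by (simp add: H_def dist_norm norm_minus_commute)
  have zz: "z - z0 = f n y *\<^sub>R s n" by (simp add: z0_def)
  let ?err = "R n z - R n z0 - DR n 1 (x n) [z - z0]"
  have "norm ?err \<le> \<epsilon> * norm (z - z0)" by (rule R_linearized[OF z z0H z0])
  also have "\<dots> \<le> \<epsilon> * (f n y * K)" unfolding zz using s_bound[of n] eps fy by (simp add: mult_left_mono)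
  finally have "\<bar>f (Suc n) ?err\<bar> \<le> K * (\<epsilon> * (f n y * K))" using f_bound[of "Suc n" ?err] K by (meson mult_left_mono order_trans zero_le_one)
  moreover have "f (Suc n) (phi n y) = a n * f n y + f (Suc n) ?err"
  proof -
    have "f (Suc n) (phi n y) = f (Suc n) (R n z)" by (simp add: f_phi dev_def f_simps f_x z_def)
    moreover have "f (Suc n) (DR n 1 (x n) [z - z0]) = a n * f n y" by (simp add: f_step zz f_simps f_s del: One_nat_def)
    ultimately show ?thesis using R_D0[OF fz0] by (simp add: f_simps)
  qed
  \<comment> \<open>No sign of \<open>a n\<close> is given; invariance of the graphs fixes the sign
    of the image, so the bounds on \<open>\<bar>a n\<bar>\<close> suffice.\<close>
  moreover have "0 \<le> f (Suc n) (phi n y)" by (rule invariance[OF y])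
  moreover have "\<nu> * f n y \<le> \<bar>a n * f n y\<bar>" "\<bar>a n * f n y\<bar> \<le> \<sigma> * f n y"
    using a_bounds[of n] fy by (auto simp: abs_mult intro: mult_right_mono)
  ultimately show "\<nu>' * f n y \<le> f (Suc n) (phi n y)" "f (Suc n) (phi n y) \<le> (\<sigma> + K * K * \<epsilon>) * f n y"
    by (auto simp: \<nu>'_def algebra_simps abs_if split: if_splits)
qed

text \<open>Here the error is proportional to the full norm of \<open>y\<close>, so \<open>w\<close>
  contracts only relative to a common bound for \<open>w\<close> and \<open>f\<close>.\<close>

lemma w_phi:
  assumes y: "y \<in> S n"
  shows "w (Suc n) (phi n y) \<le> \<kappa> * w n y + K * \<epsilon> * P * norm y"
proof -
  let ?h = "psi n y - x n"
  let ?err = "R n (psi n y) - R n (x n) - DR n 1 (x n) [?h]"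
  have "norm ?err \<le> \<epsilon> * norm ?h"
    by (rule R_linearized) (use psi_near[OF y] H_x P_ge rho in auto)
  also have "\<dots> \<le> \<epsilon> * (P * norm y)" using psi_dev[OF y] eps by (intro mult_left_mono) auto
  finally have err: "w (Suc n) ?err \<le> K * (\<epsilon> * (P * norm y))"
    using w_bound[of "Suc n" ?err] K by (meson mult_left_mono order_trans zero_le_one)
  have "w n ?h \<le> w n y"
    using w_triangle[of n y "q n y *\<^sub>R e n"] by (simp add: psi_def w_scale w_e)
  then have "\<kappa> * w n ?h \<le> \<kappa> * w n y" using rates by (intro mult_left_mono) auto
  then have A: "w (Suc n) (DR n 1 (x n) [?h]) \<le> \<kappa> * w n y" using w_step[of n ?h] by linarith
  have "w (Suc n) (phi n y) \<le> w (Suc n) (dev n y)" unfolding phi_def by (rule w_pr)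
  also have "dev n y = DR n 1 (x n) [?h] + ?err" by (simp add: dev_def x_Suc)
  also have "w (Suc n) \<dots> \<le> w (Suc n) (DR n 1 (x n) [?h]) + w (Suc n) ?err" by (rule w_triangle)
  finally show ?thesis using A err by (simp add: mult_ac)
qed

text \<open>A box in adapted coordinates, which \<open>phi\<close> can leave only through growth of
  \<open>f\<close>. The strict inequality in \<open>edge\<close> ensures that all nearby interior
  points belong to the box.\<close>

definition slab :: "nat \<Rightarrow> 'a set" where "slab n = {y \<in> E n. w n y \<le> r \<and> 0 < f n y \<and> f n y \<le> r}"
definition edge :: "nat \<Rightarrow> 'a set" where "edge n = {y \<in> E n. w n y < r \<and> f n y = 0}"

lemma slab_S: "y \<in> slab n \<Longrightarrow> y \<in> S n"
proof -
  assume y: "y \<in> slab n"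
  then have "norm y \<le> K * (w n y + \<bar>f n y\<bar>)" using norm_le[of y n] by (simp add: slab_def)
  also have "\<dots> \<le> K * (r + r)" using y K by (intro mult_left_mono) (auto simp: slab_def)
  also have "\<dots> < \<rho>" using r by simp
  finally show ?thesis using y by (simp add: S_def slab_def)
qed

lemma slab_S0: "y \<in> slab n \<Longrightarrow> y \<in> S0 n"
  using slab_S[of y n] S_D(4)[of y n] by (simp add: slab_def S0_iff)

lemma edge_S: "y \<in> edge n \<Longrightarrow> y \<in> S n"
proof -
  assume y: "y \<in> edge n"
  then have "norm y \<le> K * (w n y + \<bar>f n y\<bar>)" using norm_le[of y n] by (simp add: edge_def)
  also have "\<dots> \<le> K * (r + r)" using y K r by (intro mult_left_mono) (auto simp: edge_def)
  also have "\<dots> < \<rho>" using r by simp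
  finally show ?thesis using y by (simp add: S_def edge_def)
qed

lemma w_phi_le:
  assumes y: "y \<in> S n" "w n y \<le> t" "f n y \<le> t"
  shows "w (Suc n) (phi n y) \<le> (\<kappa> + 2 * K * K * P * \<epsilon>) * t"
proof -
  have "norm y \<le> K * (w n y + \<bar>f n y\<bar>)" by (rule norm_le[OF S_D(1)[OF y(1)]])
  also have "\<dots> \<le> K * (t + t)" using y S_D(2)[OF y(1)] K by (intro mult_left_mono) auto
  finally have "K * \<epsilon> * P * norm y \<le> K * \<epsilon> * P * (K * (t + t))" using K eps P_ge by (intro mult_left_mono) auto
  moreover have "\<kappa> * w n y \<le> \<kappa> * t" using y rates by (intro mult_left_mono) auto
  ultimately show ?thesis using w_phi[OF y(1)] by (simp add: algebra_simps)
qed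

lemma phi_slab:
  assumes y: "y \<in> slab n" and "f (Suc n) (phi n y) \<le> r"
  shows "phi n y \<in> slab (Suc n)"
proof -
  have y': "0 < f n y" "y \<in> S n" using y slab_S by (auto simp: slab_def)
  have "w (Suc n) (phi n y) \<le> (\<kappa> + 2 * K * K * P * \<epsilon>) * r"
    using y by (intro w_phi_le y') (auto simp: slab_def)
  also have "\<dots> \<le> 1 * r" using small(3) r by (intro mult_right_mono) auto
  finally have "w (Suc n) (phi n y) \<le> r" by simp
  moreover have "0 < \<nu>' * f n y" using \<nu>'_gt y' by simp
  ultimately show ?thesis using assms(2) f_growth(1)[OF y'(2)] phi_E by (auto simp: slab_def)
qed

lemma phi_edge:
  assumes y: "y \<in> edge n"
  shows "phi n y \<in> edge (Suc n)"
proof -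
  have y': "y \<in> S n" "f n y = 0" "w n y < r" "0 \<le> w n y" using y edge_S w_nonneg by (auto simp: edge_def)
  \<comment> \<open>Since \<open>f\<close> vanishes at \<open>y\<close>, \<open>w n y\<close> itself
    can serve as the common bound \<open>t\<close>, which preserves the strict inequality.\<close>
  have "w (Suc n) (phi n y) \<le> (\<kappa> + 2 * K * K * P * \<epsilon>) * w n y"
    using y' by (intro w_phi_le) auto
  also have "\<dots> \<le> 1 * w n y" using small(3) y' by (intro mult_right_mono) auto
  finally show ?thesis using y' f_growth[OF y'(1)] phi_E by (auto simp: edge_def)
qed

text \<open>For \<open>c = Dq n 1 y [v]\<close> and \<open>z = psi n y\<close> this is the
  derivative of \<open>R\<close> along the tangent vector of the graph over \<open>v\<close>. The
  slope \<open>c\<close> is left free so that the slope at one point can be inserted at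
  another.\<close>

definition T :: "nat \<Rightarrow> 'a \<Rightarrow> real \<Rightarrow> 'a \<Rightarrow> 'a" where
  "T n z c v = DR n 1 z [v + c *\<^sub>R e n]"

text \<open>At \<open>x n\<close> a multiple of \<open>e n\<close> is mapped into \<eta> and killed
  by the projection, so the slope \<open>c\<close> enters only through the error of size
  \<epsilon>.\<close>

lemma N_transfer:
  assumes z: "z \<in> H n" "norm (z - x n) < 2 * P * \<rho>" and v: "v \<in> E n" and c: "\<bar>c\<bar> \<le> K * norm v"
  shows "N (Suc n) (pr (Suc n) (T n z c v)) \<le> \<sigma>' * N n v"
proof -
  let ?h = "v + c *\<^sub>R e n"
  let ?err = "DR n 1 z [?h] - DR n 1 (x n) [?h]"
  have h: "norm ?h \<le> P * norm v"
  proof -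
    have "norm ?h \<le> norm v + \<bar>c\<bar> * norm (e n)" by (metis norm_triangle_ineq norm_scaleR)
    also have "\<dots> \<le> norm v + (K * norm v) * K" using c e_bound K by (intro add_left_mono mult_mono) auto
    finally show ?thesis by (simp add: P_def algebra_simps)
  qed
  have "norm ?err \<le> \<epsilon> * norm ?h" using multi_norm_leD[OF near[OF z], of "[?h]"] by simp
  also have "\<dots> \<le> \<epsilon> * (P * norm v)" using h eps by (intro mult_left_mono) auto
  also have "\<dots> \<le> \<epsilon> * (P * (K * N n v))" using norm_le_N[OF v] eps P_ge by (intro mult_left_mono) auto
  finally have err: "norm ?err \<le> \<epsilon> * (P * (K * N n v))" .
  have "N (Suc n) (pr (Suc n) ?err) \<le> N (Suc n) ?err" by (rule N_pr)
  also have "\<dots> \<le> 2 * K * norm ?err" by (rule N_bound)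
  also have "\<dots> \<le> 2 * K * (\<epsilon> * (P * (K * N n v)))" using err K by (intro mult_left_mono) auto
  also have "\<dots> = (2 * K * K * \<epsilon> * N n v * P) * 1" by (simp add: mult_ac)
  also have "\<dots> \<le> (2 * K * K * \<epsilon> * N n v * P) * P"
    using K eps P_ge N_nonneg[of n v] by (intro mult_left_mono) auto
  finally have E': "N (Suc n) (pr (Suc n) ?err) \<le> 2 * K * K * P * P * \<epsilon> * N n v" by (simp add: mult_ac)
  have "pr (Suc n) (T n z c v) = pr (Suc n) (DR n 1 (x n) [v]) + pr (Suc n) ?err"
  proof -
    have "DR n 1 (x n) [?h] = DR n 1 (x n) [v] + c *\<^sub>R DR n 1 (x n) [e n]"
      using DR1_linear[OF H_x] by simp
    then have "pr (Suc n) (DR n 1 (x n) [?h]) = pr (Suc n) (DR n 1 (x n) [v])"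
      by (simp add: pr_simps pr_DR_e del: One_nat_def)
    then show ?thesis by (simp add: T_def pr_simps)
  qed
  then have "N (Suc n) (pr (Suc n) (T n z c v)) \<le> N (Suc n) (DR n 1 (x n) [v]) + N (Suc n) (pr (Suc n) ?err)"
    using N_triangle[of "Suc n" "pr (Suc n) (DR n 1 (x n) [v])" "pr (Suc n) ?err"] N_pr[of "Suc n" "DR n 1 (x n) [v]"] by simp
  also have "\<dots> \<le> \<sigma> * N n v + 2 * K * K * P * P * \<epsilon> * N n v" using N_step E' by (rule add_mono)
  finally show ?thesis by (simp add: \<sigma>'_def algebra_simps)
qed

text \<open>On the orbit the image of \<open>e n\<close> has \<open>g\<close>-coordinate
  \<open>b n\<close> and no component in \<open>E (Suc n)\<close>. Near it, \<open>g\<close>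
  contributes an error of \<open>K * K * \<epsilon>\<close> and the slope functional
  \<open>G\<close> one of \<open>K * K * P * \<epsilon>\<close>.\<close>

lemma coefficient_bound:
  assumes z: "z \<in> H n" "norm (z - x n) < 2 * P * \<rho>" and G: "\<And>v. v \<in> E (Suc n) \<Longrightarrow> \<bar>G v\<bar> \<le> K * norm v"
  shows "\<tau>' \<le> \<bar>g (Suc n) (DR n 1 z [e n]) - G (pr (Suc n) (DR n 1 z [e n]))\<bar>"
proof -
  let ?err = "DR n 1 z [e n] - DR n 1 (x n) [e n]"
  have "norm ?err \<le> \<epsilon> * norm (e n)" using multi_norm_leD[OF near[OF z], of "[e n]"] by simp
  also have "\<dots> \<le> \<epsilon> * K" using e_bound eps by (intro mult_left_mono) auto
  finally have err: "norm ?err \<le> \<epsilon> * K" .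
  have "pr (Suc n) (DR n 1 z [e n]) = pr (Suc n) ?err" by (simp add: pr_simps pr_DR_e del: One_nat_def)
  then have "\<bar>G (pr (Suc n) (DR n 1 z [e n]))\<bar> \<le> K * norm (pr (Suc n) ?err)" using G[OF pr_E, of "DR n 1 z [e n]"] by simp
  also have "\<dots> \<le> K * (P * norm ?err)" using pr_bound K by (intro mult_left_mono) auto
  also have "\<dots> \<le> K * (P * (\<epsilon> * K))" using err K P_ge by (intro mult_left_mono) auto
  finally have 1: "\<bar>G (pr (Suc n) (DR n 1 z [e n]))\<bar> \<le> K * (P * (\<epsilon> * K))" .
  have "\<bar>g (Suc n) ?err\<bar> \<le> K * norm ?err" by (rule g_bound)
  also have "\<dots> \<le> K * (\<epsilon> * K)" using err K by (intro mult_left_mono) auto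
  finally have 2: "\<bar>g (Suc n) ?err\<bar> \<le> K * (\<epsilon> * K)" .
  have "g (Suc n) (DR n 1 z [e n]) = b n + g (Suc n) ?err" by (simp add: g_simps g_step g_e del: One_nat_def)
  then show ?thesis using 1 2 b_bound[of n] by (simp add: \<tau>'_def algebra_simps)
qed

end

section \<open>The differentiated functional equation\<close>

lemma prod_list_map_le:
  fixes h1 :: "'b \<Rightarrow> real" and h2 :: "'a \<Rightarrow> real"
  assumes "\<And>v. v \<in> set vs \<Longrightarrow> 0 \<le> h1 (t v) \<and> h1 (t v) \<le> c * h2 v"
  shows "0 \<le> prod_list (map h1 (map t vs)) \<and> prod_list (map h1 (map t vs)) \<le> c ^ length vs * prod_list (map h2 vs)"
  using assms
proof (induction vs)
  case (Cons v vs)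
  have IH: "0 \<le> prod_list (map h1 (map t vs))" "prod_list (map h1 (map t vs)) \<le> c ^ length vs * prod_list (map h2 vs)"
    using Cons by auto
  have v: "0 \<le> h1 (t v)" "h1 (t v) \<le> c * h2 v" using Cons.prems[of v] by auto
  have "h1 (t v) * prod_list (map h1 (map t vs)) \<le> (c * h2 v) * (c ^ length vs * prod_list (map h2 vs))"
    using IH v by (intro mult_mono) auto
  then show ?case using IH v by (simp add: mult_ac)
qed simp

context small_cocycle
begin

definition V :: "nat \<Rightarrow> 'a set" where "V n = {y \<in> E n. 0 < f n y \<and> norm y < \<rho>}"
definition Psi :: "nat \<Rightarrow> nat \<Rightarrow> 'a \<Rightarrow> 'a list \<Rightarrow> 'a" where
  "Psi n j y vs = affine_derivs (\<lambda>v. v) (x n) j y vs + Dq n j y vs *\<^sub>R e n"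
text \<open>The derivatives of z |-> \<open>g n (z - x n) - q n (pr n (z - x n))\<close>, a defining
  function of the graph on the ambient space.\<close>

definition DW :: "nat \<Rightarrow> nat \<Rightarrow> 'a \<Rightarrow> 'a list \<Rightarrow> real" where
  "DW n j z vs = affine_derivs (g n) (- g n (x n)) j z vs + - Dq n j (pr n (z - x n)) (map (pr n) vs)"
definition im :: "nat \<Rightarrow> 'a \<Rightarrow> 'a" where "im n y = R n (psi n y)"
definition Theta :: "nat \<Rightarrow> nat \<Rightarrow> 'a \<Rightarrow> 'a list \<Rightarrow> 'a" where
  "Theta n = comp_derivs (DR n) (psi n) (Psi n)"

lemma V_S: "y \<in> V n \<Longrightarrow> y \<in> S n" and V_S0: "y \<in> V n \<Longrightarrow> y \<in> S0 n"
  using rho_le by (auto simp: V_def S_def S0_iff)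

lemma slab_V: "y \<in> slab n \<Longrightarrow> y \<in> V n"
  using slab_S[of y n] by (auto simp: V_def S_def slab_def)

lemma phi_S0: "y \<in> V n \<Longrightarrow> phi n y \<in> S0 (Suc n)"
proof -
  assume y: "y \<in> V n"
  have "0 < \<nu>' * f n y" using \<nu>'_gt y by (simp add: V_def)
  then show ?thesis using f_growth(1)[OF V_S[OF y]] phi_E dev_small[OF V_S[OF y]] by (simp add: S0_iff)
qed

lemma phi_im: "phi n y = pr (Suc n) (im n y - x (Suc n))"
  by (simp add: phi_def dev_def im_def)

lemma psi_derivs: "has_derivs_on (E n) (V n) k (psi n) (Psi n)"
proof -
  have "has_derivs_on (E n) (V n) k (q n) (Dq n)"
    by (rule has_derivs_on_subset[OF q_derivs]) (use rho_le in \<open>auto simp: V_def\<close>)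
  from has_derivs_add[OF has_derivs_affine[OF bounded_linear_ident] has_derivs_linear[OF bounded_linear_scaleR_left this]]
  show ?thesis unfolding psi_def[abs_def] Psi_def[abs_def] .
qed

lemma W_derivs: "has_derivs_on UNIV {z. pr n (z - x n) \<in> S0 n} k (\<lambda>z. (- g n (x n) + g n z) + - q n (pr n (z - x n))) (DW n)"
proof -
  have q: "has_derivs_on (E n) (S0 n) k (q n) (Dq n)" using q_derivs[of n] by (simp add: S0_def)
  have "range (pr n) \<subseteq> E n" using pr_E by auto
  from has_derivs_linear[OF bounded_linear_minus[OF bounded_linear_ident] has_derivs_precompose[OF q bounded_linear_pr this, of "x n"]]
  show ?thesis unfolding DW_def[abs_def] by (rule has_derivs_add[OF has_derivs_affine[OF g_lin]])
qed

lemma im_W: "im n ` V n \<subseteq> {z. pr (Suc n) (z - x (Suc n)) \<in> S0 (Suc n)}"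
  using phi_S0 by (auto simp: phi_im)

lemma V_open:
  assumes "y \<in> V n" "h \<in> E n"
  shows "\<exists>d>0. \<forall>t. 0 < t \<and> t < d \<longrightarrow> y + t *\<^sub>R h \<in> V n"
proof -
  have "((\<lambda>t. norm (y + t *\<^sub>R h)) \<longlongrightarrow> norm (y + 0 *\<^sub>R h)) (at_right 0)" by (intro tendsto_intros)
  then have 1: "\<forall>\<^sub>F t in at_right 0. norm (y + t *\<^sub>R h) < \<rho>" using assms by (intro order_tendstoD(2)[of _ _ _ \<rho>]) (auto simp: V_def)
  have "((\<lambda>t. f n y + t * f n h) \<longlongrightarrow> f n y + 0 * f n h) (at_right 0)" by (intro tendsto_intros)
  then have 2: "\<forall>\<^sub>F t in at_right 0. 0 < f n y + t * f n h" using assms by (intro order_tendstoD(1)[of _ _ _ 0]) (auto simp: V_def)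
  from 1 2 have "\<forall>\<^sub>F t in at_right 0. y + t *\<^sub>R h \<in> V n"
    by eventually_elim (use assms E[of n] in \<open>auto simp: V_def f_simps subspace_add subspace_scale\<close>)
  then show ?thesis unfolding eventually_at_right_field by blast
qed

lemma im_derivs: "has_weak_derivs_on (E n) (V n) k (im n) (Theta n)"
  unfolding im_def[abs_def] Theta_def
proof (rule has_weak_derivs_compose[OF R_has_derivs has_derivs_imp_weak[OF psi_derivs E] _ E])
  show "psi n ` V n \<subseteq> H n" using psi_near(2) V_S by auto
  show "V n \<subseteq> E n" by (auto simp: V_def)
qed

text \<open>Invariance of the graphs says that the defining function of the next graph is zero along
  \<open>im n\<close>. Differentiating this implicit equation avoids inverting
  \<open>phi\<close>.\<close>

lemma derivs_vanish:
  assumes "m \<le> k" "y \<in> V n" "length vs = m" "set vs \<subseteq> E n"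
  shows "comp_derivs (DW (Suc n)) (im n) (Theta n) m y vs = 0"
proof (rule zero_derivs[OF _ _ E _ V_open assms])
  show V: "V n \<subseteq> E n" by (auto simp: V_def)
  show "has_weak_derivs_on (E n) (V n) k (\<lambda>y. (- g (Suc n) (x (Suc n)) + g (Suc n) (im n y)) + - q (Suc n) (pr (Suc n) (im n y - x (Suc n))))
      (comp_derivs (DW (Suc n)) (im n) (Theta n))"
    by (rule has_weak_derivs_compose[OF W_derivs im_derivs im_W E V])
  fix y assume "y \<in> V n"
  then show "(- g (Suc n) (x (Suc n)) + g (Suc n) (im n y)) + - q (Suc n) (pr (Suc n) (im n y - x (Suc n))) = 0"
    using invariance(2)[OF V_S, of y n] phi_im[of n y] by (simp add: dev_def im_def g_simps)
qed

lemma Psi_1: "Psi n 1 y [v] = v + Dq n 1 y [v] *\<^sub>R e n"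
  by (simp add: Psi_def affine_derivs_def)

lemma Psi_ge2: "2 \<le> m \<Longrightarrow> Psi n m y vs = Dq n m y vs *\<^sub>R e n"
  by (simp add: Psi_def affine_derivs_def)

lemma DW_1: "DW n 1 z [u] = g n u - Dq n 1 (pr n (z - x n)) [pr n u]"
  by (simp add: DW_def affine_derivs_def)

lemma DW_ge2: "2 \<le> m \<Longrightarrow> DW n m z us = - Dq n m (pr n (z - x n)) (map (pr n) us)"
  by (simp add: DW_def affine_derivs_def)

lemma Theta_1: "Theta n 1 y [v] = T n (psi n y) (Dq n 1 y [v]) v"
  unfolding Theta_def comp_derivs_1 Psi_1 T_def ..

text \<open>The derivative of \<open>q n\<close> of top order enters the differentiated equation
  only as a multiple of \<open>e n\<close>, which is mapped first by the derivative of
  \<open>R\<close> and then by that of the defining function; this is the resulting factor.\<close>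

definition coef :: "nat \<Rightarrow> 'a \<Rightarrow> real" where
  "coef n y = DW (Suc n) 1 (im n y) [DR n 1 (psi n y) [e n]]"

definition inner_part :: "nat \<Rightarrow> nat \<Rightarrow> 'a \<Rightarrow> 'a list \<Rightarrow> 'a" where
  "inner_part n m y vs = DR n m (psi n y) (map (\<lambda>v. Psi n 1 y [v]) vs) + lower_derivs (DR n) (psi n) (Psi n) m y vs"

text \<open>For \<open>m \<ge> 2\<close> this involves derivatives of \<open>q n\<close> at
  \<open>y\<close> and of \<open>q (Suc n)\<close> at \<open>phi n y\<close> only in orders below
  \<open>m\<close>.\<close>

definition Rest :: "nat \<Rightarrow> nat \<Rightarrow> 'a \<Rightarrow> 'a list \<Rightarrow> real" where
  "Rest n m y vs = DW (Suc n) 1 (im n y) [inner_part n m y vs] + lower_derivs (DW (Suc n)) (im n) (Theta n) m y vs"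

lemma DW_lin:
  assumes "y \<in> V n" "j \<le> k"
  shows "bounded_multilinear UNIV j (DW (Suc n) j (im n y))"
  by (rule has_derivs_onD(2)[OF W_derivs _ assms(2)]) (use im_W assms(1) in auto)

lemma DW1_linear:
  assumes "y \<in> V n"
  shows "DW (Suc n) 1 (im n y) [u + v] = DW (Suc n) 1 (im n y) [u] + DW (Suc n) 1 (im n y) [v]"
    "DW (Suc n) 1 (im n y) [t *\<^sub>R u] = t * DW (Suc n) 1 (im n y) [u]"
proof -
  have m: "bounded_multilinear UNIV (Suc 0) (DW (Suc n) 1 (im n y))" using DW_lin[OF assms, of 1] k by simp
  show "DW (Suc n) 1 (im n y) [u + v] = DW (Suc n) 1 (im n y) [u] + DW (Suc n) 1 (im n y) [v]"
    using bounded_multilinear_first[OF m, of "[]" u v 1 1] by simp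
  show "DW (Suc n) 1 (im n y) [t *\<^sub>R u] = t * DW (Suc n) 1 (im n y) [u]"
    using bounded_multilinear_first[OF m, of "[]" u 0 t 0] by simp
qed

lemma Dq1_bound: "y \<in> S0 n \<Longrightarrow> v \<in> E n \<Longrightarrow> \<bar>Dq n 1 y [v]\<bar> \<le> K * norm v"
  using multi_norm_leD[OF q_bound1, of y n "[v]"] by (simp add: S0_iff)

lemma DW1_bound:
  assumes "y \<in> V n"
  shows "\<bar>DW (Suc n) 1 (im n y) [u]\<bar> \<le> (K + K * P) * norm u"
proof -
  have "\<bar>DW (Suc n) 1 (im n y) [u]\<bar> \<le> \<bar>g (Suc n) u\<bar> + \<bar>Dq (Suc n) 1 (phi n y) [pr (Suc n) u]\<bar>"
    unfolding DW_1 phi_im[symmetric] by simp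
  also have "\<dots> \<le> K * norm u + K * (P * norm u)"
  proof (rule add_mono[OF g_bound])
    have "\<bar>Dq (Suc n) 1 (phi n y) [pr (Suc n) u]\<bar> \<le> K * norm (pr (Suc n) u)" by (rule Dq1_bound[OF phi_S0[OF assms] pr_E])
    also have "\<dots> \<le> K * (P * norm u)" using pr_bound K by (intro mult_left_mono) auto
    finally show "\<bar>Dq (Suc n) 1 (phi n y) [pr (Suc n) u]\<bar> \<le> K * (P * norm u)" .
  qed
  finally show ?thesis by (simp add: algebra_simps)
qed

lemma coef_bound: "y \<in> V n \<Longrightarrow> \<tau>' \<le> \<bar>coef n y\<bar>"
  unfolding coef_def DW_1 phi_im[symmetric]
  by (rule coefficient_bound[where G = "\<lambda>v. Dq (Suc n) 1 (phi n y) [v]"])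
    (auto intro: psi_near V_S Dq1_bound phi_S0 simp del: One_nat_def)

lemma equation_1:
  assumes "y \<in> V n" "v \<in> E n"
  shows "DW (Suc n) 1 (im n y) [T n (psi n y) (Dq n 1 y [v]) v] = 0"
  using derivs_vanish[of 1 y n "[v]"] k assms unfolding comp_derivs_1 Theta_1 by simp

text \<open>The chain rule is split twice, for the composition with the defining function and for
  \<open>R\<close> composed with \<open>psi\<close>. The second split exhibits the unknown at
  \<open>y\<close>; the \<open>m\<close>-th derivative at \<open>phi n y\<close> sits inside
  \<open>DW (Suc n) m\<close>.\<close>

lemma equation_ge2:
  assumes m: "2 \<le> m" "m \<le> k" and y: "y \<in> V n" and vs: "length vs = m" "set vs \<subseteq> E n"
  shows "coef n y * Dq n m y vs = - DW (Suc n) m (im n y) (map (\<lambda>v. Theta n 1 y [v]) vs) - Rest n m y vs"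
proof -
  have "Theta n m y vs = DR n 1 (psi n y) [Dq n m y vs *\<^sub>R e n] + inner_part n m y vs"
    unfolding Theta_def comp_derivs_split[OF m(1) vs(1)] inner_part_def Psi_ge2[OF m(1)] by (simp add: add.assoc)
  also have "DR n 1 (psi n y) [Dq n m y vs *\<^sub>R e n] = Dq n m y vs *\<^sub>R DR n 1 (psi n y) [e n]"
    by (rule DR1_linear(2)[OF psi_near(2)[OF V_S[OF y]]])
  finally have "DW (Suc n) 1 (im n y) [Theta n m y vs] = Dq n m y vs * coef n y + DW (Suc n) 1 (im n y) [inner_part n m y vs]"
    by (simp only: DW1_linear[OF y] coef_def)
  then show ?thesis
    using derivs_vanish[OF m(2) y vs] unfolding comp_derivs_split[OF m(1) vs(1)] Rest_def by (simp add: algebra_simps)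
qed

text \<open>The operator bound with respect to \<open>N\<close>. In it each argument transferred by
  one step costs at most one factor \<open>\<sigma>'\<close>; in the original norm further constants
  would accumulate along the orbit.\<close>

definition N_le :: "nat \<Rightarrow> nat \<Rightarrow> ('a list \<Rightarrow> real) \<Rightarrow> real \<Rightarrow> bool" where
  "N_le n j G C \<longleftrightarrow> (\<forall>vs. length vs = j \<and> set vs \<subseteq> E n \<longrightarrow> \<bar>G vs\<bar> \<le> C * prod_list (map (N n) vs))"

lemma N_leD: "N_le n j G C \<Longrightarrow> length vs = j \<Longrightarrow> set vs \<subseteq> E n \<Longrightarrow> \<bar>G vs\<bar> \<le> C * prod_list (map (N n) vs)"
  by (simp add: N_le_def)

lemma prod_N_nonneg: "0 \<le> prod_list (map (N n) vs)"
  by (induction vs) (auto simp: N_nonneg)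

lemma norms_le_N: "set vs \<subseteq> E n \<Longrightarrow> prod_list (map norm vs) \<le> K ^ length vs * prod_list (map (N n) vs)"
  using prod_list_map_le[of vs norm "\<lambda>v. v" K "N n"] norm_le_N by (simp add: subset_iff)

lemma N_le_norms: "prod_list (map (N n) vs) \<le> (2 * K) ^ length vs * prod_list (map norm vs)"
  using prod_list_map_le[of vs "N n" "\<lambda>v. v" "2 * K" norm] N_bound N_nonneg by simp

lemma N_le_if_multi_norm_le:
  assumes "multi_norm_le (E n) j G C" "0 \<le> C"
  shows "N_le n j G (C * K ^ j)"
  unfolding N_le_def
proof (intro allI impI, elim conjE)
  fix vs assume vs: "length vs = j" "set vs \<subseteq> E n"
  have "\<bar>G vs\<bar> \<le> C * prod_list (map norm vs)" using multi_norm_leD[OF assms(1) vs] by simp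
  also have "\<dots> \<le> C * (K ^ j * prod_list (map (N n) vs))" using norms_le_N[OF vs(2)] vs assms(2) by (intro mult_left_mono) auto
  finally show "\<bar>G vs\<bar> \<le> C * K ^ j * prod_list (map (N n) vs)" by simp
qed

lemma multi_norm_le_if_N_le:
  assumes "N_le n j G C" "0 \<le> C"
  shows "multi_norm_le (E n) j G (C * (2 * K) ^ j)"
  unfolding multi_norm_le_def
proof (intro allI impI, elim conjE)
  fix vs assume vs: "length vs = j" "set vs \<subseteq> E n"
  have "\<bar>G vs\<bar> \<le> C * prod_list (map (N n) vs)" by (rule N_leD[OF assms(1) vs])
  also have "\<dots> \<le> C * ((2 * K) ^ j * prod_list (map norm vs))" using N_le_norms[of n vs] vs assms(2) by (intro mult_left_mono) auto
  finally show "norm (G vs) \<le> C * (2 * K) ^ j * prod_list (map norm vs)" by simp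
qed

lemma N_le_pull:
  assumes "N_le (Suc n) m G C" "0 \<le> C" and y: "y \<in> V n" and vs: "length vs = m" "set vs \<subseteq> E n"
  shows "\<bar>G (map (\<lambda>v. pr (Suc n) (Theta n 1 y [v])) vs)\<bar> \<le> C * \<sigma>' ^ m * prod_list (map (N n) vs)"
proof -
  let ?us = "map (\<lambda>v. pr (Suc n) (Theta n 1 y [v])) vs"
  have "\<bar>G ?us\<bar> \<le> C * prod_list (map (N (Suc n)) ?us)"
    by (rule N_leD[OF assms(1)]) (use vs pr_E in auto)
  also have "\<dots> \<le> C * (\<sigma>' ^ length vs * prod_list (map (N n) vs))"
  proof (rule mult_left_mono[OF _ assms(2)], rule prod_list_map_le[THEN conjunct2], intro conjI N_nonneg)
    fix v assume "v \<in> set vs"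
    then have v: "v \<in> E n" using vs by auto
    show "N (Suc n) (pr (Suc n) (Theta n 1 y [v])) \<le> \<sigma>' * N n v"
      unfolding Theta_1 by (intro N_transfer psi_near V_S y v Dq1_bound V_S0)
  qed
  finally show ?thesis using vs by simp
qed

lemma Psi_bound:
  assumes "\<And>i. 1 \<le> i \<Longrightarrow> i < m \<Longrightarrow> multi_norm_le (E n) i (Dq n i y) C" "1 \<le> C" "1 \<le> i" "i < m"
  shows "multi_norm_le (E n) i (Psi n i y) (1 + C * K)"
  unfolding multi_norm_le_def
proof (intro allI impI, elim conjE)
  fix vs assume vs: "length vs = i" "set vs \<subseteq> E n"
  let ?p = "prod_list (map norm vs)"
  have "\<bar>Dq n i y vs\<bar> * norm (e n) \<le> (C * ?p) * K"
    using multi_norm_leD[OF assms(1)[OF assms(3,4)] vs] e_bound[of n] K assms(2) prod_list_norm_nonneg[of vs] by (intro mult_mono) auto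
  moreover have "norm (affine_derivs (\<lambda>v. v) (x n) i y vs) \<le> ?p"
  proof (cases "i = 1")
    case True
    then obtain v where "vs = [v]" using vs by (cases vs) auto
    then show ?thesis using True by (simp add: affine_derivs_def)
  next
    case False
    then show ?thesis using assms(3) prod_list_norm_nonneg[of vs] by (simp add: affine_derivs_def)
  qed
  ultimately show "norm (Psi n i y vs) \<le> (1 + C * K) * ?p"
    unfolding Psi_def using norm_triangle_ineq[of "affine_derivs (\<lambda>v. v) (x n) i y vs" "Dq n i y vs *\<^sub>R e n"]
    by (simp add: algebra_simps)
qed

lemma DW_bound:
  assumes "\<And>i. 1 \<le> i \<Longrightarrow> i < m \<Longrightarrow> multi_norm_le (E (Suc n)) i (Dq (Suc n) i (phi n y)) C" "1 \<le> C" "1 \<le> i" "i < m"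
  shows "multi_norm_le UNIV i (DW (Suc n) i (im n y)) (K + C * P ^ m)"
  unfolding multi_norm_le_def
proof (intro allI impI, elim conjE)
  fix vs :: "'a list" assume vs: "length vs = i"
  let ?p = "prod_list (map norm vs)"
  have p: "0 \<le> ?p" by (rule prod_list_norm_nonneg)
  have "\<bar>Dq (Suc n) i (phi n y) (map (pr (Suc n)) vs)\<bar> \<le> C * prod_list (map norm (map (pr (Suc n)) vs))"
    using multi_norm_leD[OF assms(1)[OF assms(3,4)], of "map (pr (Suc n)) vs"] vs pr_E by auto
  also have "\<dots> \<le> C * (P ^ length vs * ?p)" using pr_bound P_ge assms(2) by (intro mult_left_mono prod_list_norm_map_le) auto
  also have "\<dots> \<le> C * (P ^ m * ?p)" using P_ge p assms vs by (intro mult_left_mono mult_right_mono power_increasing) auto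
  finally have 1: "\<bar>Dq (Suc n) i (phi n y) (map (pr (Suc n)) vs)\<bar> \<le> C * (P ^ m * ?p)" .
  have 2: "\<bar>affine_derivs (g (Suc n)) (- g (Suc n) (x (Suc n))) i (im n y) vs\<bar> \<le> K * ?p"
  proof (cases "i = 1")
    case True
    then obtain v where "vs = [v]" using vs by (cases vs) auto
    then show ?thesis using True g_bound by (simp add: affine_derivs_def)
  next
    case False
    then show ?thesis using assms(3) p K by (simp add: affine_derivs_def)
  qed
  show "norm (DW (Suc n) i (im n y) vs) \<le> (K + C * P ^ m) * ?p"
    unfolding DW_def phi_im[symmetric] real_norm_def using 1 2 by (simp add: algebra_simps)
qed

lemma Theta_bound:
  assumes "\<And>i. 1 \<le> i \<Longrightarrow> i < m \<Longrightarrow> multi_norm_le (E n) i (Dq n i y) C" "1 \<le> C" "1 \<le> i" "i < m" "m \<le> k" "y \<in> V n"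
  shows "multi_norm_le (E n) i (Theta n i y) (length (set_partitions i) * ((1 + C * K) * (1 + C * K) ^ i))"
proof -
  have "1 * K \<le> C * K" using assms(2) K by (intro mult_right_mono) auto
  then have "K \<le> 1 + C * K" by linarith
  then show ?thesis unfolding Theta_def
    using assms K by (intro comp_derivs_bound Psi_bound[of m] multi_norm_le_mono[OF DR_bound] psi_near V_S) auto
qed

text \<open>A sum in place of a maximum: one bound for the derivatives \<open>Theta n i\<close> and
  \<open>DW (Suc n) i\<close> of all orders below \<open>m\<close>.\<close>

definition Theta_const :: "nat \<Rightarrow> real \<Rightarrow> real" where
  "Theta_const m C = (\<Sum>i\<le>m. length (set_partitions i) * ((1 + C * K) * (1 + C * K) ^ i)) + (K + C * P ^ m)"

lemma Theta_const:
  assumes "1 \<le> C"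
  shows "1 \<le> Theta_const m C" "K + C * P ^ m \<le> Theta_const m C"
    "i \<le> m \<Longrightarrow> length (set_partitions i) * ((1 + C * K) * (1 + C * K) ^ i) \<le> Theta_const m C"
proof -
  have nn: "0 \<le> length (set_partitions i) * ((1 + C * K) * (1 + C * K) ^ i)" for i
    using assms K by simp
  have "0 \<le> C * P ^ m" using assms P_ge by simp
  then have P0: "0 \<le> K + C * P ^ m" "1 \<le> K + C * P ^ m" using K by linarith+
  have s: "0 \<le> (\<Sum>i\<le>m. length (set_partitions i) * ((1 + C * K) * (1 + C * K) ^ i))" by (intro sum_nonneg nn)
  show "1 \<le> Theta_const m C" "K + C * P ^ m \<le> Theta_const m C" unfolding Theta_const_def using P0 s by linarith+
  assume "i \<le> m"
  then have "length (set_partitions i) * ((1 + C * K) * (1 + C * K) ^ i) \<le> (\<Sum>i\<le>m. length (set_partitions i) * ((1 + C * K) * (1 + C * K) ^ i))"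
    by (intro member_le_sum nn) auto
  then show "length (set_partitions i) * ((1 + C * K) * (1 + C * K) ^ i) \<le> Theta_const m C" unfolding Theta_const_def using P0 by linarith
qed

lemma Rest_bound:
  assumes m: "2 \<le> m" "m \<le> k" and C: "1 \<le> C"
  shows "\<exists>B\<ge>0. \<forall>n. \<forall>y\<in>V n. (\<forall>i. 1 \<le> i \<and> i < m \<longrightarrow> multi_norm_le (E n) i (Dq n i y) C \<and>
      multi_norm_le (E (Suc n)) i (Dq (Suc n) i (phi n y)) C) \<longrightarrow> multi_norm_le (E n) m (Rest n m y) B"
proof -
  define C1 where "C1 = 1 + C * K"
  define C4 where "C4 = Theta_const m C"
  \<comment> \<open>\<open>B1\<close> bounds \<open>inner_part\<close> and \<open>B2\<close> the
    lower terms of the outer composition; \<open>K + K * P\<close> will bound the first derivative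
    of the defining function.\<close>
  define B1 where "B1 = K * C1 ^ m + length (lower_partitions m) * (C1 * C1 ^ m)"
  define B2 where "B2 = length (lower_partitions m) * (C4 * C4 ^ m)"
  have "1 * K \<le> C * K" using C K by (intro mult_right_mono) auto
  then have C1: "1 \<le> C1" "K \<le> C1" using K unfolding C1_def by linarith+
  have C4: "1 \<le> C4" "K + C * P ^ m \<le> C4" using Theta_const[OF C] by (auto simp: C4_def)
  have B: "0 \<le> B1" "0 \<le> B2" using C1 C4 K by (auto simp: B1_def B2_def)
  show ?thesis
  proof (intro exI[of _ "(K + K * P) * B1 + B2"] conjI allI ballI impI)
    show "0 \<le> (K + K * P) * B1 + B2" using B K P_ge by simp
    fix n y assume y: "y \<in> V n" and bd: "\<forall>i. 1 \<le> i \<and> i < m \<longrightarrow> multi_norm_le (E n) i (Dq n i y) C \<and>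
      multi_norm_le (E (Suc n)) i (Dq (Suc n) i (phi n y)) C"
    have bPsi: "multi_norm_le (E n) i (Psi n i y) C1" if "1 \<le> i" "i < m" for i
      unfolding C1_def by (rule Psi_bound[of m, OF _ C that]) (use bd in simp)
    have bTheta: "multi_norm_le (E n) i (Theta n i y) C4" if "1 \<le> i" "i < m" for i
      by (rule multi_norm_le_mono[OF Theta_bound[of m, OF _ C that m(2) y]]) (use bd that Theta_const(3)[OF C, of i m] in \<open>auto simp: C4_def\<close>)
    have bDW: "multi_norm_le UNIV i (DW (Suc n) i (im n y)) C4" if "1 \<le> i" "i < m" for i
      by (rule multi_norm_le_mono[OF DW_bound[of m, OF _ C that] C4(2)]) (use bd in simp)
    have bDR: "multi_norm_le UNIV i (DR n i (psi n y)) K" if "1 \<le> i" "i \<le> m" for i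
      by (rule DR_bound) (use that m psi_near(2)[OF V_S[OF y]] in auto)
    have low1: "multi_norm_le (E n) m (lower_derivs (DR n) (psi n) (Psi n) m y) (length (lower_partitions m) * (C1 * C1 ^ m))"
      using bPsi C1 by (intro lower_derivs_bound multi_norm_le_mono[OF bDR]) auto
    have low2: "multi_norm_le (E n) m (lower_derivs (DW (Suc n)) (im n) (Theta n) m y) B2"
      unfolding B2_def using bTheta bDW C4 by (intro lower_derivs_bound) auto
    show "multi_norm_le (E n) m (Rest n m y) ((K + K * P) * B1 + B2)" unfolding multi_norm_le_def
    proof (intro allI impI, elim conjE)
      fix vs assume vs: "length vs = m" "set vs \<subseteq> E n"
      let ?p = "prod_list (map norm vs)"
      have "norm (DR n m (psi n y) (map (\<lambda>v. Psi n 1 y [v]) vs)) \<le> K * prod_list (map norm (map (\<lambda>v. Psi n 1 y [v]) vs))"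
        using multi_norm_leD[OF bDR[of m], of "map (\<lambda>v. Psi n 1 y [v]) vs"] vs m by simp
      also have "\<dots> \<le> K * (C1 ^ length vs * ?p)"
        using multi_norm_leD[OF bPsi, of 1 "[_]"] vs m C1 K
        by (intro mult_left_mono prod_list_mono_bound) (auto simp: subset_iff)
      finally have "norm (inner_part n m y vs) \<le> K * (C1 ^ m * ?p) + length (lower_partitions m) * (C1 * C1 ^ m) * ?p"
        unfolding inner_part_def vs(1) by (rule norm_triangle_mono[OF _ multi_norm_leD[OF low1 vs]])
      then have "norm (inner_part n m y vs) \<le> B1 * ?p" by (simp add: B1_def algebra_simps)
      then have "(K + K * P) * norm (inner_part n m y vs) \<le> (K + K * P) * (B1 * ?p)" using K P_ge by (intro mult_left_mono) auto
      then have "\<bar>DW (Suc n) 1 (im n y) [inner_part n m y vs]\<bar> \<le> (K + K * P) * (B1 * ?p)" using DW1_bound[OF y, of "inner_part n m y vs"] by linarith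
      moreover have "\<bar>lower_derivs (DW (Suc n)) (im n) (Theta n) m y vs\<bar> \<le> B2 * ?p" using multi_norm_leD[OF low2 vs] by simp
      ultimately show "norm (Rest n m y vs) \<le> ((K + K * P) * B1 + B2) * ?p"
        unfolding Rest_def real_norm_def by (simp add: algebra_simps)
    qed
  qed
qed

end

section \<open>Bounds and oscillations of the derivatives\<close>

lemma multi_cauchy_cong:
  assumes "multi_cauchy E j \<F> F" "\<And>y vs. length vs = j \<Longrightarrow> F y vs = G y vs"
  shows "multi_cauchy E j \<F> G"
  using assms(1) unfolding multi_cauchy_def multi_norm_le_def by (simp add: assms(2))

context small_cocycle
begin

lemma N_le_mono:
  assumes "N_le n j G C" "C \<le> C'"
  shows "N_le n j G C'"
  unfolding N_le_def
proof (intro allI impI, elim conjE)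
  fix vs assume vs: "length vs = j" "set vs \<subseteq> E n"
  show "\<bar>G vs\<bar> \<le> C' * prod_list (map (N n) vs)"
    using N_leD[OF assms(1) vs] mult_right_mono[OF assms(2) prod_N_nonneg[of n vs]] by linarith
qed

lemma DW_pull:
  assumes m: "2 \<le> m" and G: "N_le (Suc n) m G C" "0 \<le> C" and y: "y \<in> V n" and vs: "length vs = m" "set vs \<subseteq> E n"
  shows "\<bar>G (map (pr (Suc n)) (map (\<lambda>v. Theta n 1 y [v]) vs))\<bar> \<le> C * \<sigma>' ^ m * prod_list (map (N n) vs)"
  using N_le_pull[OF G y vs] by (simp add: comp_def)

text \<open>Points far from the boundary satisfy a bound by hypothesis.  A point \<open>y\<close> near the boundary is
  moved away from it by \<open>phi\<close>; in the equation for the derivative at \<open>y\<close> the one at \<open>phi n y\<close> enters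
  with the factor \<open>\<sigma>' ^ m / \<tau>' < 1\<close>, so that a bound that dominates the lower order terms is inherited.\<close>

lemma derivs_bounded:
  "1 \<le> m \<Longrightarrow> m \<le> k \<Longrightarrow> \<exists>C\<ge>1. \<forall>n. \<forall>y\<in>slab n. multi_norm_le (E n) m (Dq n m y) C"
proof (induction m rule: less_induct)
  case (less m)
  show ?case
  proof (cases "m = 1")
    case True
    have "multi_norm_le (E n) 1 (Dq n 1 y) K" if "y \<in> slab n" for n y
      using slab_S0[OF that] by (intro q_bound1) (auto simp: S0_iff)
    then show ?thesis using True K by auto
  next
    case False
    then have m: "2 \<le> m" "m \<le> k" using less.prems by auto
    have "\<forall>i. \<exists>C. 1 \<le> i \<and> i < m \<longrightarrow> 1 \<le> C \<and> (\<forall>n. \<forall>y\<in>slab n. multi_norm_le (E n) i (Dq n i y) C)"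
    proof
      fix i
      show "\<exists>C. 1 \<le> i \<and> i < m \<longrightarrow> 1 \<le> C \<and> (\<forall>n. \<forall>y\<in>slab n. multi_norm_le (E n) i (Dq n i y) C)"
        using less.IH[of i] m by (cases "1 \<le> i \<and> i < m") auto
    qed
    then have "\<exists>c. \<forall>i. 1 \<le> i \<and> i < m \<longrightarrow> 1 \<le> c i \<and> (\<forall>n. \<forall>y\<in>slab n. multi_norm_le (E n) i (Dq n i y) (c i))"
      by (rule choice)
    then obtain c where c: "\<And>i. 1 \<le> i \<and> i < m \<longrightarrow> 1 \<le> c i \<and> (\<forall>n. \<forall>y\<in>slab n. multi_norm_le (E n) i (Dq n i y) (c i))"
      by blast
    define C where "C = 1 + (\<Sum>i<m. \<bar>c i\<bar>)"
    have C: "1 \<le> C" by (simp add: C_def sum_nonneg)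
    have bC: "multi_norm_le (E n) i (Dq n i y) C" if "1 \<le> i" "i < m" "y \<in> slab n" for i n y
    proof (rule multi_norm_le_mono[of _ _ _ "c i"])
      show "multi_norm_le (E n) i (Dq n i y) (c i)" using c[of i] that by blast
      have "\<bar>c i\<bar> \<le> (\<Sum>i<m. \<bar>c i\<bar>)" using that by (intro member_le_sum) auto
      then show "c i \<le> C" by (simp add: C_def)
    qed
    obtain B where B: "0 \<le> B" "\<And>n y. y \<in> V n \<Longrightarrow> (\<forall>i. 1 \<le> i \<and> i < m \<longrightarrow> multi_norm_le (E n) i (Dq n i y) C \<and>
      multi_norm_le (E (Suc n)) i (Dq (Suc n) i (phi n y)) C) \<Longrightarrow> multi_norm_le (E n) m (Rest n m y) B"
      using Rest_bound[OF m C] by blast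
    \<comment> \<open>As \<open>f\<close> grows by at most the factor \<open>\<sigma>'\<close>, a
      point of the box with \<open>f n y \<le> t0\<close> is still in the box after one
      step.\<close>
    define t0 where "t0 = r / \<sigma>'"
    have t0: "0 < t0" using r \<sigma>'_ge by (simp add: t0_def)
    obtain C0 where C0: "\<forall>n. \<forall>j\<in>{1..k}. \<forall>y\<in>E n. t0 \<le> f n y \<and> norm y < \<delta> \<longrightarrow> multi_norm_le (E n) j (Dq n j y) C0"
      using q_bound[OF t0] by blast
    have gap: "0 < \<tau>' - \<sigma>' ^ m" using \<tau>'_gt(1)[OF m(2)] by simp
    \<comment> \<open>The first summand covers the points with \<open>t0 \<le> f n y\<close>; the
      second yields \<open>M * \<sigma>' ^ m + B * K ^ m \<le> M * \<tau>'\<close>, so that the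
      equation reproduces the bound \<open>M\<close>.\<close>
    define M where "M = max 0 C0 * K ^ m + B * K ^ m / (\<tau>' - \<sigma>' ^ m)"
    have BK: "0 \<le> B * K ^ m" using B K by simp
    have M: "0 \<le> M" "B * K ^ m \<le> M * (\<tau>' - \<sigma>' ^ m)" "max 0 C0 * K ^ m \<le> M"
    proof -
      have 1: "0 \<le> max 0 C0 * K ^ m" using K by simp
      have 2: "0 \<le> B * K ^ m / (\<tau>' - \<sigma>' ^ m)" using BK gap by simp
      show "0 \<le> M" "max 0 C0 * K ^ m \<le> M" unfolding M_def using 1 2 by linarith+
      have "B * K ^ m = B * K ^ m / (\<tau>' - \<sigma>' ^ m) * (\<tau>' - \<sigma>' ^ m)" using gap by simp
      also have "\<dots> \<le> M * (\<tau>' - \<sigma>' ^ m)" unfolding M_def using 1 gap by (intro mult_right_mono) auto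
      finally show "B * K ^ m \<le> M * (\<tau>' - \<sigma>' ^ m)" .
    qed
    have far: "N_le n m (Dq n m y) M" if "y \<in> slab n" "t0 \<le> f n y" for n y
    proof -
      have "multi_norm_le (E n) m (Dq n m y) C0"
        using C0 m slab_S[OF that(1)] that S_D[of y n] by auto
      then have "multi_norm_le (E n) m (Dq n m y) (max 0 C0)" by (rule multi_norm_le_mono) simp
      then have "N_le n m (Dq n m y) (max 0 C0 * K ^ m)" by (rule N_le_if_multi_norm_le) simp
      then show ?thesis using M(3) by (rule N_le_mono)
    qed
    \<comment> \<open>The exponent counts steps: \<open>f\<close> grows at least by the factor
      \<open>\<nu>'\<close> in each, so a point with \<open>t0 / \<nu>' ^ i \<le> f n y\<close> has
      left the zone \<open>f < t0\<close> after at most \<open>i\<close> of them.\<close>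
    have level: "\<forall>n. \<forall>y\<in>slab n. t0 / \<nu>' ^ i \<le> f n y \<longrightarrow> N_le n m (Dq n m y) M" for i
    proof (induction i)
      case 0
      then show ?case using far by simp
    next
      case (Suc i)
      show ?case
      proof (intro allI ballI impI)
        fix n y assume y: "y \<in> slab n" "t0 / \<nu>' ^ Suc i \<le> f n y"
        show "N_le n m (Dq n m y) M"
        proof (cases "t0 \<le> f n y")
          case True
          then show ?thesis using far y by blast
        next
          case False
          have fy: "0 < f n y" using y by (simp add: slab_def)
          have yS: "y \<in> S n" and yV: "y \<in> V n" using y slab_S slab_V by auto
          have "f (Suc n) (phi n y) \<le> (\<sigma> + K * K * \<epsilon>) * f n y" by (rule f_growth(2)[OF yS])
          also have "\<dots> \<le> \<sigma>' * f n y" using \<sigma>'_ge fy by (intro mult_right_mono) auto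
          also have "\<dots> \<le> \<sigma>' * t0" using False \<sigma>'_ge by (intro mult_left_mono) auto
          also have "\<dots> = r" using \<sigma>'_ge by (simp add: t0_def)
          finally have phi: "phi n y \<in> slab (Suc n)" by (rule phi_slab[OF y(1)])
          have "t0 / \<nu>' ^ i = \<nu>' * (t0 / \<nu>' ^ Suc i)" using \<nu>'_gt by simp
          also have "\<dots> \<le> \<nu>' * f n y" using y \<nu>'_gt by (intro mult_left_mono) auto
          also have "\<dots> \<le> f (Suc n) (phi n y)" by (rule f_growth(1)[OF yS])
          finally have IH: "N_le (Suc n) m (Dq (Suc n) m (phi n y)) M" using Suc.IH phi by blast
          have Rb: "multi_norm_le (E n) m (Rest n m y) B" using bC[OF _ _ y(1)] bC[OF _ _ phi] by (intro B(2)[OF yV]) blast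
          show ?thesis unfolding N_le_def
          proof (intro allI impI, elim conjE)
            fix vs assume vs: "length vs = m" "set vs \<subseteq> E n"
            let ?\<Pi> = "prod_list (map (N n) vs)" and ?X = "DW (Suc n) m (im n y) (map (\<lambda>v. Theta n 1 y [v]) vs)"
            have "\<bar>?X\<bar> \<le> M * \<sigma>' ^ m * ?\<Pi>"
              using DW_pull[OF m(1) IH M(1) yV vs] unfolding DW_ge2[OF m(1)] phi_im[symmetric] by simp
            moreover have "\<bar>Rest n m y vs\<bar> \<le> B * K ^ m * ?\<Pi>"
              using N_leD[OF N_le_if_multi_norm_le[OF Rb B(1)] vs] .
            moreover have "\<bar>coef n y * Dq n m y vs\<bar> \<le> \<bar>?X\<bar> + \<bar>Rest n m y vs\<bar>"
              unfolding equation_ge2[OF m yV vs] by simp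
            moreover have "\<tau>' * \<bar>Dq n m y vs\<bar> \<le> \<bar>coef n y * Dq n m y vs\<bar>"
              unfolding abs_mult by (intro mult_right_mono coef_bound yV) auto
            moreover have "B * K ^ m * ?\<Pi> \<le> M * (\<tau>' - \<sigma>' ^ m) * ?\<Pi>" using M(2) prod_N_nonneg by (intro mult_right_mono)
            ultimately have "\<tau>' * \<bar>Dq n m y vs\<bar> \<le> \<tau>' * (M * ?\<Pi>)" by (simp add: algebra_simps)
            then show "\<bar>Dq n m y vs\<bar> \<le> M * ?\<Pi>" using \<tau>'_gt(2) by simp
          qed
        qed
      qed
    qed
    have "multi_norm_le (E n) m (Dq n m y) (max 1 (M * (2 * K) ^ m))" if y: "y \<in> slab n" for n y
    proof -
      have fy: "0 < f n y" using y by (simp add: slab_def)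
      obtain i where "t0 / f n y < \<nu>' ^ i" using real_arch_pow[OF \<nu>'_gt] by blast
      then have "t0 / \<nu>' ^ i \<le> f n y" using fy \<nu>'_gt by (simp add: field_simps)
      then have "N_le n m (Dq n m y) M" using level y by blast
      then show ?thesis using M(1) by (intro multi_norm_le_mono[OF multi_norm_le_if_N_le]) auto
    qed
    then show ?thesis by (intro exI[of _ "max 1 (M * (2 * K) ^ m)"]) auto
  qed
qed

section \<open>Oscillation of the derivatives at points of the hyperplane\<close>

definition fl :: "nat \<Rightarrow> 'a \<Rightarrow> 'a filter" where "fl n p = at p within S0 n"

lemma eventually_slab: "p \<in> edge n \<Longrightarrow> \<forall>\<^sub>F y in fl n p. y \<in> slab n"
proof -
  assume p: "p \<in> edge n"
  define d where "d = (r - w n p) / K"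
  have d: "0 < d" "K * d \<le> r" "w n p + K * d = r" using p K w_nonneg[of n p] by (auto simp: d_def edge_def)
  have "y \<in> slab n" if "y \<in> S0 n" "dist y p < d" for y
  proof -
    have "K * norm (y - p) \<le> K * d" using that K by (intro mult_left_mono) (auto simp: dist_norm)
    then have "w n (y - p) \<le> K * d" "\<bar>f n (y - p)\<bar> \<le> K * d" using w_bound[of n "y - p"] f_bound[of n "y - p"] by linarith+
    moreover have "w n y \<le> w n p + w n (y - p)" using w_triangle[of n p "y - p"] by simp
    moreover have "f n (y - p) = f n y" using p by (simp add: edge_def f_simps)
    ultimately show ?thesis using that(1) d by (auto simp: slab_def S0_iff)
  qed
  then show ?thesis unfolding fl_def eventually_at using d(1) by blast
qed

lemma phi_filterlim:
  assumes p: "p \<in> edge n"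
  shows "filterlim (phi n) (fl (Suc n) (phi n p)) (fl n p)"
proof -
  let ?L = "(K + 1) * P * P"
  have "(phi n \<longlongrightarrow> phi n p) (fl n p)"
  proof (rule Lim_null[THEN iffD2], rule Lim_null_comparison)
    show "\<forall>\<^sub>F y in fl n p. norm (phi n y - phi n p) \<le> ?L * norm (y - p)"
      using eventually_slab[OF p] by eventually_elim (intro phi_lip slab_S edge_S p)
    have "((\<lambda>y. ?L * norm (y - p)) \<longlongrightarrow> ?L * norm (p - p)) (fl n p)" unfolding fl_def by (intro tendsto_intros)
    then show "((\<lambda>y. ?L * norm (y - p)) \<longlongrightarrow> 0) (fl n p)" by simp
  qed
  \<comment> \<open>The target filter is punctured; \<open>f\<close> separates the images of
    interior points from the image of \<open>p\<close>, where it vanishes.\<close>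
  moreover have "\<forall>\<^sub>F y in fl n p. phi n y \<in> S0 (Suc n) \<and> phi n y \<noteq> phi n p"
    using eventually_slab[OF p]
  proof eventually_elim
    case (elim y)
    have "phi n y \<in> S0 (Suc n)" by (rule phi_S0[OF slab_V[OF elim]])
    moreover have "f (Suc n) (phi n p) = 0" using phi_edge[OF p] by (simp add: edge_def)
    ultimately show ?case by (auto simp: S0_iff)
  qed
  ultimately show ?thesis unfolding fl_def[of "Suc n"] filterlim_at by simp
qed

lemma DR_cauchy:
  assumes p: "p \<in> edge n" and j: "j \<le> k"
  shows "multi_cauchy UNIV j (fl n p) (\<lambda>y. DR n j (psi n y))"
proof (rule multi_cauchy_tendsto)
  fix e' :: real assume e: "0 < e'"
  have H: "psi n p \<in> H n" by (rule psi_near(2)[OF edge_S[OF p]])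
  obtain d where d: "d > 0" "\<And>z. z \<in> H n \<Longrightarrow> z \<noteq> psi n p \<Longrightarrow> dist z (psi n p) < d \<Longrightarrow> multi_norm_le UNIV j (\<lambda>vs. DR n j z vs - DR n j (psi n p) vs) e'"
    using multi_tendstoD[OF DR_tendsto[OF H j] e] by blast
  have "\<forall>\<^sub>F y in fl n p. dist y p < d / P"
    unfolding fl_def eventually_at using d(1) P_ge by (intro exI[of _ "d / P"]) auto
  with eventually_slab[OF p]
  show "\<forall>\<^sub>F y in fl n p. multi_norm_le UNIV j (\<lambda>vs. DR n j (psi n y) vs - DR n j (psi n p) vs) e'"
  proof eventually_elim
    case (elim y)
    have "norm (psi n y - psi n p) \<le> P * norm (y - p)" by (intro psi_lip slab_S edge_S elim p)
    also have "\<dots> < d" using elim(2) P_ge by (simp add: dist_norm field_simps)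
    finally have "dist (psi n y) (psi n p) < d" by (simp add: dist_norm)
    moreover have "multi_norm_le UNIV j (\<lambda>vs. DR n j (psi n p) vs - DR n j (psi n p) vs) e'"
      unfolding multi_norm_le_def using e prod_list_norm_nonneg by (auto intro!: mult_nonneg_nonneg simp: less_imp_le)
    ultimately show ?case using d(2)[OF psi_near(2)[OF slab_S[OF elim(1)]]] by (cases "psi n y = psi n p") simp_all
  qed
qed

lemma Psi_cauchy:
  assumes "multi_cauchy (E n) i (fl n p) (Dq n i)" "1 \<le> i"
  shows "multi_cauchy (E n) i (fl n p) (Psi n i)"
  unfolding multi_cauchy_def
proof (intro allI impI)
  fix e' :: real assume "0 < e'"
  then have "0 < e' / K" using K by simp
  from multi_cauchyD[OF assms(1) this]
  show "\<forall>\<^sub>F w in fl n p \<times>\<^sub>F fl n p. multi_norm_le (E n) i (\<lambda>vs. Psi n i (fst w) vs - Psi n i (snd w) vs) e'"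
  proof eventually_elim
    case (elim u)
    show ?case unfolding multi_norm_le_def
    proof (intro allI impI, elim conjE)
      fix vs assume vs: "length vs = i" "set vs \<subseteq> E n"
      have "Psi n i (fst u) vs - Psi n i (snd u) vs = (Dq n i (fst u) vs - Dq n i (snd u) vs) *\<^sub>R e n"
        using assms(2) by (simp add: Psi_def affine_derivs_def scaleR_diff_left)
      also have "norm \<dots> \<le> (e' / K * prod_list (map norm vs)) * K"
        unfolding norm_scaleR using multi_norm_leD[OF elim vs] e_bound K by (intro mult_mono) auto
      finally show "norm (Psi n i (fst u) vs - Psi n i (snd u) vs) \<le> e' * prod_list (map norm vs)" using K by simp
    qed
  qed
qed

lemma DW_cauchy:
  assumes p: "p \<in> edge n" and "multi_cauchy (E (Suc n)) i (fl (Suc n) (phi n p)) (Dq (Suc n) i)" "1 \<le> i"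
  shows "multi_cauchy UNIV i (fl n p) (\<lambda>y. DW (Suc n) i (im n y))"
  unfolding multi_cauchy_def
proof (intro allI impI)
  fix e' :: real assume e': "0 < e'"
  have Pi: "0 < P ^ i" using P_ge by simp
  have "0 < e' / P ^ i" using e' Pi by simp
  from multi_cauchyD[OF multi_cauchy_compose[OF assms(2) phi_filterlim[OF p]] this]
  show "\<forall>\<^sub>F w in fl n p \<times>\<^sub>F fl n p. multi_norm_le UNIV i (\<lambda>vs. DW (Suc n) i (im n (fst w)) vs - DW (Suc n) i (im n (snd w)) vs) e'"
  proof eventually_elim
    case (elim u)
    show ?case unfolding multi_norm_le_def
    proof (intro allI impI, elim conjE)
      fix vs :: "'a list" assume vs: "length vs = i"
      let ?us = "map (pr (Suc n)) vs"
      have us: "set ?us \<subseteq> E (Suc n)" using pr_E by auto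
      have eq: "DW (Suc n) i (im n (fst u)) vs - DW (Suc n) i (im n (snd u)) vs = - (Dq (Suc n) i (phi n (fst u)) ?us - Dq (Suc n) i (phi n (snd u)) ?us)"
        using assms(3) unfolding DW_def phi_im[symmetric] by (simp add: affine_derivs_def)
      have "norm (DW (Suc n) i (im n (fst u)) vs - DW (Suc n) i (im n (snd u)) vs) \<le> e' / P ^ i * prod_list (map norm ?us)"
        unfolding eq norm_minus_cancel by (rule multi_norm_leD[OF elim _ us]) (use vs in simp)
      also have "\<dots> \<le> e' / P ^ i * (P ^ length vs * prod_list (map norm vs))"
        by (intro mult_left_mono prod_list_norm_map_le pr_bound) (use e' P_ge in simp_all)
      also have "\<dots> = e' * prod_list (map norm vs)" using P_ge vs by simp
      finally show "norm (DW (Suc n) i (im n (fst u)) vs - DW (Suc n) i (im n (snd u)) vs) \<le> e' * prod_list (map norm vs)" .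
    qed
  qed
qed

text \<open>The bound is demanded for all indices and all boundary points together, because the
  equation at \<open>p\<close> refers to \<open>phi n p\<close> at index
  \<open>Suc n\<close>.\<close>

definition oscillation_le :: "nat \<Rightarrow> real \<Rightarrow> bool" where
  "oscillation_le m \<omega> \<longleftrightarrow> (\<forall>n. \<forall>p\<in>edge n. \<forall>\<^sub>F u in fl n p \<times>\<^sub>F fl n p. N_le n m (\<lambda>vs. Dq n m (fst u) vs - Dq n m (snd u) vs) \<omega>)"

lemma oscillation_le_mono:
  assumes "oscillation_le m \<omega>" "\<omega> \<le> \<omega>'"
  shows "oscillation_le m \<omega>'"
  unfolding oscillation_le_def
proof (intro allI ballI)
  fix n p assume "p \<in> edge n"
  then have "\<forall>\<^sub>F u in fl n p \<times>\<^sub>F fl n p. N_le n m (\<lambda>vs. Dq n m (fst u) vs - Dq n m (snd u) vs) \<omega>"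
    using assms(1) unfolding oscillation_le_def by blast
  then show "\<forall>\<^sub>F u in fl n p \<times>\<^sub>F fl n p. N_le n m (\<lambda>vs. Dq n m (fst u) vs - Dq n m (snd u) vs) \<omega>'"
    by eventually_elim (rule N_le_mono[OF _ assms(2)])
qed

lemma oscillation_phi:
  assumes "oscillation_le m \<omega>" "p \<in> edge n"
  shows "\<forall>\<^sub>F u in fl n p \<times>\<^sub>F fl n p. N_le (Suc n) m (\<lambda>vs. Dq (Suc n) m (phi n (fst u)) vs - Dq (Suc n) m (phi n (snd u)) vs) \<omega>"
proof -
  have "\<forall>\<^sub>F u in fl (Suc n) (phi n p) \<times>\<^sub>F fl (Suc n) (phi n p). N_le (Suc n) m (\<lambda>vs. Dq (Suc n) m (fst u) vs - Dq (Suc n) m (snd u) vs) \<omega>"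
    using assms(1) phi_edge[OF assms(2)] unfolding oscillation_le_def by blast
  moreover have "filterlim (\<lambda>u. (phi n (fst u), phi n (snd u))) (fl (Suc n) (phi n p) \<times>\<^sub>F fl (Suc n) (phi n p)) (fl n p \<times>\<^sub>F fl n p)"
    by (intro filterlim_Pair filterlim_compose[OF phi_filterlim[OF assms(2)]] filterlim_fst filterlim_snd)
  ultimately have "\<forall>\<^sub>F u in fl n p \<times>\<^sub>F fl n p. N_le (Suc n) m (\<lambda>vs. Dq (Suc n) m (fst (phi n (fst u), phi n (snd u))) vs
     - Dq (Suc n) m (snd (phi n (fst u), phi n (snd u))) vs) \<omega>"
    unfolding filterlim_iff by blast
  then show ?thesis by simp
qed

lemma oscillation_start:
  assumes "1 \<le> m" "m \<le> k"
  obtains \<omega> where "0 \<le> \<omega>" "oscillation_le m \<omega>"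
proof -
  obtain C where C: "1 \<le> C" "\<And>n y. y \<in> slab n \<Longrightarrow> multi_norm_le (E n) m (Dq n m y) C"
    using derivs_bounded[OF assms] by blast
  have "oscillation_le m (2 * C * K ^ m)" unfolding oscillation_le_def
  proof (intro allI ballI)
    fix n p assume p: "p \<in> edge n"
    from eventually_fst[OF eventually_slab[OF p]] eventually_snd[OF eventually_slab[OF p]]
    show "\<forall>\<^sub>F u in fl n p \<times>\<^sub>F fl n p. N_le n m (\<lambda>vs. Dq n m (fst u) vs - Dq n m (snd u) vs) (2 * C * K ^ m)"
    proof eventually_elim
      case (elim u)
      have b: "N_le n m (Dq n m (fst u)) (C * K ^ m)" "N_le n m (Dq n m (snd u)) (C * K ^ m)"
        using C elim by (auto intro: N_le_if_multi_norm_le)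
      show ?case unfolding N_le_def
      proof (intro allI impI, elim conjE)
        fix vs assume vs: "length vs = m" "set vs \<subseteq> E n"
        show "\<bar>Dq n m (fst u) vs - Dq n m (snd u) vs\<bar> \<le> 2 * C * K ^ m * prod_list (map (N n) vs)"
          using N_leD[OF b(1) vs] N_leD[OF b(2) vs] by linarith
      qed
    qed
  qed
  moreover have "0 \<le> 2 * C * K ^ m" using C K by simp
  ultimately show thesis using that by blast
qed

text \<open>One application of the equation shrinks an oscillation bound that holds along the whole orbit by
  the factor \<open>\<sigma>' ^ m / \<tau>' < 1\<close>, up to an arbitrarily small error: the terms of lower order converge.\<close>

lemma oscillation_vanishes:
  assumes m: "1 \<le> m" "m \<le> k"
    and step: "\<And>\<omega> d. 0 \<le> \<omega> \<Longrightarrow> 0 < d \<Longrightarrow> oscillation_le m \<omega> \<Longrightarrow> oscillation_le m (\<sigma>' ^ m / \<tau>' * \<omega> + d)"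
    and p: "p \<in> edge n"
  shows "multi_cauchy (E n) m (fl n p) (Dq n m)"
proof -
  define \<theta> where "\<theta> = \<sigma>' ^ m / \<tau>'"
  have \<theta>: "0 \<le> \<theta>" "\<theta> < 1" using \<tau>'_gt(1)[OF m(2)] \<tau>'_gt(2) \<sigma>'_ge by (auto simp: \<theta>_def)
  obtain \<omega>0 where \<omega>0: "0 \<le> \<omega>0" "oscillation_le m \<omega>0" using oscillation_start[OF m] by blast
  have all: "oscillation_le m d" if d: "0 < d" for d
  proof -
    have osc: "oscillation_le m (\<theta> ^ i * \<omega>0 + d / 2)" for i
    proof (induction i)
      case 0
      show ?case by (rule oscillation_le_mono[OF \<omega>0(2)]) (use d in simp)
    next
      case (Suc i)
      \<comment> \<open>The error \<open>d * (1 - \<theta>) / 2\<close> makes \<open>d / 2\<close>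
        the fixed point of the recursion, so the bounds decrease to \<open>d / 2\<close>.\<close>
      have "0 \<le> \<theta> ^ i * \<omega>0 + d / 2" "0 < d * (1 - \<theta>) / 2" using \<theta> \<omega>0 d by auto
      from step[OF this Suc] have "oscillation_le m (\<theta> * (\<theta> ^ i * \<omega>0 + d / 2) + d * (1 - \<theta>) / 2)" by (simp add: \<theta>_def)
      moreover have "\<theta> * (\<theta> ^ i * \<omega>0 + d / 2) + d * (1 - \<theta>) / 2 = \<theta> ^ Suc i * \<omega>0 + d / 2" by (simp add: field_simps)
      ultimately show ?case by simp
    qed
    have "\<exists>i. \<theta> ^ i * \<omega>0 < d / 2"
    proof -
      have "(\<lambda>i. \<theta> ^ i * \<omega>0) \<longlonglongrightarrow> 0 * \<omega>0" using \<theta> by (intro tendsto_intros LIMSEQ_power_zero) auto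
      then have "\<forall>\<^sub>F i in sequentially. \<theta> ^ i * \<omega>0 < d / 2" using d by (intro order_tendstoD(2)[of _ 0]) auto
      then show ?thesis by (auto simp: eventually_sequentially)
    qed
    then obtain i where "\<theta> ^ i * \<omega>0 < d / 2" by blast
    then have le: "\<theta> ^ i * \<omega>0 + d / 2 \<le> d" by simp
    from oscillation_le_mono[OF osc le] show ?thesis .
  qed
  show ?thesis unfolding multi_cauchy_def
  proof (intro allI impI)
    fix d :: real assume d: "0 < d"
    define d' where "d' = d / (2 * K) ^ m"
    have d': "0 < d'" "d' * (2 * K) ^ m = d" using d K by (auto simp: d'_def)
    have "\<forall>\<^sub>F u in fl n p \<times>\<^sub>F fl n p. N_le n m (\<lambda>vs. Dq n m (fst u) vs - Dq n m (snd u) vs) d'"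
      using all[OF d'(1)] p unfolding oscillation_le_def by blast
    then show "\<forall>\<^sub>F u in fl n p \<times>\<^sub>F fl n p. multi_norm_le (E n) m (\<lambda>vs. Dq n m (fst u) vs - Dq n m (snd u) vs) d"
    proof eventually_elim
      case (elim u)
      show ?case using multi_norm_le_if_N_le[OF elim] d' by simp
    qed
  qed
qed

text \<open>The slope \<open>c'\<close> at \<open>y'\<close> is inserted into the equation at
  \<open>y\<close>. What remains is \<open>coef n y\<close> times the difference of the slopes,
  against two errors: the change of the defining function between \<open>y\<close> and
  \<open>y'\<close>, which is the oscillation at \<open>phi n p\<close> after one transfer, and the
  change of the derivative of \<open>R\<close> between two nearby graph points, which is
  small.\<close>

lemma oscillation_step_1:
  assumes \<omega>: "0 \<le> \<omega>" and d: "0 < d" and osc: "oscillation_le 1 \<omega>"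
  shows "oscillation_le 1 (\<sigma>' ^ 1 / \<tau>' * \<omega> + d)"
  unfolding oscillation_le_def
proof (intro allI ballI)
  fix n p assume p: "p \<in> edge n"
  \<comment> \<open>\<open>K + K * P\<close> bounds the first derivative of the defining function,
    and \<open>P * K\<close> bounds the lifted vector in terms of \<open>N\<close>.\<close>
  define c where "c = (K + K * P) * P * K"
  have c: "0 < c" using K P_ge by (auto simp: c_def intro!: mult_pos_pos add_pos_pos)
  define d1 where "d1 = d * \<tau>' / c"
  have d1: "0 < d1" "c * d1 = d * \<tau>'" using d c \<tau>'_gt(2) by (auto simp: d1_def)
  have "\<forall>\<^sub>F u in fl n p \<times>\<^sub>F fl n p. multi_norm_le UNIV 1 (\<lambda>vs. DR n 1 (psi n (fst u)) vs - DR n 1 (psi n (snd u)) vs) d1"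
    by (rule multi_cauchyD[OF DR_cauchy[OF p k] d1(1)])
  with oscillation_phi[OF osc p] eventually_fst[OF eventually_slab[OF p]] eventually_snd[OF eventually_slab[OF p]]
  show "\<forall>\<^sub>F u in fl n p \<times>\<^sub>F fl n p. N_le n 1 (\<lambda>vs. Dq n 1 (fst u) vs - Dq n 1 (snd u) vs) (\<sigma>' ^ 1 / \<tau>' * \<omega> + d)"
  proof eventually_elim
    case (elim u)
    obtain y y' where u: "u = (y, y')" by (cases u)
    have yV: "y \<in> V n" "y' \<in> V n" using elim u slab_V by auto
    show ?case unfolding N_le_def
    proof (intro allI impI, elim conjE)
      fix vs assume vs: "length vs = 1" "set vs \<subseteq> E n"
      then obtain v where v: "vs = [v]" "v \<in> E n" by (cases vs) auto
      define c' where "c' = Dq n 1 y' [v]"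
      define D where "D = Dq n 1 y [v] - c'"
      have c'_bound: "\<bar>c'\<bar> \<le> K * norm v" unfolding c'_def by (rule Dq1_bound[OF V_S0[OF yV(2)] v(2)])
      let ?t = "T n (psi n y) c' v" and ?t' = "T n (psi n y') c' v"
      let ?W = "\<lambda>y u. DW (Suc n) 1 (im n y) [u]"
      have "T n (psi n y) (Dq n 1 y [v]) v = D *\<^sub>R DR n 1 (psi n y) [e n] + ?t"
        unfolding T_def DR1_linear[OF psi_near(2)[OF V_S[OF yV(1)]]] by (simp add: D_def scaleR_diff_left)
      then have "?W y (T n (psi n y) (Dq n 1 y [v]) v) = D * coef n y + ?W y ?t" by (simp only: DW1_linear[OF yV(1)] coef_def)
      then have eq: "coef n y * D = - ?W y ?t" using equation_1[OF yV(1) v(2)] by (simp add: mult.commute)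
      have eq': "?W y' ?t' = 0" using equation_1[OF yV(2) v(2)] by (simp only: c'_def)
      have 1: "\<bar>?W y ?t - ?W y' ?t\<bar> \<le> \<omega> * (\<sigma>' * N n v)"
      proof -
        let ?a = "pr (Suc n) ?t"
        have "?W y ?t - ?W y' ?t = - (Dq (Suc n) 1 (phi n y) [?a] - Dq (Suc n) 1 (phi n y') [?a])"
          unfolding DW_1 phi_im[symmetric] by simp
        moreover have "\<bar>Dq (Suc n) 1 (phi n y) [?a] - Dq (Suc n) 1 (phi n y') [?a]\<bar> \<le> \<omega> * N (Suc n) ?a"
          using N_leD[OF elim(1), of "[?a]"] pr_E by (simp add: u)
        moreover have "\<omega> * N (Suc n) ?a \<le> \<omega> * (\<sigma>' * N n v)"
          by (intro mult_left_mono[OF N_transfer] psi_near V_S yV v c'_bound \<omega>)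
        ultimately show ?thesis by simp
      qed
      have 2: "\<bar>?W y' ?t - ?W y' ?t'\<bar> \<le> c * d1 * N n v"
      proof -
        let ?h = "v + c' *\<^sub>R e n"
        have "\<bar>?W y' ?t - ?W y' ?t'\<bar> = \<bar>?W y' (?t + (-1) *\<^sub>R ?t')\<bar>" unfolding DW1_linear[OF yV(2)] by simp
        also have "\<dots> \<le> (K + K * P) * norm (?t + (-1) *\<^sub>R ?t')" by (rule DW1_bound[OF yV(2)])
        also have "\<dots> \<le> (K + K * P) * (d1 * (P * (K * N n v)))"
        proof (rule mult_left_mono)
          have "norm (?t + (-1) *\<^sub>R ?t') \<le> d1 * norm ?h"
            using multi_norm_leD[OF elim(4), of "[?h]"] by (simp add: u T_def)
          moreover have "norm ?h \<le> P * (K * N n v)"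
          proof -
            have "norm ?h \<le> norm v + \<bar>c'\<bar> * norm (e n)" by (metis norm_triangle_ineq norm_scaleR)
            also have "\<dots> \<le> norm v + (K * norm v) * K" using c'_bound e_bound K by (intro add_left_mono mult_mono) auto
            also have "\<dots> = P * norm v" by (simp add: P_def algebra_simps)
            also have "\<dots> \<le> P * (K * N n v)" using norm_le_N[OF v(2)] P_ge by (intro mult_left_mono) auto
            finally show ?thesis .
          qed
          then have "d1 * norm ?h \<le> d1 * (P * (K * N n v))" using d1(1) by (intro mult_left_mono) auto
          ultimately show "norm (?t + (-1) *\<^sub>R ?t') \<le> d1 * (P * (K * N n v))" by linarith
        qed (use K P_ge in auto)
        also have "\<dots> = c * d1 * N n v" by (simp add: c_def mult_ac)
        finally show ?thesis .
      qed
      have "\<tau>' * \<bar>D\<bar> \<le> \<bar>coef n y * D\<bar>" unfolding abs_mult by (intro mult_right_mono coef_bound yV) auto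
      also have "\<dots> \<le> \<omega> * (\<sigma>' * N n v) + c * d1 * N n v" unfolding eq using 1 2 eq' by simp
      also have "\<dots> = \<tau>' * ((\<sigma>' / \<tau>' * \<omega> + d) * N n v)" unfolding d1(2) using \<tau>'_gt(2) by (simp add: field_simps)
      finally have "\<bar>D\<bar> \<le> (\<sigma>' / \<tau>' * \<omega> + d) * N n v" using \<tau>'_gt(2) by simp
      then show "\<bar>Dq n 1 (fst u) vs - Dq n 1 (snd u) vs\<bar> \<le> (\<sigma>' ^ 1 / \<tau>' * \<omega> + d) * prod_list (map (N n) vs)"
        by (simp add: u v D_def c'_def)
    qed
  qed
qed

lemma orders_bounded:
  assumes "m \<le> k"
  obtains C where "1 \<le> C" "\<And>i n y. 1 \<le> i \<Longrightarrow> i \<le> m \<Longrightarrow> y \<in> slab n \<Longrightarrow> multi_norm_le (E n) i (Dq n i y) C"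
proof -
  have "\<forall>i. \<exists>C. 1 \<le> i \<and> i \<le> m \<longrightarrow> (\<forall>n. \<forall>y\<in>slab n. multi_norm_le (E n) i (Dq n i y) C)"
  proof
    fix i
    show "\<exists>C. 1 \<le> i \<and> i \<le> m \<longrightarrow> (\<forall>n. \<forall>y\<in>slab n. multi_norm_le (E n) i (Dq n i y) C)"
      using derivs_bounded[of i] assms by (cases "1 \<le> i \<and> i \<le> m") auto
  qed
  then have "\<exists>c. \<forall>i. 1 \<le> i \<and> i \<le> m \<longrightarrow> (\<forall>n. \<forall>y\<in>slab n. multi_norm_le (E n) i (Dq n i y) (c i))" by (rule choice)
  then obtain c where c: "\<And>i. 1 \<le> i \<and> i \<le> m \<longrightarrow> (\<forall>n. \<forall>y\<in>slab n. multi_norm_le (E n) i (Dq n i y) (c i))" by blast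
  show thesis
  proof (rule that[of "1 + (\<Sum>i\<le>m. \<bar>c i\<bar>)"])
    show "1 \<le> 1 + (\<Sum>i\<le>m. \<bar>c i\<bar>)" by (simp add: sum_nonneg)
    fix i n y assume *: "1 \<le> i" "i \<le> m" "y \<in> slab n"
    have "\<bar>c i\<bar> \<le> (\<Sum>i\<le>m. \<bar>c i\<bar>)" using * by (intro member_le_sum) auto
    then have le: "c i \<le> 1 + (\<Sum>i\<le>m. \<bar>c i\<bar>)" by linarith
    have "multi_norm_le (E n) i (Dq n i y) (c i)" using c[of i] * by blast
    then show "multi_norm_le (E n) i (Dq n i y) (1 + (\<Sum>i\<le>m. \<bar>c i\<bar>))" using le by (rule multi_norm_le_mono)
  qed
qed

lemma eventually_phi_slab:
  assumes p: "p \<in> edge n"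
  shows "\<forall>\<^sub>F y in fl n p. phi n y \<in> slab (Suc n)"
  using eventually_slab[OF phi_edge[OF p]] phi_filterlim[OF p] unfolding filterlim_iff by blast

text \<open>Subtracting \<open>equation_ge2\<close> at \<open>y\<close> and \<open>y'\<close> leaves
  the difference of the \<open>m\<close>-th derivatives at the two images, which is the transferred
  oscillation, and differences of \<open>Theta n 1\<close>, \<open>Rest\<close> and
  \<open>coef\<close>. These contain only lower orders and are Cauchy by \<open>IH\<close>; where
  they meet an \<open>m\<close>-th derivative, the latter is bounded.\<close>

lemma oscillation_step:
  assumes m: "2 \<le> m" "m \<le> k"
    and IH: "\<And>i n p. 1 \<le> i \<Longrightarrow> i < m \<Longrightarrow> p \<in> edge n \<Longrightarrow> multi_cauchy (E n) i (fl n p) (Dq n i)"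
    and \<omega>: "0 \<le> \<omega>" and d: "0 < d" and osc: "oscillation_le m \<omega>"
  shows "oscillation_le m (\<sigma>' ^ m / \<tau>' * \<omega> + d)"
  unfolding oscillation_le_def
proof (intro allI ballI)
  fix n p assume p: "p \<in> edge n"
  let ?F = "fl n p"
  obtain C where C: "1 \<le> C" "\<And>i n y. 1 \<le> i \<Longrightarrow> i \<le> m \<Longrightarrow> y \<in> slab n \<Longrightarrow> multi_norm_le (E n) i (Dq n i y) C"
    using orders_bounded[OF m(2)] by blast
  \<comment> \<open>A common bound for all families below. The exponent \<open>Suc m\<close> occurs
    because \<open>DW\<close> is needed up to order \<open>m\<close> itself, whereas
    \<open>DW_bound\<close> covers the orders below its parameter.\<close>
  define D where "D = Theta_const m C + (1 + C * K) + (K + C * P ^ Suc m)"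
  have CK: "1 * K \<le> C * K" using C(1) K by (intro mult_right_mono) auto
  have CP: "0 \<le> C * P ^ Suc m" "0 \<le> C * K" using C(1) K P_ge by auto
  have D: "1 \<le> D" "Theta_const m C \<le> D" "1 + C * K \<le> D" "K \<le> D" "K + C * P ^ Suc m \<le> D"
    using Theta_const(1)[OF C(1), of m] CK CP K unfolding D_def by linarith+
  have bPsi: "\<forall>\<^sub>F y in ?F. multi_norm_le (E n) i (Psi n i y) D" if "1 \<le> i" "i \<le> m" for i
    using eventually_slab[OF p]
  proof eventually_elim
    case (elim y)
    show ?case by (rule multi_norm_le_mono[OF Psi_bound[of "Suc m"] D(3)]) (use C(1) C(2)[OF _ _ elim] that in simp_all)
  qed
  have bTheta: "\<forall>\<^sub>F y in ?F. multi_norm_le (E n) i (Theta n i y) D" if "1 \<le> i" "i < m" for i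
    using eventually_slab[OF p]
  proof eventually_elim
    case (elim y)
    have "length (set_partitions i) * ((1 + C * K) * (1 + C * K) ^ i) \<le> D"
      by (rule order_trans[OF Theta_const(3)[OF C(1)] D(2)]) (use that in simp)
    moreover have "multi_norm_le (E n) i (Theta n i y) (length (set_partitions i) * ((1 + C * K) * (1 + C * K) ^ i))"
      by (rule Theta_bound[of m]) (use C(1) C(2)[OF _ _ elim] that m slab_V[OF elim] in simp_all)
    ultimately show ?case by (rule multi_norm_le_mono[rotated])
  qed
  have bDW: "\<forall>\<^sub>F y in ?F. multi_norm_le UNIV i (DW (Suc n) i (im n y)) D \<and> bounded_multilinear UNIV i (DW (Suc n) i (im n y))"
    if "1 \<le> i" "i \<le> m" for i
    using eventually_slab[OF p] eventually_phi_slab[OF p]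
  proof eventually_elim
    case (elim y)
    have "multi_norm_le UNIV i (DW (Suc n) i (im n y)) D"
      by (rule multi_norm_le_mono[OF DW_bound[of "Suc m"] D(5)]) (use C(1) C(2)[OF _ _ elim(2)] that in simp_all)
    then show ?case using DW_lin[OF slab_V[OF elim(1)], of i] that m by simp
  qed
  have bDR: "\<forall>\<^sub>F y in ?F. multi_norm_le UNIV i (DR n i (psi n y)) D \<and> bounded_multilinear UNIV i (DR n i (psi n y))"
    if "1 \<le> i" "i \<le> m" for i
    using eventually_slab[OF p]
  proof eventually_elim
    case (elim y)
    have H: "psi n y \<in> H n" by (rule psi_near(2)[OF slab_S[OF elim]])
    show ?case using multi_norm_le_mono[OF DR_bound[OF H] D(4)] has_derivs_onD(2)[OF R_has_derivs H] that m by simp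
  qed
  have cPsi: "multi_cauchy (E n) i ?F (Psi n i)" if "1 \<le> i" "i < m" for i
    by (rule Psi_cauchy[OF IH[OF that p] that(1)])
  have cDR: "multi_cauchy UNIV i ?F (\<lambda>y. DR n i (psi n y))" if "1 \<le> i" "i \<le> m" for i
    by (rule DR_cauchy[OF p]) (use that m in simp)
  have cDW: "multi_cauchy UNIV i ?F (\<lambda>y. DW (Suc n) i (im n y))" if "1 \<le> i" "i < m" for i
    by (rule DW_cauchy[OF p IH[OF that phi_edge[OF p]] that(1)])
  have cTheta: "multi_cauchy (E n) i ?F (Theta n i)" if "1 \<le> i" "i < m" for i
    unfolding Theta_def
  proof (rule multi_cauchy_comp_derivs[where C = D])
    fix j assume j: "1 \<le> j" "j \<le> i"
    show "\<forall>\<^sub>F y in ?F. multi_norm_le UNIV j (DR n j (psi n y)) D \<and> bounded_multilinear UNIV j (DR n j (psi n y))"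
      by (rule bDR) (use j that in simp_all)
    show "multi_cauchy UNIV j ?F (\<lambda>y. DR n j (psi n y))" by (rule cDR) (use j that in simp_all)
    show "\<forall>\<^sub>F y in ?F. multi_norm_le (E n) j (Psi n j y) D" by (rule bPsi) (use j that in simp_all)
    show "multi_cauchy (E n) j ?F (Psi n j)" by (rule cPsi) (use j that in simp_all)
  qed (use D(1) that in simp_all)
  \<comment> \<open>The leading terms of \<open>inner_part\<close> and of \<open>Rest\<close> are
    partition terms for the finest and the coarsest partition, so the Cauchy lemma for partition
    terms covers them too.\<close>
  have parts: "is_partition m [[0..<m]]" "is_partition m (map (\<lambda>i. [i]) [0..<m])"
  proof -
    show "is_partition m [[0..<m]]" using m by (cases m) (auto simp: is_partition_def)
    have "concat (map (\<lambda>i. [i]) xs) = xs" for xs :: "nat list" by (induction xs) auto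
    then show "is_partition m (map (\<lambda>i. [i]) [0..<m])" by (auto simp: is_partition_def)
  qed
  have c_inner: "multi_cauchy (E n) m ?F (local.inner_part n m)"
  proof -
    have "multi_cauchy (E n) m ?F (\<lambda>y vs. partition_term (\<lambda>i. DR n i (psi n y)) (\<lambda>i. Psi n i y) vs (map (\<lambda>i. [i]) [0..<m]))"
    proof (rule multi_cauchy_partition_term[OF parts(2) _ _ _ _ D(1)])
      show "\<forall>\<^sub>F y in ?F. multi_norm_le UNIV (length (map (\<lambda>i. [i]) [0..<m])) (DR n (length (map (\<lambda>i. [i]) [0..<m])) (psi n y)) D \<and>
         bounded_multilinear UNIV (length (map (\<lambda>i. [i]) [0..<m])) (DR n (length (map (\<lambda>i. [i]) [0..<m])) (psi n y))"
        using bDR[of m] m by simp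
      show "multi_cauchy UNIV (length (map (\<lambda>i. [i]) [0..<m])) ?F (\<lambda>y. DR n (length (map (\<lambda>i. [i]) [0..<m])) (psi n y))"
        using cDR[of m] m by simp
      fix b assume "b \<in> set (map (\<lambda>i. [i]) [0..<m])"
      then have "length b = 1" by auto
      then show "\<forall>\<^sub>F y in ?F. multi_norm_le (E n) (length b) (Psi n (length b) y) D" "multi_cauchy (E n) (length b) ?F (Psi n (length b))"
        using bPsi[of 1] cPsi[of 1] m by simp_all
    qed
    then have 1: "multi_cauchy (E n) m ?F (\<lambda>y vs. DR n m (psi n y) (map (\<lambda>v. Psi n 1 y [v]) vs))"
      by (rule multi_cauchy_cong) (rule partition_term_finest)
    have 2: "multi_cauchy (E n) m ?F (lower_derivs (DR n) (psi n) (Psi n) m)"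
    proof (rule multi_cauchy_lower_derivs[where C = D])
      fix j assume j: "1 \<le> j" "j < m"
      show "\<forall>\<^sub>F y in ?F. multi_norm_le UNIV j (DR n j (psi n y)) D \<and> bounded_multilinear UNIV j (DR n j (psi n y))"
        by (rule bDR) (use j m in simp_all)
      show "multi_cauchy UNIV j ?F (\<lambda>y. DR n j (psi n y))" by (rule cDR) (use j m in simp_all)
      show "\<forall>\<^sub>F y in ?F. multi_norm_le (E n) j (Psi n j y) D" by (rule bPsi) (use j m in simp_all)
      show "multi_cauchy (E n) j ?F (Psi n j)" by (rule cPsi) (use j m in simp_all)
    qed (use D(1) m in simp_all)
    show ?thesis using multi_cauchy_add[OF 1 2] by (simp add: inner_part_def[abs_def])
  qed
  obtain B where B: "1 \<le> B" "D \<le> B" "\<forall>\<^sub>F y in ?F. multi_norm_le (E n) m (local.inner_part n m y) B"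
  proof -
    define B1 where "B1 = D * D ^ m + length (lower_partitions m) * (D * D ^ m)"
    have "\<forall>\<^sub>F y in ?F. \<forall>i\<in>{1..m}. multi_norm_le (E n) i (Psi n i y) D \<and> multi_norm_le UNIV i (DR n i (psi n y)) D"
    proof (intro eventually_ball_finite ballI)
      fix i assume "i \<in> {1..m}"
      then show "\<forall>\<^sub>F y in ?F. multi_norm_le (E n) i (Psi n i y) D \<and> multi_norm_le UNIV i (DR n i (psi n y)) D"
        using eventually_conj[OF bPsi[of i] bDR[of i]] by (auto elim: eventually_mono)
    qed simp
    then have "\<forall>\<^sub>F y in ?F. multi_norm_le (E n) m (local.inner_part n m y) B1"
    proof eventually_elim
      case (elim y)
      have low: "multi_norm_le (E n) m (lower_derivs (DR n) (psi n) (Psi n) m y) (length (lower_partitions m) * (D * D ^ m))"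
        by (rule lower_derivs_bound) (use elim D in auto)
      show ?case unfolding multi_norm_le_def
      proof (intro allI impI, elim conjE)
        fix vs assume vs: "length vs = m" "set vs \<subseteq> E n"
        have "norm (partition_term (\<lambda>i. DR n i (psi n y)) (\<lambda>i. Psi n i y) vs (map (\<lambda>i. [i]) [0..<m])) \<le> D * D ^ m * prod_list (map norm vs)"
          by (rule partition_term_bound[OF parts(2) vs]) (use elim D m in auto)
        then have 1: "norm (DR n m (psi n y) (map (\<lambda>v. Psi n 1 y [v]) vs)) \<le> D * D ^ m * prod_list (map norm vs)"
          by (simp only: partition_term_finest[OF vs(1)])
        show "norm (local.inner_part n m y vs) \<le> B1 * prod_list (map norm vs)"
          unfolding inner_part_def B1_def using norm_triangle_mono[OF 1 multi_norm_leD[OF low vs]] by (simp add: algebra_simps)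
      qed
    qed
    then have ev: "\<forall>\<^sub>F y in ?F. multi_norm_le (E n) m (local.inner_part n m y) (max D B1)"
      by eventually_elim (erule multi_norm_le_mono, simp)
    show thesis by (rule that[of "max D B1"]) (use ev D in auto)
  qed
  have cRest: "multi_cauchy (E n) m ?F (Rest n m)"
  proof -
    \<comment> \<open>Only the single block of length \<open>m\<close> is evaluated, so
      \<open>inner_part\<close> can stand in for a whole family of inner derivatives.\<close>
    let ?A = "\<lambda>y vs. partition_term (\<lambda>i. DW (Suc n) i (im n y)) (\<lambda>i. local.inner_part n i y) vs [[0..<m]]"
    have "multi_cauchy (E n) m ?F ?A"
    proof (rule multi_cauchy_partition_term[OF parts(1) _ _ _ _ B(1)])
      have "\<forall>\<^sub>F y in ?F. multi_norm_le UNIV 1 (DW (Suc n) 1 (im n y)) D \<and> bounded_multilinear UNIV 1 (DW (Suc n) 1 (im n y))"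
        using m by (intro bDW) auto
      then have "\<forall>\<^sub>F y in ?F. multi_norm_le UNIV 1 (DW (Suc n) 1 (im n y)) B \<and> bounded_multilinear UNIV 1 (DW (Suc n) 1 (im n y))"
        by eventually_elim (auto elim: multi_norm_le_mono[OF _ B(2)])
      then show "\<forall>\<^sub>F y in ?F. multi_norm_le UNIV (length [[0..<m]]) (DW (Suc n) (length [[0..<m]]) (im n y)) B \<and>
          bounded_multilinear UNIV (length [[0..<m]]) (DW (Suc n) (length [[0..<m]]) (im n y))" by simp
      show "multi_cauchy UNIV (length [[0..<m]]) ?F (\<lambda>y. DW (Suc n) (length [[0..<m]]) (im n y))" using cDW[of 1] m by simp
      fix b assume "b \<in> set [[0..<m]]"
      then have "length b = m" by simp
      then show "\<forall>\<^sub>F y in ?F. multi_norm_le (E n) (length b) (local.inner_part n (length b) y) B" "multi_cauchy (E n) (length b) ?F (local.inner_part n (length b))"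
        using B(3) c_inner by simp_all
    qed
    then have 1: "multi_cauchy (E n) m ?F (\<lambda>y vs. DW (Suc n) 1 (im n y) [local.inner_part n m y vs])"
      by (rule multi_cauchy_cong) (rule partition_term_coarsest)
    have 2: "multi_cauchy (E n) m ?F (lower_derivs (DW (Suc n)) (im n) (Theta n) m)"
    proof (rule multi_cauchy_lower_derivs[where C = D])
      fix j assume j: "1 \<le> j" "j < m"
      show "\<forall>\<^sub>F y in ?F. multi_norm_le UNIV j (DW (Suc n) j (im n y)) D \<and> bounded_multilinear UNIV j (DW (Suc n) j (im n y))"
        by (rule bDW) (use j m in simp_all)
      show "multi_cauchy UNIV j ?F (\<lambda>y. DW (Suc n) j (im n y))" by (rule cDW) (use j m in simp_all)
      show "\<forall>\<^sub>F y in ?F. multi_norm_le (E n) j (Theta n j y) D" by (rule bTheta) (use j m in simp_all)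
      show "multi_cauchy (E n) j ?F (Theta n j)" by (rule cTheta) (use j m in simp_all)
    qed (use D(1) m in simp_all)
    show ?thesis using multi_cauchy_add[OF 1 2] by (simp add: Rest_def[abs_def])
  qed
  \<comment> \<open>The denominator collects the three errors that arise below: from
    \<open>coef\<close> times the bound \<open>C\<close>, from changing the arguments of
    \<open>DW\<close>, and from \<open>Rest\<close>. The factor \<open>K ^ m\<close> converts
    products of norms into products of \<open>N\<close>.\<close>
  define d1 where "d1 = d * \<tau>' / ((D * K * K + D * K + 1) * C * K ^ m + (D * m * D ^ m) * K ^ m + K ^ m)"
  let ?c = "(D * K * K + D * K + 1) * C * K ^ m + (D * m * D ^ m) * K ^ m + K ^ m"
  have c: "0 < ?c" using D C(1) K by (intro add_nonneg_pos add_nonneg_nonneg mult_nonneg_nonneg) auto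
  have d1: "0 < d1" "?c * d1 = d * \<tau>'" using d c \<tau>'_gt(2) by (auto simp: d1_def)
  have "\<forall>\<^sub>F u in ?F \<times>\<^sub>F ?F. multi_norm_le UNIV 1 (\<lambda>vs. DR n 1 (psi n (fst u)) vs - DR n 1 (psi n (snd u)) vs) d1"
    "\<forall>\<^sub>F u in ?F \<times>\<^sub>F ?F. multi_norm_le UNIV 1 (\<lambda>vs. DW (Suc n) 1 (im n (fst u)) vs - DW (Suc n) 1 (im n (snd u)) vs) d1"
    "\<forall>\<^sub>F u in ?F \<times>\<^sub>F ?F. multi_norm_le (E n) 1 (\<lambda>vs. Theta n 1 (fst u) vs - Theta n 1 (snd u) vs) d1"
    "\<forall>\<^sub>F u in ?F \<times>\<^sub>F ?F. multi_norm_le (E n) m (\<lambda>vs. Rest n m (fst u) vs - Rest n m (snd u) vs) d1"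
    using m cRest by (auto intro!: multi_cauchyD cDR cDW cTheta d1(1) simp del: One_nat_def)
  moreover have "\<forall>\<^sub>F u in ?F \<times>\<^sub>F ?F. multi_norm_le (E n) 1 (Theta n 1 (fst u)) D" "\<forall>\<^sub>F u in ?F \<times>\<^sub>F ?F. multi_norm_le (E n) 1 (Theta n 1 (snd u)) D"
    using bTheta[of 1] m by (auto intro: eventually_fst eventually_snd simp del: One_nat_def)
  moreover have "\<forall>\<^sub>F u in ?F \<times>\<^sub>F ?F. multi_norm_le UNIV m (DW (Suc n) m (im n (snd u))) D \<and> bounded_multilinear UNIV m (DW (Suc n) m (im n (snd u)))"
    using bDW[of m] m by (intro eventually_snd) auto
  moreover have "\<forall>\<^sub>F u in ?F \<times>\<^sub>F ?F. multi_norm_le UNIV 1 (DW (Suc n) 1 (im n (snd u))) D"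
    using bDW[of 1] m by (intro eventually_snd[where P = "\<lambda>y. multi_norm_le UNIV 1 (DW (Suc n) 1 (im n y)) D"]) (auto elim: eventually_mono)
  ultimately show "\<forall>\<^sub>F u in ?F \<times>\<^sub>F ?F. N_le n m (\<lambda>vs. Dq n m (fst u) vs - Dq n m (snd u) vs) (\<sigma>' ^ m / \<tau>' * \<omega> + d)"
    using oscillation_phi[OF osc p] eventually_fst[OF eventually_slab[OF p]] eventually_snd[OF eventually_slab[OF p]]
  proof eventually_elim
    case (elim u)
    obtain y y' where u: "u = (y, y')" by (cases u)
    have yb: "y \<in> slab n" "y' \<in> slab n" and yV: "y \<in> V n" "y' \<in> V n" using elim u slab_V by auto
    show ?case unfolding N_le_def
    proof (intro allI impI, elim conjE)
      fix vs assume vs: "length vs = m" "set vs \<subseteq> E n"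
      let ?p = "prod_list (map norm vs)" and ?\<Pi> = "prod_list (map (N n) vs)"
      let ?W = "\<lambda>y. DW (Suc n) m (im n y)" and ?t = "\<lambda>y. map (\<lambda>v. Theta n 1 y [v]) vs"
      let ?D = "Dq n m y vs - Dq n m y' vs"
      have p0: "0 \<le> ?p" "0 \<le> ?\<Pi>" "?p \<le> K ^ m * ?\<Pi>"
        using prod_list_norm_nonneg prod_N_nonneg norms_le_N[OF vs(2)] vs(1) by auto
      have X1: "\<bar>?W y (?t y) - ?W y' (?t y)\<bar> \<le> \<omega> * \<sigma>' ^ m * ?\<Pi>"
      proof -
        have "N_le (Suc n) m (\<lambda>vs. Dq (Suc n) m (phi n y) vs - Dq (Suc n) m (phi n y') vs) \<omega>" using elim by (simp add: u)
        from DW_pull[OF m(1) this \<omega> yV(1) vs] show ?thesis unfolding DW_ge2[OF m(1)] phi_im[symmetric] by (simp add: abs_minus_commute)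
      qed
      have X2: "\<bar>?W y' (?t y) - ?W y' (?t y')\<bar> \<le> D * m * D ^ m * d1 * ?p"
      proof -
        have "norm (?W y' (?t y) - ?W y' (?t y')) \<le> D * length vs * D ^ length vs * d1 * prod_list (map norm vs)"
        proof (rule multilinear_list_diff)
          fix v assume "v \<in> set vs"
          then have v: "v \<in> E n" using vs by auto
          show "norm (Theta n 1 y [v]) \<le> D * norm v" "norm (Theta n 1 y' [v]) \<le> D * norm v"
            using multi_norm_leD[OF elim(5), of "[v]"] multi_norm_leD[OF elim(6), of "[v]"] v by (simp_all add: u)
          show "norm (Theta n 1 y [v] - Theta n 1 y' [v]) \<le> d1 * norm v"
            using multi_norm_leD[OF elim(3), of "[v]"] v by (simp add: u)
        qed (use elim D d1 vs in \<open>auto simp: u\<close>)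
        then show ?thesis using vs by simp
      qed
      have Rs: "\<bar>Rest n m y vs - Rest n m y' vs\<bar> \<le> d1 * ?p"
        using multi_norm_leD[OF elim(4) vs] by (simp add: u)
      have cf: "\<bar>coef n y - coef n y'\<bar> \<le> (D * K * K + D * K + 1) * d1"
      proof -
        let ?b = "DR n 1 (psi n y) [e n]" and ?b' = "DR n 1 (psi n y') [e n]"
        have b: "norm ?b \<le> K * K" using DR1_bound[OF psi_near(2)[OF V_S[OF yV(1)]], of "e n"] e_bound[of n] K
          by (meson mult_left_mono order_trans zero_le_one)
        have "norm (?b + (-1) *\<^sub>R ?b') \<le> d1 * norm (e n)" using multi_norm_leD[OF elim(1), of "[e n]"] by (simp add: u)
        also have "\<dots> \<le> d1 * K" using e_bound d1 by (intro mult_left_mono) auto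
        finally have b': "norm (?b + (-1) *\<^sub>R ?b') \<le> d1 * K" .
        have "\<bar>DW (Suc n) 1 (im n y) [?b] - DW (Suc n) 1 (im n y') [?b]\<bar> \<le> d1 * norm ?b"
          using multi_norm_leD[OF elim(2), of "[?b]"] by (simp add: u)
        also have "\<dots> \<le> d1 * (K * K)" using b d1 by (intro mult_left_mono) auto
        finally have 1: "\<bar>DW (Suc n) 1 (im n y) [?b] - DW (Suc n) 1 (im n y') [?b]\<bar> \<le> d1 * (K * K)" .
        have "\<bar>DW (Suc n) 1 (im n y') [?b + (-1) *\<^sub>R ?b']\<bar> \<le> D * norm (?b + (-1) *\<^sub>R ?b')"
          using multi_norm_leD[OF elim(8), of "[?b + (-1) *\<^sub>R ?b']"] by (simp add: u)
        also have "\<dots> \<le> D * (d1 * K)" using b' D by (intro mult_left_mono) auto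
        finally have 2: "\<bar>DW (Suc n) 1 (im n y') [?b] - DW (Suc n) 1 (im n y') [?b']\<bar> \<le> D * (d1 * K)"
          unfolding DW1_linear[OF yV(2)] by simp
        have "1 * (d1 * (K * K)) \<le> D * (d1 * (K * K))" using D d1 K by (intro mult_right_mono) auto
        moreover have "\<bar>coef n y - coef n y'\<bar> \<le> d1 * (K * K) + D * (d1 * K)" unfolding coef_def using 1 2 by linarith
        ultimately show ?thesis using d1 by (simp add: algebra_simps)
      qed
      have Cy': "\<bar>Dq n m y' vs\<bar> \<le> C * ?p" using multi_norm_leD[OF C(2)[OF _ _ yb(2)] vs] m by simp
      have eq: "coef n y * ?D = - (?W y (?t y) - ?W y' (?t y)) - (?W y' (?t y) - ?W y' (?t y')) - (Rest n m y vs - Rest n m y' vs)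
          - (coef n y - coef n y') * Dq n m y' vs"
        using equation_ge2[OF m yV(1) vs] equation_ge2[OF m yV(2) vs] by (simp add: algebra_simps)
      have cD: "\<bar>(coef n y - coef n y') * Dq n m y' vs\<bar> \<le> ((D * K * K + D * K + 1) * d1) * (C * ?p)"
        unfolding abs_mult using cf Cy' D K d1 by (intro mult_mono) auto
      have "\<tau>' * \<bar>?D\<bar> \<le> \<bar>coef n y * ?D\<bar>" unfolding abs_mult by (intro mult_right_mono coef_bound yV) auto
      also have "\<dots> \<le> \<omega> * \<sigma>' ^ m * ?\<Pi> + D * m * D ^ m * d1 * ?p + d1 * ?p + ((D * K * K + D * K + 1) * d1) * (C * ?p)"
        unfolding eq using X1 X2 Rs cD by linarith
      also have "\<dots> = \<omega> * \<sigma>' ^ m * ?\<Pi> + ((D * m * D ^ m + 1 + (D * K * K + D * K + 1) * C) * d1) * ?p" by (simp add: algebra_simps)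
      also have "\<dots> \<le> \<omega> * \<sigma>' ^ m * ?\<Pi> + ((D * m * D ^ m + 1 + (D * K * K + D * K + 1) * C) * d1) * (K ^ m * ?\<Pi>)"
        using p0 D K C(1) d1 by (intro add_left_mono mult_left_mono) auto
      also have "\<dots> = \<omega> * \<sigma>' ^ m * ?\<Pi> + (?c * d1) * ?\<Pi>" by (simp add: algebra_simps)
      also have "\<dots> = \<tau>' * ((\<sigma>' ^ m / \<tau>' * \<omega> + d) * ?\<Pi>)" unfolding d1(2) using \<tau>'_gt(2) by (simp add: field_simps)
      finally have "\<bar>?D\<bar> \<le> (\<sigma>' ^ m / \<tau>' * \<omega> + d) * ?\<Pi>" using \<tau>'_gt(2) by simp
      then show "\<bar>Dq n m (fst u) vs - Dq n m (snd u) vs\<bar> \<le> (\<sigma>' ^ m / \<tau>' * \<omega> + d) * ?\<Pi>" by (simp add: u)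
    qed
  qed
qed

theorem derivs_cauchy: "1 \<le> m \<Longrightarrow> m \<le> k \<Longrightarrow> p \<in> edge n \<Longrightarrow> multi_cauchy (E n) m (fl n p) (Dq n m)"
proof (induction m arbitrary: n p rule: less_induct)
  case (less m)
  show ?case
  proof (rule oscillation_vanishes[OF less.prems(1,2) _ less.prems(3)])
    fix \<omega> d :: real assume *: "0 \<le> \<omega>" "0 < d" "oscillation_le m \<omega>"
    show "oscillation_le m (\<sigma>' ^ m / \<tau>' * \<omega> + d)"
    proof (cases "m = 1")
      case True
      then show ?thesis using oscillation_step_1[OF *(1,2)] *(3) by simp
    next
      case False
      then have m: "2 \<le> m" using less.prems by simp
      show ?thesis
        by (rule oscillation_step[OF m less.prems(2) _ *]) (use less.IH less.prems(2) in auto)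
    qed
  qed
qed

end

context graph_cocycle
begin

text \<open>The rate inequalities are strict, so they persist for small \<epsilon> by continuity;
  the uniform continuity of the first derivatives at the orbit then provides \<rho>, and \<rho>
  provides \<open>r\<close>.\<close>

theorem derivs_cauchy_at_boundary:
  "\<exists>\<rho>>0. \<rho> \<le> \<delta> \<and> (\<forall>n m p. 1 \<le> m \<and> m \<le> k \<and> p \<in> E n \<and> f n p = 0 \<and> norm p < \<rho> \<longrightarrow>
      multi_cauchy (E n) m (at p within {y \<in> E n. 0 < f n y \<and> norm y < \<delta>}) (Dq n m))"
proof -
  have "((\<lambda>h. (\<tau> - K * K * (1 + P) * h) - (\<sigma> + 2 * K * K * P * P * h) ^ k) \<longlongrightarrow>
      (\<tau> - K * K * (1 + P) * 0) - (\<sigma> + 2 * K * K * P * P * 0) ^ k) (at_right 0)" by (intro tendsto_intros)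
  then have 1: "\<forall>\<^sub>F h in at_right 0. 0 < (\<tau> - K * K * (1 + P) * h) - (\<sigma> + 2 * K * K * P * P * h) ^ k"
    by (rule order_tendstoD(1)) (use rates in simp)
  have "((\<lambda>h. \<nu> - K * K * h) \<longlongrightarrow> \<nu> - K * K * 0) (at_right 0)" by (intro tendsto_intros)
  then have 2: "\<forall>\<^sub>F h in at_right 0. 1 < \<nu> - K * K * h" using rates by (intro order_tendstoD(1)[of _ _ _ 1]) auto
  have "((\<lambda>h. \<kappa> + 2 * K * K * P * h) \<longlongrightarrow> \<kappa> + 2 * K * K * P * 0) (at_right 0)" by (intro tendsto_intros)
  then have 3: "\<forall>\<^sub>F h in at_right 0. \<kappa> + 2 * K * K * P * h < 1" using rates by (intro order_tendstoD(2)[of _ _ _ 1]) auto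
  have "\<forall>\<^sub>F h in at_right (0::real). 0 < h \<and> h < 1" unfolding eventually_at_right_field by (intro exI[of _ 1]) auto
  with 1 2 3 have "\<forall>\<^sub>F h in at_right 0. 0 < h \<and> h \<le> 1 \<and> (\<sigma> + 2 * K * K * P * P * h) ^ k < \<tau> - K * K * (1 + P) * h \<and>
      1 < \<nu> - K * K * h \<and> \<kappa> + 2 * K * K * P * h < 1" by eventually_elim auto
  then obtain \<epsilon> where eps: "0 < \<epsilon>" "\<epsilon> \<le> 1" "(\<sigma> + 2 * K * K * P * P * \<epsilon>) ^ k < \<tau> - K * K * (1 + P) * \<epsilon>"
      "1 < \<nu> - K * K * \<epsilon>" "\<kappa> + 2 * K * K * P * \<epsilon> < 1"
    using eventually_happens'[OF trivial_limit_at_right_real] by blast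
  obtain r1 where r1: "0 < r1" "\<And>n z. z \<in> ball (x n) \<delta> \<inter> {z. 0 \<le> f n z} \<Longrightarrow> norm (z - x n) < r1 \<Longrightarrow>
        multi_norm_le UNIV 1 (\<lambda>vs. DR n 1 z vs - DR n 1 (x n) vs) \<epsilon>"
    using R_unif[OF eps(1)] by blast
  \<comment> \<open>Dividing by the sum of the two factors meets both requirements on \<rho> at
    once.\<close>
  define c where "c = 2 * P + (K + 1) * P * P"
  define \<rho> where "\<rho> = min \<delta> r1 / c"
  have c: "0 < 2 * P" "0 < (K + 1) * P * P" "0 < c" using P_ge K by (auto simp: c_def intro!: add_pos_pos mult_pos_pos)
  have \<rho>: "0 < \<rho>" using \<delta> r1 c by (simp add: \<rho>_def)
  have "2 * P * \<rho> \<le> c * \<rho>" "(K + 1) * P * P * \<rho> \<le> c * \<rho>"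
    using c \<rho> by (intro mult_right_mono; simp add: c_def)+
  moreover have "c * \<rho> = min \<delta> r1" using c by (simp add: \<rho>_def)
  ultimately have le: "2 * P * \<rho> \<le> \<delta>" "2 * P * \<rho> \<le> r1" "(K + 1) * P * P * \<rho> \<le> \<delta>" by linarith+
  define r where "r = \<rho> / (4 * K)"
  have r: "0 < r" "2 * K * r < \<rho>" using \<rho> K by (auto simp: r_def)
  interpret small_cocycle E e s x g f w a b R DR q Dq k \<delta> \<kappa> \<nu> \<sigma> \<tau> K \<epsilon> \<rho> r
  proof unfold_locales
    fix z n assume "z \<in> H n" "norm (z - x n) < 2 * P * \<rho>"
    then show "multi_norm_le UNIV 1 (\<lambda>vs. DR n 1 z vs - DR n 1 (x n) vs) \<epsilon>"
      using r1(2)[of z n] le(2) by (simp add: H_def)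
  qed (use eps \<rho> le r in simp_all)
  show ?thesis
  \<comment> \<open>The radius \<open>r / K\<close> puts the points with \<open>f n p = 0\<close>
    into \<open>edge\<close>, as \<open>w n p \<le> K * norm p\<close>.\<close>
  proof (intro exI[of _ "min \<delta> (r / K)"] conjI allI impI; (elim conjE)?)
    show "0 < min \<delta> (r / K)" "min \<delta> (r / K) \<le> \<delta>" using \<delta> r K by auto
    fix n m p assume *: "1 \<le> m" "m \<le> k" "p \<in> E n" "f n p = 0" "norm p < min \<delta> (r / K)"
    have "w n p \<le> K * norm p" by (rule w_bound)
    also have "\<dots> < r" using * K by (simp add: field_simps)
    finally have "p \<in> edge n" using * by (simp add: edge_def)
    from derivs_cauchy[OF *(1,2) this] show "multi_cauchy (E n) m (at p within {y \<in> E n. 0 < f n y \<and> norm y < \<delta>}) (Dq n m)"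
      by (simp add: fl_def S0_def)
  qed
qed

end

section \<open>Coordinates for the splitting\<close>

text \<open>The estimate serves twice: applied to the difference of two decompositions it gives
  uniqueness, hence linearity of the coordinate, and applied to a single one it gives
  continuity.\<close>

lemma coordinate_functional:
  fixes E :: "'a::real_normed_vector set"
  assumes E: "subspace E" and dec: "\<And>z. \<exists>t. z - t *\<^sub>R e \<in> E"
    and bound: "\<And>v t. v \<in> E \<Longrightarrow> \<bar>t\<bar> \<le> K * norm (v + t *\<^sub>R e)" and e: "e \<noteq> 0"
  obtains g where "bounded_linear g" "\<And>u. \<bar>g u\<bar> \<le> K * norm u" "\<And>u. u - g u *\<^sub>R e \<in> E"
    "\<And>v t. v \<in> E \<Longrightarrow> g (v + t *\<^sub>R e) = t"
proof -
  from dec obtain g where g: "\<And>z. z - g z *\<^sub>R e \<in> E" by metis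
  have uniq: "g (v + t *\<^sub>R e) = t" if "v \<in> E" for v t
  proof -
    have "(v + t *\<^sub>R e - g (v + t *\<^sub>R e) *\<^sub>R e) - v \<in> E" by (intro subspace_diff E g that)
    then have "(t - g (v + t *\<^sub>R e)) *\<^sub>R e \<in> E" by (simp add: algebra_simps)
    from bound[OF subspace_neg[OF E this], of "t - g (v + t *\<^sub>R e)"] show ?thesis by simp
  qed
  have bd: "\<bar>g u\<bar> \<le> K * norm u" for u using bound[OF g, of "g u" u] by simp
  have "linear g"
  proof
    fix u v t
    have "g ((u - g u *\<^sub>R e + (v - g v *\<^sub>R e)) + (g u + g v) *\<^sub>R e) = g u + g v"
      by (rule uniq[OF subspace_add[OF E g g]])
    then show "g (u + v) = g u + g v" by (simp add: algebra_simps)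
    have "g (t *\<^sub>R (u - g u *\<^sub>R e) + (t * g u) *\<^sub>R e) = t * g u" by (rule uniq[OF subspace_scale[OF E g]])
    then show "g (t *\<^sub>R u) = t *\<^sub>R g u" by (simp add: algebra_simps)
  qed
  then have "bounded_linear g"
    by (intro bounded_linear.intro bounded_linear_axioms.intro exI[of _ K]) (use bd in \<open>auto simp: mult.commute\<close>)
  then show thesis using that bd g uniq by blast
qed

text \<open>The coordinate along \<open>- v\<close> is positive on \<open>Dm\<close>. Its continuity
  comes from the positive distance \<open>d\<close> of \<open>v\<close> to the closed
  subspace.\<close>

lemma half_space_functional:
  fixes D0 :: "'a::real_normed_vector set"
  assumes "closed D0" "subspace D0" "half_spaces D0 Dm Dp"
  obtains F v where "bounded_linear F" "\<And>z. F z = 0 \<longleftrightarrow> z \<in> D0" "\<And>z. 0 < F z \<longleftrightarrow> z \<in> Dm" "\<And>z. z - F z *\<^sub>R v \<in> D0"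
proof -
  obtain v where v: "v \<notin> D0" "Dm = {u - t *\<^sub>R v |u t. u \<in> D0 \<and> 0 < t}" "Dp = {u + t *\<^sub>R v |u t. u \<in> D0 \<and> 0 < t}"
    "UNIV = D0 \<union> Dm \<union> Dp"
    using assms(3) unfolding half_spaces_def by blast
  define d where "d = infdist v D0"
  have ne: "D0 \<noteq> {}" using subspace_0[OF assms(2)] by blast
  have d: "0 < d"
    using in_closed_iff_infdist_zero[OF assms(1) ne, of v] v(1) infdist_nonneg[of v D0] by (simp add: d_def less_le)
  have v0: "- v \<noteq> 0" using v(1) subspace_0[OF assms(2)] by auto
  have dec: "\<exists>t. z - t *\<^sub>R (- v) \<in> D0" for z
  proof -
    have "z \<in> D0 \<union> Dm \<union> Dp" using v(4) by blast
    then consider "z \<in> D0" | u t where "u \<in> D0" "z = u - t *\<^sub>R v" | u t where "u \<in> D0" "z = u + t *\<^sub>R v"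
      unfolding v(2,3) by blast
    then show ?thesis
    proof cases
      case 1
      then show ?thesis by (intro exI[of _ 0]) simp
    next
      case 2
      then show ?thesis by (intro exI[of _ t]) simp
    next
      case 3
      then show ?thesis by (intro exI[of _ "-t"]) simp
    qed
  qed
  have bound: "\<bar>t\<bar> \<le> 1 / d * norm (u + t *\<^sub>R (- v))" if u: "u \<in> D0" for u t
  proof (cases "t = 0")
    case True
    then show ?thesis using d by simp
  next
    case False
    have "d \<le> dist v ((1 / t) *\<^sub>R u)" unfolding d_def by (intro infdist_le subspace_scale assms u)
    also have "\<dots> = norm (u + t *\<^sub>R (- v)) / \<bar>t\<bar>"
    proof -
      have "v - (1 / t) *\<^sub>R u = (- (1 / t)) *\<^sub>R (u + t *\<^sub>R (- v))" using False by (simp add: algebra_simps)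
      then show ?thesis by (simp add: dist_norm)
    qed
    finally show ?thesis using d False by (simp add: field_simps)
  qed
  from coordinate_functional[OF assms(2) dec bound v0]
  obtain F where F: "bounded_linear F" "\<And>u. u - F u *\<^sub>R (- v) \<in> D0" "\<And>u t. u \<in> D0 \<Longrightarrow> F (u + t *\<^sub>R (- v)) = t" by metis
  have F0: "F u = 0" if "u \<in> D0" for u using F(3)[OF that, of 0] by simp
  have ker: "F z = 0 \<longleftrightarrow> z \<in> D0" for z using F(2)[of z] F0[of z] by auto
  have pos: "0 < F z \<longleftrightarrow> z \<in> Dm" for z
  proof
    assume "0 < F z"
    then show "z \<in> Dm" unfolding v(2) using F(2)[of z] by (intro CollectI exI[of _ "z - F z *\<^sub>R (- v)"] exI[of _ "F z"]) simp
  next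
    assume "z \<in> Dm"
    then obtain u t where "u \<in> D0" "0 < t" "z = u - t *\<^sub>R v" unfolding v(2) by blast
    then show "0 < F z" using F(3)[of u t] by simp
  qed
  show thesis by (rule that[OF F(1) ker pos, of "- v"]) (rule F(2))
qed

text \<open>The quotient of consecutive geometric means telescopes. Rescaling \<open>u\<close> by
  \<Omega> thus turns the mean growth over \<open>N\<close> steps into growth in each single step,
  while \<Omega> stays comparable to the norm.\<close>

lemma geometric_mean_scale:
  fixes u :: "nat \<Rightarrow> 'a::real_normed_vector"
  assumes N: "0 < N" and u: "\<And>n. u n \<noteq> 0" and cC: "0 < c" "0 < C"
    and bounds: "\<And>n i. i < N \<Longrightarrow> c * norm (u n) \<le> norm (u (n + i)) \<and> norm (u (n + i)) \<le> C * norm (u n)"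
  defines "\<Omega> \<equiv> \<lambda>n. root N (\<Prod>i<N. norm (u (n + i)))"
  shows "0 < \<Omega> n" "c * norm (u n) \<le> \<Omega> n" "\<Omega> n \<le> C * norm (u n)"
    "\<Omega> (Suc n) = root N (norm (u (n + N)) / norm (u n)) * \<Omega> n"
proof -
  have pos: "0 < norm (u n)" for n using u by simp
  have prod_pos: "0 < (\<Prod>i<N. norm (u (n + i)))" for n using pos by (intro prod_pos) auto
  show "0 < \<Omega> n" unfolding \<Omega>_def using N prod_pos by simp
  have "(c * norm (u n)) ^ N = (\<Prod>i<N. c * norm (u n))" by simp
  also have "\<dots> \<le> (\<Prod>i<N. norm (u (n + i)))" using bounds cC by (intro prod_mono) auto
  finally have "root N ((c * norm (u n)) ^ N) \<le> \<Omega> n" unfolding \<Omega>_def using N by (intro real_root_le_mono) auto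
  then show "c * norm (u n) \<le> \<Omega> n" using N cC by (simp add: real_root_power_cancel)
  have "(\<Prod>i<N. norm (u (n + i))) \<le> (\<Prod>i<N. C * norm (u n))" using bounds by (intro prod_mono) auto
  also have "\<dots> = (C * norm (u n)) ^ N" by simp
  finally have "\<Omega> n \<le> root N ((C * norm (u n)) ^ N)" unfolding \<Omega>_def using N by (intro real_root_le_mono) auto
  then show "\<Omega> n \<le> C * norm (u n)" using N cC by (simp add: real_root_power_cancel)
  have "norm (u n) * (\<Prod>i<N. norm (u (Suc n + i))) = (\<Prod>i<Suc N. norm (u (n + i)))"
    by (subst prod.lessThan_Suc_shift) simp
  also have "\<dots> = (\<Prod>i<N. norm (u (n + i))) * norm (u (n + N))" by simp
  finally have "(\<Prod>i<N. norm (u (Suc n + i))) = norm (u (n + N)) / norm (u n) * (\<Prod>i<N. norm (u (n + i)))"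
    using pos[of n] by (simp add: field_simps)
  then show "\<Omega> (Suc n) = root N (norm (u (n + N)) / norm (u n)) * \<Omega> n"
    unfolding \<Omega>_def by (simp only: real_root_mult)
qed

text \<open>The quotient is constant on the line except at \<open>0\<close>, where it is
  \<open>0 / 0 = 0\<close> and does not affect the supremum.\<close>

lemma norm_on_line:
  fixes L :: "'a::real_normed_vector \<Rightarrow> 'a"
  assumes "linear L" "u \<noteq> 0" "V = range (\<lambda>t. t *\<^sub>R u)"
  shows "norm_on L V = norm (L u) / norm u"
proof -
  have *: "norm (L v) / norm v = (if v = 0 then 0 else norm (L u) / norm u)" if "v \<in> V" for v
    using that assms by (auto simp: linear_cmul linear_0)
  have uV: "u \<in> V" using assms(3) by (auto intro: range_eqI[of _ _ 1])
  show ?thesis unfolding norm_on_def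
  proof (rule cSup_eq_maximum)
    show "norm (L u) / norm u \<in> (\<lambda>v. norm (L v) / norm v) ` V" using uV by blast
    fix y assume "y \<in> (\<lambda>v. norm (L v) / norm v) ` V"
    then show "y \<le> norm (L u) / norm u" using * by auto
  qed
qed

section \<open>Linear cocycles and expansion rates along lines\<close>

lemma compose_from_Suc': "compose_from A m (Suc j) = compose_from A (Suc m) j \<circ> A m"
  by (induction j) (auto simp: fun_eq_iff)

lemma compose_from_linear:
  assumes "\<And>n. linear (A n)"
  shows "linear (compose_from A n j)"
proof (induction j)
  case 0
  then show ?case by (simp only: compose_from.simps linear_id)
next
  case (Suc j)
  then show ?case unfolding compose_from.simps by (rule linear_compose[OF _ assms])
qed

lemma compose_from_orbit:
  assumes "\<And>n. u (Suc n) = A n (u n)"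
  shows "compose_from A n j (u n) = u (n + j)"
  by (induction j) (auto simp: assms)

lemma max_expansion_rate_line:
  fixes A :: "nat \<Rightarrow> 'a::real_normed_vector \<Rightarrow> 'a"
  assumes "\<And>n. linear (A n)" "\<And>n. u (Suc n) = A n (u n)" "\<And>n. u n \<noteq> 0" "\<And>n. V n = range (\<lambda>t. t *\<^sub>R u n)"
    and "max_expansion_rate A V = ereal lam" "lam < \<sigma>"
  shows "\<forall>\<^sub>F N in sequentially. \<forall>n. root N (norm (u (n + N)) / norm (u n)) \<le> \<sigma>"
proof -
  have "Limsup sequentially (\<lambda>n. SUP m. ereal (root n (norm_on (compose_from A m n) (V m)))) < ereal \<sigma>"
    using assms(5,6) unfolding max_expansion_rate_def by simp
  from Limsup_lessD[OF this] show ?thesis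
  proof eventually_elim
    case (elim N)
    show ?case
    proof
      fix n
      have "ereal (root N (norm_on (compose_from A n N) (V n))) < ereal \<sigma>" by (rule SUP_lessD[OF elim UNIV_I])
      then show "root N (norm (u (n + N)) / norm (u n)) \<le> \<sigma>"
        by (simp add: norm_on_line[OF compose_from_linear[OF assms(1)] assms(3,4)] compose_from_orbit[where u = u and A = A, OF assms(2)])
    qed
  qed
qed

lemma min_expansion_rate_line:
  fixes A :: "nat \<Rightarrow> 'a::real_normed_vector \<Rightarrow> 'a"
  assumes "\<And>n. linear (A n)" "\<And>n. u (Suc n) = A n (u n)" "\<And>n. u n \<noteq> 0" "\<And>n. V n = range (\<lambda>t. t *\<^sub>R u n)"
    and "min_expansion_rate A V = ereal lam" "\<tau> < lam"
  shows "\<forall>\<^sub>F N in sequentially. \<forall>n. \<tau> \<le> root N (norm (u (n + N)) / norm (u n))"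
proof -
  have "ereal \<tau> < Liminf sequentially (\<lambda>n. INF m. ereal (root n (norm_on (compose_from A m n) (V m))))"
    using assms(5,6) unfolding min_expansion_rate_def by simp
  from less_LiminfD[OF this] show ?thesis
  proof eventually_elim
    case (elim N)
    show ?case
    proof
      fix n
      have "ereal \<tau> < ereal (root N (norm_on (compose_from A n N) (V n)))" by (rule less_INF_D[OF elim UNIV_I])
      then show "\<tau> \<le> root N (norm (u (n + N)) / norm (u n))"
        by (simp add: norm_on_line[OF compose_from_linear[OF assms(1)] assms(3,4)] compose_from_orbit[where u = u and A = A, OF assms(2)])
    qed
  qed
qed

text \<open>The linear part of the problem: \<open>A n\<close> stands for the derivative of
  \<open>R n\<close> at \<open>x n\<close>, \<open>us\<close> and \<open>hs\<close> are orbits of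
  vectors spanning \<xi> and \<eta>, and \<open>F\<close> is a functional that measures the position
  relative to \<open>D0\<close>.\<close>

locale linear_splitting =
  fixes A :: "nat \<Rightarrow> 'a::real_normed_vector \<Rightarrow> 'a" and D0 :: "'a set" and F :: "'a \<Rightarrow> real" and v0 :: 'a
    and l \<xi> \<eta> :: "nat \<Rightarrow> 'a set" and us hs :: "nat \<Rightarrow> 'a" and k :: nat and C0 lam1 lam2 :: real
  assumes A_lin: "linear (A n)" and A_bound: "norm (A n v) \<le> C0 * norm v" and C0: "1 \<le> C0"
    and D0: "subspace D0" and F: "bounded_linear F" and F_ker: "F z = 0 \<longleftrightarrow> z \<in> D0" and F_dec: "z - F z *\<^sub>R v0 \<in> D0"
    and A_D0: "v \<in> D0 \<Longrightarrow> A n v \<in> D0"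
    and us: "us (Suc n) = A n (us n)" "us 0 \<noteq> 0" "\<xi> n = range (\<lambda>t. t *\<^sub>R us n)"
    and hs: "hs (Suc n) = A n (hs n)" "hs 0 \<noteq> 0" "\<eta> n = range (\<lambda>t. t *\<^sub>R hs n)" "hs 0 \<in> D0"
    and l: "l (Suc n) = A n ` l n" "l 0 \<subseteq> D0"
    and stable: "stable_distribution A l" and unstable: "unstable_distribution A (\<lambda>n. \<xi> n + \<eta> n)"
    and transversal: "uniformly_transversal \<xi> D0"
    and rates: "min_expansion_rate A \<eta> = ereal lam1" "max_expansion_rate A \<xi> = ereal lam2"
      "lam1 > lam2" "real k < ln lam1 / ln lam2" and k: "1 \<le> k"
    and codim: "codim_one (l n + \<xi> n)"
begin

lemma in_xi_eta: "t *\<^sub>R us n + t' *\<^sub>R hs n \<in> \<xi> n + \<eta> n"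
  unfolding us(3) hs(3) by (intro set_plus_intro rangeI)

lemma us_mem: "us n \<in> \<xi> n + \<eta> n" and hs_mem: "hs n \<in> \<xi> n + \<eta> n"
  using in_xi_eta[of 1 n 0] in_xi_eta[of 0 n 1] by simp_all

lemma orbit: "compose_from A n j (us n) = us (n + j)" "compose_from A n j (hs n) = hs (n + j)"
  using compose_from_orbit[of us A] compose_from_orbit[of hs A] us(1) hs(1) by auto

lemma compose_bound: "norm (compose_from A n j v) \<le> C0 ^ j * norm v"
proof (induction j)
  case (Suc j)
  have "norm (compose_from A n (Suc j) v) \<le> C0 * norm (compose_from A n j v)" using A_bound by simp
  also have "\<dots> \<le> C0 * (C0 ^ j * norm v)" using Suc C0 by (intro mult_left_mono) auto
  finally show ?case by simp
qed simp

lemma expansion: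
  obtains c \<nu> where "0 < c" "1 < \<nu>" "\<And>n j v. v \<in> \<xi> n + \<eta> n \<Longrightarrow> c * \<nu> ^ j * norm v \<le> norm (compose_from A n j v)"
  using unstable unfolding unstable_distribution_def by blast

lemma contraction:
  obtains C \<mu> where "0 < C" "0 < \<mu>" "\<mu> < 1" "\<And>n j v. v \<in> l n \<Longrightarrow> norm (compose_from A n j v) \<le> C * \<mu> ^ j * norm v"
  using stable unfolding stable_distribution_def by blast

lemma nonzero: "us n \<noteq> 0" "hs n \<noteq> 0"
proof -
  obtain c \<nu> where c: "0 < c" "1 < \<nu>" "\<And>n j v. v \<in> \<xi> n + \<eta> n \<Longrightarrow> c * \<nu> ^ j * norm v \<le> norm (compose_from A n j v)"
    using expansion by blast
  have "0 < c * \<nu> ^ n * norm (us 0)" "0 < c * \<nu> ^ n * norm (hs 0)" using c us(2) hs(2) by simp_all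
  then show "us n \<noteq> 0" "hs n \<noteq> 0"
    using c(3)[OF us_mem[of 0], of n] c(3)[OF hs_mem[of 0], of n] orbit[of 0 n] by auto
qed

lemma subspace_l: "subspace (l n)"
  using stable unfolding stable_distribution_def invariant_distribution_def by blast

lemma in_D0: "hs n \<in> D0" "l n \<subseteq> D0"
proof -
  show "hs n \<in> D0" by (induction n) (auto simp: hs A_D0)
  show "l n \<subseteq> D0" by (induction n) (use l A_D0 in auto)
qed

text \<open>A number \<open>N\<close> of steps is chosen over which the mean growth already shows
  the asymptotic rates. The constant of the unstable distribution disappears since its
  \<open>N\<close>-th root tends to \<open>1\<close>. Turning the quotient of logarithms into
  \<open>lam2 ^ k < lam1\<close> requires \<open>1 < lam2\<close>, which holds because vectors of
  \<xi> expand.\<close>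

lemma rates_one_step:
  obtains N \<nu> \<sigma> \<tau> where "0 < N" "1 < \<nu>" "\<sigma> ^ k < \<tau>"
    "\<And>n. \<nu> \<le> root N (norm (us (n + N)) / norm (us n))" "\<And>n. root N (norm (us (n + N)) / norm (us n)) \<le> \<sigma>"
    "\<And>n. \<tau> \<le> root N (norm (hs (n + N)) / norm (hs n))"
proof -
  obtain c \<nu> where c: "0 < c" "1 < \<nu>" "\<And>n j v. v \<in> \<xi> n + \<eta> n \<Longrightarrow> c * \<nu> ^ j * norm v \<le> norm (compose_from A n j v)"
    using expansion by blast
  \<comment> \<open>A rate strictly between \<open>1\<close> and \<nu> leaves room for the factor
    \<open>root N c\<close>.\<close>
  define \<nu>1 where "\<nu>1 = (1 + \<nu>) / 2"
  have \<nu>1: "1 < \<nu>1" "\<nu>1 < \<nu>" using c by (auto simp: \<nu>1_def)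
  have "(\<lambda>N. root N c * \<nu>) \<longlonglongrightarrow> 1 * \<nu>" using c by (intro tendsto_intros LIMSEQ_root_const)
  then have "\<forall>\<^sub>F N in sequentially. \<nu>1 < root N c * \<nu>" using \<nu>1 by (intro order_tendstoD(1)[of _ "1 * \<nu>"]) auto
  moreover have "\<forall>\<^sub>F N in sequentially. 0 < (N::nat)" by (rule eventually_gt_at_top)
  ultimately have low: "\<forall>\<^sub>F N in sequentially. 0 < N \<and> (\<forall>n. \<nu>1 \<le> root N (norm (us (n + N)) / norm (us n)))"
  proof eventually_elim
    case (elim N)
    have "\<nu>1 \<le> root N (norm (us (n + N)) / norm (us n))" for n
    proof -
      have "c * \<nu> ^ N \<le> norm (us (n + N)) / norm (us n)"
        using c(3)[OF us_mem[of n], of N] orbit(1)[of n N] nonzero(1)[of n] by (simp add: pos_le_divide_eq)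
      then have "root N (c * \<nu> ^ N) \<le> root N (norm (us (n + N)) / norm (us n))" using elim by (intro real_root_le_mono) auto
      moreover have "root N (c * \<nu> ^ N) = root N c * \<nu>" using elim c by (simp add: real_root_mult real_root_power_cancel)
      ultimately show ?thesis using elim by linarith
    qed
    then show ?case using elim by blast
  qed
  have up: "\<forall>\<^sub>F N in sequentially. \<forall>n. root N (norm (us (n + N)) / norm (us n)) \<le> \<sigma>" if "lam2 < \<sigma>" for \<sigma>
    by (rule max_expansion_rate_line[OF A_lin us(1) nonzero(1) us(3) rates(2) that])
  \<comment> \<open>For large \<open>N\<close> the same mean growth lies between
    \<open>\<nu>1\<close> and any \<sigma> above \<open>lam2\<close>.\<close>
  have "\<nu>1 \<le> lam2"
  proof (rule dense_ge)
    fix \<sigma> assume "lam2 < \<sigma>"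
    from low up[OF this] have "\<forall>\<^sub>F N in sequentially. \<nu>1 \<le> \<sigma>"
      by eventually_elim (meson order_trans)
    then show "\<nu>1 \<le> \<sigma>" by simp
  qed
  then have lam2: "1 < lam2" "1 < lam1" using \<nu>1 rates(3) by linarith+
  have "real k * ln lam2 < ln lam1" using rates(4) lam2 by (simp add: pos_less_divide_eq)
  then have "ln (lam2 ^ k) < ln lam1" using lam2 by (simp add: ln_realpow)
  then have gap: "lam2 ^ k < lam1" using lam2 by simp
  define \<tau> where "\<tau> = (lam2 ^ k + lam1) / 2"
  have \<tau>: "lam2 ^ k < \<tau>" "\<tau> < lam1" using gap by (auto simp: \<tau>_def)
  have "((\<lambda>h. (lam2 + h) ^ k) \<longlongrightarrow> (lam2 + 0) ^ k) (at_right 0)" by (intro tendsto_intros)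
  then have "\<forall>\<^sub>F h in at_right 0. (lam2 + h) ^ k < \<tau>" by (rule order_tendstoD(2)) (use \<tau> in simp)
  moreover have "\<forall>\<^sub>F h in at_right (0::real). 0 < h" unfolding eventually_at_right_field by (intro exI[of _ 1]) auto
  ultimately have "\<forall>\<^sub>F h in at_right 0. (lam2 + h) ^ k < \<tau> \<and> 0 < h" by (rule eventually_conj)
  then obtain h where h: "(lam2 + h) ^ k < \<tau>" "0 < h" using eventually_happens'[OF trivial_limit_at_right_real] by blast
  have "\<forall>\<^sub>F N in sequentially. \<forall>n. \<tau> \<le> root N (norm (hs (n + N)) / norm (hs n))"
    by (rule min_expansion_rate_line[OF A_lin hs(1) nonzero(2) hs(3) rates(1) \<tau>(2)])
  moreover have "\<forall>\<^sub>F N in sequentially. \<forall>n. root N (norm (us (n + N)) / norm (us n)) \<le> lam2 + h" by (rule up) (use h in simp)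
  ultimately have "\<forall>\<^sub>F N in sequentially. (0 < N \<and> (\<forall>n. \<nu>1 \<le> root N (norm (us (n + N)) / norm (us n)))) \<and>
     (\<forall>n. root N (norm (us (n + N)) / norm (us n)) \<le> lam2 + h) \<and> (\<forall>n. \<tau> \<le> root N (norm (hs (n + N)) / norm (hs n)))"
    using low by eventually_elim blast
  then obtain N where "0 < N" "\<And>n. \<nu>1 \<le> root N (norm (us (n + N)) / norm (us n))"
     "\<And>n. root N (norm (us (n + N)) / norm (us n)) \<le> lam2 + h" "\<And>n. \<tau> \<le> root N (norm (hs (n + N)) / norm (hs n))"
    using eventually_happens'[OF sequentially_bot] by blast
  then show thesis using that[of N \<nu>1 "lam2 + h" \<tau>] \<nu>1 h by blast
qed

text \<open>The angle comes from the different growth. After \<open>j\<close> steps with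
  \<open>C * \<mu> ^ j < c\<close> the unstable part dominates the contracted stable part, so the
  image of \<open>v + h\<close> is bounded below in terms of \<open>h\<close>; the bounded iterate
  carries this back to \<open>v + h\<close>.\<close>

lemma stable_unstable_transversal:
  obtains K1 where "0 \<le> K1" "\<And>n v h. v \<in> l n \<Longrightarrow> h \<in> \<xi> n + \<eta> n \<Longrightarrow> norm h \<le> K1 * norm (v + h)"
proof -
  obtain c \<nu> where c: "0 < c" "1 < \<nu>" "\<And>n j v. v \<in> \<xi> n + \<eta> n \<Longrightarrow> c * \<nu> ^ j * norm v \<le> norm (compose_from A n j v)"
    using expansion by blast
  obtain C \<mu> where C: "0 < C" "0 < \<mu>" "\<mu> < 1" "\<And>n j v. v \<in> l n \<Longrightarrow> norm (compose_from A n j v) \<le> C * \<mu> ^ j * norm v"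
    using contraction by blast
  have "(\<lambda>j. C * \<mu> ^ j) \<longlonglongrightarrow> C * 0" using C by (intro tendsto_intros LIMSEQ_power_zero) auto
  then have "\<forall>\<^sub>F j in sequentially. C * \<mu> ^ j < c" by (rule order_tendstoD(2)) (use c in simp)
  then obtain j where j: "C * \<mu> ^ j < c" using eventually_happens'[OF sequentially_bot] by blast
  have C0j: "0 \<le> C0 ^ j" "0 \<le> C * \<mu> ^ j" using C0 C by auto
  define K1 where "K1 = (C0 ^ j + C * \<mu> ^ j) / (c - C * \<mu> ^ j)"
  show thesis
  proof (rule that[of K1])
    show "0 \<le> K1" using C0j j by (simp add: K1_def)
    fix n v h assume v: "v \<in> l n" and h: "h \<in> \<xi> n + \<eta> n"
    have "c * 1 * norm h \<le> c * \<nu> ^ j * norm h" using c one_le_power[of \<nu> j] by (intro mult_right_mono mult_left_mono) auto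
    also have "\<dots> \<le> norm (compose_from A n j h)" by (rule c(3)[OF h])
    also have "compose_from A n j h = compose_from A n j (v + h) - compose_from A n j v"
      using linear_add[OF compose_from_linear[of A n j, OF A_lin], of v h] by simp
    also have "norm \<dots> \<le> C0 ^ j * norm (v + h) + C * \<mu> ^ j * norm v"
      by (rule order_trans[OF norm_triangle_ineq4 add_mono[OF compose_bound C(4)[OF v]]])
    also have "\<dots> \<le> C0 ^ j * norm (v + h) + C * \<mu> ^ j * (norm (v + h) + norm h)"
      using norm_triangle_ineq4[of "v + h" h] C0j by (intro add_left_mono mult_left_mono) auto
    finally have "(c - C * \<mu> ^ j) * norm h \<le> (C0 ^ j + C * \<mu> ^ j) * norm (v + h)" by (simp add: algebra_simps)
    then show "norm h \<le> K1 * norm (v + h)" using j by (simp add: K1_def field_simps)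
  qed
qed

lemma xi_transversal:
  obtains c where "0 < c" "\<And>n h d. h \<in> \<xi> n \<Longrightarrow> d \<in> D0 \<Longrightarrow> c * norm h \<le> norm (h + d)"
    "\<And>n h. h \<in> \<xi> n \<Longrightarrow> c * norm h \<le> \<bar>F h\<bar> * norm v0"
proof -
  obtain c where c: "0 < c" "\<And>n v. v \<in> \<xi> n \<Longrightarrow> c * norm v \<le> infdist v D0"
    using transversal unfolding uniformly_transversal_def by blast
  have 1: "c * norm h \<le> norm (h + d)" if "h \<in> \<xi> n" "d \<in> D0" for n h d
  proof -
    have "infdist h D0 \<le> dist h (- d)" by (intro infdist_le subspace_neg D0 that)
    then show ?thesis using c(2)[OF that(1)] by (simp add: dist_norm)
  qed
  have "c * norm h \<le> \<bar>F h\<bar> * norm v0" if "h \<in> \<xi> n" for n h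
  proof -
    have "infdist h D0 \<le> dist h (h - F h *\<^sub>R v0)" by (intro infdist_le F_dec)
    then show ?thesis using c(2)[OF that] by (simp add: dist_norm)
  qed
  with 1 c(1) show thesis using that by blast
qed

lemma codim_decomposition:
  assumes e: "e \<notin> l n + \<xi> n"
  shows "\<exists>t. z - t *\<^sub>R e \<in> l n + \<xi> n"
proof -
  let ?E = "l n + \<xi> n"
  obtain v where v: "subspace ?E" "span (insert v ?E) = UNIV" using codim unfolding codim_one_def by blast
  have dec: "\<exists>a. z - a *\<^sub>R v \<in> ?E" for z
  proof -
    have "z \<in> span (insert v ?E)" using v(2) by simp
    then obtain a where "z - a *\<^sub>R v \<in> span ?E" unfolding span_breakdown_eq by blast
    then show ?thesis using v(1) by (metis span_eq_iff)
  qed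
  obtain a where a: "e - a *\<^sub>R v \<in> ?E" using dec by blast
  obtain b where b: "z - b *\<^sub>R v \<in> ?E" using dec by blast
  have a0: "a \<noteq> 0" using a e by auto
  have "(z - b *\<^sub>R v) - (b / a) *\<^sub>R (e - a *\<^sub>R v) \<in> ?E" by (intro subspace_diff subspace_scale v(1) a b)
  then have "z - (b / a) *\<^sub>R e \<in> ?E" using a0 by (simp add: algebra_simps)
  then show ?thesis ..
qed

lemma scaled_vectors:
  assumes N: "0 < N"
  obtains \<Omega>s \<Omega>h C where "1 \<le> C" "\<And>n. 0 < \<Omega>s n" "\<And>n. 0 < \<Omega>h n"
    "\<And>n. norm (us n) \<le> C * \<Omega>s n" "\<And>n. \<Omega>s n \<le> C * norm (us n)"
    "\<And>n. norm (hs n) \<le> C * \<Omega>h n" "\<And>n. \<Omega>h n \<le> C * norm (hs n)"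
    "\<And>n. \<Omega>s (Suc n) = root N (norm (us (n + N)) / norm (us n)) * \<Omega>s n"
    "\<And>n. \<Omega>h (Suc n) = root N (norm (hs (n + N)) / norm (hs n)) * \<Omega>h n"
proof -
  obtain c \<nu> where c: "0 < c" "1 < \<nu>" "\<And>n j v. v \<in> \<xi> n + \<eta> n \<Longrightarrow> c * \<nu> ^ j * norm v \<le> norm (compose_from A n j v)"
    using expansion by blast
  have grow: "c * norm (u n) \<le> norm (u (n + i)) \<and> norm (u (n + i)) \<le> C0 ^ N * norm (u n)"
    if "i < N" "\<And>n. u n \<in> \<xi> n + \<eta> n" "\<And>n j. compose_from A n j (u n) = u (n + j)" for u n i
  proof
    have "c * 1 * norm (u n) \<le> c * \<nu> ^ i * norm (u n)" using c one_le_power[of \<nu> i] by (intro mult_right_mono mult_left_mono) auto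
    also have "\<dots> \<le> norm (u (n + i))" using c(3)[OF that(2)[of n], of i] that(3) by simp
    finally show "c * norm (u n) \<le> norm (u (n + i))" by simp
    have "norm (u (n + i)) \<le> C0 ^ i * norm (u n)" using compose_bound[of n i "u n"] that(3) by simp
    also have "\<dots> \<le> C0 ^ N * norm (u n)" using that C0 by (intro mult_right_mono power_increasing) auto
    finally show "norm (u (n + i)) \<le> C0 ^ N * norm (u n)" .
  qed
  have C0N: "0 < C0 ^ N" using C0 by simp
  note gs = geometric_mean_scale[of N us, OF N nonzero(1) c(1) C0N grow[OF _ us_mem orbit(1)]]
  note gh = geometric_mean_scale[of N hs, OF N nonzero(2) c(1) C0N grow[OF _ hs_mem orbit(2)]]
  define C where "C = 1 + C0 ^ N + 1 / c"
  have C: "1 \<le> C" "C0 ^ N \<le> C" "1 / c \<le> C" using C0N c by (auto simp: C_def)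
  have up: "z \<le> C * y" if "z \<le> C0 ^ N * y" "0 \<le> y" for z y
    using that(1) mult_right_mono[OF C(2) that(2)] by linarith
  have low: "y \<le> C * z" if "c * y \<le> z" "0 < z" for z y
  proof -
    have "y \<le> 1 / c * z" using that c by (simp add: field_simps)
    also have "\<dots> \<le> C * z" using C that by (intro mult_right_mono) auto
    finally show ?thesis .
  qed
  show thesis
    by (rule that[OF C(1) gs(1) gh(1) low[OF gs(2) gs(1)] up[OF gs(3) norm_ge_zero] low[OF gh(2) gh(1)] up[OF gh(3) norm_ge_zero] gs(4) gh(4)])
qed

text \<open>\<open>s n\<close> and \<open>e n\<close> are the spanning vectors divided by geometric
  means, so that the multipliers \<open>a n\<close> (up to sign) and \<open>b n\<close> are mean
  growths over \<open>N\<close> steps. Transversality bounds the coordinates uniformly, and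
  \<open>w\<close> is a finite Lyapunov sum over the component in \<open>l n\<close>.\<close>

theorem coordinates:
  obtains g K e f s w \<kappa> a \<nu> \<sigma> b \<tau> c \<phi> where
    "\<And>n. bounded_linear (g n)" "\<And>n u. \<bar>g n u\<bar> \<le> K * norm u" "\<And>n. g n (e n) = 1" "\<And>n v. v \<in> l n + \<xi> n \<Longrightarrow> g n v = 0"
    "\<And>n u. u - g n u *\<^sub>R e n \<in> l n + \<xi> n" "\<And>n. norm (e n) \<le> K"
    "\<And>n. bounded_linear (f n)" "\<And>n u. \<bar>f n u\<bar> \<le> K * norm u" "\<And>n. f n (e n) = 0" "\<And>n. f n (s n) = 1" "\<And>n. norm (s n) \<le> K"
    "\<And>n u. 0 \<le> w n u" "\<And>n u v. w n (u + v) \<le> w n u + w n v" "\<And>n t u. w n (t *\<^sub>R u) = \<bar>t\<bar> * w n u"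
    "\<And>n u. w n u \<le> K * norm u" "\<And>n. w n (e n) = 0" "\<And>n v. v \<in> l n + \<xi> n \<Longrightarrow> norm v \<le> K * (w n v + \<bar>f n v\<bar>)"
    "\<And>n u. w (Suc n) (A n u) \<le> \<kappa> * w n u" "\<And>n u. f (Suc n) (A n u) = a n * f n u" "\<And>n. \<nu> \<le> \<bar>a n\<bar>" "\<And>n. \<bar>a n\<bar> \<le> \<sigma>"
    "\<And>n u. g (Suc n) (A n u) = b n * g n u" "\<And>n. \<tau> \<le> \<bar>b n\<bar>"
    "0 < \<kappa>" "\<kappa> < 1" "1 < \<nu>" "\<sigma> ^ k < \<tau>" "1 \<le> K"
    "\<And>n. \<eta> n = range (\<lambda>t. t *\<^sub>R e n)" "\<And>n. s n \<in> l n + \<xi> n" "0 < c" "\<And>n. c \<le> \<phi> n" "\<And>n z. F z = \<phi> n * f n z"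
proof -
  obtain N \<nu> \<sigma> \<tau> where N: "0 < N" "1 < \<nu>" "\<sigma> ^ k < \<tau>"
    "\<And>n. \<nu> \<le> root N (norm (us (n + N)) / norm (us n))" "\<And>n. root N (norm (us (n + N)) / norm (us n)) \<le> \<sigma>"
    "\<And>n. \<tau> \<le> root N (norm (hs (n + N)) / norm (hs n))"
    using rates_one_step by metis
  obtain \<Omega>s \<Omega>h C where Om: "1 \<le> C" "\<And>n. 0 < \<Omega>s n" "\<And>n. 0 < \<Omega>h n"
    "\<And>n. norm (us n) \<le> C * \<Omega>s n" "\<And>n. \<Omega>s n \<le> C * norm (us n)"
    "\<And>n. norm (hs n) \<le> C * \<Omega>h n" "\<And>n. \<Omega>h n \<le> C * norm (hs n)"
    "\<And>n. \<Omega>s (Suc n) = root N (norm (us (n + N)) / norm (us n)) * \<Omega>s n"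
    "\<And>n. \<Omega>h (Suc n) = root N (norm (hs (n + N)) / norm (hs n)) * \<Omega>h n"
    using scaled_vectors[OF N(1)] by metis
  obtain K1 where K1: "0 \<le> K1" "\<And>n v h. v \<in> l n \<Longrightarrow> h \<in> \<xi> n + \<eta> n \<Longrightarrow> norm h \<le> K1 * norm (v + h)"
    using stable_unstable_transversal by blast
  obtain ct where ct: "0 < ct" "\<And>n h d. h \<in> \<xi> n \<Longrightarrow> d \<in> D0 \<Longrightarrow> ct * norm h \<le> norm (h + d)"
    "\<And>n h. h \<in> \<xi> n \<Longrightarrow> ct * norm h \<le> \<bar>F h\<bar> * norm v0"
    using xi_transversal by blast
  obtain C1 \<mu> where C1: "0 < C1" "0 < \<mu>" "\<mu> < 1" "\<And>n j v. v \<in> l n \<Longrightarrow> norm (compose_from A n j v) \<le> C1 * \<mu> ^ j * norm v"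
    using contraction by blast
  obtain KF where KF: "0 < KF" "\<And>u. norm (F u) \<le> norm u * KF" using bounded_linear.pos_bounded[OF F] by blast
  note Fl = bounded_linear.linear[OF F]
  define rs where "rs n = root N (norm (us (n + N)) / norm (us n))" for n
  define rh where "rh n = root N (norm (hs (n + N)) / norm (hs n))" for n
  \<comment> \<open>This sign makes \<open>F (s n)\<close> positive, so that \<open>f n\<close> and
    \<open>F\<close> have the same sign everywhere.\<close>
  define sg where "sg n = sgn (F (us n))" for n
  define s where "s n = (sg n / \<Omega>s n) *\<^sub>R us n" for n
  define e where "e n = (1 / \<Omega>h n) *\<^sub>R hs n" for n
  define \<phi> where "\<phi> n = F (s n)" for n
  define a where "a n = sg n * sg (Suc n) * rs n" for n
  have us_D0: "F (us n) \<noteq> 0" for n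
  proof
    assume "F (us n) = 0"
    moreover have "us n \<in> \<xi> n" unfolding us(3) by (rule range_eqI[of _ _ 1]) simp
    ultimately have "ct * norm (us n) \<le> 0" using ct(3)[of "us n" n] by simp
    then show False using ct(1) nonzero(1)[of n] by (simp add: mult_le_0_iff)
  qed
  have sg: "\<bar>sg n\<bar> = 1" "sg n * sg n = 1" "sg n * F (us n) = \<bar>F (us n)\<bar>" for n
    using us_D0[of n] by (auto simp: sg_def sgn_real_def)
  have norm_s: "norm (s n) \<le> C" "1 / C \<le> norm (s n)" for n
    using Om(4,5)[of n] Om(1) Om(2)[of n] sg(1)[of n] by (auto simp: s_def field_simps)
  have norm_e: "norm (e n) \<le> C" "1 / C \<le> norm (e n)" for n
    using Om(6,7)[of n] Om(1) Om(3)[of n] by (auto simp: e_def field_simps)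
  have s_xi: "t *\<^sub>R s n \<in> \<xi> n" for t n unfolding us(3) s_def by (auto intro: range_eqI)
  have e_D0: "t *\<^sub>R e n \<in> D0" for t n unfolding e_def by (intro subspace_scale D0 in_D0)
  have eta_e: "\<eta> n = range (\<lambda>t. t *\<^sub>R e n)" for n
  proof -
    have "t *\<^sub>R hs n = (t * \<Omega>h n) *\<^sub>R e n" "t *\<^sub>R e n = (t / \<Omega>h n) *\<^sub>R hs n" for t
      using Om(3)[of n] by (simp_all add: e_def)
    then show ?thesis unfolding hs(3) by (intro equalityI image_subsetI; blast intro: range_eqI)
  qed
  have xi_s: "\<exists>t. h = t *\<^sub>R s n" if hm: "h \<in> \<xi> n" for h n
  proof -
    obtain t where "h = t *\<^sub>R us n" using hm unfolding us(3) by blast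
    moreover have "(t * sg n * \<Omega>s n) *\<^sub>R s n = (t * (sg n * sg n)) *\<^sub>R us n" using Om(2)[of n] by (simp add: s_def mult_ac)
    ultimately have "h = (t * sg n * \<Omega>s n) *\<^sub>R s n" by (simp add: sg(2))
    then show ?thesis ..
  qed
  have A_s: "A n (s n) = a n *\<^sub>R s (Suc n)" for n
  proof -
    have "a n *\<^sub>R s (Suc n) = (sg n * rs n * (sg (Suc n) * sg (Suc n)) / \<Omega>s (Suc n)) *\<^sub>R us (Suc n)"
      by (simp add: a_def s_def mult_ac)
    also have "sg n * rs n * (sg (Suc n) * sg (Suc n)) / \<Omega>s (Suc n) = sg n / \<Omega>s n"
      using Om(2)[of n] Om(2)[of "Suc n"] Om(8)[of n] unfolding sg(2) rs_def by (auto simp: field_simps)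
    finally have "a n *\<^sub>R s (Suc n) = (sg n / \<Omega>s n) *\<^sub>R A n (us n)" by (simp only: us(1))
    then show ?thesis unfolding s_def[of n] linear_cmul[OF A_lin] by (rule sym)
  qed
  have A_e: "A n (e n) = rh n *\<^sub>R e (Suc n)" for n
  proof -
    have "rh n / \<Omega>h (Suc n) = 1 / \<Omega>h n"
      using Om(3)[of n] Om(3)[of "Suc n"] Om(9)[of n] unfolding rh_def by (auto simp: field_simps)
    then show ?thesis by (simp add: e_def hs(1) linear_cmul[OF A_lin])
  qed
  have abs_a: "\<bar>a n\<bar> = rs n" for n
    using sg(1)[of n] sg(1)[of "Suc n"] N(2) N(4)[of n] by (simp add: a_def abs_mult rs_def)
  \<comment> \<open>Uniformity in \<open>n\<close> makes the quotients \<open>F u / \<phi> n\<close>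
    uniformly bounded. The summand \<open>1\<close> keeps the denominator positive.\<close>
  have phi_lower: "ct / (C * (norm v0 + 1)) \<le> \<phi> n" for n
  proof -
    have pos: "0 < \<phi> n"
    proof -
      have "\<phi> n = (sg n * F (us n)) / \<Omega>s n" by (simp add: \<phi>_def s_def linear_cmul[OF Fl])
      then show ?thesis using us_D0[of n] Om(2)[of n] by (simp add: sg(3))
    qed
    have "ct * (1 / C) \<le> ct * norm (s n)" using norm_s ct(1) by (intro mult_left_mono) auto
    also have "\<dots> \<le> \<bar>F (s n)\<bar> * norm v0" using ct(3)[OF s_xi[of 1 n]] by simp
    also have "\<dots> \<le> \<phi> n * (norm v0 + 1)" using pos by (simp add: \<phi>_def algebra_simps)
    finally have "ct * (1 / C) * C \<le> \<phi> n * (norm v0 + 1) * C" using Om(1) by (intro mult_right_mono) auto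
    then have "ct \<le> \<phi> n * (C * (norm v0 + 1))" using Om(1) by (simp add: mult_ac)
    moreover have "0 < C * (norm v0 + 1)" using Om(1) by (intro mult_pos_pos add_nonneg_pos) auto
    ultimately show ?thesis by (simp only: pos_divide_le_eq)
  qed
  define c where "c = ct / (C * (norm v0 + 1))"
  have c: "0 < c" "c \<le> \<phi> n" "0 < \<phi> n" for n
  proof -
    show 1: "0 < c" using ct Om(1) by (simp add: c_def add_nonneg_pos)
    show 2: "c \<le> \<phi> n" using phi_lower by (simp add: c_def)
    show "0 < \<phi> n" using 1 2 by linarith
  qed
  define f where "f n u = F u / \<phi> n" for n u
  have f_lin: "bounded_linear (f n)" for n
    unfolding f_def using bounded_linear_compose[OF bounded_linear_divide F] by simp
  have f_bound: "\<bar>f n u\<bar> \<le> KF / c * norm u" for n u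
  proof -
    have "\<bar>f n u\<bar> = \<bar>F u\<bar> / \<phi> n" using c(3)[of n] by (simp add: f_def)
    also have "\<dots> \<le> (KF * norm u) / c" using KF c(1) c(2)[of n] by (intro frac_le) (auto simp: mult.commute)
    finally show ?thesis by simp
  qed
  have f_e: "f n (e n) = 0" for n using F_ker[of "e n"] e_D0[of 1 n] by (simp add: f_def)
  have f_s: "f n (s n) = 1" for n using c(3)[of n] by (simp add: f_def \<phi>_def)
  have f_l: "f n v = 0" if "v \<in> D0" for n v using F_ker[of v] that by (simp add: f_def)
  note fl = bounded_linear.linear[OF f_lin]
  define Kg where "Kg = (K1 + 1 / ct) * C"
  \<comment> \<open>The \<xi>-part \<open>h\<close> is estimated by transversality to
    \<open>D0\<close>, which contains the other two parts; then \<open>h + t *\<^sub>R e n\<close>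
    by the angle between stable and unstable directions. Their difference gives
    \<open>t\<close>.\<close>
  have e_coord: "\<bar>t\<bar> \<le> Kg * norm (v + t *\<^sub>R e n)" if v: "v \<in> l n + \<xi> n" for v t n
  proof -
    obtain p h where ph: "v = p + h" "p \<in> l n" "h \<in> \<xi> n" using v by (auto elim: set_plus_elim)
    let ?u = "v + t *\<^sub>R e n"
    have "p + t *\<^sub>R e n \<in> D0" using ph in_D0(2) e_D0 by (intro subspace_add D0) auto
    from ct(2)[OF ph(3) this] have "ct * norm h \<le> norm ?u" by (simp add: ph(1) algebra_simps)
    then have 1: "norm h \<le> 1 / ct * norm ?u" using ct(1) by (simp add: field_simps)
    have "h + t *\<^sub>R e n \<in> \<xi> n + \<eta> n" unfolding eta_e using ph(3) by (intro set_plus_intro) auto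
    from K1(2)[OF ph(2) this] have 2: "norm (h + t *\<^sub>R e n) \<le> K1 * norm ?u" by (simp add: ph(1) algebra_simps)
    have "\<bar>t\<bar> * norm (e n) \<le> norm (h + t *\<^sub>R e n) + norm h" using norm_triangle_ineq4[of "h + t *\<^sub>R e n" h] by simp
    also have "\<dots> \<le> (K1 + 1 / ct) * norm ?u" using 1 2 by (simp add: algebra_simps)
    finally have 3: "\<bar>t\<bar> * norm (e n) \<le> (K1 + 1 / ct) * norm ?u" .
    have "\<bar>t\<bar> * (1 / C) \<le> \<bar>t\<bar> * norm (e n)" using norm_e by (intro mult_left_mono) auto
    then have "\<bar>t\<bar> * (1 / C) \<le> (K1 + 1 / ct) * norm ?u" using 3 by linarith
    then have "\<bar>t\<bar> * (1 / C) * C \<le> (K1 + 1 / ct) * norm ?u * C" using Om(1) by (intro mult_right_mono) auto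
    then show ?thesis using Om(1) by (simp add: Kg_def mult_ac)
  qed
  have subE: "subspace (l n + \<xi> n)" for n using codim unfolding codim_one_def by blast
  have e_ne: "e n \<noteq> 0" for n using norm_e(2)[of n] Om(1) by auto
  have e_notin: "e n \<notin> l n + \<xi> n" for n
  proof
    assume "e n \<in> l n + \<xi> n"
    from e_coord[OF subspace_neg[OF subE this], of 1] show False by simp
  qed
  have "\<forall>n. \<exists>g. bounded_linear g \<and> (\<forall>u. \<bar>g u\<bar> \<le> Kg * norm u) \<and> (\<forall>u. u - g u *\<^sub>R e n \<in> l n + \<xi> n) \<and>
      (\<forall>v t. v \<in> l n + \<xi> n \<longrightarrow> g (v + t *\<^sub>R e n) = t)"
  proof
    fix n
    from coordinate_functional[OF subE codim_decomposition[OF e_notin] e_coord e_ne, of n] obtain g where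
      "bounded_linear g" "\<And>u. \<bar>g u\<bar> \<le> Kg * norm u" "\<And>u. u - g u *\<^sub>R e n \<in> l n + \<xi> n"
      "\<And>v t. v \<in> l n + \<xi> n \<Longrightarrow> g (v + t *\<^sub>R e n) = t" by blast
    then show "\<exists>g. bounded_linear g \<and> (\<forall>u. \<bar>g u\<bar> \<le> Kg * norm u) \<and> (\<forall>u. u - g u *\<^sub>R e n \<in> l n + \<xi> n) \<and>
      (\<forall>v t. v \<in> l n + \<xi> n \<longrightarrow> g (v + t *\<^sub>R e n) = t)" by blast
  qed
  from choice[OF this] obtain g where g: "\<And>n. bounded_linear (g n)" "\<And>n u. \<bar>g n u\<bar> \<le> Kg * norm u"
      "\<And>n u. u - g n u *\<^sub>R e n \<in> l n + \<xi> n" "\<And>n v t. v \<in> l n + \<xi> n \<Longrightarrow> g n (v + t *\<^sub>R e n) = t" by blast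
  note gl = bounded_linear.linear[OF g(1)]
  have g_e: "g n (e n) = 1" for n using g(4)[OF subspace_0[OF subE], of n 1] by simp
  have g_E: "g n v = 0" if "v \<in> l n + \<xi> n" for n v using g(4)[OF that, of 0] by simp
  have l_E: "v \<in> l n + \<xi> n" if "v \<in> l n" for n v
    using set_plus_intro[OF that s_xi[of 0 n]] by simp
  have s_E: "s n \<in> l n + \<xi> n" for n
    using set_plus_intro[OF subspace_0[OF subspace_l[of n]] s_xi[of 1 n]] by simp
  \<comment> \<open>The component in \<open>l n\<close>, left over after removing those in \<eta>
    and \<xi>.\<close>
  define pl where "pl n u = u - g n u *\<^sub>R e n - f n u *\<^sub>R s n" for n u
  have pl_l: "pl n u \<in> l n" for n u
  proof -
    obtain p h where ph: "u - g n u *\<^sub>R e n = p + h" "p \<in> l n" "h \<in> \<xi> n" using g(3)[of u n] by (auto elim: set_plus_elim)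
    obtain t where t: "h = t *\<^sub>R s n" using xi_s[OF ph(3)] by blast
    have "f n (u - g n u *\<^sub>R e n) = f n u" by (simp add: linear_diff[OF fl] linear_cmul[OF fl] f_e)
    moreover have "f n (p + h) = t" using f_l[OF subsetD[OF in_D0(2) ph(2)]] by (simp add: t linear_add[OF fl] linear_cmul[OF fl] f_s)
    ultimately have "t = f n u" using ph(1) by simp
    then show ?thesis using ph t by (simp add: pl_def)
  qed
  have coord_A: "g (Suc n) (A n u) = rh n * g n u" "f (Suc n) (A n u) = a n * f n u" "pl (Suc n) (A n u) = A n (pl n u)" for n u
  proof -
    have Apl: "A n (pl n u) \<in> l (Suc n)" using pl_l l(1) by blast
    have Au: "A n u = A n (pl n u) + (f n u * a n) *\<^sub>R s (Suc n) + (g n u * rh n) *\<^sub>R e (Suc n)"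
    proof -
      have "A n u = A n (pl n u + f n u *\<^sub>R s n + g n u *\<^sub>R e n)" by (simp add: pl_def)
      also have "\<dots> = A n (pl n u) + (f n u * a n) *\<^sub>R s (Suc n) + (g n u * rh n) *\<^sub>R e (Suc n)"
        by (simp only: linear_add[OF A_lin] linear_cmul[OF A_lin] A_s A_e scaleR_scaleR)
      finally show ?thesis .
    qed
    have "f (Suc n) (A n (pl n u)) = 0" by (rule f_l[OF subsetD[OF in_D0(2) Apl]])
    then show fA: "f (Suc n) (A n u) = a n * f n u"
      by (subst Au) (simp add: linear_add[OF fl] linear_cmul[OF fl] f_s f_e)
    show gA: "g (Suc n) (A n u) = rh n * g n u"
      by (subst Au) (simp add: linear_add[OF gl] linear_cmul[OF gl] g_E[OF l_E[OF Apl]] g_E[OF s_E] g_e)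
    show "pl (Suc n) (A n u) = A n (pl n u)"
      unfolding pl_def[of "Suc n"] fA gA by (subst Au) (simp add: algebra_simps)
  qed
  have pl_lin: "pl n (u + v) = pl n u + pl n v" "pl n (t *\<^sub>R u) = t *\<^sub>R pl n u" for n u v t
    by (simp_all add: pl_def linear_add[OF fl] linear_cmul[OF fl] linear_add[OF gl] linear_cmul[OF gl] algebra_simps)
  have pl_e: "pl n (e n) = 0" for n by (simp add: pl_def g_e f_e)
  define Kp where "Kp = 1 + Kg * C + KF / c * C"
  have Kg0: "0 \<le> Kg" "0 \<le> KF / c" using K1 ct Om(1) KF c(1) by (auto simp: Kg_def)
  have pl_bound: "norm (pl n u) \<le> Kp * norm u" for n u
  proof -
    have "norm (pl n u) \<le> norm u + \<bar>g n u\<bar> * norm (e n) + \<bar>f n u\<bar> * norm (s n)"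
      unfolding pl_def using norm_triangle_ineq4[of "u - g n u *\<^sub>R e n" "f n u *\<^sub>R s n"] norm_triangle_ineq4[of u "g n u *\<^sub>R e n"] by simp
    also have "\<dots> \<le> norm u + (Kg * norm u) * C + (KF / c * norm u) * C"
      using g(2) f_bound norm_e norm_s Kg0 by (intro add_mono mult_mono order_refl mult_nonneg_nonneg) auto
    finally show ?thesis by (simp add: Kp_def algebra_simps)
  qed
  define \<kappa> where "\<kappa> = (1 + \<mu>) / 2"
  have \<kappa>: "0 < \<kappa>" "\<kappa> < 1" "\<mu> < \<kappa>" using C1 by (auto simp: \<kappa>_def)
  \<comment> \<open>The number \<open>m\<close> is taken so large that \<open>m\<close> steps
    contract vectors of \<open>l n\<close> at least by \<open>\<kappa> ^ m\<close>; this makes the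
    new last term of the shifted sum at most the dropped first one.\<close>
  have "(\<lambda>j. C1 * (\<mu> / \<kappa>) ^ j) \<longlonglongrightarrow> C1 * 0" using C1 \<kappa> by (intro tendsto_intros LIMSEQ_power_zero) auto
  then have "\<forall>\<^sub>F j in sequentially. C1 * (\<mu> / \<kappa>) ^ j < 1" by (rule order_tendstoD(2)) simp
  moreover have "\<forall>\<^sub>F j in sequentially. 0 < (j::nat)" by (rule eventually_gt_at_top)
  ultimately have "\<forall>\<^sub>F j in sequentially. C1 * (\<mu> / \<kappa>) ^ j < 1 \<and> 0 < j" by (rule eventually_conj)
  then obtain m where m: "C1 * (\<mu> / \<kappa>) ^ m < 1" "0 < m" using eventually_happens'[OF sequentially_bot] by blast
  \<comment> \<open>One step shifts this sum by one place, at the price of a factor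
    \<kappa>.\<close>
  define w where "w n u = (\<Sum>i<m. norm (compose_from A n i (pl n u)) / \<kappa> ^ i)" for n u
  note cl = compose_from_linear[of A, OF A_lin]
  have w_bound: "w n u \<le> (\<Sum>i<m. C0 ^ i / \<kappa> ^ i) * (Kp * norm u)" for n u
  proof -
    have "w n u \<le> (\<Sum>i<m. C0 ^ i / \<kappa> ^ i * (Kp * norm u))" unfolding w_def
    proof (rule sum_mono)
      fix i
      have "norm (compose_from A n i (pl n u)) \<le> C0 ^ i * norm (pl n u)" by (rule compose_bound)
      also have "\<dots> \<le> C0 ^ i * (Kp * norm u)" using pl_bound C0 by (intro mult_left_mono) auto
      finally show "norm (compose_from A n i (pl n u)) / \<kappa> ^ i \<le> C0 ^ i / \<kappa> ^ i * (Kp * norm u)"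
        using \<kappa> by (simp add: divide_simps)
    qed
    then show ?thesis by (simp only: sum_distrib_right)
  qed
  have w_step: "w (Suc n) (A n u) \<le> \<kappa> * w n u" for n u
  proof -
    define h where "h i = norm (compose_from A n i (pl n u)) / \<kappa> ^ i" for i
    have "w (Suc n) (A n u) = (\<Sum>i<m. norm (compose_from A n (Suc i) (pl n u)) / \<kappa> ^ i)"
      unfolding w_def coord_A compose_from_Suc' by simp
    also have "\<dots> = (\<Sum>i<m. \<kappa> * h (Suc i))" using \<kappa> by (intro sum.cong refl) (simp add: h_def)
    also have "\<dots> = \<kappa> * (\<Sum>i<m. h (Suc i))" by (simp only: sum_distrib_left)
    also have "\<dots> \<le> \<kappa> * (\<Sum>i<m. h i)"
    proof (rule mult_left_mono)
      have "h m \<le> h 0"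
      proof -
        have "h m \<le> C1 * \<mu> ^ m * norm (pl n u) / \<kappa> ^ m" unfolding h_def using C1(4)[OF pl_l] \<kappa> by (intro divide_right_mono) auto
        also have "\<dots> = (C1 * (\<mu> / \<kappa>) ^ m) * norm (pl n u)" by (simp add: power_divide)
        also have "\<dots> \<le> 1 * norm (pl n u)" using m by (intro mult_right_mono) auto
        finally show ?thesis by (simp add: h_def)
      qed
      moreover have "h 0 + (\<Sum>i<m. h (Suc i)) = (\<Sum>i<m. h i) + h m"
        by (subst sum.lessThan_Suc_shift[symmetric]) simp
      ultimately show "(\<Sum>i<m. h (Suc i)) \<le> (\<Sum>i<m. h i)" by linarith
    qed (use \<kappa> in simp)
    finally show ?thesis by (simp add: w_def h_def)
  qed
  have w_nonneg: "0 \<le> w n u" for n u unfolding w_def using \<kappa> by (intro sum_nonneg) auto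
  have w_tri: "w n (u + v) \<le> w n u + w n v" for n u v
    unfolding w_def sum.distrib[symmetric]
  proof (rule sum_mono)
    fix i
    have "norm (compose_from A n i (pl n (u + v))) \<le> norm (compose_from A n i (pl n u)) + norm (compose_from A n i (pl n v))"
      unfolding pl_lin linear_add[OF cl] by (rule norm_triangle_ineq)
    then show "norm (compose_from A n i (pl n (u + v))) / \<kappa> ^ i \<le> norm (compose_from A n i (pl n u)) / \<kappa> ^ i + norm (compose_from A n i (pl n v)) / \<kappa> ^ i"
      using \<kappa> by (simp add: add_divide_distrib[symmetric] divide_right_mono)
  qed
  have w_scale: "w n (t *\<^sub>R u) = \<bar>t\<bar> * w n u" for n t u
    unfolding w_def pl_lin linear_cmul[OF cl] by (simp add: sum_distrib_left)
  have w_e: "w n (e n) = 0" for n unfolding w_def pl_e linear_0[OF cl] by simp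
  have norm_le: "norm v \<le> C * (w n v + \<bar>f n v\<bar>)" if v: "v \<in> l n + \<xi> n" for n v
  proof -
    have "norm (compose_from A n 0 (pl n v)) / \<kappa> ^ 0 \<le> w n v"
      unfolding w_def using m \<kappa> by (intro member_le_sum) auto
    then have 1: "norm (pl n v) \<le> w n v" by simp
    have "v = pl n v + f n v *\<^sub>R s n" using g_E[OF v] by (simp add: pl_def)
    then have "norm v \<le> norm (pl n v) + \<bar>f n v\<bar> * norm (s n)" by (metis norm_triangle_ineq norm_scaleR)
    also have "\<dots> \<le> 1 * w n v + \<bar>f n v\<bar> * C" using 1 norm_s by (intro add_mono mult_left_mono) auto
    also have "\<dots> \<le> C * w n v + \<bar>f n v\<bar> * C" using Om(1) w_nonneg by (intro add_right_mono mult_right_mono) auto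
    finally show ?thesis by (simp add: algebra_simps)
  qed
  define Kw where "Kw = (\<Sum>i<m. C0 ^ i / \<kappa> ^ i) * Kp"
  define K where "K = 1 + Kg + C + KF / c + \<bar>Kw\<bar>"
  have K: "1 \<le> K" "Kg \<le> K" "C \<le> K" "KF / c \<le> K" "Kw \<le> K" using Kg0 Om(1) unfolding K_def by linarith+
  have le: "z \<le> K * y" if "z \<le> K' * y" "K' \<le> K" "0 \<le> y" for z K' y :: real
    using that(1) mult_right_mono[OF that(2,3)] by linarith
  show thesis
  proof (rule that[of g K e f s w \<kappa> a \<nu> \<sigma> rh \<tau> c \<phi>])
    show "\<bar>g n u\<bar> \<le> K * norm u" for n u by (rule le[OF g(2) K(2)]) simp
    show "norm (e n) \<le> K" "norm (s n) \<le> K" for n using norm_e(1)[of n] norm_s(1)[of n] K(3) by linarith+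
    show "\<bar>f n u\<bar> \<le> K * norm u" for n u by (rule le[OF f_bound K(4)]) simp
    show "w n u \<le> K * norm u" for n u by (rule le[OF _ K(5)]) (use w_bound[of n u] in \<open>simp_all add: Kw_def mult.assoc\<close>)
    show "norm v \<le> K * (w n v + \<bar>f n v\<bar>)" if "v \<in> l n + \<xi> n" for n v
      by (rule le[OF norm_le[OF that] K(3)]) (use w_nonneg[of n v] in simp)
    show "\<tau> \<le> \<bar>rh n\<bar>" for n using N(6)[of n] by (simp add: rh_def)
    show "\<nu> \<le> \<bar>a n\<bar>" "\<bar>a n\<bar> \<le> \<sigma>" for n using N(4,5) by (simp_all add: abs_a rs_def)
    show "F z = \<phi> n * f n z" for n z using c(3)[of n] by (simp add: f_def)
  qed (use g f_lin f_e f_s g_e g_E w_nonneg w_tri w_scale w_e w_step coord_A \<kappa> N(2,3) K(1) eta_e s_E c in simp_all)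
qed

end

section \<open>Regularity of a graph up to the boundary\<close>

lemma half_ball_shift:
  fixes f :: "'a::real_normed_vector \<Rightarrow> real"
  assumes E: "subspace E" and f: "bounded_linear f" and s: "s \<in> E" "f s = 1" and y: "y \<in> E" "0 \<le> f y" "norm y < \<rho>"
  shows "\<exists>d>0. \<forall>t. 0 < t \<and> t < d \<longrightarrow> y + t *\<^sub>R s \<in> {y \<in> E. 0 < f y \<and> norm y < \<rho>}"
proof -
  note fl = bounded_linear.linear[OF f]
  have "((\<lambda>t. norm (y + t *\<^sub>R s)) \<longlongrightarrow> norm (y + 0 *\<^sub>R s)) (at_right 0)" by (intro tendsto_intros)
  then have 1: "\<forall>\<^sub>F t in at_right 0. norm (y + t *\<^sub>R s) < \<rho>" by (rule order_tendstoD(2)) (use y in simp)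
  have "\<forall>\<^sub>F t in at_right (0::real). 0 < t" unfolding eventually_at_right_field by (intro exI[of _ 1]) auto
  with 1 have "\<forall>\<^sub>F t in at_right 0. y + t *\<^sub>R s \<in> {y \<in> E. 0 < f y \<and> norm y < \<rho>}"
    by eventually_elim (use E s y in \<open>simp add: linear_add[OF fl] linear_cmul[OF fl] subspace_add subspace_scale\<close>)
  then show ?thesis unfolding eventually_at_right_field by blast
qed

lemma half_ball_open:
  fixes f :: "'a::real_normed_vector \<Rightarrow> real"
  assumes E: "subspace E" and f: "bounded_linear f" and y: "y \<in> {y \<in> E. 0 < f y \<and> norm y < \<rho>}" and h: "h \<in> E"
  shows "\<exists>d>0. \<forall>t. 0 < t \<and> t < d \<longrightarrow> y + t *\<^sub>R h \<in> {y \<in> E. 0 < f y \<and> norm y < \<rho>}"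
proof -
  note fl = bounded_linear.linear[OF f]
  have "((\<lambda>t. norm (y + t *\<^sub>R h)) \<longlongrightarrow> norm (y + 0 *\<^sub>R h)) (at_right 0)" by (intro tendsto_intros)
  then have 1: "\<forall>\<^sub>F t in at_right 0. norm (y + t *\<^sub>R h) < \<rho>" by (rule order_tendstoD(2)) (use y in simp)
  have "((\<lambda>t. f y + t * f h) \<longlongrightarrow> f y + 0 * f h) (at_right 0)" by (intro tendsto_intros)
  then have 2: "\<forall>\<^sub>F t in at_right 0. 0 < f y + t * f h" by (rule order_tendstoD(1)) (use y in simp)
  from 1 2 have "\<forall>\<^sub>F t in at_right 0. y + t *\<^sub>R h \<in> {y \<in> E. 0 < f y \<and> norm y < \<rho>}"
    by eventually_elim (use E h y in \<open>simp add: linear_add[OF fl] linear_cmul[OF fl] subspace_add subspace_scale\<close>)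
  then show ?thesis unfolding eventually_at_right_field by blast
qed

lemma half_ball_convex:
  fixes f :: "'a::real_normed_vector \<Rightarrow> real"
  assumes "subspace E" "bounded_linear f"
  shows "convex {y \<in> E. 0 < f y \<and> norm y < \<rho>}" "convex {y \<in> E. 0 \<le> f y \<and> norm y < \<rho>}"
proof -
  note fl = bounded_linear.linear[OF assms(2)]
  have "f -` {0<..} = {y. 0 < f y}" "f -` {0..} = {y. 0 \<le> f y}" by auto
  then have "convex {y. 0 < f y}" "convex {y. 0 \<le> f y}"
    using convex_linear_vimage[OF fl, of "{0<..}"] convex_linear_vimage[OF fl, of "{0..}"] by simp_all
  moreover have "convex {y :: 'a. norm y < \<rho>}" using convex_ball[of 0 \<rho>] by (simp add: ball_def)
  moreover have "{y \<in> E. 0 < f y \<and> norm y < \<rho>} = E \<inter> ({y. 0 < f y} \<inter> {y. norm y < \<rho>})"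
    "{y \<in> E. 0 \<le> f y \<and> norm y < \<rho>} = E \<inter> ({y. 0 \<le> f y} \<inter> {y. norm y < \<rho>})" by auto
  ultimately show "convex {y \<in> E. 0 < f y \<and> norm y < \<rho>}" "convex {y \<in> E. 0 \<le> f y \<and> norm y < \<rho>}"
    using subspace_imp_convex[OF assms(1)] by (simp_all add: convex_Int)
qed

lemma derivs_unique:
  assumes "has_derivs_on E S k f F" "has_derivs_on E S k f G" and E: "subspace E" "S \<subseteq> E"
    and S: "\<And>x h. x \<in> S \<Longrightarrow> h \<in> E \<Longrightarrow> \<exists>d>0. \<forall>t. 0 < t \<and> t < d \<longrightarrow> x + t *\<^sub>R h \<in> S"
    and "j \<le> k" "x \<in> S" "length vs = j" "set vs \<subseteq> E"
  shows "F j x vs = G j x vs"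
proof -
  have "has_weak_derivs_on E S k (\<lambda>x. f x - f x) (\<lambda>j x vs. F j x vs - G j x vs)"
    by (intro has_weak_derivs_diff has_derivs_imp_weak assms)
  from zero_derivs[OF this _ E S assms(6-9)] show ?thesis by simp
qed

text \<open>The Cauchy property is given for the scalar derivatives \<open>g (DQ m y vs)\<close>.
  Since \<open>Q\<close> takes values in the line of \<open>e\<close>, uniqueness of derivatives
  places \<open>DQ\<close> there as well, so the vector derivatives are Cauchy; completeness gives
  their limits, and \<open>derivs_extend_to_boundary\<close> makes them derivatives. Order zero is
  covered by continuity of \<open>Q\<close>.\<close>

lemma boundary_regularity:
  fixes Q :: "'a::banach \<Rightarrow> 'a" and f g :: "'a \<Rightarrow> real"
  assumes E: "subspace E" and f: "bounded_linear f" and s: "s \<in> E" "f s = 1" and g: "bounded_linear g"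
    and DQ: "has_derivs_on E {y \<in> E. 0 < f y \<and> norm y < \<delta>} k Q DQ"
    and Q_cont: "continuous_on {y \<in> E. 0 \<le> f y \<and> norm y < \<delta>} Q"
    and Q_line: "\<And>y. y \<in> E \<Longrightarrow> 0 \<le> f y \<Longrightarrow> norm y < \<delta> \<Longrightarrow> Q y = g (Q y) *\<^sub>R e"
    and cauchy: "\<And>m p. 1 \<le> m \<Longrightarrow> m \<le> k \<Longrightarrow> p \<in> E \<Longrightarrow> f p = 0 \<Longrightarrow> norm p < \<rho> \<Longrightarrow>
        multi_cauchy E m (at p within {y \<in> E. 0 < f y \<and> norm y < \<delta>}) (\<lambda>y vs. g (DQ m y vs))"
    and \<rho>: "\<rho> \<le> \<delta>"
  defines "S r \<equiv> {y \<in> E. 0 \<le> f y \<and> norm y < r}" and "S0 r \<equiv> {y \<in> E. 0 < f y \<and> norm y < r}"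
    and "B \<equiv> {y \<in> E. f y = 0 \<and> norm y < \<rho>}"
  shows "\<forall>j\<le>k. \<forall>p\<in>B. \<exists>L. bounded_multilinear E j L \<and> multi_tendsto E j (S0 \<delta>) (DQ j) p L"
    and "\<exists>G. has_derivs_on E (S \<rho>) k Q G \<and> (\<forall>j\<le>k. \<forall>p\<in>B. multi_tendsto E j (S \<rho>) (G j) p (G j p))"
    and "Ck_on E (S0 \<rho>) k Q \<longrightarrow> Ck_on E (S \<rho>) k Q"
proof -
  note fl = bounded_linear.linear[OF f]
  note op = half_ball_open[OF E f]
  have DQ_line: "DQ j y vs = g (DQ j y vs) *\<^sub>R e" if "j \<le> k" "y \<in> S0 \<delta>" "length vs = j" "set vs \<subseteq> E" for j y vs
  proof -
    have "bounded_linear (\<lambda>v. g v *\<^sub>R e)" by (rule bounded_linear_compose[OF bounded_linear_scaleR_left g])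
    from has_derivs_linear[OF this DQ]
    have d1: "has_derivs_on E (S0 \<delta>) k (\<lambda>y. g (Q y) *\<^sub>R e) (\<lambda>j y vs. g (DQ j y vs) *\<^sub>R e)" by (simp add: S0_def)
    have d2: "has_derivs_on E (S0 \<delta>) k (\<lambda>y. g (Q y) *\<^sub>R e) DQ"
      using DQ Q_line unfolding has_derivs_on_def S0_def by simp
    have S0E: "S0 \<delta> \<subseteq> E" by (auto simp: S0_def)
    have opn: "\<exists>d>0. \<forall>t. 0 < t \<and> t < d \<longrightarrow> x + t *\<^sub>R h \<in> S0 \<delta>" if "x \<in> S0 \<delta>" "h \<in> E" for x h
      using op[of x \<delta> h] that unfolding S0_def by blast
    show ?thesis by (rule derivs_unique[OF d2 d1 E S0E opn that])
  qed
  have in_S0: "\<forall>\<^sub>F y in at p within S0 \<delta>. y \<in> S0 \<delta>" for p by (simp add: eventually_at_filter)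
  have cauchy': "multi_cauchy E j (at p within S0 \<delta>) (DQ j)" if j: "j \<le> k" and p: "p \<in> B" for j p
  proof (cases "j = 0")
    case True
    have "(Q \<longlongrightarrow> Q p) (at p within {y \<in> E. 0 \<le> f y \<and> norm y < \<delta>})"
      using Q_cont p \<rho> by (auto simp: continuous_on_def B_def)
    then have lim: "(Q \<longlongrightarrow> Q p) (at p within S0 \<delta>)" by (rule tendsto_within_subset) (auto simp: S0_def)
    show ?thesis unfolding True
    proof (rule multi_cauchy_tendsto[where L = "\<lambda>vs. Q p"])
      fix e' :: real assume "0 < e'"
      from tendstoD[OF lim this] in_S0[of p]
      show "\<forall>\<^sub>F y in at p within S0 \<delta>. multi_norm_le E 0 (\<lambda>vs. DQ 0 y vs - Q p) e'"
        by eventually_elim (use has_derivs_onD(1)[OF DQ] in \<open>simp add: multi_norm_le_def S0_def dist_norm less_imp_le\<close>)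
    qed
  next
    case False
    show ?thesis unfolding multi_cauchy_def
    proof (intro allI impI)
      fix d :: real assume d: "0 < d"
      then have "0 < d / (norm e + 1)" by (simp add: add_nonneg_pos)
      moreover have "multi_cauchy E j (at p within S0 \<delta>) (\<lambda>y vs. g (DQ j y vs))"
        unfolding S0_def using False j p by (intro cauchy) (auto simp: B_def)
      ultimately have "\<forall>\<^sub>F w in (at p within S0 \<delta>) \<times>\<^sub>F (at p within S0 \<delta>). multi_norm_le E j (\<lambda>vs. g (DQ j (fst w) vs) - g (DQ j (snd w) vs)) (d / (norm e + 1))"
        by (rule multi_cauchyD[rotated])
      with eventually_fst[OF in_S0[of p]] eventually_snd[OF in_S0[of p]]
      show "\<forall>\<^sub>F w in (at p within S0 \<delta>) \<times>\<^sub>F (at p within S0 \<delta>). multi_norm_le E j (\<lambda>vs. DQ j (fst w) vs - DQ j (snd w) vs) d"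
      proof eventually_elim
        case (elim w)
        show ?case unfolding multi_norm_le_def
        proof (intro allI impI, elim conjE)
          fix vs assume vs: "length vs = j" "set vs \<subseteq> E"
          let ?p = "prod_list (map norm vs)"
          have "DQ j (fst w) vs - DQ j (snd w) vs = (g (DQ j (fst w) vs) - g (DQ j (snd w) vs)) *\<^sub>R e"
            using DQ_line[OF j elim(1) vs] DQ_line[OF j elim(2) vs] by (simp add: scaleR_diff_left)
          then have "norm (DQ j (fst w) vs - DQ j (snd w) vs) = norm (g (DQ j (fst w) vs) - g (DQ j (snd w) vs)) * norm e" by simp
          also have "\<dots> \<le> (d / (norm e + 1) * ?p) * (norm e + 1)"
            using multi_norm_leD[OF elim(3) vs] d prod_list_norm_nonneg[of vs] by (intro mult_mono) (auto intro!: mult_nonneg_nonneg)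
          also have "\<dots> = d * ?p" by (simp add: add_nonneg_eq_0_iff)
          finally show "norm (DQ j (fst w) vs - DQ j (snd w) vs) \<le> d * ?p" .
        qed
      qed
    qed
  qed
  have s0: "s \<noteq> 0" using s(2) linear_0[OF fl] by auto
  \<comment> \<open>Completeness yields limits along proper filters only; boundary points are
    approached by interior ones along \<open>s\<close>.\<close>
  have nontriv: "at p within S0 \<delta> \<noteq> bot" if p: "p \<in> B" for p
  proof -
    have "p islimpt S0 \<delta>" unfolding islimpt_approachable
    proof (intro allI impI)
      fix d :: real assume d: "0 < d"
      have "p \<in> E" "0 \<le> f p" "norm p < \<delta>" using p \<rho> by (auto simp: B_def)
      from half_ball_shift[OF E f s this] obtain d' where d': "0 < d'" "\<And>t. 0 < t \<Longrightarrow> t < d' \<Longrightarrow> p + t *\<^sub>R s \<in> S0 \<delta>"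
        unfolding S0_def by blast
      define t where "t = min (d' / 2) (d / (2 * norm s))"
      have t: "0 < t" "t < d'" using d d' s0 by (auto simp: t_def)
      have "t * norm s \<le> d / (2 * norm s) * norm s" by (intro mult_right_mono) (auto simp: t_def)
      also have "\<dots> < d" using d s0 by simp
      finally show "\<exists>y\<in>S0 \<delta>. y \<noteq> p \<and> dist y p < d"
        using d'(2)[OF t] t s0 by (intro bexI[of _ "p + t *\<^sub>R s"]) (auto simp: dist_norm)
    qed
    then show ?thesis using trivial_limit_within by blast
  qed
  show lim: "\<forall>j\<le>k. \<forall>p\<in>B. \<exists>L. bounded_multilinear E j L \<and> multi_tendsto E j (S0 \<delta>) (DQ j) p L"
  proof (intro allI impI ballI)
    fix j p assume j: "j \<le> k" and p: "p \<in> B"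
    have "\<forall>\<^sub>F y in at p within S0 \<delta>. bounded_multilinear E j (DQ j y)"
      using in_S0[of p] by eventually_elim (use has_derivs_onD(2)[OF DQ _ j] in \<open>simp add: S0_def\<close>)
    from multi_cauchy_limit[OF cauchy'[OF j p] nontriv[OF p] E this] obtain L where
      "bounded_multilinear E j L" "\<And>e. e > 0 \<Longrightarrow> \<forall>\<^sub>F y in at p within S0 \<delta>. multi_norm_le E j (\<lambda>vs. DQ j y vs - L vs) e" by blast
    then show "\<exists>L. bounded_multilinear E j L \<and> multi_tendsto E j (S0 \<delta>) (DQ j) p L"
      unfolding multi_tendsto_def by blast
  qed
  then have "\<forall>j. \<forall>p. \<exists>L. j \<le> k \<and> p \<in> B \<longrightarrow> bounded_multilinear E j L \<and> multi_tendsto E j (S0 \<delta>) (DQ j) p L" by blast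
  then obtain L where L: "\<And>j p. j \<le> k \<Longrightarrow> p \<in> B \<Longrightarrow> bounded_multilinear E j (L j p)"
    "\<And>j p. j \<le> k \<Longrightarrow> p \<in> B \<Longrightarrow> multi_tendsto E j (S0 \<delta>) (DQ j) p (L j p)" by metis
  have sub: "S0 \<rho> \<subseteq> S0 \<delta>" "S \<rho> \<subseteq> S \<delta>" "S0 \<rho> \<subseteq> S \<rho>" "S \<rho> \<subseteq> E" "S0 \<rho> \<subseteq> E" using \<rho> by (auto simp: S0_def S_def)
  have B: "S \<rho> - S0 \<rho> = B" by (auto simp: S_def S0_def B_def)
  have DQ\<rho>: "has_derivs_on E (S0 \<rho>) k Q DQ" using DQ sub(1) has_derivs_on_subset unfolding S0_def by blast
  have shift: "\<exists>d>0. \<forall>t. 0 < t \<and> t < d \<longrightarrow> y + t *\<^sub>R s \<in> S0 \<rho>" if "y \<in> S \<rho>" for y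
    using half_ball_shift[OF E f s, of y \<rho>] that by (simp add: S_def S0_def)
  have S0_open: "\<exists>d>0. \<forall>z\<in>S \<rho>. dist z y < d \<longrightarrow> z \<in> S0 \<rho>" if y: "y \<in> S0 \<rho>" for y
  proof -
    obtain K where K: "0 < K" "\<And>u. norm (f u) \<le> norm u * K" using bounded_linear.pos_bounded[OF f] by blast
    have fy: "0 < f y" using y by (simp add: S0_def)
    have "z \<in> S0 \<rho>" if z: "z \<in> S \<rho>" "dist z y < f y / K" for z
    proof -
      have "\<bar>f (z - y)\<bar> \<le> norm (z - y) * K" using K(2)[of "z - y"] by simp
      also have "\<dots> < f y" using z(2) K by (simp add: dist_norm field_simps)
      finally have "0 < f z" by (simp add: linear_diff[OF fl])
      then show ?thesis using z(1) by (simp add: S_def S0_def)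
    qed
    then show ?thesis using fy K by (intro exI[of _ "f y / K"]) auto
  qed
  have limB: "multi_tendsto E j (S0 \<rho>) (DQ j) p (L j p)" if "j \<le> k" "p \<in> S \<rho> - S0 \<rho>" for j p
  proof -
    have "multi_tendsto E j (S0 \<delta>) (DQ j) p (L j p)" using L(2) that B by simp
    then show ?thesis unfolding multi_tendsto_def using filter_leD[OF at_le[OF sub(1)]] by blast
  qed
  have linB: "bounded_multilinear E j (L j p)" if "j \<le> k" "p \<in> S \<rho> - S0 \<rho>" for j p using L(1) that B by simp
  have "continuous_on (S \<rho>) Q" by (rule continuous_on_subset[OF Q_cont]) (use \<rho> in \<open>auto simp: S_def\<close>)
  note ext = derivs_extend_to_boundary[of E "S \<rho>" "S0 \<rho>" s Q k DQ L,
      OF E sub(4,3) half_ball_convex(1)[OF E f, of \<rho>, folded S0_def] s(1) shift S0_open this DQ\<rho> linB limB]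
  show "\<exists>G. has_derivs_on E (S \<rho>) k Q G \<and> (\<forall>j\<le>k. \<forall>p\<in>B. multi_tendsto E j (S \<rho>) (G j) p (G j p))"
    using ext(1,2) B by blast
  show "Ck_on E (S0 \<rho>) k Q \<longrightarrow> Ck_on E (S \<rho>) k Q"
  proof
    assume "Ck_on E (S0 \<rho>) k Q"
    then obtain G where G: "has_derivs_on E (S0 \<rho>) k Q G" "\<And>j x. j \<le> k \<Longrightarrow> x \<in> S0 \<rho> \<Longrightarrow> multi_tendsto E j (S0 \<rho>) (G j) x (G j x)"
      unfolding Ck_on_def has_cont_derivs_on_def by blast
    \<comment> \<open>\<open>Ck_on\<close> supplies some family \<open>G\<close> of derivatives;
      uniqueness identifies it with \<open>DQ\<close> on arguments from \<open>E\<close>, so its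
      continuity transfers.\<close>
    have eq: "DQ j x vs = G j x vs" if "j \<le> k" "x \<in> S0 \<rho>" "length vs = j" "set vs \<subseteq> E" for j x vs
      by (rule derivs_unique[OF DQ\<rho> G(1) E sub(5) _ that]) (use op[of _ \<rho>] in \<open>simp add: S0_def\<close>)
    have "multi_tendsto E j (S0 \<rho>) (DQ j) x (DQ j x)" if j: "j \<le> k" and x: "x \<in> S0 \<rho>" for j x
      unfolding multi_tendsto_def
    proof (intro allI impI)
      fix d :: real assume "0 < d"
      with G(2)[OF j x] have "\<forall>\<^sub>F y in at x within S0 \<rho>. multi_norm_le E j (\<lambda>vs. G j y vs - G j x vs) d"
        unfolding multi_tendsto_def by blast
      moreover have "\<forall>\<^sub>F y in at x within S0 \<rho>. y \<in> S0 \<rho>" by (simp add: eventually_at_filter)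
      ultimately show "\<forall>\<^sub>F y in at x within S0 \<rho>. multi_norm_le E j (\<lambda>vs. DQ j y vs - DQ j x vs) d"
        by eventually_elim (use eq[OF j] x in \<open>simp add: multi_norm_le_def\<close>)
    qed
    then have ck: "has_cont_derivs_on E (S0 \<rho>) k Q DQ" using DQ\<rho> unfolding has_cont_derivs_on_def by blast
    show "Ck_on E (S \<rho>) k Q" unfolding Ck_on_def
      by (rule exI, rule ext(3)[OF _ _ _ _ _ _ ck]) assumption+
  qed
qed

section \<open>Lines, Lipschitz bounds and distances to a hyperplane\<close>

lemma subspace_dim_1:
  fixes V :: "'a::real_vector set"
  assumes "subspace V" "dim V = 1"
  obtains u where "u \<noteq> 0" "V = range (\<lambda>t. t *\<^sub>R u)"
proof -
  obtain B where B: "B \<subseteq> V" "independent B" "V \<subseteq> span B" "card B = dim V" using basis_exists by blast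
  then obtain u where u: "B = {u}" using assms(2) by (auto simp: card_1_singleton_iff)
  have "u \<noteq> 0" using B(2) u dependent_zero by blast
  moreover have "V = range (\<lambda>t. t *\<^sub>R u)"
    using B(1,3) u assms(1) by (auto simp: span_singleton subspace_scale)
  ultimately show thesis using that by blast
qed

lemma derivs_lipschitz:
  fixes F :: "nat \<Rightarrow> 'a::real_normed_vector \<Rightarrow> 'a list \<Rightarrow> 'b::real_normed_vector"
  assumes F: "has_derivs_on E S k f F" and E: "subspace E" "S \<subseteq> E" "convex S" and j: "j < k"
    and bound: "\<And>z. z \<in> S \<Longrightarrow> multi_norm_le E (Suc j) (F (Suc j) z) C"
    and xy: "x \<in> S" "y \<in> S" and vs: "length vs = j" "set vs \<subseteq> E"
  shows "norm (F j y vs - F j x vs) \<le> C * norm (y - x) * prod_list (map norm vs)"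
proof -
  have "norm (F j y vs - F j x vs - 0) \<le> C * norm (y - x) * prod_list (map norm vs)"
  proof (rule mean_value_derivs[OF has_derivs_imp_weak[OF F E(1)] E(1,2) j _ vs])
    show sub: "closed_segment x y \<subseteq> S" by (rule closed_segment_subset[OF xy E(3)])
    fix u assume "u \<in> closed_segment x y"
    then have "u \<in> S" using sub by blast
    moreover have "y - x \<in> E" using xy E by (intro subspace_diff) auto
    ultimately show "norm (F (Suc j) u ((y - x) # vs) - 0) \<le> C * norm (y - x) * prod_list (map norm vs)"
      using multi_norm_leD[OF bound, of u "(y - x) # vs"] vs by (simp add: mult.assoc)
  qed
  then show ?thesis by simp
qed

lemma multi_norm_le_functional:
  assumes "multi_norm_le E j G C" "\<And>u. \<bar>g u\<bar> \<le> K * norm u" "0 \<le> K"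
  shows "multi_norm_le E j (\<lambda>vs. g (G vs)) (K * C)"
  unfolding multi_norm_le_def
proof (intro allI impI, elim conjE)
  fix vs assume "length vs = j" "set vs \<subseteq> E"
  then have "K * norm (G vs) \<le> K * (C * prod_list (map norm vs))"
    using assms(3) by (intro mult_left_mono multi_norm_leD[OF assms(1)]) auto
  then show "norm (g (G vs)) \<le> K * C * prod_list (map norm vs)" using assms(2)[of "G vs"] by (simp add: mult.assoc)
qed

text \<open>It converts a lower bound for the coordinate transversal to \<open>D0\<close> into a
  distance from \<open>D0\<close>, in terms of which the bounds off the boundary are given.\<close>

lemma infdist_ge_functional:
  fixes F :: "'a::real_normed_vector \<Rightarrow> real"
  assumes F: "linear F" "\<And>u. \<bar>F u\<bar> \<le> K * norm u" "0 < K" and D: "\<And>d. d \<in> D \<Longrightarrow> F d = 0" "D \<noteq> {}"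
  shows "\<bar>F z\<bar> / K \<le> infdist z D"
  unfolding infdist_notempty[OF D(2)]
proof (rule cINF_greatest[OF D(2)])
  fix d assume "d \<in> D"
  then have "\<bar>F z\<bar> \<le> K * dist z d" using F(2)[of "z - d"] D(1) by (simp add: linear_diff[OF F(1)] dist_norm)
  then show "\<bar>F z\<bar> / K \<le> dist z d" using F(3) by (simp add: field_simps)
qed

lemma image_line:
  assumes "linear A" "V = range (\<lambda>t. t *\<^sub>R u)"
  shows "A ` V = range (\<lambda>t. t *\<^sub>R A u)"
  by (simp add: assms(2) image_image linear_cmul[OF assms(1)])

text \<open>The derivative along \<open>D0\<close> only sees the values of \<open>R\<close> on \<open>D0\<close>.\<close>

lemma deriv_preserves_hyperplane:
  fixes F :: "'a::real_normed_vector \<Rightarrow> real"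
  assumes F: "bounded_linear F" "\<And>z. F z = 0 \<longleftrightarrow> z \<in> D0" and R: "R ` D0 \<subseteq> D0"
    and derivs: "has_derivs_on UNIV S k R DR" and k: "0 < k" and p: "p \<in> D0" "p \<in> S"
    and S: "ball p \<delta> \<inter> D0 \<subseteq> S" "0 < \<delta>" and v: "v \<in> D0"
  shows "DR 1 p [v] \<in> D0"
proof (cases "v = 0")
  case True
  have "bounded_multilinear UNIV (Suc 0) (DR 1 p)" using has_derivs_onD(2)[OF derivs p(2), of 1] k by simp
  from bounded_multilinear_first[OF this, of "[]" 0 0 0 0] have "DR 1 p [v] = 0" using True by simp
  moreover have "F 0 = 0" by (rule linear_0[OF bounded_linear.linear[OF F(1)]])
  ultimately show ?thesis using F(2)[of 0] by simp
next
  case False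
  note Fl = bounded_linear.linear[OF F(1)]
  obtain K where K: "0 < K" "\<And>u. norm (F u) \<le> norm u * K" using bounded_linear.pos_bounded[OF F(1)] by blast
  have m: "bounded_multilinear UNIV (Suc 0) (DR 1 p)" using has_derivs_onD(2)[OF derivs p(2), of 1] k by simp
  have "\<bar>F (DR 1 p [v])\<bar> \<le> 0"
  proof (rule field_le_epsilon)
    fix d :: real assume d: "0 < d"
    define d' where "d' = d / (K * norm v)"
    have d': "0 < d'" using d K False by (simp add: d'_def)
    have "\<forall>\<^sub>F y in at p within S. multi_norm_le UNIV 0 (\<lambda>vs. DR 0 y vs - DR 0 p vs - DR (Suc 0) p ((y - p) # vs)) (d' * norm (y - p))"
      using derivs p(2) k d' unfolding has_derivs_on_def by blast
    then obtain r where r: "0 < r" "\<And>y. y \<in> S \<Longrightarrow> y \<noteq> p \<Longrightarrow> dist y p < r \<Longrightarrow>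
        multi_norm_le UNIV 0 (\<lambda>vs. DR 0 y vs - DR 0 p vs - DR (Suc 0) p ((y - p) # vs)) (d' * norm (y - p))"
      unfolding eventually_at by blast
    \<comment> \<open>Small enough to stay both in the semi-neighbourhood and in the range of the
      estimate; by homogeneity \<open>t\<close> cancels at the end.\<close>
    define t where "t = min r \<delta> / (2 * norm v)"
    have t: "0 < t" "t * norm v < r" "t * norm v < \<delta>" using r S(2) False by (auto simp: t_def min_def field_simps)
    define y where "y = p + t *\<^sub>R v"
    have "F p = 0" "F v = 0" using F(2) p(1) v by blast+
    then have "F y = 0" by (simp add: y_def linear_add[OF Fl] linear_cmul[OF Fl])
    then have yD: "y \<in> D0" using F(2) by blast
    have "dist p y < \<delta>" "dist y p < r" "y \<noteq> p" using t False by (simp_all add: y_def dist_norm)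
    then have yS: "y \<in> S" using S(1) yD by auto
    have Ry: "F (R y) = 0" "F (R p) = 0" using R yD p(1) F(2) by blast+
    have "norm (R y - R p - DR 1 p [y - p]) \<le> d' * norm (y - p)"
      using multi_norm_leD[OF r(2)[OF yS \<open>y \<noteq> p\<close> \<open>dist y p < r\<close>], of "[]"] has_derivs_onD(1)[OF derivs yS] has_derivs_onD(1)[OF derivs p(2)]
      by simp
    from mult_right_mono[OF this less_imp_le[OF K(1)]] K(2)[of "R y - R p - DR 1 p [y - p]"]
    have "\<bar>F (R y - R p - DR 1 p [y - p])\<bar> \<le> d' * norm (y - p) * K" unfolding real_norm_def by (rule order_trans[rotated])
    moreover have "DR 1 p [y - p] = t *\<^sub>R DR 1 p [v]"
      using bounded_multilinear_first[OF m, of "[]" v 0 t 0] by (simp add: y_def)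
    ultimately have "t * \<bar>F (DR 1 p [v])\<bar> \<le> d' * (t * norm v) * K"
      using Ry t by (simp add: linear_diff[OF Fl] linear_cmul[OF Fl] abs_mult y_def)
    also have "\<dots> = t * d" using K False by (simp add: d'_def)
    finally show "\<bar>F (DR 1 p [v])\<bar> \<le> 0 + d" using t by simp
  qed
  then show ?thesis using F(2) by simp
qed

theorem theorem6p1:
  fixes D0 Dm Dp :: "'a::banach set"
    and R :: "nat \<Rightarrow> 'a \<Rightarrow> 'a"
    and DR :: "nat \<Rightarrow> nat \<Rightarrow> 'a \<Rightarrow> 'a list \<Rightarrow> 'a"
    and dR :: "nat \<Rightarrow> 'a \<Rightarrow> 'a"
    and x :: "nat \<Rightarrow> 'a"
    and k :: nat and \<delta> lam1 lam2 :: real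
    and \<xi> \<eta> l :: "nat \<Rightarrow> 'a set"
    and M U :: "nat \<Rightarrow> 'a set"
    and Q :: "nat \<Rightarrow> 'a \<Rightarrow> 'a"
    and DQ :: "nat \<Rightarrow> nat \<Rightarrow> 'a \<Rightarrow> 'a list \<Rightarrow> 'a"
  assumes D0: "closed D0" "codim_one D0" "half_spaces D0 Dm Dp"
    and R_D0: "\<And>n. R n ` D0 \<subseteq> D0"
    and orbit: "x 0 \<in> D0" "\<And>n. x (Suc n) = R n (x n)"
    and k: "k \<ge> 1" and \<delta>: "\<delta> > 0"
    \<comment> \<open>\<open>R n\<close> is smooth on the semi-neighborhood, \<open>DR n j\<close> being its \<open>j\<close>-th derivative\<close>
    and R_smooth: "\<And>n. has_cont_derivs_on UNIV (ball (x n) \<delta> \<inter> (D0 \<union> Dm)) k (R n) (DR n)"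
    and R_bounded: "\<exists>C. \<forall>n. \<forall>j\<in>{1..k}. \<forall>z \<in> ball (x n) \<delta> \<inter> (D0 \<union> Dm).
                      multi_norm_le UNIV j (DR n j z) C"
    \<comment> \<open>for \<open>k \<ge> 2\<close> the next property follows from the bound on second derivatives\<close>
    and R_unif: "k = 1 \<Longrightarrow> \<forall>e>0. \<exists>r>0. \<forall>n. \<forall>z \<in> ball (x n) r \<inter> ball (x n) \<delta> \<inter> (D0 \<union> Dm).
                      multi_norm_le UNIV 1 (\<lambda>vs. DR n 1 z vs - DR n 1 (x n) vs) e"
    and dR: "\<And>n v. dR n v = DR n 1 (x n) [v]"
    \<comment> \<open>the splitting and its images\<close>
    and splitting: "splitting (\<xi> 0) (\<eta> 0) (l 0)" "dim (\<xi> 0) = 1" "dim (\<eta> 0) = 1" "l 0 + \<eta> 0 = D0"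
    and push: "\<And>n. \<xi> (Suc n) = dR n ` \<xi> n" "\<And>n. \<eta> (Suc n) = dR n ` \<eta> n" "\<And>n. l (Suc n) = dR n ` l n"
    and stable: "stable_distribution dR l"
    and unstable: "unstable_distribution dR (\<lambda>n. \<xi> n + \<eta> n)"
    and transversal: "uniformly_transversal \<xi> D0"
    and rates: "min_expansion_rate dR \<eta> = ereal lam1" "max_expansion_rate dR \<xi> = ereal lam2"
               "lam1 > lam2" "real k < ln lam1 / ln lam2"
    \<comment> \<open>the codimension-1 local manifolds with border, as graphs over domains in \<open>l n + \<xi> n\<close>\<close>
    and M_graph: "\<And>n. M n = graph_at (x n) (U n) (Q n)" "\<And>n. Q n ` U n \<subseteq> \<eta> n"
    and M_codim: "\<And>n. codim_one (l n + \<xi> n)"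
    and U: "\<And>n. U n \<subseteq> chart (x n) (l n + \<xi> n) (D0 \<union> Dm)"
           "\<And>n. chart (x n) (l n + \<xi> n) ((D0 \<union> Dm) \<inter> ball (x n) \<delta>) \<subseteq> U n"
    and M_pass: "\<And>n. x n \<in> M n"
    and M_inv: "\<And>n. (R n ` M n) \<inter> ball (x (Suc n)) \<delta> \<subseteq> M (Suc n)"
    and M_stable: "local_stable_manifold R x (\<lambda>n. M n \<inter> D0)"
                  "\<And>n. tangent_space (M n \<inter> D0) (x n) = l n"
    \<comment> \<open>\<open>DQ n j\<close> is the \<open>j\<close>-th derivative of \<open>Q n\<close>\<close>
    and Q_diff: "\<And>n. has_derivs_on (l n + \<xi> n) (chart (x n) (l n + \<xi> n) ((D0 \<union> Dm) \<inter> ball (x n) \<delta>)) 1 (Q n) (DQ n)"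
    and Q_bounded: "\<exists>C. \<forall>n. \<forall>y \<in> chart (x n) (l n + \<xi> n) ((D0 \<union> Dm) \<inter> ball (x n) \<delta>).
                      multi_norm_le (l n + \<xi> n) 1 (DQ n 1 y) C"
    and Q_k_diff: "\<And>n. has_derivs_on (l n + \<xi> n) (chart (x n) (l n + \<xi> n) (Dm \<inter> ball (x n) \<delta>)) k (Q n) (DQ n)"
    and Q_k_bounded: "\<And>\<delta>\<^sub>1. 0 < \<delta>\<^sub>1 \<Longrightarrow> \<delta>\<^sub>1 < \<delta> \<Longrightarrow>
                      \<exists>C. \<forall>n. \<forall>j\<in>{1..k}.
                        \<forall>y \<in> chart (x n) (l n + \<xi> n)
                               (Dm \<inter> ball (x n) \<delta> \<inter> ({z. infdist z D0 < \<delta>} - {z. infdist z D0 < \<delta>\<^sub>1})).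
                          multi_norm_le (l n + \<xi> n) j (DQ n j y) C"
  shows "\<exists>\<delta>'. 0 < \<delta>' \<and> \<delta>' \<le> \<delta> \<and> (\<forall>n.
           \<comment> \<open>the derivatives have limits at the points of \<open>D0\<close>\<close>
           (\<forall>j\<le>k. \<forall>p \<in> chart (x n) (l n + \<xi> n) (D0 \<inter> ball (x n) \<delta>').
              \<exists>L. bounded_multilinear (l n + \<xi> n) j L \<and>
                  multi_tendsto (l n + \<xi> n) j (chart (x n) (l n + \<xi> n) (Dm \<inter> ball (x n) \<delta>)) (DQ n j) p L) \<and>
           \<comment> \<open>\<open>Q n\<close> is \<open>k\<close> times differentiable up to \<open>D0\<close>, with derivatives continuous at \<open>D0\<close>\<close>
           (\<exists>F. has_derivs_on (l n + \<xi> n) (chart (x n) (l n + \<xi> n) ((D0 \<union> Dm) \<inter> ball (x n) \<delta>')) k (Q n) F \<and>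
                (\<forall>j\<le>k. \<forall>p \<in> chart (x n) (l n + \<xi> n) (D0 \<inter> ball (x n) \<delta>').
                   multi_tendsto (l n + \<xi> n) j (chart (x n) (l n + \<xi> n) ((D0 \<union> Dm) \<inter> ball (x n) \<delta>')) (F j) p (F j p))) \<and>
           \<comment> \<open>\<open>Q n\<close> is of class \<open>Ck\<close> up to \<open>D0\<close>, provided that its derivatives are continuous off \<open>D0\<close>\<close>
           (Ck_on (l n + \<xi> n) (chart (x n) (l n + \<xi> n) (Dm \<inter> ball (x n) \<delta>')) k (Q n) \<longrightarrow>
            Ck_on (l n + \<xi> n) (chart (x n) (l n + \<xi> n) ((D0 \<union> Dm) \<inter> ball (x n) \<delta>')) k (Q n)))"
proof -
  let ?E = "\<lambda>n. l n + \<xi> n"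
  let ?H = "\<lambda>n. ball (x n) \<delta> \<inter> (D0 \<union> Dm)"
  have sub: "subspace D0" using D0(2) unfolding codim_one_def by blast
  have sub_E: "subspace (?E n)" for n using M_codim[of n] unfolding codim_one_def by blast
  obtain F v0 where F: "bounded_linear F" "\<And>z. F z = 0 \<longleftrightarrow> z \<in> D0" "\<And>z. 0 < F z \<longleftrightarrow> z \<in> Dm" "\<And>z. z - F z *\<^sub>R v0 \<in> D0"
    by (rule half_space_functional[OF D0(1) sub D0(3)]) blast
  note Fl = bounded_linear.linear[OF F(1)]
  have half: "z \<in> D0 \<union> Dm \<longleftrightarrow> 0 \<le> F z" for z using F(2,3)[of z] by auto
  have x_D0: "x n \<in> D0" for n
  proof (induction n)
    case (Suc n)
    then show ?case using R_D0[of n] orbit(2)[of n] by auto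
  qed (rule orbit(1))
  have Fx: "F (x n) = 0" for n using F(2) x_D0 by blast
  have x_H: "x n \<in> ?H n" for n using x_D0 \<delta> by simp
  have R_derivs: "has_derivs_on UNIV (?H n) k (R n) (DR n)" for n
    using R_smooth[of n] unfolding has_cont_derivs_on_def by blast
  obtain C1 where C1: "\<And>n j z. j \<in> {1..k} \<Longrightarrow> z \<in> ?H n \<Longrightarrow> multi_norm_le UNIV j (DR n j z) C1" using R_bounded by blast
  define C0 where "C0 = max 1 C1"
  have C0: "1 \<le> C0" by (simp add: C0_def)
  have R_bd: "multi_norm_le UNIV j (DR n j z) C0" if "z \<in> ?H n" "1 \<le> j" "j \<le> k" for n j z
    using multi_norm_le_mono[OF C1[of j z n], of C0] that by (simp add: C0_def)
  have m1: "bounded_multilinear UNIV (Suc 0) (DR n 1 (x n))" for n using has_derivs_onD(2)[OF R_derivs x_H, of 1] k by simp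
  have dR_lin: "linear (dR n)" for n
  proof
    show "dR n (u + v) = dR n u + dR n v" for u v
      using bounded_multilinear_first[OF m1[of n], of "[]" u v 1 1] by (simp add: dR)
    show "dR n (t *\<^sub>R u) = t *\<^sub>R dR n u" for t u
      using bounded_multilinear_first[OF m1[of n], of "[]" u 0 t 0] by (simp add: dR)
  qed
  have dR_bound: "norm (dR n v) \<le> C0 * norm v" for n v
    using multi_norm_leD[OF R_bd[OF x_H[of n], of 1], of "[v]"] k by (simp add: dR)
  have dR_D0: "dR n v \<in> D0" if "v \<in> D0" for n v
    unfolding dR by (rule deriv_preserves_hyperplane[OF F(1,2) R_D0 R_derivs _ x_D0 x_H _ \<delta> that]) (use k in auto)
  note spl = splitting(1)[unfolded splitting_def]
  have sub0: "subspace (\<xi> 0)" "subspace (\<eta> 0)" "subspace (l 0)" using spl by blast+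
  obtain u0 where u0: "u0 \<noteq> 0" "\<xi> 0 = range (\<lambda>t. t *\<^sub>R u0)" by (rule subspace_dim_1[OF sub0(1) splitting(2)])
  obtain h0 where h0: "h0 \<noteq> 0" "\<eta> 0 = range (\<lambda>t. t *\<^sub>R h0)" by (rule subspace_dim_1[OF sub0(2) splitting(3)])
  define us where "us n = compose_from dR 0 n u0" for n
  define hs where "hs n = compose_from dR 0 n h0" for n
  have us: "us (Suc n) = dR n (us n)" "us 0 = u0" "hs (Suc n) = dR n (hs n)" "hs 0 = h0" for n
    by (simp_all add: us_def hs_def)
  have \<xi>_line: "\<xi> n = range (\<lambda>t. t *\<^sub>R us n)" for n
  proof (induction n)
    case (Suc n)
    show ?case unfolding push us by (rule image_line[OF dR_lin Suc])
  qed (simp add: us u0)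
  have \<eta>_line: "\<eta> n = range (\<lambda>t. t *\<^sub>R hs n)" for n
  proof (induction n)
    case (Suc n)
    show ?case unfolding push us by (rule image_line[OF dR_lin Suc])
  qed (simp add: us h0)
  have l0: "l 0 \<subseteq> D0"
  proof
    fix v assume "v \<in> l 0"
    from set_plus_intro[OF this subspace_0[OF sub0(2)]] show "v \<in> D0" using splitting(4) by simp
  qed
  have "h0 \<in> \<eta> 0" unfolding h0(2) by (rule range_eqI[of _ _ 1]) simp
  from set_plus_intro[OF subspace_0[OF sub0(3)] this] have h0_D0: "h0 \<in> D0" using splitting(4) by simp
  interpret L: linear_splitting dR D0 F v0 l \<xi> \<eta> us hs k C0 lam1 lam2
    by (rule linear_splitting.intro) (fact dR_lin dR_bound C0 sub F(1) F(2) F(4) dR_D0 us(1) us(3) \<xi>_line \<eta>_line push(3) l0 stable unstable transversal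
        rates k M_codim | simp add: us u0 h0 h0_D0)+
  obtain g K e f s w \<kappa> a \<nu> \<sigma> b \<tau> c \<phi> where
    g: "\<And>n. bounded_linear (g n)" "\<And>n u. \<bar>g n u\<bar> \<le> K * norm u" "\<And>n. g n (e n) = 1" "\<And>n v. v \<in> l n + \<xi> n \<Longrightarrow> g n v = 0"
    "\<And>n u. u - g n u *\<^sub>R e n \<in> l n + \<xi> n" "\<And>n. norm (e n) \<le> K"
    and f: "\<And>n. bounded_linear (f n)" "\<And>n u. \<bar>f n u\<bar> \<le> K * norm u" "\<And>n. f n (e n) = 0" "\<And>n. f n (s n) = 1" "\<And>n. norm (s n) \<le> K"
    and w: "\<And>n u. 0 \<le> w n u" "\<And>n u v. w n (u + v) \<le> w n u + w n v" "\<And>n t u. w n (t *\<^sub>R u) = \<bar>t\<bar> * w n u"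
    "\<And>n u. w n u \<le> K * norm u" "\<And>n. w n (e n) = 0" "\<And>n v. v \<in> l n + \<xi> n \<Longrightarrow> norm v \<le> K * (w n v + \<bar>f n v\<bar>)"
    and steps: "\<And>n u. w (Suc n) (dR n u) \<le> \<kappa> * w n u" "\<And>n u. f (Suc n) (dR n u) = a n * f n u" "\<And>n. \<nu> \<le> \<bar>a n\<bar>" "\<And>n. \<bar>a n\<bar> \<le> \<sigma>"
    "\<And>n u. g (Suc n) (dR n u) = b n * g n u" "\<And>n. \<tau> \<le> \<bar>b n\<bar>"
    and rt: "0 < \<kappa>" "\<kappa> < 1" "1 < \<nu>" "\<sigma> ^ k < \<tau>" "1 \<le> K"
    and ec: "\<And>n. \<eta> n = range (\<lambda>t. t *\<^sub>R e n)" "\<And>n. s n \<in> l n + \<xi> n" "0 < c" "\<And>n. c \<le> \<phi> n" "\<And>n z. F z = \<phi> n * f n z"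
  proof (rule L.coordinates, goal_cases)
    case (1 g K e f s w \<kappa> a \<nu> \<sigma> b \<tau> c \<phi>)
    show ?case by (rule that[of g K e f s w \<kappa> a \<nu> \<sigma> b \<tau> c \<phi>, OF 1(2-)])
  qed
  note gl = bounded_linear.linear[OF g(1)] and fl = bounded_linear.linear[OF f(1)]
  have \<phi>: "0 < \<phi> n" for n using ec(3) ec(4)[of n] by linarith
  have Ff: "0 \<le> F z \<longleftrightarrow> 0 \<le> f n z" "0 < F z \<longleftrightarrow> 0 < f n z" "F z = 0 \<longleftrightarrow> f n z = 0" for n z
    using \<phi>[of n] by (simp_all add: ec(5)[of z n] zero_le_mult_iff zero_less_mult_iff not_less less_imp_le)
  have fx: "f n (x n) = 0" for n using Ff(3) Fx by blast
  have H_eq: "?H n = ball (x n) \<delta> \<inter> {z. 0 \<le> f n z}" for n using half Ff(1)[of _ n] by blast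
  have Fadd: "F (x n + y) = F y" for n y by (simp add: linear_add[OF Fl] Fx)
  have in_ball: "x n + y \<in> ball (x n) r \<longleftrightarrow> norm y < r" for n y r by (simp add: dist_norm)
  have half_chart: "x n + y \<in> D0 \<union> Dm \<longleftrightarrow> 0 \<le> f n y" "x n + y \<in> Dm \<longleftrightarrow> 0 < f n y" "x n + y \<in> D0 \<longleftrightarrow> f n y = 0" for n y
    unfolding half F(2,3)[symmetric] Fadd by (rule Ff)+
  have charts: "chart (x n) (?E n) ((D0 \<union> Dm) \<inter> ball (x n) r) = {y \<in> ?E n. 0 \<le> f n y \<and> norm y < r}"
    "chart (x n) (?E n) (Dm \<inter> ball (x n) r) = {y \<in> ?E n. 0 < f n y \<and> norm y < r}"
    "chart (x n) (?E n) (D0 \<inter> ball (x n) r) = {y \<in> ?E n. f n y = 0 \<and> norm y < r}" for n r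
    unfolding chart_def Int_iff half_chart in_ball by (rule refl)+
  have convex: "convex {y \<in> ?E n. 0 \<le> f n y \<and> norm y < \<delta>}" for n by (rule half_ball_convex(2)[OF sub_E f(1)])
  define q where "q n y = g n (Q n y)" for n y
  define Dq where "Dq n j y vs = g n (DQ n j y vs)" for n j y vs
  have \<eta>_eq: "u = g n u *\<^sub>R e n" if "u \<in> \<eta> n" for n u using that g(3) unfolding ec(1) by (auto simp: linear_cmul[OF gl])
  have Q_eq: "Q n y = q n y *\<^sub>R e n" if "y \<in> U n" for n y using \<eta>_eq[of "Q n y" n] M_graph(2)[of n] that unfolding q_def by blast
  have in_U: "y \<in> U n" if "y \<in> ?E n" "0 \<le> f n y" "norm y < \<delta>" for n y using U(2)[of n] that unfolding charts by blast
  have U_E: "y \<in> ?E n" "0 \<le> f n y" if "y \<in> U n" for n y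
    using U(1)[of n] that half_chart(1)[of n y] unfolding chart_def by blast+
  have Q_0: "Q n 0 = 0" for n
  proof -
    \<comment> \<open>The graph passes through \<open>x n\<close> over some \<open>y\<close>.
      Applying \<open>g n\<close>, which vanishes on the base space, shows that first the height and
      then \<open>y\<close> itself is zero.\<close>
    obtain y where y: "y \<in> U n" "x n = x n + y + Q n y" using M_pass[of n] unfolding M_graph graph_at_def by blast
    then have "y + q n y *\<^sub>R e n = 0" using Q_eq[OF y(1)] by (simp add: add.assoc)
    moreover have "g n (y + q n y *\<^sub>R e n) = q n y" by (simp add: linear_add[OF gl] linear_cmul[OF gl] g(3) g(4)[OF U_E(1)[OF y(1)]])
    ultimately have "q n y = 0" using linear_0[OF gl] by simp
    with \<open>y + q n y *\<^sub>R e n = 0\<close> Q_eq[OF y(1)] show ?thesis by simp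
  qed
  \<comment> \<open>The image of a graph point lies in the next manifold, hence is a graph point
    over some \<open>y'\<close> in its domain. The coordinate \<open>g\<close> identifies its height
    as \<open>g (Suc n) u\<close>, so that \<open>y'\<close> is the projection of \<open>u\<close>,
    and \<open>f\<close> takes the same value at \<open>u\<close> and at \<open>y'\<close>.\<close>
  have invariant: "0 \<le> f (Suc n) u \<and> q (Suc n) (u - g (Suc n) u *\<^sub>R e (Suc n)) = g (Suc n) u"
    if y: "y \<in> ?E n" "0 \<le> f n y" "norm y < \<delta>" and u: "u = R n (x n + y + q n y *\<^sub>R e n) - x (Suc n)" "norm u < \<delta>" for n y u
  proof -
    have "x n + y + q n y *\<^sub>R e n \<in> M n" unfolding M_graph graph_at_def using in_U[OF y] Q_eq[OF in_U[OF y]] by force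
    moreover have "R n (x n + y + q n y *\<^sub>R e n) = x (Suc n) + u" using u(1) by simp
    moreover have "x (Suc n) + u \<in> ball (x (Suc n)) \<delta>" using u(2) in_ball by blast
    ultimately have "x (Suc n) + u \<in> M (Suc n)" using M_inv[of n] by (metis IntI image_eqI subsetD)
    then obtain y' where y': "y' \<in> U (Suc n)" "x (Suc n) + u = x (Suc n) + y' + Q (Suc n) y'"
      unfolding M_graph graph_at_def by blast
    then have uy: "u = y' + q (Suc n) y' *\<^sub>R e (Suc n)" using Q_eq[OF y'(1)] by (simp add: add.assoc)
    have gu: "g (Suc n) u = q (Suc n) y'" unfolding uy
      by (simp add: linear_add[OF gl] linear_cmul[OF gl] g(3) g(4)[OF U_E(1)[OF y'(1)]])
    have "f (Suc n) u = f (Suc n) y'" unfolding uy by (simp add: linear_add[OF fl] linear_cmul[OF fl] f(3))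
    then show ?thesis using U_E(2)[OF y'(1)] gu uy by simp
  qed
  obtain C2 where C2: "\<And>n y. y \<in> chart (x n) (?E n) ((D0 \<union> Dm) \<inter> ball (x n) \<delta>) \<Longrightarrow> multi_norm_le (?E n) 1 (DQ n 1 y) C2"
    using Q_bounded by blast
  define CQ where "CQ = max 0 C2"
  have CQ0: "0 \<le> CQ" by (simp add: CQ_def)
  have CQ: "multi_norm_le (?E n) 1 (DQ n 1 y) CQ" if "y \<in> ?E n" "0 \<le> f n y" "norm y < \<delta>" for n y
    using multi_norm_le_mono[OF C2[of y n], of CQ] that unfolding charts by (simp add: CQ_def)
  have Q_lip: "norm (Q n y' - Q n y) \<le> CQ * norm (y' - y)"
    if "y \<in> {y \<in> ?E n. 0 \<le> f n y \<and> norm y < \<delta>}" "y' \<in> {y \<in> ?E n. 0 \<le> f n y \<and> norm y < \<delta>}" for n y y'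
  proof -
    have "norm (DQ n 0 y' [] - DQ n 0 y []) \<le> CQ * norm (y' - y) * prod_list (map norm ([] :: 'a list))"
      by (rule derivs_lipschitz[OF Q_diff[of n, unfolded charts] sub_E _ convex _ _ that])
        (use CQ in \<open>auto simp del: One_nat_def simp add: One_nat_def[symmetric]\<close>)
    then show ?thesis using has_derivs_onD(1)[OF Q_diff[of n, unfolded charts]] that by simp
  qed
  \<comment> \<open>One constant for the coordinates, the derivatives of \<open>R\<close> and the
    slopes of \<open>q\<close>.\<close>
  define K' where "K' = K + C0 + K * CQ"
  have "0 \<le> K * CQ" using rt CQ0 by simp
  then have K': "K \<le> K'" "C0 \<le> K'" "K * CQ \<le> K'" "1 \<le> K'" "0 \<le> K" using rt(5) C0 unfolding K'_def by linarith+
  have up: "z \<le> K' * r" if "z \<le> K * r" "0 \<le> r" for z r using mult_right_mono[OF K'(1) that(2)] that(1) by linarith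
  obtain KF where KF: "0 < KF" "\<And>u. \<bar>F u\<bar> \<le> KF * norm u"
    using bounded_linear.pos_bounded[OF F(1)] by (auto simp: mult.commute)
  have q_bound: "\<exists>C. \<forall>n. \<forall>j\<in>{1..k}. \<forall>y\<in>?E n. t \<le> f n y \<and> norm y < \<delta> \<longrightarrow> multi_norm_le (?E n) j (Dq n j y) C" if t: "0 < t" for t
  proof -
    \<comment> \<open>\<open>t \<le> f n y\<close> yields a distance of at least
      \<open>c * t / KF\<close> from \<open>D0\<close>; the cap \<open>\<delta> / 2\<close> gives
      \<open>d < \<delta>\<close>, as the given bounds demand.\<close>
    define d where "d = min (\<delta> / 2) (c * t / KF)"
    have d: "0 < d" "d < \<delta>" using \<delta> t ec(3) KF by (auto simp: d_def)
    obtain C where C: "\<And>n j y. j \<in> {1..k} \<Longrightarrow> y \<in> chart (x n) (?E n) (Dm \<inter> ball (x n) \<delta> \<inter> ({z. infdist z D0 < \<delta>} - {z. infdist z D0 < d})) \<Longrightarrow>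
        multi_norm_le (?E n) j (DQ n j y) C" using Q_k_bounded[OF d] by blast
    have "multi_norm_le (?E n) j (Dq n j y) (K * C)" if j: "j \<in> {1..k}" and y: "y \<in> ?E n" "t \<le> f n y" "norm y < \<delta>" for n j y
    proof -
      have "c * t \<le> \<phi> n * f n y" using ec(3) ec(4)[of n] y t by (intro mult_mono) auto
      also have "\<dots> = F (x n + y)" using ec(5) Fadd by simp
      finally have "c * t / KF \<le> \<bar>F (x n + y)\<bar> / KF" using KF by (intro divide_right_mono) auto
      also have "\<dots> \<le> infdist (x n + y) D0" using F(2) x_D0[of n] by (intro infdist_ge_functional[OF Fl KF(2,1)]) auto
      finally have "d \<le> infdist (x n + y) D0" by (simp add: d_def)
      moreover have "infdist (x n + y) D0 < \<delta>" using infdist_le[OF x_D0, of "x n + y" n] y(3) by (simp add: dist_norm)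
      moreover have "x n + y \<in> Dm" "x n + y \<in> ball (x n) \<delta>" using half_chart(2) in_ball y t by auto
      ultimately have "y \<in> chart (x n) (?E n) (Dm \<inter> ball (x n) \<delta> \<inter> ({z. infdist z D0 < \<delta>} - {z. infdist z D0 < d}))"
        using y(1) unfolding chart_def by simp
      from multi_norm_le_functional[OF C[OF j this] g(2) K'(5)] show ?thesis unfolding Dq_def .
    qed
    then show ?thesis by blast
  qed
  have R_unif': "\<exists>r>0. \<forall>n. \<forall>z\<in>ball (x n) \<delta> \<inter> {z. 0 \<le> f n z}. norm (z - x n) < r \<longrightarrow>
        multi_norm_le UNIV 1 (\<lambda>vs. DR n 1 z vs - DR n 1 (x n) vs) d" if d: "0 < d" for d
  proof (cases "k = 1")
    case True
    obtain r where "0 < r" and r: "\<And>n z. z \<in> ball (x n) r \<inter> ball (x n) \<delta> \<inter> (D0 \<union> Dm) \<Longrightarrow>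
        multi_norm_le UNIV 1 (\<lambda>vs. DR n 1 z vs - DR n 1 (x n) vs) d" using R_unif[OF True] d by meson
    have "multi_norm_le UNIV 1 (\<lambda>vs. DR n 1 z vs - DR n 1 (x n) vs) d"
      if z: "z \<in> ball (x n) \<delta> \<inter> {z. 0 \<le> f n z}" "norm (z - x n) < r" for n z
    proof (rule r)
      show "z \<in> ball (x n) r \<inter> ball (x n) \<delta> \<inter> (D0 \<union> Dm)" 
        using z half[of z] Ff(1)[of z n] by (auto simp: dist_norm norm_minus_commute)
    qed
    then show ?thesis using \<open>0 < r\<close> by blast
  next
    case False
    have H_convex: "convex (?H n)" for n
    proof -
      have "f n -` {0..} = {z. 0 \<le> f n z}" by auto
      then have "convex {z. 0 \<le> f n z}" using convex_linear_vimage[OF fl[of n], of "{0..}"] by simp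
      then show ?thesis unfolding H_eq by (intro convex_Int convex_ball)
    qed
    show ?thesis
    \<comment> \<open>For \<open>k \<ge> 2\<close> the bound \<open>C0\<close> on second derivatives
      is a Lipschitz constant of the first derivative on the convex half ball.\<close>
    proof (intro exI[of _ "d / C0"] conjI allI ballI impI)
      show "0 < d / C0" using d C0 by simp
      fix n z assume z: "z \<in> ball (x n) \<delta> \<inter> {z. 0 \<le> f n z}" "norm (z - x n) < d / C0"
      have zH: "z \<in> ?H n" using z(1) H_eq[of n] by blast
      show "multi_norm_le UNIV 1 (\<lambda>vs. DR n 1 z vs - DR n 1 (x n) vs) d"
        unfolding multi_norm_le_def
      proof (intro allI impI, elim conjE)
        fix vs :: "'a list" assume vs: "length vs = 1" "set vs \<subseteq> UNIV"
        have "norm (DR n 1 z vs - DR n 1 (x n) vs) \<le> C0 * norm (z - x n) * prod_list (map norm vs)"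
        proof (rule derivs_lipschitz[OF R_derivs subspace_UNIV subset_UNIV H_convex _ _ x_H zH vs])
          show "1 < k" using k False by simp
          fix z' assume "z' \<in> ?H n"
          then show "multi_norm_le UNIV (Suc 1) (DR n (Suc 1) z') C0" by (rule R_bd) (use k False in auto)
        qed
        also have "\<dots> \<le> d * prod_list (map norm vs)"
          using z(2) C0 prod_list_norm_nonneg[of vs] by (intro mult_right_mono) (auto simp: field_simps)
        finally show "norm (DR n 1 z vs - DR n 1 (x n) vs) \<le> d * prod_list (map norm vs)" .
      qed
    qed
  qed
  interpret G: graph_cocycle ?E e s x g f w a b R DR q Dq k \<delta> \<kappa> \<nu> \<sigma> \<tau> K'
  proof (rule graph_cocycle.intro)
    fix n
    show "\<bar>g n u\<bar> \<le> K' * norm u" "\<bar>f n u\<bar> \<le> K' * norm u" "w n u \<le> K' * norm u" for u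
      using up g(2) f(2) w(4) by simp_all
    show "norm (e n) \<le> K'" "norm (s n) \<le> K'" using g(6)[of n] f(5)[of n] K'(1) by linarith+
    show "norm v \<le> K' * (w n v + \<bar>f n v\<bar>)" if "v \<in> ?E n" for v
      using w(6)[OF that] w(1)[of n v] by (intro up) auto
    show "w (Suc n) (DR n 1 (x n) [u]) \<le> \<kappa> * w n u" "f (Suc n) (DR n 1 (x n) [u]) = a n * f n u"
      "g (Suc n) (DR n 1 (x n) [u]) = b n * g n u" for u using steps(1,2,5)[where n = n and u = u] unfolding dR by simp_all
    show "f (Suc n) (R n z) = 0" if "f n z = 0" for z
    proof -
      have "z \<in> D0" using that Ff(3)[of z n] F(2)[of z] by blast
      then have "R n z \<in> D0" using R_D0[of n] by blast
      then show ?thesis using Ff(3)[of "R n z" "Suc n"] F(2)[of "R n z"] by blast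
    qed
    show "has_cont_derivs_on UNIV (ball (x n) \<delta> \<inter> {z. 0 \<le> f n z}) k (R n) (DR n)" using R_smooth[of n] unfolding H_eq .
    show "multi_norm_le UNIV j (DR n j z) K'" if "z \<in> ball (x n) \<delta> \<inter> {z. 0 \<le> f n z}" "1 \<le> j" "j \<le> k" for z j
      by (rule multi_norm_le_mono[OF R_bd K'(2)]) (use that H_eq[of n] in simp_all)
    have "has_derivs_on (?E n) {y \<in> ?E n. 0 < f n y \<and> norm y < \<delta>} k (\<lambda>y. g n (Q n y)) (\<lambda>j y vs. g n (DQ n j y vs))"
      by (rule has_derivs_linear[OF g(1) Q_k_diff[of n, unfolded charts]])
    then show "has_derivs_on (?E n) {y \<in> ?E n. 0 < f n y \<and> norm y < \<delta>} k (q n) (Dq n)"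
      unfolding q_def[abs_def] Dq_def[abs_def] .
    show "\<bar>q n y - q n y'\<bar> \<le> K' * norm (y - y')"
      if "y \<in> ?E n" "y' \<in> ?E n" "0 \<le> f n y" "0 \<le> f n y'" "norm y < \<delta>" "norm y' < \<delta>" for y y'
    proof -
      have "\<bar>q n y - q n y'\<bar> \<le> K * norm (Q n y - Q n y')" using g(2)[of n "Q n y - Q n y'"] by (simp add: q_def linear_diff[OF gl])
      also have "\<dots> \<le> K * (CQ * norm (y - y'))" using Q_lip[of y' n y] that K'(5) by (intro mult_left_mono) auto
      also have "\<dots> \<le> K' * norm (y - y')" using mult_right_mono[OF K'(3), of "norm (y - y')"] by (simp add: mult.assoc)
      finally show ?thesis .
    qed
    show "q n 0 = 0" by (simp add: q_def Q_0 linear_0[OF gl])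
    show "multi_norm_le (?E n) 1 (Dq n 1 y) K'" if "y \<in> ?E n" "0 < f n y" "norm y < \<delta>" for y
      using multi_norm_le_mono[OF multi_norm_le_functional[OF CQ[of y n] g(2) K'(5)] K'(3)] that unfolding Dq_def by simp
    show "0 \<le> f (Suc n) u \<and> (norm (u - g (Suc n) u *\<^sub>R e (Suc n)) < \<delta> \<longrightarrow> q (Suc n) (u - g (Suc n) u *\<^sub>R e (Suc n)) = g (Suc n) u)"
      if "y \<in> ?E n" "0 \<le> f n y" "norm y < \<delta>" "u = R n (x n + y + q n y *\<^sub>R e n) - x (Suc n)" "norm u < \<delta>" for y u
      using invariant[OF that] by blast
  qed (fact sub_E g f w steps rt fx K' k \<delta> orbit(2) q_bound R_unif')+
  obtain \<rho> where \<rho>: "0 < \<rho>" "\<rho> \<le> \<delta>" and cauchy: "\<And>n m p. 1 \<le> m \<Longrightarrow> m \<le> k \<Longrightarrow> p \<in> ?E n \<Longrightarrow> f n p = 0 \<Longrightarrow> norm p < \<rho> \<Longrightarrow>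
      multi_cauchy (?E n) m (at p within {y \<in> ?E n. 0 < f n y \<and> norm y < \<delta>}) (Dq n m)"
    using G.derivs_cauchy_at_boundary by blast
  have Q_cont: "continuous_on {y \<in> ?E n. 0 \<le> f n y \<and> norm y < \<delta>} (Q n)" for n
    by (rule lipschitz_on_continuous_on[of CQ]) (auto intro!: lipschitz_onI simp: dist_norm CQ0 intro: Q_lip)
  have Q_line: "Q n y = g n (Q n y) *\<^sub>R e n" if "y \<in> ?E n" "0 \<le> f n y" "norm y < \<delta>" for n y
    using Q_eq[OF in_U[OF that]] by (simp add: q_def)
  note reg = boundary_regularity[OF sub_E f(1) ec(2) f(4) g(1) Q_k_diff[unfolded charts] Q_cont Q_line
      cauchy[unfolded Dq_def[abs_def]] \<rho>(2)]
  show ?thesis unfolding charts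
    by (rule exI[of _ \<rho>], rule conjI[OF \<rho>(1) conjI[OF \<rho>(2)]], rule allI, intro conjI; rule reg; assumption)
qed

end
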